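(* Let $\Omega\subset\mathbb{R}^N$ be a bounded open set. Let $p\in[2,N)$ and $1\ge s_0>s_1>s_2>\dots\ge0$. Let $(a_k)_{k\ge0}$ be real numbers with $\sum_{k=0}^{+\infty}a_k\in(0,+\infty)$, $a_0>0$ and $a_k\ge0$ for all $k\ge1$. Let $m,q$ be real constants with $1\le m<p\le q<p_{s_0}^*:=\frac{pN}{N-ps_0}$. Then there exists an open interval $\Lambda\subset(0,+\infty)$ such that, for every $\lambda\in\Lambda$, the problem $$\sum_{k=0}^{+\infty}a_k(-\Delta_p)^{s_k}u=|u|^{p_{s_0}^*-2}u+\lambda(|u|^{m-1}+|u|^{q-1})\ \text{ in }\Omega,\qquad u=0\ \text{ in }\mathbb{R}^N\setminus\Omega,$$ has at least one nonnegative nontrivial weak solution $u_\lambda\in\mathbb{X}(\Omega)$.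
   Context: For $s\in(0,1)$ put $C_{N,p,s}:=\frac{\frac{sp}{2}(1-s)2^{2s-1}}{\pi^{(N-1)/2}}\frac{\Gamma(\frac{N+ps}{2})}{\Gamma(\frac{p+1}{2})\Gamma(2-s)}$ and $[u]_{s,p}:=\left(C_{N,p,s}\iint_{\mathbb{R}^{2N}}\frac{|u(x)-u(y)|^p}{|x-y|^{N+sp}}dx\,dy\right)^{1/p}$; also $[u]_{0,p}:=\|u\|_{L^p(\mathbb{R}^N)}$ and $[u]_{1,p}:=\|\nabla u\|_{L^p(\mathbb{R}^N)}$. $\mathbb{X}(\Omega)$ is the space of measurable $u:\mathbb{R}^N\to\mathbb{R}$ with $u=0$ in $\mathbb{R}^N\setminus\Omega$ and finite norm $\left(\sum_{k\ge0}a_k[u]_{s_k,p}^p\right)^{1/p}$. The operator $(-\Delta_p)^s$ is $2C_{N,p,s}\lim_{\varepsilon\searrow0}\int_{\mathbb{R}^N\setminus B_\varepsilon(x)}\frac{|u(x)-u(y)|^{p-2}(u(x)-u(y))}{|x-y|^{N+sp}}dy$ for $s\in(0,1)$ and $-\operatorname{div}(|\nabla u|^{p-2}\nabla u)$ for $s=1$. Put $E_s(u,v):=C_{N,p,s}\iint_{\mathbb{R}^{2N}}\frac{|u(x)-u(y)|^{p-2}(u(x)-u(y))(v(x)-v(y))}{|x-y|^{N+sp}}dx\,dy$ for $s\in(0,1)$, $E_0(u,v):=\int_\Omega|u|^{p-2}uv\,dx$, $E_1(u,v):=\int_\Omega|\nabla u|^{p-2}\nabla u\cdot\nabla v\,dx$.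 A weak solution is $u\in\mathbb{X}(\Omega)$ with $\sum_{k\ge0}a_kE_{s_k}(u,v)=\int_\Omega\left(|u|^{p_{s_0}^*-2}u+\lambda(|u|^{m-1}+|u|^{q-1})\right)v\,dx$ for all $v\in\mathbb{X}(\Omega)$. *)

theory Defs
  imports "HOL-Analysis.Analysis"
begin

text \<open>
  \<open>\<real>\<^sup>N\<close> is an arbitrary Euclidean space \<^typ>\<open>'a::euclidean_space\<close> with \<open>N = DIM('a)\<close>; double
  integrals over \<open>\<real>\<^sup>2\<^sup>N\<close> are taken with respect to Lebesgue measure on \<^typ>\<open>'a \<times> 'a\<close>.
  Elements of \<open>\<X>(\<Omega>)\<close> are Lebesgue measurable functions, and all pointwise conditions on
  them are understood almost everywhere.
\<close>

subsection \<open>Weak gradients\<close>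

primrec iterated_partial :: "'a list \<Rightarrow> ('a::euclidean_space \<Rightarrow> real) \<Rightarrow> 'a \<Rightarrow> real" where
  "iterated_partial [] f = f"
| "iterated_partial (b # bs) f = (\<lambda>x. frechet_derivative (iterated_partial bs f) (at x) b)"

text \<open>\<open>C\<^sub>c\<^sup>\<infinity>(\<real>\<^sup>N)\<close>: differentiability of every iterated partial derivative also gives its
  continuity.\<close>

definition test_function :: "('a::euclidean_space \<Rightarrow> real) \<Rightarrow> bool" where
  "test_function \<phi> \<longleftrightarrow>
     (\<forall>bs. set bs \<subseteq> Basis \<longrightarrow> iterated_partial bs \<phi> differentiable_on UNIV) \<and>
     compact (closure {x. \<phi> x \<noteq> 0})"

definition locally_integrable :: "('a::euclidean_space \<Rightarrow> 'b::euclidean_space) \<Rightarrow> bool" where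
  "locally_integrable f \<longleftrightarrow> (\<forall>K. compact K \<longrightarrow> set_integrable lebesgue K f)"

definition has_weak_gradient ::
    "('a::euclidean_space \<Rightarrow> real) \<Rightarrow> ('a \<Rightarrow> 'a) \<Rightarrow> bool" where
  "has_weak_gradient u G \<longleftrightarrow> locally_integrable u \<and> locally_integrable G \<and>
     (\<forall>\<phi>. test_function \<phi> \<longrightarrow> (\<forall>b\<in>Basis.
        (LINT x|lebesgue. u x * frechet_derivative \<phi> (at x) b) =
        - (LINT x|lebesgue. (G x \<bullet> b) * \<phi> x)))"

text \<open>Unique up to null sets if it exists.\<close>

definition weak_gradient :: "('a::euclidean_space \<Rightarrow> real) \<Rightarrow> 'a \<Rightarrow> 'a" where
  "weak_gradient u = (SOME G. has_weak_gradient u G)"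

subsection \<open>The seminorms and the space \<open>\<X>(\<Omega>)\<close>\<close>

text \<open>Used for \<open>r > 0\<close> only.\<close>

definition ennreal_powr :: "ennreal \<Rightarrow> real \<Rightarrow> ennreal" where
  "ennreal_powr x r = (if x = top then top else ennreal (enn2real x powr r))"

definition Lp_norm :: "real \<Rightarrow> ('a::euclidean_space \<Rightarrow> 'b::real_normed_vector) \<Rightarrow> ennreal" where
  "Lp_norm p f = ennreal_powr (\<integral>\<^sup>+x. ennreal (norm (f x) powr p) \<partial>lebesgue) (1 / p)"

definition frac_const :: "real \<Rightarrow> real \<Rightarrow> real \<Rightarrow> real" where
  "frac_const N p s =
     (s * p / 2 * (1 - s) * 2 powr (2 * s - 1)) / pi powr ((N - 1) / 2) *
     (Gamma ((N + p * s) / 2) / (Gamma ((p + 1) / 2) * Gamma (2 - s)))"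

definition seminorm_sp :: "real \<Rightarrow> real \<Rightarrow> ('a::euclidean_space \<Rightarrow> real) \<Rightarrow> ennreal" where
  "seminorm_sp s p u =
     (if s = 0 then Lp_norm p u
      else if s = 1 then
        (if \<exists>G. has_weak_gradient u G then Lp_norm p (weak_gradient u) else top)
      else ennreal_powr
        (ennreal (frac_const (real DIM('a)) p s) *
         (\<integral>\<^sup>+(x, y). ennreal (\<bar>u x - u y\<bar> powr p / norm (x - y) powr (real DIM('a) + s * p))
            \<partial>lebesgue))
        (1 / p))"

definition X_norm ::
    "real \<Rightarrow> (nat \<Rightarrow> real) \<Rightarrow> (nat \<Rightarrow> real) \<Rightarrow> ('a::euclidean_space \<Rightarrow> real) \<Rightarrow> ennreal" where
  "X_norm p s a u =
     ennreal_powr (\<Sum>k. ennreal (a k) * ennreal_powr (seminorm_sp (s k) p u) p) (1 / p)"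

definition X_space ::
    "'a::euclidean_space set \<Rightarrow> real \<Rightarrow> (nat \<Rightarrow> real) \<Rightarrow> (nat \<Rightarrow> real) \<Rightarrow> ('a \<Rightarrow> real) set" where
  "X_space \<Omega> p s a =
     {u. u \<in> borel_measurable lebesgue \<and> (AE x in lebesgue. x \<notin> \<Omega> \<longrightarrow> u x = 0) \<and>
         X_norm p s a u < top}"

subsection \<open>Weak solutions\<close>

text \<open>If \<open>a\<^sub>k > 0\<close> and \<open>u, v \<in> \<X>(\<Omega>)\<close>, the integrand of \<open>E\<^bsub>s\<^sub>k\<^esub>(u, v)\<close> is integrable by Hoelder's
  inequality.  For \<open>p = 2\<close> the convention \<open>0 powr 0 = 0\<close> is harmless here, since the
  power is multiplied by \<open>0\<close> there.\<close>

definition energy_form ::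
    "'a::euclidean_space set \<Rightarrow> real \<Rightarrow> real \<Rightarrow> ('a \<Rightarrow> real) \<Rightarrow> ('a \<Rightarrow> real) \<Rightarrow> real" where
  "energy_form \<Omega> p s u v =
     (if s = 0 then (LINT x:\<Omega>|lebesgue. \<bar>u x\<bar> powr (p - 2) * u x * v x)
      else if s = 1 then
        (LINT x:\<Omega>|lebesgue.
           norm (weak_gradient u x) powr (p - 2) * (weak_gradient u x \<bullet> weak_gradient v x))
      else frac_const (real DIM('a)) p s *
        (LINT (x, y)|lebesgue.
           \<bar>u x - u y\<bar> powr (p - 2) * (u x - u y) * (v x - v y)
             / norm (x - y) powr (real DIM('a) + s * p)))"

definition critical_exponent :: "real \<Rightarrow> real \<Rightarrow> real \<Rightarrow> real" where
  "critical_exponent N p s = p * N / (N - p * s)"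

text \<open>The power \<open>t\<^sup>r\<close> for \<open>t, r \<ge> 0\<close> with \<open>0\<^sup>0 = 1\<close>, unlike \<open>powr\<close>; this matters for
  \<open>|u|\<^sup>m\<^sup>-\<^sup>1\<close> when \<open>m = 1\<close>.\<close>

definition pow0 :: "real \<Rightarrow> real \<Rightarrow> real" where
  "pow0 t r = (if r = 0 then 1 else t powr r)"

definition nonlinearity :: "real \<Rightarrow> real \<Rightarrow> real \<Rightarrow> real \<Rightarrow> real \<Rightarrow> real" where
  "nonlinearity r m q l t =
     pow0 \<bar>t\<bar> (r - 2) * t + l * (pow0 \<bar>t\<bar> (m - 1) + pow0 \<bar>t\<bar> (q - 1))"

text \<open>Requiring integrability and summability explicitly rules out default values of the
  integral on the right and of the series on the left.\<close>

definition weak_solution ::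
    "'a::euclidean_space set \<Rightarrow> real \<Rightarrow> (nat \<Rightarrow> real) \<Rightarrow> (nat \<Rightarrow> real) \<Rightarrow> real \<Rightarrow> real \<Rightarrow> real \<Rightarrow>
     ('a \<Rightarrow> real) \<Rightarrow> bool" where
  "weak_solution \<Omega> p s a m q l u \<longleftrightarrow> u \<in> X_space \<Omega> p s a \<and>
     (let f = nonlinearity (critical_exponent (real DIM('a)) p (s 0)) m q l in
      \<forall>v \<in> X_space \<Omega> p s a.
        set_integrable lebesgue \<Omega> (\<lambda>x. f (u x) * v x) \<and>
        (\<lambda>k. a k * energy_form \<Omega> p (s k) u v) sums (LINT x:\<Omega>|lebesgue. f (u x) * v x))"

end

theory Submission imports Defs begin

text \<open>
  Since the orders decrease strictly and are nonnegative, every \<open>s\<^sub>k\<close> is positive, so the operator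
  is \<open>a\<^sub>0\<close> times the \<open>p\<close>-Laplacian (only if \<open>s\<^sub>0 = 1\<close>) plus one nonlocal operator with the
  kernel \<open>K(z) = \<Sum>\<^sub>k a\<^sub>k C\<^sub>k |z| powr (-N - s\<^sub>k p)\<close>.  By Clarkson's inequality and convex minimisation
  the operator can be inverted on bounded right-hand sides, without any Sobolev embedding;
  the inverse is order preserving, and the solution \<open>e\<close> with right-hand side \<open>1\<close> is bounded by
  some \<open>T\<^sub>1\<close>.  The nonlinearity \<open>h\<close> is increasing on \<open>[0, \<infinity>)\<close>.  As \<open>p\<^sup>* > p\<close>, for small
  \<open>\<lambda>\<close> there are \<open>T\<close> and \<open>c\<close> with \<open>c T\<^sub>1 \<le> T\<close> and \<open>h(2T) \<le> c\<^sup>p\<^sup>-\<^sup>1\<close>, so \<open>c e\<close> is a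
  supersolution bounded by \<open>T\<close>.  Monotone iteration downwards from \<open>c e\<close>, with vanishing positive
  shifts in the argument of \<open>h\<close>, converges to a bounded nonnegative weak solution; Picone's inequality
  keeps the limit from being \<open>0\<close> because the term \<open>\<lambda> u\<^sup>m\<^sup>-\<^sup>1\<close> is \<open>p\<close>-sublinear.  Criticality of
  the exponent therefore plays no role.
\<close>

subsection \<open>Vector inequalities for the p-Laplacian flux\<close>

text \<open>Truncation, chain rules and Picone's inequality need a calculus of weak gradients. It is
  built on translations: a weak gradient integrates along almost every segment, so difference
  quotients converge in \<open>L1\<close>, and conversely \<open>L1\<close> limits of difference
  quotients are weak gradients. Chain rules, uniqueness, Poincare inequalities and the vanishing of
  gradients on zero sets become statements about difference quotients. Bounded right-hand sides pair
  with \<open>L1\<close>, so a Poincare inequality for the \<open>L1\<close> norm makes the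
  minimisation coercive. Uniform convexity makes minimising sequences Cauchy; limits are strong and
  pass through the nonlinear flux. One set of inequalities serves both parts of the operator:
  \<open>pflux\<close> lives on inner product spaces and is applied to gradients under Lebesgue
  measure and to differences \<open>u x - u y\<close> under the measure with density
  \<open>K (x - y)\<close>. The parts differ in the bound for \<open>e\<close>: without a local part
  it comes from the interaction with a ball outside \<Omega>, otherwise from an iteration over level
  sets.\<close>

definition pflux :: "real \<Rightarrow> 'e::real_inner \<Rightarrow> 'e" where
  "pflux p x = norm x powr (p - 2) *\<^sub>R x"

lemma norm_pflux: "norm (pflux p x) = norm x powr (p - 1)"
proof (cases "x = 0")
  case False
  have "norm x powr (p - 2) * norm x = norm x powr (p - 2) * norm x powr 1" using False by simp
  also have "\<dots> = norm x powr (p - 1)" by (subst powr_add [symmetric]) simp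
  finally show ?thesis by (simp add: pflux_def)
qed (simp add: pflux_def)

lemma pflux_inner_self: "pflux p x \<bullet> x = norm x powr p"
proof (cases "x = 0")
  case False
  have "norm x powr (p - 2) * (norm x)\<^sup>2 = norm x powr (p - 2) * norm x powr 2" using False by simp
  also have "\<dots> = norm x powr p" by (subst powr_add [symmetric]) simp
  finally show ?thesis by (simp add: pflux_def power2_norm_eq_inner)
qed (simp add: pflux_def)

lemma pflux_zero [simp]: "pflux p 0 = 0"
  by (simp add: pflux_def)

lemma pflux_scaleR: "c \<ge> 0 \<Longrightarrow> pflux p (c *\<^sub>R x) = c powr (p - 1) *\<^sub>R pflux p x"
proof (cases "c = 0")
  case False
  assume "c \<ge> 0"
  have "c powr (p - 2) * c = c powr (p - 2) * c powr 1" using False \<open>c \<ge> 0\<close> by simp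
  also have "\<dots> = c powr (p - 1)" by (subst powr_add [symmetric]) simp
  finally have *: "c powr (p - 2) * c = c powr (p - 1)" .
  show ?thesis using \<open>c \<ge> 0\<close> by (simp add: pflux_def powr_mult mult_ac flip: *)
qed simp

lemma young_powr:
  fixes a b :: real assumes "p > 1" "a \<ge> 0" "b \<ge> 0"
  shows "a powr (p - 1) * b \<le> (p - 1) / p * a powr p + b powr p / p"
proof -
  have c: "1 / (p / (p - 1)) + 1 / p = 1" using assms by (simp add: field_simps)
  have "a powr (p - 1) * b \<le> (a powr (p - 1)) powr (p / (p - 1)) / (p / (p - 1)) + b powr p / p"
    by (rule Youngs_inequality) (use assms c in \<open>auto simp: field_simps\<close>)
  also have "(a powr (p - 1)) powr (p / (p - 1)) = a powr p"
    using assms by (simp add: powr_powr)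
  finally show ?thesis by (simp add: mult.commute)
qed

lemma pflux_young:
  fixes x y :: "'e::real_inner" assumes "p > 1"
  shows "\<bar>pflux p x \<bullet> y\<bar> \<le> (p - 1) / p * norm x powr p + norm y powr p / p"
proof -
  have "\<bar>pflux p x \<bullet> y\<bar> \<le> norm x powr (p - 1) * norm y"
    using Cauchy_Schwarz_ineq2[of "pflux p x" y] by (simp add: norm_pflux)
  also have "\<dots> \<le> (p - 1) / p * norm x powr p + norm y powr p / p"
    by (rule young_powr) (use assms in auto)
  finally show ?thesis .
qed

text \<open>Expanding the inner product reduces this to Young's inequality with exponents
  \<open>p\<close> and \<open>p / (p - 1)\<close>. It says that \<open>p *\<^sub>R pflux p x\<close>
  is a subgradient of the \<open>p\<close>-th power of the norm, and it is the common source of the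
  convexity, Jensen and minimality arguments below.\<close>

lemma pflux_subgradient:
  fixes x y :: "'e::real_inner" assumes "p > 1"
  shows "norm x powr p + p * (pflux p x \<bullet> (y - x)) \<le> norm y powr p"
proof -
  have "p * (pflux p x \<bullet> y) \<le> (p - 1) * norm x powr p + norm y powr p"
  proof -
    have "pflux p x \<bullet> y \<le> (p - 1) / p * norm x powr p + norm y powr p / p"
      using pflux_young[OF assms, of x y] by linarith
    then have "p * (pflux p x \<bullet> y) \<le> p * ((p - 1) / p * norm x powr p + norm y powr p / p)"
      using assms by (intro mult_left_mono) auto
    then show ?thesis using assms by (simp add: distrib_left)
  qed
  then show ?thesis by (simp add: inner_diff_right pflux_inner_self algebra_simps)
qed

text \<open>The pairing splits into the mean of the two weights times the squared distance, plus a
  product of two differences of equal sign, which is nonnegative because \<open>p \<ge> 2\<close>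
  makes the weight nondecreasing. The larger norm is at least half the distance, and the constant is
  \<open>(1 / 2) powr (p - 2) / 2\<close>.\<close>

lemma pflux_strong_mono:
  fixes x y :: "'e::real_inner" assumes "p \<ge> 2"
  shows "2 powr (1 - p) * norm (x - y) powr p \<le> (pflux p x - pflux p y) \<bullet> (x - y)"
proof (cases "x = y")
  case False
  define a b where "a = norm x" and "b = norm y"
  have id: "(pflux p x - pflux p y) \<bullet> (x - y)
      = (a powr (p - 2) + b powr (p - 2)) / 2 * (norm (x - y))\<^sup>2
        + (a powr (p - 2) - b powr (p - 2)) / 2 * (a\<^sup>2 - b\<^sup>2)"
    unfolding a_def b_def pflux_def power2_norm_eq_inner
    by (simp add: algebra_simps inner_commute) (simp add: field_simps)
  have mono: "0 \<le> (a powr (p - 2) - b powr (p - 2)) / 2 * (a\<^sup>2 - b\<^sup>2)"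
  proof (cases "a \<le> b")
    case True
    have "a powr (p - 2) \<le> b powr (p - 2)"
      using True assms by (intro powr_mono2) (auto simp: a_def)
    moreover have "a\<^sup>2 \<le> b\<^sup>2" using True by (intro power_mono) (auto simp: a_def)
    ultimately show ?thesis by (intro mult_nonpos_nonpos) auto
  next
    case False
    have "b powr (p - 2) \<le> a powr (p - 2)"
      using False assms by (intro powr_mono2) (auto simp: b_def)
    moreover have "b\<^sup>2 \<le> a\<^sup>2" using False by (intro power_mono) (auto simp: b_def)
    ultimately show ?thesis by (intro mult_nonneg_nonneg) auto
  qed
  define M where "M = max a b"
  have M: "norm (x - y) / 2 \<le> M"
    using norm_triangle_ineq4[of x y] by (auto simp: M_def a_def b_def)
  have "(norm (x - y) / 2) powr (p - 2) \<le> M powr (p - 2)"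
    using M assms by (intro powr_mono2) auto
  also have "\<dots> \<le> a powr (p - 2) + b powr (p - 2)"
    by (auto simp: M_def max_def)
  finally have le: "(norm (x - y) / 2) powr (p - 2) \<le> a powr (p - 2) + b powr (p - 2)" .
  have "2 powr (1 - p) * norm (x - y) powr p
      = (norm (x - y) / 2) powr (p - 2) / 2 * (norm (x - y))\<^sup>2"
  proof -
    have "(norm (x - y))\<^sup>2 = norm (x - y) powr 2" using False by simp
    moreover have "norm (x - y) powr (p - 2) * norm (x - y) powr 2 = norm (x - y) powr p"
      by (subst powr_add [symmetric]) simp
    moreover have "(2::real) powr (1 - p) = 1 / (2 powr (p - 2) * 2)"
    proof -
      have "(2::real) powr (p - 2) * 2 = 2 powr (p - 1)"
        using powr_add[of 2 "p - 2" 1] by simp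
      then show ?thesis by (simp add: powr_diff divide_simps)
    qed
    ultimately show ?thesis by (simp add: powr_divide)
  qed
  also have "\<dots> \<le> (a powr (p - 2) + b powr (p - 2)) / 2 * (norm (x - y))\<^sup>2"
    using le by (intro mult_right_mono divide_right_mono) auto
  finally show ?thesis using id mono by linarith
qed simp

text \<open>The subgradient inequalities at the convex combination \<open>z\<close> are averaged;
  the linear terms cancel.\<close>

lemma convex_powr:
  fixes x y t :: real assumes "p \<ge> 1" "x \<ge> 0" "y \<ge> 0" "0 \<le> t" "t \<le> 1"
  shows "((1 - t) * x + t * y) powr p \<le> (1 - t) * x powr p + t * y powr p"
proof (cases "p = 1")
  case False
  define z where "z = (1 - t) * x + t * y"
  have "z \<ge> 0" unfolding z_def using assms by simp
  have p: "p > 1" using False assms by simp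
  have 1: "z powr p + p * (pflux p z * (x - z)) \<le> x powr p"
    using pflux_subgradient[OF p, of z x] assms \<open>z \<ge> 0\<close> by simp
  have 2: "z powr p + p * (pflux p z * (y - z)) \<le> y powr p"
    using pflux_subgradient[OF p, of z y] assms \<open>z \<ge> 0\<close> by simp
  have "(1 - t) * (z powr p + p * (pflux p z * (x - z))) + t * (z powr p + p * (pflux p z * (y - z)))
     \<le> (1 - t) * x powr p + t * y powr p"
    using 1 2 assms by (intro add_mono mult_left_mono) auto
  moreover have "(1 - t) * (z powr p + p * (pflux p z * (x - z))) + t * (z powr p + p * (pflux p z * (y - z)))
     = z powr p + p * pflux p z * ((1 - t) * x + t * y - z)" by (simp add: algebra_simps)
  ultimately show ?thesis by (simp add: z_def)
qed (use assms in simp)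

lemma powr_superadd:
  fixes a b :: real assumes "r \<ge> 1" "a \<ge> 0" "b \<ge> 0"
  shows "a powr r + b powr r \<le> (a + b) powr r"
proof -
  have *: "x powr r \<le> x * (a + b) powr (r - 1)" if "0 \<le> x" "x \<le> a + b" for x
  proof (cases "x = 0")
    case False
    have "x powr r = x powr 1 * x powr (r - 1)" by (subst powr_add [symmetric]) simp
    also have "\<dots> \<le> x * (a + b) powr (r - 1)"
      using that assms False by (auto intro!: mult_left_mono powr_mono2)
    finally show ?thesis .
  qed simp
  have "a powr r + b powr r \<le> a * (a + b) powr (r - 1) + b * (a + b) powr (r - 1)"
    using *[of a] *[of b] assms by auto
  also have "\<dots> = (a + b) powr r"
  proof (cases "a + b = 0")
    case False
    then have "(a + b) powr r = (a + b) powr 1 * (a + b) powr (r - 1)"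
      by (subst powr_add [symmetric]) simp
    then show ?thesis using assms False by (simp add: distrib_right)
  qed simp
  finally show ?thesis .
qed

text \<open>The parallelogram law is an identity between squares. Raised to the power
  \<open>p / 2 \<ge> 1\<close>, it combines with superadditivity on the left and convexity on the
  right.\<close>

lemma clarkson:
  fixes x y :: "'e::real_inner" assumes "p \<ge> 2"
  shows "norm ((x + y) /\<^sub>R 2) powr p + norm ((x - y) /\<^sub>R 2) powr p \<le> (norm x powr p + norm y powr p) / 2"
proof -
  have sq: "norm z powr p = ((norm z)\<^sup>2) powr (p / 2)" for z :: 'e
    by (cases "z = 0") (simp_all add: powr_powr flip: powr_numeral)
  have "norm ((x + y) /\<^sub>R 2) powr p + norm ((x - y) /\<^sub>R 2) powr p
      \<le> ((norm ((x + y) /\<^sub>R 2))\<^sup>2 + (norm ((x - y) /\<^sub>R 2))\<^sup>2) powr (p / 2)"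
    unfolding sq using assms by (intro powr_superadd) auto
  also have "(norm ((x + y) /\<^sub>R 2))\<^sup>2 + (norm ((x - y) /\<^sub>R 2))\<^sup>2 = (1 - 1/2) * (norm x)\<^sup>2 + (1/2) * (norm y)\<^sup>2"
    unfolding power2_norm_eq_inner by (simp add: algebra_simps inner_commute)
  also have "\<dots> powr (p / 2) \<le> (1 - 1/2) * ((norm x)\<^sup>2) powr (p / 2) + (1/2) * ((norm y)\<^sup>2) powr (p / 2)"
    using assms by (intro convex_powr) auto
  finally show ?thesis by (simp add: sq)
qed

lemma norm_add_powr_le:
  fixes x y :: "'e::real_normed_vector" assumes "p \<ge> 1"
  shows "norm (x + y) powr p \<le> 2 powr p * (norm x powr p + norm y powr p)"
proof -
  have "norm (x + y) powr p \<le> (2 * max (norm x) (norm y)) powr p"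
    using norm_triangle_ineq[of x y] assms by (intro powr_mono2) auto
  also have "\<dots> = 2 powr p * max (norm x) (norm y) powr p" by (simp add: powr_mult)
  also have "\<dots> \<le> 2 powr p * (norm x powr p + norm y powr p)"
    by (intro mult_left_mono) (auto simp: max_def)
  finally show ?thesis .
qed

lemma continuous_pflux:
  assumes "p \<ge> 2" shows "isCont (pflux p) (x::'e::real_inner)"
proof (cases "x = 0")
  case True
  have "((\<lambda>y::'e. norm y powr (p - 1)) \<longlongrightarrow> norm (0::'e) powr (p - 1)) (at 0)"
    using assms tendsto_norm[OF tendsto_ident_at[of "0::'e" UNIV]] by (intro tendsto_powr') auto
  then have "((\<lambda>y::'e. norm (pflux p y)) \<longlongrightarrow> 0) (at 0)"
    using assms by (simp add: norm_pflux)
  then have "((\<lambda>y::'e. pflux p y) \<longlongrightarrow> 0) (at 0)"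
    by (rule tendsto_norm_zero_cancel)
  then show ?thesis using True by (simp add: isCont_def)
next
  case False
  then show ?thesis unfolding pflux_def by (intro continuous_intros) auto
qed

lemma borel_measurable_pflux [measurable]:
  assumes "p \<ge> 2" and [measurable]: "f \<in> borel_measurable M"
  shows "(\<lambda>x. pflux p (f x) :: 'e::euclidean_space) \<in> borel_measurable M"
  unfolding pflux_def by measurable

lemma powr_lipschitz:
  fixes a b :: real assumes "p > 1" "0 \<le> a" "a \<le> c" "0 \<le> b" "b \<le> c"
  shows "\<bar>a powr p - b powr p\<bar> \<le> p * c powr (p - 1) * \<bar>a - b\<bar>"
proof -
  have *: "x powr p - y powr p \<le> p * c powr (p - 1) * \<bar>a - b\<bar>"
    if "0 \<le> x" "x \<le> c" "0 \<le> y" "\<bar>x - y\<bar> = \<bar>a - b\<bar>" for x y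
  proof -
    have "x powr p - y powr p \<le> p * (- (pflux p x * (y - x)))"
      using pflux_subgradient[OF assms(1), of x y] that by (simp add: algebra_simps)
    also have "\<dots> \<le> p * (norm (pflux p x) * \<bar>y - x\<bar>)"
      using assms(1) abs_ge_minus_self[of "pflux p x * (y - x)"]
      by (intro mult_left_mono) (auto simp: abs_mult)
    also have "\<dots> \<le> p * (c powr (p - 1) * \<bar>y - x\<bar>)"
      unfolding norm_pflux using assms(1) that
      by (intro mult_left_mono mult_right_mono powr_mono2) auto
    finally show ?thesis using that(4) by (simp add: abs_minus_commute mult_ac)
  qed
  show ?thesis using *[of a b] *[of b a] assms by (auto simp: abs_le_iff abs_minus_commute)
qed

lemma has_real_derivative_abs_powr:
  assumes "p > 1"
  shows "((\<lambda>t. \<bar>t\<bar> powr p) has_real_derivative p * pflux p t) (at (t::real))"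
proof (cases "t = 0")
  case True
  have "((\<lambda>h::real. \<bar>h\<bar> powr (p - 1)) \<longlongrightarrow> 0) (at 0)"
    using assms by (auto intro!: tendsto_eq_intros tendsto_powr'[where b="p-1", THEN tendsto_eq_rhs])
  moreover have "\<bar>\<bar>h\<bar> powr p / h\<bar> = \<bar>h\<bar> powr (p - 1)" for h :: real
    by (cases "h = 0") (simp_all add: powr_diff)
  ultimately have "((\<lambda>h::real. \<bar>h\<bar> powr p / h) \<longlongrightarrow> 0) (at 0)"
    by (intro tendsto_rabs_zero_cancel[where f="\<lambda>h. \<bar>h\<bar> powr p / h"]) simp
  then show ?thesis using True by (simp add: has_field_derivative_iff)
next
  case False
  have d: "((\<lambda>t. \<bar>t\<bar> powr p) has_real_derivative p * \<bar>t\<bar> powr (p - 1) * sgn t) (at t)"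
  proof (cases "t > 0")
    case True
    have "((\<lambda>t. t powr p) has_real_derivative p * t powr (p - 1)) (at t)"
      using True by (auto intro!: derivative_eq_intros simp: powr_diff)
    then have "((\<lambda>t. \<bar>t\<bar> powr p) has_real_derivative p * t powr (p - 1)) (at t)"
      by (rule has_field_derivative_transform_within_open[where S="{0<..}"]) (use True in auto)
    then show ?thesis using True by simp
  next
    case f: False
    have "((\<lambda>t. (- t) powr p) has_real_derivative - (p * (- t) powr (p - 1))) (at t)"
      using False f by (auto intro!: derivative_eq_intros simp: powr_diff)
    then have "((\<lambda>t. \<bar>t\<bar> powr p) has_real_derivative - (p * (- t) powr (p - 1))) (at t)"
      by (rule has_field_derivative_transform_within_open[where S="{..<0}"]) (use False f in auto)
    then show ?thesis using False f by simp
  qed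
  have "\<bar>t\<bar> powr (p - 1) = \<bar>t\<bar> powr (p - 2) * \<bar>t\<bar>"
    using powr_add[of "\<bar>t\<bar>" "p - 2" 1] False by simp
  then have "p * \<bar>t\<bar> powr (p - 1) * sgn t = p * pflux p t"
    by (simp add: pflux_def mult.assoc abs_mult_sgn)
  with d show ?thesis by simp
qed

text \<open>The left side has degree 0 in \<open>(a, b)\<close>, so for \<open>a > b\<close> only
  the ratio \<open>r = b / a\<close> matters. The bound \<open>s \<le> \<bar>s - t\<bar> + t\<close>
  is written as a convex combination of \<open>\<bar>s - t\<bar> / (1 - r)\<close> and
  \<open>t / r\<close> with weights \<open>1 - r\<close> and \<open>r\<close>, and convexity of the
  power concludes. The case \<open>b > a\<close> is the same with the points exchanged.\<close>

lemma picone_discrete: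
  fixes a b s t :: real
  assumes p: "p \<ge> 2" and "a > 0" "b > 0" "s \<ge> 0" "t \<ge> 0"
  shows "pflux p (a - b) * (s powr p * a powr (1 - p) - t powr p * b powr (1 - p)) \<le> \<bar>s - t\<bar> powr p"
proof -
  have *: "pflux p (a - b) * (s powr p * a powr (1 - p) - t powr p * b powr (1 - p)) \<le> \<bar>s - t\<bar> powr p"
    if "a > b" "b > 0" "s \<ge> 0" "t \<ge> 0" for a b s t :: real
  proof -
    define r where "r = b / a"
    have r: "0 < r" "r < 1" "b = r * a" "a > 0" using that by (auto simp: r_def)
    have "s powr p \<le> (\<bar>s - t\<bar> + t) powr p" using that p by (intro powr_mono2) auto
    also have "\<bar>s - t\<bar> + t = (1 - r) * (\<bar>s - t\<bar> / (1 - r)) + r * (t / r)" using r by simp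
    also have "\<dots> powr p \<le> (1 - r) * (\<bar>s - t\<bar> / (1 - r)) powr p + r * (t / r) powr p"
      using r p that by (intro convex_powr) auto
    finally have "(1 - r) powr (p - 1) * s powr p \<le> (1 - r) powr (p - 1) *
        ((1 - r) * (\<bar>s - t\<bar> / (1 - r)) powr p + r * (t / r) powr p)"
      by (intro mult_left_mono) auto
    also have "\<dots> = \<bar>s - t\<bar> powr p + (1 - r) powr (p - 1) * t powr p * r powr (1 - p)"
      using r that by (simp add: powr_divide powr_diff field_simps)
    finally have main: "(1 - r) powr (p - 1) * (s powr p - t powr p * r powr (1 - p)) \<le> \<bar>s - t\<bar> powr p"
      by (simp add: algebra_simps)
    have "pflux p (a - b) = (a - b) powr (p - 1)"
      using that powr_add[of "a - b" "p - 2" 1] by (simp add: pflux_def)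
    also have "\<dots> = a powr (p - 1) * (1 - r) powr (p - 1)"
      using r by (subst powr_mult [symmetric]) (auto simp: algebra_simps)
    finally have fl: "pflux p (a - b) = a powr (p - 1) * (1 - r) powr (p - 1)" .
    have bb: "b powr (1 - p) = r powr (1 - p) * a powr (1 - p)" using r by (simp add: powr_mult)
    have aa: "a powr (p - 1) * a powr (1 - p) = 1" using r by (subst powr_add [symmetric]) simp
    have "pflux p (a - b) * (s powr p * a powr (1 - p) - t powr p * b powr (1 - p))
       = (a powr (p - 1) * a powr (1 - p)) * ((1 - r) powr (p - 1) * (s powr p - t powr p * r powr (1 - p)))"
      unfolding fl bb by (simp add: algebra_simps)
    then show ?thesis using main aa by simp
  qed
  consider "a > b" | "a = b" | "b > a" by linarith
  then show ?thesis
  proof cases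
    case 3
    have "pflux p (a - b) = - pflux p (b - a)" by (simp add: pflux_def abs_minus_commute algebra_simps)
    then have "pflux p (a - b) * (s powr p * a powr (1 - p) - t powr p * b powr (1 - p))
        = pflux p (b - a) * (t powr p * b powr (1 - p) - s powr p * a powr (1 - p))"
      by (simp add: algebra_simps)
    also have "\<dots> \<le> \<bar>t - s\<bar> powr p" using *[of a b t s] 3 assms by simp
    finally show ?thesis by (simp add: abs_minus_commute)
  qed (use * assms in auto)
qed

text \<open>If \<open>f\<close> and \<open>g\<close> are the gradients of \<open>s\<close> and
  \<open>a\<close>, the vector paired with the flux is the gradient of
  \<open>s powr p * a powr (1 - p)\<close>. Young's inequality for \<open>norm g * s / a\<close> and
  \<open>norm f\<close> absorbs the mixed term into the negative one.\<close>

lemma picone_local: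
  fixes g f :: "'e::real_inner" and a s :: real
  assumes p: "p \<ge> 2" and "a > 0" "s \<ge> 0"
  shows "pflux p g \<bullet> ((p * s powr (p - 1) * a powr (1 - p)) *\<^sub>R f - ((p - 1) * s powr p * a powr (- p)) *\<^sub>R g)
      \<le> norm f powr p"
proof -
  define t where "t = norm g * s / a"
  have t: "t \<ge> 0" using assms by (auto simp: t_def)
  have "pflux p g \<bullet> f \<le> norm g powr (p - 1) * norm f"
    using Cauchy_Schwarz_ineq2[of "pflux p g" f] by (simp add: norm_pflux)
  then have 1: "p * s powr (p - 1) * a powr (1 - p) * (pflux p g \<bullet> f)
     \<le> p * s powr (p - 1) * a powr (1 - p) * (norm g powr (p - 1) * norm f)"
    using assms by (intro mult_left_mono) auto
  have t1: "t powr (p - 1) = s powr (p - 1) * a powr (1 - p) * norm g powr (p - 1)"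
    using assms by (simp add: t_def powr_mult powr_divide powr_diff field_simps)
  have t2: "t powr p = s powr p * a powr (- p) * norm g powr p"
    using assms by (simp add: t_def powr_mult powr_divide powr_minus field_simps)
  have "p * (t powr (p - 1) * norm f) \<le> p * ((p - 1) / p * t powr p + norm f powr p / p)"
    using assms t by (intro mult_left_mono young_powr) auto
  then have 2: "p * (t powr (p - 1) * norm f) \<le> (p - 1) * t powr p + norm f powr p"
    using p by (simp add: distrib_left)
  show ?thesis using 1 2 unfolding t1 t2 by (simp add: inner_diff_right pflux_inner_self mult_ac)
qed

subsection \<open>Integrals of p-th powers\<close>

text \<open>Integrals of \<open>p\<close>-th powers are kept without the root: energies then add up
  and Clarkson's inequality integrates directly, with \<open>norm_add_powr_le\<close> in place of
  the triangle inequality.\<close>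

definition Lp_fun :: "real \<Rightarrow> 'm measure \<Rightarrow> ('m \<Rightarrow> 'e::euclidean_space) \<Rightarrow> bool" where
  "Lp_fun p M f \<longleftrightarrow> f \<in> borel_measurable M \<and> integrable M (\<lambda>x. norm (f x) powr p)"

lemma Lp_fun_measurable: "Lp_fun p M f \<Longrightarrow> f \<in> borel_measurable M"
  by (simp add: Lp_fun_def)

lemma Lp_fun_integrable: "Lp_fun p M f \<Longrightarrow> integrable M (\<lambda>x. norm (f x) powr p)"
  by (simp add: Lp_fun_def)

lemma Lp_fun_bound:
  assumes "integrable M h" and "f \<in> borel_measurable M" and "AE x in M. norm (f x) powr p \<le> h x"
  shows "Lp_fun p M f"
  unfolding Lp_fun_def
proof (intro conjI)
  note [measurable] = assms(2)
  have "(\<lambda>x. norm (f x) powr p) \<in> borel_measurable M" by measurable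
  then show "integrable M (\<lambda>x. norm (f x) powr p)"
    by (rule Bochner_Integration.integrable_bound[OF assms(1)]) (use assms(3) in auto)
qed fact

lemma Lp_fun_zero [simp]: "Lp_fun p M (\<lambda>_. 0)"
  by (simp add: Lp_fun_def)

lemma Lp_fun_add:
  assumes "p \<ge> 1" "Lp_fun p M f" "Lp_fun p M g"
  shows "Lp_fun p M (\<lambda>x. f x + g x)"
proof (rule Lp_fun_bound)
  show "integrable M (\<lambda>x. 2 powr p * (norm (f x) powr p + norm (g x) powr p))"
    using assms by (auto simp: Lp_fun_def)
  show "(\<lambda>x. f x + g x) \<in> borel_measurable M" using assms by (auto simp: Lp_fun_def)
qed (use norm_add_powr_le[OF assms(1)] in auto)

lemma Lp_fun_scaleR:
  assumes "Lp_fun p M f" shows "Lp_fun p M (\<lambda>x. c *\<^sub>R f x)"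
  using assms by (auto simp: Lp_fun_def powr_mult)

lemma Lp_fun_diff:
  assumes "p \<ge> 1" "Lp_fun p M f" "Lp_fun p M g"
  shows "Lp_fun p M (\<lambda>x. f x - g x)"
  using Lp_fun_add[OF assms(1,2) Lp_fun_scaleR[OF assms(3), of "-1"]] by simp

lemma Lp_fun_cong_AE:
  assumes "Lp_fun p M f" "g \<in> borel_measurable M" "AE x in M. g x = f x"
  shows "Lp_fun p M g"
  by (rule Lp_fun_bound[OF Lp_fun_integrable[OF assms(1)] assms(2)]) (use assms(3) in auto)

lemma integrable_pflux_inner:
  assumes "p \<ge> 2" "Lp_fun p M f" "Lp_fun p M g"
  shows "integrable M (\<lambda>x. pflux p (f x) \<bullet> g x)"
proof (rule Bochner_Integration.integrable_bound)
  show "integrable M (\<lambda>x. (p - 1) / p * norm (f x) powr p + norm (g x) powr p / p)"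
    using assms by (auto simp: Lp_fun_def)
  note [measurable] = assms(2,3)[THEN Lp_fun_measurable] borel_measurable_pflux[OF assms(1)]
  show "(\<lambda>x. pflux p (f x) \<bullet> g x) \<in> borel_measurable M" by measurable
  show "AE x in M. norm (pflux p (f x) \<bullet> g x) \<le> norm ((p - 1) / p * norm (f x) powr p + norm (g x) powr p / p)"
    using pflux_young[of p] assms(1) by (auto intro!: AE_I2)
qed

text \<open>Convergence in mean gives almost everywhere convergence only along subsequences. If the
  claim failed, the enumeration of the bad indices would be a sequence without a convergent further
  subsequence.\<close>

lemma tendsto_by_subseq:
  fixes X :: "nat \<Rightarrow> 'b::metric_space"
  assumes "\<And>r::nat \<Rightarrow> nat. strict_mono r \<Longrightarrow> \<exists>r'::nat \<Rightarrow> nat. strict_mono r' \<and> (\<lambda>n. X (r (r' n))) \<longlonglongrightarrow> L"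
  shows "X \<longlonglongrightarrow> L"
proof (rule ccontr)
  assume "\<not> X \<longlonglongrightarrow> L"
  then obtain e where e: "e > 0" "\<And>N. \<exists>n\<ge>N. dist (X n) L \<ge> e"
    unfolding lim_sequentially by (metis not_le)
  define S where "S = {n. dist (X n) L \<ge> e}"
  have "infinite S" unfolding infinite_nat_iff_unbounded_le S_def using e(2) by blast
  then have sm: "strict_mono (enumerate S)" and mem: "\<And>n. enumerate S n \<in> S"
    by (auto simp: strict_mono_enumerate enumerate_in_set)
  obtain r' :: "nat \<Rightarrow> nat" where "(\<lambda>n. X (enumerate S (r' n))) \<longlonglongrightarrow> L"
    using assms[OF sm] by blast
  then obtain n where "dist (X (enumerate S (r' n))) L < e"
    using e(1) unfolding lim_sequentially by blast
  with mem[of "r' n"] show False by (simp add: S_def)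
qed

text \<open>Dominated convergence with a majorant that varies by an error tending to 0 in mean: the
  truncation \<open>F n\<close> of \<open>norm (D n x) - e n x\<close> at 0 has a fixed majorant,
  and only the integral of \<open>e n\<close> is left over.\<close>

lemma tendsto_integral_dominated_error:
  fixes D :: "nat \<Rightarrow> 'm \<Rightarrow> 'e::euclidean_space"
  assumes D: "\<And>n. D n \<in> borel_measurable M" and H: "integrable M H"
    and e: "\<And>n. integrable M (e n)" "\<And>n x. 0 \<le> e n x" "(\<lambda>n. \<integral>x. e n x \<partial>M) \<longlonglongrightarrow> 0"
    and bound: "\<And>n. AE x in M. norm (D n x) \<le> H x + e n x"
    and lim: "AE x in M. (\<lambda>n. D n x) \<longlonglongrightarrow> 0"
  shows "(\<lambda>n. \<integral>x. norm (D n x) \<partial>M) \<longlonglongrightarrow> 0"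
proof -
  note [measurable] = D borel_measurable_integrable[OF H] borel_measurable_integrable[OF e(1)]
  have int: "integrable M (D n)" for n
    using bound[of n] by (intro Bochner_Integration.integrable_bound[OF Bochner_Integration.integrable_add[OF H e(1)[of n]] D]) auto
  define F where "F n x = max 0 (norm (D n x) - e n x)" for n x
  have [measurable]: "F n \<in> borel_measurable M" for n unfolding F_def by measurable
  have Fb: "AE x in M. norm (F n x) \<le> \<bar>H x\<bar>" for n
    using bound[of n]
  proof eventually_elim
    case (elim x)
    then show ?case by (simp add: F_def)
  qed
  have F0: "AE x in M. (\<lambda>n. F n x) \<longlonglongrightarrow> 0"
    using lim
  proof eventually_elim
    case (elim x)
    show ?case
    proof (rule tendsto_sandwich[OF _ _ tendsto_const tendsto_norm_zero[OF elim]])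
      show "\<forall>\<^sub>F n in sequentially. F n x \<le> norm (D n x)" using e(2) by (simp add: F_def)
    qed (simp add: F_def)
  qed
  have "(\<lambda>n. \<integral>x. F n x \<partial>M) \<longlonglongrightarrow> (\<integral>x. 0 \<partial>M)"
    by (rule integral_dominated_convergence[where w="\<lambda>x. \<bar>H x\<bar>"]) (use Fb F0 H in auto)
  from tendsto_add[OF this e(3)]
  have lim': "(\<lambda>n. (\<integral>x. F n x \<partial>M) + (\<integral>x. e n x \<partial>M)) \<longlonglongrightarrow> 0" by simp
  have Fi: "integrable M (F n)" for n
    using Fb[of n] by (intro Bochner_Integration.integrable_bound[OF integrable_abs[OF H]]) auto
  have "(\<integral>x. norm (D n x) \<partial>M) \<le> (\<integral>x. F n x \<partial>M) + (\<integral>x. e n x \<partial>M)" for n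
  proof -
    have "(\<integral>x. norm (D n x) \<partial>M) \<le> (\<integral>x. F n x + e n x \<partial>M)"
      using int Fi e(1) by (intro integral_mono) (auto simp: F_def)
    then show ?thesis using Fi e(1) by simp
  qed
  then show ?thesis
    by (intro tendsto_sandwich[OF _ _ tendsto_const lim']) (auto intro!: always_eventually)
qed

lemma Lp_AE_subseq:
  fixes f :: "'m \<Rightarrow> 'e::euclidean_space"
  assumes p: "p \<ge> 1" and fs: "\<And>n. Lp_fun p M (fs n)" "Lp_fun p M f"
    and lim: "(\<lambda>n. \<integral>x. norm (fs n x - f x) powr p \<partial>M) \<longlonglongrightarrow> 0"
  shows "\<exists>r::nat \<Rightarrow> nat. strict_mono r \<and> (AE x in M. (\<lambda>n. fs (r n) x) \<longlonglongrightarrow> f x)"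
proof -
  have int: "integrable M (\<lambda>x. norm (fs n x - f x) powr p)" for n
    using Lp_fun_diff[OF p fs(1) fs(2)] by (simp add: Lp_fun_def)
  obtain r :: "nat \<Rightarrow> nat" where r: "strict_mono r"
    "AE x in M. (\<lambda>n. norm (fs (r n) x - f x) powr p) \<longlonglongrightarrow> 0"
    using tendsto_L1_AE_subseq[of M "\<lambda>n x. norm (fs n x - f x) powr p"] int lim by auto
  have "AE x in M. (\<lambda>n. fs (r n) x) \<longlonglongrightarrow> f x"
    using r(2)
  proof eventually_elim
    case (elim x)
    have "(\<lambda>n. (norm (fs (r n) x - f x) powr p) powr (1 / p)) \<longlonglongrightarrow> 0 powr (1 / p)"
      using elim p by (intro tendsto_powr') auto
    then have "(\<lambda>n. norm (fs (r n) x - f x)) \<longlonglongrightarrow> 0"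
      using p by (simp add: powr_powr)
    then show ?case using LIM_zero_cancel tendsto_norm_zero_iff by fastforce
  qed
  with r(1) show ?thesis by blast
qed

text \<open>Along an almost everywhere convergent subsequence the difference of the integrands is
  bounded by a fixed integrable function plus a multiple of
  \<open>norm (fs n x - f x) powr p\<close>, which tends to 0 in mean. The limit does not depend on
  the subsequence, so the whole sequence converges.\<close>

lemma tendsto_integral_pflux:
  fixes f g :: "'m \<Rightarrow> 'e::euclidean_space"
  assumes p: "p \<ge> 2" and fs: "\<And>n. Lp_fun p M (fs n)" "Lp_fun p M f" and g: "Lp_fun p M g"
    and lim: "(\<lambda>n. \<integral>x. norm (fs n x - f x) powr p \<partial>M) \<longlonglongrightarrow> 0"
  shows "(\<lambda>n. \<integral>x. pflux p (fs n x) \<bullet> g x \<partial>M) \<longlonglongrightarrow> (\<integral>x. pflux p (f x) \<bullet> g x \<partial>M)"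
proof (rule tendsto_by_subseq)
  fix r :: "nat \<Rightarrow> nat" assume r: "strict_mono r"
  have lim': "(\<lambda>n. \<integral>x. norm (fs (r n) x - f x) powr p \<partial>M) \<longlonglongrightarrow> 0"
    using LIMSEQ_subseq_LIMSEQ[OF lim r] by (simp add: o_def)
  obtain r' :: "nat \<Rightarrow> nat" where r': "strict_mono r'" "AE x in M. (\<lambda>n. fs (r (r' n)) x) \<longlonglongrightarrow> f x"
    using Lp_AE_subseq[OF _ fs(1) fs(2) lim'] p by auto
  define h where "h n x = fs (r (r' n)) x" for n x
  have h: "Lp_fun p M (h n)" for n unfolding h_def by (rule fs)
  have limh: "(\<lambda>n. \<integral>x. norm (h n x - f x) powr p \<partial>M) \<longlonglongrightarrow> 0"
    using LIMSEQ_subseq_LIMSEQ[OF lim' r'(1)] by (simp add: o_def h_def)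
  have ih: "integrable M (\<lambda>x. pflux p (h n x) \<bullet> g x)" for n by (rule integrable_pflux_inner[OF p h g])
  have iF: "integrable M (\<lambda>x. pflux p (f x) \<bullet> g x)" by (rule integrable_pflux_inner[OF p fs(2) g])
  define D where "D n x = pflux p (h n x) \<bullet> g x - pflux p (f x) \<bullet> g x" for n x
  have Di: "integrable M (D n)" for n unfolding D_def using ih iF by auto
  have yo: "\<bar>pflux p x \<bullet> y\<bar> \<le> norm x powr p + norm y powr p" for x y :: 'e
  proof -
    have "(p - 1) / p * norm x powr p \<le> 1 * norm x powr p" using p by (intro mult_right_mono) auto
    moreover have "norm y powr p / p \<le> norm y powr p" using p by (auto simp: divide_simps mult_le_cancel_left1)
    ultimately show ?thesis using pflux_young[of p x y] p by linarith
  qed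
  have "(\<lambda>n. \<integral>x. norm (D n x) \<partial>M) \<longlonglongrightarrow> 0"
  proof (rule tendsto_integral_dominated_error[where e="\<lambda>n x. 2 powr p * norm (h n x - f x) powr p"
        and H="\<lambda>x. 2 powr p * norm (f x) powr p + norm (f x) powr p + 2 * norm (g x) powr p"])
    show "D n \<in> borel_measurable M" for n using Di by blast
    show "integrable M (\<lambda>x. 2 powr p * norm (f x) powr p + norm (f x) powr p + 2 * norm (g x) powr p)"
      using fs(2) g by (auto simp: Lp_fun_def)
    show "integrable M (\<lambda>x. 2 powr p * norm (h n x - f x) powr p)" for n
      using Lp_fun_diff[OF _ h fs(2)] p by (auto simp: Lp_fun_def)
    show "(\<lambda>n. \<integral>x. 2 powr p * norm (h n x - f x) powr p \<partial>M) \<longlonglongrightarrow> 0"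
      using tendsto_mult_right_zero[OF limh, of "2 powr p"] by simp
    show "AE x in M. norm (D n x) \<le> 2 powr p * norm (f x) powr p + norm (f x) powr p + 2 * norm (g x) powr p
        + 2 powr p * norm (h n x - f x) powr p" for n
    proof (rule AE_I2)
      fix x
      have "norm (h n x) powr p \<le> 2 powr p * (norm (h n x - f x) powr p + norm (f x) powr p)"
        using norm_add_powr_le[of p "h n x - f x" "f x"] p by simp
      then show "norm (D n x) \<le> 2 powr p * norm (f x) powr p + norm (f x) powr p + 2 * norm (g x) powr p
        + 2 powr p * norm (h n x - f x) powr p"
        using yo[of "h n x" "g x"] yo[of "f x" "g x"] unfolding D_def distrib_left real_norm_def by linarith
    qed
    show "AE x in M. (\<lambda>n. D n x) \<longlonglongrightarrow> 0"
      using r'(2)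
    proof eventually_elim
      case (elim x)
      have "(\<lambda>n. pflux p (h n x)) \<longlonglongrightarrow> pflux p (f x)"
        using elim unfolding h_def by (rule isCont_tendsto_compose[OF continuous_pflux[OF p]])
      then have "(\<lambda>n. D n x) \<longlonglongrightarrow> pflux p (f x) \<bullet> g x - pflux p (f x) \<bullet> g x"
        unfolding D_def by (intro tendsto_intros)
      then show ?case by simp
    qed
  qed simp
  then have "(\<lambda>n. \<integral>x. D n x \<partial>M) \<longlonglongrightarrow> 0"
    by (rule Lim_null_comparison[rotated]) (use Di in \<open>auto intro!: always_eventually integral_norm_bound\<close>)
  moreover have "(\<integral>x. D n x \<partial>M) = (\<integral>x. pflux p (h n x) \<bullet> g x \<partial>M) - (\<integral>x. pflux p (f x) \<bullet> g x \<partial>M)" for n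
    unfolding D_def using ih iF by (rule Bochner_Integration.integral_diff)
  ultimately have "(\<lambda>n. \<integral>x. pflux p (h n x) \<bullet> g x \<partial>M) \<longlonglongrightarrow> (\<integral>x. pflux p (f x) \<bullet> g x \<partial>M)"
    by (simp add: LIM_zero_iff)
  then show "\<exists>r'. strict_mono r' \<and> (\<lambda>n. \<integral>x. pflux p (fs (r (r' n)) x) \<bullet> g x \<partial>M) \<longlonglongrightarrow> (\<integral>x. pflux p (f x) \<bullet> g x \<partial>M)"
    using r'(1) by (auto simp: h_def)
qed

lemma Lp_fatou:
  fixes f :: "'m \<Rightarrow> 'e::euclidean_space"
  assumes p: "p \<ge> 1" and fs: "\<And>n. Lp_fun p M (fs n)" and f: "f \<in> borel_measurable M"
    and le: "\<And>n. (\<integral>x. norm (fs n x) powr p \<partial>M) \<le> c"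
    and lim: "AE x in M. (\<lambda>n. fs n x) \<longlonglongrightarrow> f x"
  shows "Lp_fun p M f" and "(\<integral>x. norm (f x) powr p \<partial>M) \<le> c"
proof -
  note [measurable] = f fs[THEN Lp_fun_measurable]
  have c0: "c \<ge> 0" using le[of 0] by (rule order_trans[rotated]) simp
  have "AE x in M. (\<lambda>n. ennreal (norm (fs n x) powr p)) \<longlonglongrightarrow> ennreal (norm (f x) powr p)"
    using lim by eventually_elim (use p in \<open>auto intro!: tendsto_powr' tendsto_norm\<close>)
  then have "AE x in M. ennreal (norm (f x) powr p) = liminf (\<lambda>n. ennreal (norm (fs n x) powr p))"
    by eventually_elim (metis lim_imp_Liminf trivial_limit_sequentially)
  then have "(\<integral>\<^sup>+x. ennreal (norm (f x) powr p) \<partial>M) = (\<integral>\<^sup>+x. liminf (\<lambda>n. ennreal (norm (fs n x) powr p)) \<partial>M)"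
    by (rule nn_integral_cong_AE)
  also have "\<dots> \<le> liminf (\<lambda>n. \<integral>\<^sup>+x. ennreal (norm (fs n x) powr p) \<partial>M)"
    by (rule nn_integral_liminf) measurable
  also have "\<dots> = liminf (\<lambda>n. ennreal (\<integral>x. norm (fs n x) powr p \<partial>M))"
    using fs by (subst nn_integral_eq_integral) (auto simp: Lp_fun_def)
  also have "\<dots> \<le> liminf (\<lambda>n. ennreal c)"
    using le by (intro Liminf_mono always_eventually) (auto intro: ennreal_leI)
  finally have nn: "(\<integral>\<^sup>+x. ennreal (norm (f x) powr p) \<partial>M) \<le> ennreal c" by (simp add: Liminf_const)
  then have "(\<integral>\<^sup>+x. ennreal (norm (f x) powr p) \<partial>M) < \<infinity>" by (simp add: le_less_trans)
  then show "Lp_fun p M f" unfolding Lp_fun_def by (intro conjI integrableI_nonneg) auto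
  then have "ennreal (\<integral>x. norm (f x) powr p \<partial>M) \<le> ennreal c"
    using nn by (subst nn_integral_eq_integral [symmetric]) (auto simp: Lp_fun_def)
  then show "(\<integral>x. norm (f x) powr p \<partial>M) \<le> c" using c0 by simp
qed

text \<open>On a rapid subsequence the increments have integrals at most
  \<open>(4 powr - p) ^ k\<close>, so these stay summable after weighting with
  \<open>(2 powr p) ^ k\<close>. Hence almost everywhere the increments are bounded by a multiple of
  \<open>(1 / 2) ^ k\<close> and the subsequence converges pointwise; Fatou's lemma then turns the
  Cauchy condition into convergence in mean.\<close>

lemma Lp_complete:
  fixes fs :: "nat \<Rightarrow> 'm \<Rightarrow> 'e::euclidean_space"
  assumes p: "p \<ge> 1" and fs: "\<And>n. Lp_fun p M (fs n)"
    and cau: "\<And>e. e > 0 \<Longrightarrow> \<exists>N. \<forall>m\<ge>N. \<forall>n\<ge>N. (\<integral>x. norm (fs m x - fs n x) powr p \<partial>M) \<le> e"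
  shows "\<exists>f. Lp_fun p M f \<and> (\<lambda>n. \<integral>x. norm (fs n x - f x) powr p \<partial>M) \<longlonglongrightarrow> 0"
proof -
  note [measurable] = fs[THEN Lp_fun_measurable]
  obtain N0 where N0: "\<And>k m n. m \<ge> N0 k \<Longrightarrow> n \<ge> N0 k \<Longrightarrow> (\<integral>x. norm (fs m x - fs n x) powr p \<partial>M) \<le> (4 powr - p) ^ k"
    using cau[of "(4 powr - p) ^ k" for k] by (metis powr_gt_zero zero_less_power zero_neq_numeral)
  define r where "r = rec_nat (N0 0) (\<lambda>k m. max (Suc m) (N0 (Suc k)))"
  have rS: "r (Suc k) = max (Suc (r k)) (N0 (Suc k))" for k by (simp add: r_def)
  have r: "strict_mono r" by (rule strict_monoI_Suc) (simp add: rS)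
  have rN: "r k \<ge> N0 k" for k by (cases k) (simp_all add: r_def)
  define d where "d k x = fs (r (Suc k)) x - fs (r k) x" for k x
  have dL: "Lp_fun p M (d k)" for k unfolding d_def by (rule Lp_fun_diff[OF p fs fs])
  note [measurable] = dL[THEN Lp_fun_measurable]
  have dint: "(\<integral>x. norm (d k x) powr p \<partial>M) \<le> (4 powr - p) ^ k" for k
    unfolding d_def using rN[of k] strict_mono_less_eq[OF r, of k "Suc k"] by (intro N0) auto
  have "(\<integral>\<^sup>+x. (\<Sum>k. ennreal ((2 powr p) ^ k * norm (d k x) powr p)) \<partial>M)
      = (\<Sum>k. \<integral>\<^sup>+x. ennreal ((2 powr p) ^ k * norm (d k x) powr p) \<partial>M)"
    by (rule nn_integral_suminf) measurable
  also have "\<dots> \<le> (\<Sum>k. ennreal ((2 powr - p) ^ k))"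
  proof (rule suminf_le)
    fix k
    have "(\<integral>\<^sup>+x. ennreal ((2 powr p) ^ k * norm (d k x) powr p) \<partial>M) = ennreal (\<integral>x. (2 powr p) ^ k * norm (d k x) powr p \<partial>M)"
      using dL[of k] by (intro nn_integral_eq_integral) (auto simp: Lp_fun_def)
    also have "(\<integral>x. (2 powr p) ^ k * norm (d k x) powr p \<partial>M) \<le> (2 powr p) ^ k * (4 powr - p) ^ k"
      using dint[of k] by simp
    also have "\<dots> = (2 powr - p) ^ k"
    proof -
      have "(2::real) powr p * 4 powr - p = 2 powr - p"
      proof -
        have "(4::real) powr - p = (2 * 2) powr - p" by simp
        also have "\<dots> = 2 powr - p * 2 powr - p" by (subst powr_mult) auto
        finally show ?thesis by (simp add: powr_minus)
      qed
      then show ?thesis by (metis power_mult_distrib)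
    qed
    finally show "(\<integral>\<^sup>+x. ennreal ((2 powr p) ^ k * norm (d k x) powr p) \<partial>M) \<le> ennreal ((2 powr - p) ^ k)"
      by (simp add: ennreal_leI)
  qed auto
  also have "\<dots> < \<infinity>"
  proof -
    have "(2::real) powr - p < 1" using p by (simp add: powr_minus divide_simps)
    then have "summable (\<lambda>k. ((2::real) powr - p) ^ k)" by (intro summable_geometric) auto
    then show ?thesis by (simp add: suminf_ennreal2)
  qed
  finally have "AE x in M. (\<Sum>k. ennreal ((2 powr p) ^ k * norm (d k x) powr p)) \<noteq> \<infinity>"
    by (intro nn_integral_PInf_AE) auto
  then have conv: "AE x in M. convergent (\<lambda>k. fs (r k) x)"
  proof eventually_elim
    case (elim x)
    then have sm: "summable (\<lambda>k. (2 powr p) ^ k * norm (d k x) powr p)"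
      by (intro summable_suminf_not_top) auto
    then obtain C where C: "\<And>k. (2 powr p) ^ k * norm (d k x) powr p \<le> C"
      using summable_imp_bounded[OF sm] unfolding bounded_iff by auto
    have C0: "C \<ge> 0" using C[of 0] by (rule order_trans[rotated]) simp
    have b: "norm (d k x) \<le> C powr (1 / p) * (1 / 2) ^ k" for k
    proof -
      have "norm (d k x) powr p \<le> C / (2 powr p) ^ k" using C[of k] by (simp add: field_simps)
      then have "(norm (d k x) powr p) powr (1 / p) \<le> (C / (2 powr p) ^ k) powr (1 / p)"
        using p by (intro powr_mono2) auto
      also have "\<dots> = C powr (1 / p) / ((2 powr p) ^ k) powr (1 / p)" using C0 by (simp add: powr_divide)
      also have "((2 powr p) ^ k) powr (1 / p) = (2::real) ^ k"
        using p by (simp add: powr_powr mult.commute flip: powr_realpow)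
      finally show ?thesis using p by (simp add: powr_powr power_divide)
    qed
    have sg: "summable (\<lambda>k. C powr (1 / p) * (1 / 2) ^ k)"
      by (intro summable_mult summable_geometric) simp
    have "summable (\<lambda>k. d k x)"
      by (rule summable_comparison_test'[OF sg b])
    then have "convergent (\<lambda>n. \<Sum>k<n. d k x)" by (simp add: summable_iff_convergent)
    moreover have "(\<Sum>k<n. d k x) = fs (r n) x - fs (r 0) x" for n
      unfolding d_def by (rule sum_lessThan_telescope)
    ultimately have "convergent (\<lambda>n. fs (r n) x - fs (r 0) x)" by simp
    then have "convergent (\<lambda>n. (fs (r n) x - fs (r 0) x) + fs (r 0) x)"
      by (intro convergent_add convergent_const)
    then show ?case by simp
  qed
  define f where "f x = lim (\<lambda>k. fs (r k) x)" for x
  have fm [measurable]: "f \<in> borel_measurable M" unfolding f_def by measurable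
  have lim: "AE x in M. (\<lambda>k. fs (r k) x) \<longlonglongrightarrow> f x"
    using conv by eventually_elim (simp add: f_def convergent_LIMSEQ_iff)
  have fat: "Lp_fun p M (\<lambda>x. fs n x - f x)" "(\<integral>x. norm (fs n x - f x) powr p \<partial>M) \<le> e"
    if N: "\<forall>m\<ge>N. \<forall>n\<ge>N. (\<integral>x. norm (fs m x - fs n x) powr p \<partial>M) \<le> e" and n: "n \<ge> N" for N n e
  proof -
    have *: "AE x in M. (\<lambda>k. fs n x - fs (r (k + N)) x) \<longlonglongrightarrow> fs n x - f x"
      using lim by eventually_elim (intro tendsto_intros LIMSEQ_ignore_initial_segment)
    have **: "(\<integral>x. norm (fs n x - fs (r (k + N)) x) powr p \<partial>M) \<le> e" for k
      using N n seq_suble[OF r, of "k + N"] by auto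
    have m: "(\<lambda>x. fs n x - f x) \<in> borel_measurable M" by measurable
    show "Lp_fun p M (\<lambda>x. fs n x - f x)" "(\<integral>x. norm (fs n x - f x) powr p \<partial>M) \<le> e"
      using Lp_fatou[OF p Lp_fun_diff[OF p fs fs] m ** *] by auto
  qed
  obtain N1 where "\<forall>m\<ge>N1. \<forall>n\<ge>N1. (\<integral>x. norm (fs m x - fs n x) powr p \<partial>M) \<le> 1" using cau[of 1] by auto
  from Lp_fun_diff[OF p fs[of N1] fat(1)[OF this order_refl]] have "Lp_fun p M f" by simp
  moreover have "(\<lambda>n. \<integral>x. norm (fs n x - f x) powr p \<partial>M) \<longlonglongrightarrow> 0"
  proof (rule LIMSEQ_I)
    fix e :: real assume "e > 0"
    then obtain N where N: "\<forall>m\<ge>N. \<forall>n\<ge>N. (\<integral>x. norm (fs m x - fs n x) powr p \<partial>M) \<le> e / 2"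
      using cau[of "e / 2"] by auto
    show "\<exists>no. \<forall>n\<ge>no. norm ((\<integral>x. norm (fs n x - f x) powr p \<partial>M) - 0) < e"
    proof (intro exI allI impI)
      fix n assume "n \<ge> N"
      from fat(2)[OF N this] show "norm ((\<integral>x. norm (fs n x - f x) powr p \<partial>M) - 0) < e"
        using \<open>e > 0\<close> by simp
    qed
  qed
  ultimately show ?thesis by blast
qed

lemma Lp_clarkson:
  fixes f g :: "'m \<Rightarrow> 'e::euclidean_space"
  assumes p: "p \<ge> 2" and f: "Lp_fun p M f" and g: "Lp_fun p M g"
  shows "(\<integral>x. norm ((f x + g x) /\<^sub>R 2) powr p \<partial>M) + (\<integral>x. norm ((f x - g x) /\<^sub>R 2) powr p \<partial>M)
     \<le> ((\<integral>x. norm (f x) powr p \<partial>M) + (\<integral>x. norm (g x) powr p \<partial>M)) / 2"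
proof -
  have p1: "p \<ge> 1" using p by simp
  note [simp] = Lp_fun_integrable[OF f] Lp_fun_integrable[OF g]
    Lp_fun_integrable[OF Lp_fun_scaleR[OF Lp_fun_add[OF p1 f g]]]
    Lp_fun_integrable[OF Lp_fun_scaleR[OF Lp_fun_diff[OF p1 f g]]]
  have "(\<integral>x. norm ((f x + g x) /\<^sub>R 2) powr p \<partial>M) + (\<integral>x. norm ((f x - g x) /\<^sub>R 2) powr p \<partial>M)
     = (\<integral>x. norm ((f x + g x) /\<^sub>R 2) powr p + norm ((f x - g x) /\<^sub>R 2) powr p \<partial>M)"
    by (rule Bochner_Integration.integral_add [symmetric]) fact+
  also have "\<dots> \<le> (\<integral>x. (norm (f x) powr p + norm (g x) powr p) / 2 \<partial>M)"
    by (rule integral_mono) (use clarkson[OF p] in \<open>auto intro!: Bochner_Integration.integrable_add simp del: norm_scaleR scaleR_right_distrib\<close>)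
  also have "\<dots> = ((\<integral>x. norm (f x) powr p \<partial>M) + (\<integral>x. norm (g x) powr p \<partial>M)) / 2" by simp
  finally show ?thesis .
qed

lemma Lp_subgradient:
  fixes f g :: "'m \<Rightarrow> 'e::euclidean_space"
  assumes p: "p \<ge> 2" and f: "Lp_fun p M f" and g: "Lp_fun p M g"
  shows "(\<integral>x. norm (f x) powr p \<partial>M) + p * (\<integral>x. pflux p (f x) \<bullet> (g x - f x) \<partial>M) \<le> (\<integral>x. norm (g x) powr p \<partial>M)"
proof -
  have i: "integrable M (\<lambda>x. pflux p (f x) \<bullet> (g x - f x))"
    using p by (intro integrable_pflux_inner f Lp_fun_diff g) auto
  have "(\<integral>x. norm (f x) powr p + p * (pflux p (f x) \<bullet> (g x - f x)) \<partial>M) \<le> (\<integral>x. norm (g x) powr p \<partial>M)"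
    by (rule integral_mono) (use f g i pflux_subgradient[of p] p in \<open>auto simp: Lp_fun_def\<close>)
  then show ?thesis using f i by (simp add: Lp_fun_def)
qed

lemma Lp_strong_mono:
  fixes f g :: "'m \<Rightarrow> 'e::euclidean_space"
  assumes p: "p \<ge> 2" and f: "Lp_fun p M f" and g: "Lp_fun p M g"
  shows "2 powr (1 - p) * (\<integral>x. norm (f x - g x) powr p \<partial>M)
     \<le> (\<integral>x. pflux p (f x) \<bullet> (f x - g x) \<partial>M) - (\<integral>x. pflux p (g x) \<bullet> (f x - g x) \<partial>M)"
proof -
  have p1: "p \<ge> 1" using p by simp
  note fg = Lp_fun_diff[OF p1 f g]
  have "2 powr (1 - p) * (\<integral>x. norm (f x - g x) powr p \<partial>M) = (\<integral>x. 2 powr (1 - p) * norm (f x - g x) powr p \<partial>M)"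
    by simp
  also have "\<dots> \<le> (\<integral>x. pflux p (f x) \<bullet> (f x - g x) - pflux p (g x) \<bullet> (f x - g x) \<partial>M)"
  proof (rule integral_mono)
    show "integrable M (\<lambda>x. pflux p (f x) \<bullet> (f x - g x) - pflux p (g x) \<bullet> (f x - g x))"
      by (rule Bochner_Integration.integrable_diff integrable_pflux_inner p f g fg)+
  qed (use fg pflux_strong_mono[OF p] in \<open>auto simp: Lp_fun_def simp flip: inner_diff_left\<close>)
  also have "\<dots> = (\<integral>x. pflux p (f x) \<bullet> (f x - g x) \<partial>M) - (\<integral>x. pflux p (g x) \<bullet> (f x - g x) \<partial>M)"
    by (rule Bochner_Integration.integral_diff integrable_pflux_inner p f g fg)+
  finally show ?thesis .
qed

subsection \<open>Minimisation of a uniformly convex energy\<close>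

text \<open>\<open>N u / p\<close> plays the role of the energy and \<open>A u\<close> that of its
  derivative; \<open>A_sub\<close> expresses this as a subgradient inequality. Members of
  \<open>V\<close> are functions rather than classes. \<open>poincare\<close> controls the
  \<open>L1\<close> norm, the norm dual to bounded right-hand sides.\<close>

locale p_form =
  fixes V :: "('a::euclidean_space \<Rightarrow> real) set" and p CP :: real
    and N :: "('a \<Rightarrow> real) \<Rightarrow> real" and A :: "('a \<Rightarrow> real) \<Rightarrow> ('a \<Rightarrow> real) \<Rightarrow> real"
  assumes p2: "p \<ge> 2"
    and V_zero: "(\<lambda>_. 0) \<in> V"
    and V_lin: "u \<in> V \<Longrightarrow> v \<in> V \<Longrightarrow> (\<lambda>x. u x + c * v x) \<in> V"
    and V_int: "u \<in> V \<Longrightarrow> integrable lborel u"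
    and N_nonneg: "0 \<le> N u"
    and N_scale: "u \<in> V \<Longrightarrow> N (\<lambda>x. c * u x) = \<bar>c\<bar> powr p * N u"
    and N_clarkson: "u \<in> V \<Longrightarrow> v \<in> V \<Longrightarrow>
      N (\<lambda>x. (u x + v x) / 2) + N (\<lambda>x. (u x - v x) / 2) \<le> (N u + N v) / 2"
    and A_sub: "u \<in> V \<Longrightarrow> v \<in> V \<Longrightarrow> N u + p * A u (\<lambda>x. v x - u x) \<le> N v"
    and A_lin: "u \<in> V \<Longrightarrow> v \<in> V \<Longrightarrow> w \<in> V \<Longrightarrow> A u (\<lambda>x. v x + c * w x) = A u v + c * A u w"
    and A_cont: "(\<And>n. us n \<in> V) \<Longrightarrow> u \<in> V \<Longrightarrow> v \<in> V \<Longrightarrow>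
      (\<lambda>n. N (\<lambda>x. us n x - u x)) \<longlonglongrightarrow> 0 \<Longrightarrow> (\<lambda>n. A (us n) v) \<longlonglongrightarrow> A u v"
    and A_bound: "u \<in> V \<Longrightarrow> v \<in> V \<Longrightarrow> \<bar>A u v\<bar> \<le> N u + N v"
    and CP_pos: "CP > 0"
    and poincare: "u \<in> V \<Longrightarrow> (\<integral>x. \<bar>u x\<bar> \<partial>lborel) powr p \<le> CP * N u"
    and complete: "(\<And>n. us n \<in> V) \<Longrightarrow>
      (\<And>e. e > 0 \<Longrightarrow> \<exists>M. \<forall>m\<ge>M. \<forall>n\<ge>M. N (\<lambda>x. us m x - us n x) \<le> e) \<Longrightarrow>
      \<exists>u\<in>V. (\<lambda>n. N (\<lambda>x. us n x - u x)) \<longlonglongrightarrow> 0"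
begin

lemma V_add: "u \<in> V \<Longrightarrow> v \<in> V \<Longrightarrow> (\<lambda>x. u x + v x) \<in> V"
  using V_lin[of u v 1] by simp

lemma V_diff: "u \<in> V \<Longrightarrow> v \<in> V \<Longrightarrow> (\<lambda>x. u x - v x) \<in> V"
  using V_lin[of u v "-1"] by simp

lemma V_scale: "u \<in> V \<Longrightarrow> (\<lambda>x. c * u x) \<in> V"
  using V_lin[OF V_zero, of u c] by simp

text \<open>\<open>A_bound\<close> is not homogeneous but \<open>A u\<close> is linear: scaling the
  second argument by \<open>s\<close> bounds \<open>\<bar>A u (w n)\<bar>\<close> by
  \<open>N u / s + s powr (p - 1) * N (w n)\<close>. First \<open>s\<close> is chosen large, then
  \<open>n\<close>.\<close>

lemma A_small:
  assumes u: "u \<in> V" and w: "\<And>n. w n \<in> V" and lim: "(\<lambda>n. N (w n)) \<longlonglongrightarrow> 0"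
  shows "(\<lambda>n. A u (w n)) \<longlonglongrightarrow> 0"
proof (rule LIMSEQ_I)
  fix e :: real assume e: "e > 0"
  define s where "s = 2 * N u / e + 1"
  have s: "s > 0" using e N_nonneg[of u] by (auto simp: s_def intro!: add_nonneg_pos)
  have Ns: "N u / s < e / 2" using e s N_nonneg[of u] by (simp add: s_def field_simps)
  have "(\<lambda>n. s powr (p - 1) * N (w n)) \<longlonglongrightarrow> 0" using tendsto_mult_right_zero[OF lim] .
  then obtain no where no: "\<And>n. n \<ge> no \<Longrightarrow> s powr (p - 1) * N (w n) < e / 2"
    using order_tendstoD(2)[of _ 0 sequentially "e/2"] e unfolding eventually_sequentially by (metis half_gt_zero)
  show "\<exists>no. \<forall>n\<ge>no. norm (A u (w n) - 0) < e"
  proof (intro exI allI impI)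
    fix n assume n: "n \<ge> no"
    have "A u (\<lambda>x. s * w n x) = s * A u (w n)"
      using A_lin[OF u V_zero w, of s n] A_lin[OF u V_zero V_zero, of 1] by simp
    then have "s * \<bar>A u (w n)\<bar> = \<bar>A u (\<lambda>x. s * w n x)\<bar>" using s by (simp add: abs_mult)
    also have "\<dots> \<le> N u + s powr p * N (w n)"
      using A_bound[OF u V_scale[OF w]] N_scale[OF w] s by (metis abs_of_pos)
    finally have "\<bar>A u (w n)\<bar> \<le> (N u + s powr p * N (w n)) / s" using s by (simp add: field_simps)
    also have "\<dots> = N u / s + s powr (p - 1) * N (w n)" using s by (simp add: powr_diff field_simps)
    also have "\<dots> < e" using Ns no[OF n] by linarith
    finally show "norm (A u (w n) - 0) < e" by simp
  qed
qed

lemma L1_tendsto: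
  assumes w: "\<And>n. w n \<in> V" and lim: "(\<lambda>n. N (w n)) \<longlonglongrightarrow> 0"
  shows "(\<lambda>n. \<integral>x. \<bar>w n x\<bar> \<partial>lborel) \<longlonglongrightarrow> 0"
proof -
  have "(\<lambda>n. (CP * N (w n)) powr (1 / p)) \<longlonglongrightarrow> (CP * 0) powr (1 / p)"
    using p2 CP_pos N_nonneg by (intro tendsto_powr' tendsto_intros lim) auto
  then have *: "(\<lambda>n. (CP * N (w n)) powr (1 / p)) \<longlonglongrightarrow> 0" by simp
  show ?thesis
  proof (rule tendsto_sandwich[OF _ _ tendsto_const *])
    show "\<forall>\<^sub>F n in sequentially. (\<integral>x. \<bar>w n x\<bar> \<partial>lborel) \<le> (CP * N (w n)) powr (1 / p)"
    proof (rule always_eventually, rule allI)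
      fix n
      have "((\<integral>x. \<bar>w n x\<bar> \<partial>lborel) powr p) powr (1 / p) \<le> (CP * N (w n)) powr (1 / p)"
        using poincare[OF w] p2 by (intro powr_mono2) auto
      then show "(\<integral>x. \<bar>w n x\<bar> \<partial>lborel) \<le> (CP * N (w n)) powr (1 / p)"
        using p2 by (simp add: powr_powr)
    qed
  qed simp
qed

lemma integrable_bounded_mult:
  assumes "u \<in> V" and [measurable]: "g \<in> borel_measurable lborel" and "\<And>x. \<bar>g x\<bar> \<le> B"
  shows "integrable lborel (\<lambda>x. g x * u x)"
proof -
  have [measurable]: "u \<in> borel_measurable borel" using borel_measurable_integrable[OF V_int[OF assms(1)]] by simp
  show ?thesis
    by (rule Bochner_Integration.integrable_bound[OF integrable_mult_right[OF V_int[OF assms(1)], of B]])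
      (use assms(3) in \<open>auto simp: abs_mult intro!: AE_I2 mult_right_mono intro: order_trans[OF _ abs_ge_self]\<close>)
qed

lemma bounded_mult_le:
  assumes "u \<in> V" and [measurable]: "g \<in> borel_measurable lborel" and "\<And>x. \<bar>g x\<bar> \<le> B"
  shows "\<bar>\<integral>x. g x * u x \<partial>lborel\<bar> \<le> B * (\<integral>x. \<bar>u x\<bar> \<partial>lborel)"
proof -
  have "\<bar>\<integral>x. g x * u x \<partial>lborel\<bar> \<le> (\<integral>x. \<bar>g x * u x\<bar> \<partial>lborel)" by (rule integral_abs_bound)
  also have "\<dots> \<le> (\<integral>x. B * \<bar>u x\<bar> \<partial>lborel)"
    using integrable_abs[OF integrable_bounded_mult[OF assms]] V_int[OF assms(1)] assms(3)
    by (intro integral_mono) (auto simp: abs_mult intro!: mult_right_mono)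
  finally show ?thesis by simp
qed

text \<open>Clarkson's inequality bounds the distance of two near-minimisers of \<open>J\<close> by
  their excess over the infimum, so a minimising sequence is Cauchy and converges in
  \<open>V\<close>. The subgradient inequality at the limit yields its minimality, and the one at
  perturbed points yields the Euler equation.\<close>

lemma solve:
  assumes g: "g \<in> borel_measurable lborel" and B: "\<And>x. \<bar>g x\<bar> \<le> B"
  shows "\<exists>u\<in>V. \<forall>v\<in>V. A u v = (\<integral>x. g x * v x \<partial>lborel)"
proof -
  define L where "L v = (\<integral>x. g x * v x \<partial>lborel)" for v
  define J where "J v = N v / p - L v" for v
  have B0: "B \<ge> 0" using B[of 0] by simp
  have Lb: "\<bar>L v\<bar> \<le> B * (\<integral>x. \<bar>v x\<bar> \<partial>lborel)" if "v \<in> V" for v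
    unfolding L_def by (rule bounded_mult_le[OF that g B])
  have Llin: "L (\<lambda>x. u x + c * v x) = L u + c * L v" if "u \<in> V" "v \<in> V" for u v c
    using integrable_bounded_mult[OF that(1) g B] integrable_bounded_mult[OF that(2) g B]
    unfolding L_def by (simp add: distrib_left mult.left_commute)
  have Ldiff: "L (\<lambda>x. u x - v x) = L u - L v" if "u \<in> V" "v \<in> V" for u v
    using Llin[OF that, of "-1"] by simp
  \<comment> \<open>Since \<open>t0 powr (p - 1) = B * p * CP\<close>, the coercive term
    \<open>t powr p / (p * CP)\<close> dominates \<open>B * t\<close> beyond \<open>t0\<close>;
    below \<open>t0\<close> the linear term is at most \<open>B * t0\<close>.\<close>
  define t0 where "t0 = (B * p * CP) powr (1 / (p - 1))"
  have Jlow: "J v \<ge> - (B * t0)" if v: "v \<in> V" for v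
  proof -
    define t where "t = (\<integral>x. \<bar>v x\<bar> \<partial>lborel)"
    have t: "t \<ge> 0" by (simp add: t_def)
    have "t powr p / (p * CP) \<le> N v / p" using poincare[OF v] p2 CP_pos by (simp add: t_def field_simps)
    moreover have "L v \<le> B * t" using Lb[OF v] by (simp add: t_def)
    moreover have "t powr p / (p * CP) - B * t \<ge> - (B * t0)"
    proof (cases "t \<le> t0")
      case True
      then have "B * t \<le> B * t0" using B0 by (intro mult_left_mono)
      moreover have "0 \<le> t powr p / (p * CP)" using p2 CP_pos by simp
      ultimately show ?thesis by linarith
    next
      case False
      then have "t > 0" using powr_ge_zero[of "B * p * CP"] unfolding t0_def by (meson le_less_trans not_le)
      have "t0 powr (p - 1) \<le> t powr (p - 1)" using False p2 by (intro powr_mono2) (auto simp: t0_def)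
      also have "t0 powr (p - 1) = B * p * CP" unfolding t0_def using p2 B0 CP_pos by (simp add: powr_powr)
      finally have "B * p * CP * t \<le> t powr (p - 1) * t" using t by (intro mult_right_mono) auto
      also have "\<dots> = t powr p" using powr_add[of t "p - 1" 1] \<open>t > 0\<close> by simp
      finally have "B * t \<le> t powr p / (p * CP)" using p2 CP_pos by (simp add: field_simps)
      moreover have "B * t0 \<ge> 0" using B0 by (simp add: t0_def)
      ultimately show ?thesis by linarith
    qed
    ultimately show ?thesis unfolding J_def by linarith
  qed
  define j where "j = Inf (J ` V)"
  have bdd: "bdd_below (J ` V)" using Jlow by (intro bdd_belowI2)
  have jle: "j \<le> J v" if "v \<in> V" for v unfolding j_def by (rule cINF_lower[OF bdd that])
  have "\<exists>u\<in>V. J u < j + e" if "e > 0" for e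
    using cINF_less_iff[OF _ bdd, of "j + e"] V_zero that unfolding j_def by force
  then have "\<exists>u\<in>V. J u < j + 1 / real (Suc n)" for n by simp
  then obtain us where us: "\<And>n. us n \<in> V" "\<And>n. J (us n) < j + 1 / real (Suc n)" by metis
  \<comment> \<open>The midpoint of \<open>u\<close> and \<open>v\<close> lies in \<open>V\<close>,
    so its value of \<open>J\<close> is at least \<open>j\<close>; what Clarkson's inequality leaves
    for the half difference is the mean excess of \<open>u\<close> and \<open>v\<close>.\<close>
  have Jmid: "N (\<lambda>x. u x - v x) \<le> 2 powr p * p * ((J u + J v) / 2 - j)" if uv: "u \<in> V" "v \<in> V" for u v
  proof -
    have h: "(\<lambda>x. (u x + v x) / 2) = (\<lambda>x. (1/2) * (u x + v x))" by (auto simp: field_simps)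
    have hV: "(\<lambda>x. (u x + v x) / 2) \<in> V" unfolding h by (intro V_scale V_add uv)
    have "(\<lambda>x. (u x - v x) / 2) = (\<lambda>x. (1/2) * (u x - v x))" by (auto simp: field_simps)
    then have N2: "N (\<lambda>x. (u x - v x) / 2) = N (\<lambda>x. u x - v x) / 2 powr p"
      using N_scale[OF V_diff[OF uv], of "1/2"] by (simp add: powr_divide)
    have L2: "L (\<lambda>x. (u x + v x) / 2) = (L u + L v) / 2"
      using Llin[OF V_zero V_add[OF uv], of "1/2"] Llin[OF uv, of 1] unfolding h by (simp add: L_def)
    have "N (\<lambda>x. (u x - v x) / 2) \<le> (N u + N v) / 2 - p * (J (\<lambda>x. (u x + v x) / 2) + L (\<lambda>x. (u x + v x) / 2))"
    proof -
      have "p * (J (\<lambda>x. (u x + v x) / 2) + L (\<lambda>x. (u x + v x) / 2)) = N (\<lambda>x. (u x + v x) / 2)"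
        using p2 by (simp add: J_def)
      then show ?thesis using N_clarkson[OF uv] by linarith
    qed
    also have "\<dots> = p * ((J u + J v) / 2 - J (\<lambda>x. (u x + v x) / 2))"
      unfolding L2 J_def using p2 by (simp add: field_simps)
    also have "\<dots> \<le> p * ((J u + J v) / 2 - j)" using jle[OF hV] p2 by simp
    finally show ?thesis unfolding N2 by (simp add: field_simps)
  qed
  have "\<exists>M. \<forall>m\<ge>M. \<forall>n\<ge>M. N (\<lambda>x. us m x - us n x) \<le> e" if e: "e > 0" for e
  proof -
    have pp: "2 powr p * p > 0" using p2 by simp
    define d where "d = e / (2 powr p * p)"
    have "d > 0" using e pp by (simp add: d_def)
    then obtain M where M: "1 / real (Suc M) < d" using nat_approx_posE by blast
    have gen: "x \<le> z \<Longrightarrow> y \<le> z \<Longrightarrow> a < j + x \<Longrightarrow> b < j + y \<Longrightarrow> z < d \<Longrightarrow> (a + b) / 2 - j \<le> d"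
      for x y z a b :: real by argo
    have "N (\<lambda>x. us m x - us n x) \<le> e" if "m \<ge> M" "n \<ge> M" for m n
    proof -
      have "1 / real (Suc m) \<le> 1 / real (Suc M)" "1 / real (Suc n) \<le> 1 / real (Suc M)"
        using that by (auto simp: divide_simps)
      then have "(J (us m) + J (us n)) / 2 - j \<le> d"
        using gen us(2)[of m] us(2)[of n] M by blast
      then have "2 powr p * p * ((J (us m) + J (us n)) / 2 - j) \<le> 2 powr p * p * d"
        using pp by (intro mult_left_mono) auto
      then show ?thesis using Jmid[OF us(1)[of m] us(1)[of n]] pp p2 by (simp add: d_def split: if_splits)
    qed
    then show ?thesis by blast
  qed
  from complete[OF us(1) this] obtain u where u: "u \<in> V" and lim: "(\<lambda>n. N (\<lambda>x. us n x - u x)) \<longlonglongrightarrow> 0"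
    by blast
  have dV: "(\<lambda>x. us n x - u x) \<in> V" for n by (intro V_diff us(1) u)
  have "J u \<le> j"
  proof -
    have Llim: "(\<lambda>n. L (\<lambda>x. us n x - u x)) \<longlonglongrightarrow> 0"
    proof (rule Lim_null_comparison)
      show "(\<lambda>n. B * (\<integral>x. \<bar>us n x - u x\<bar> \<partial>lborel)) \<longlonglongrightarrow> 0"
        using tendsto_mult_right_zero[OF L1_tendsto[OF dV lim]] .
    qed (use Lb[OF dV] in auto)
    have "J u \<le> j + 1 / real (Suc n) - A u (\<lambda>x. us n x - u x) + L (\<lambda>x. us n x - u x)" for n
    proof -
      have "N u / p \<le> N (us n) / p - A u (\<lambda>x. us n x - u x)"
        using A_sub[OF u us(1)[of n]] p2 by (simp add: field_simps)
      then show ?thesis using us(2)[of n] Ldiff[OF us(1)[of n] u] unfolding J_def by linarith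
    qed
    moreover have "(\<lambda>n. j + 1 / real (Suc n) - A u (\<lambda>x. us n x - u x) + L (\<lambda>x. us n x - u x)) \<longlonglongrightarrow> j + 0 - 0 + 0"
      by (intro tendsto_intros LIMSEQ_Suc[OF lim_1_over_n] A_small u dV lim Llim)
    ultimately show ?thesis by (intro LIMSEQ_le_const[of _ j]) auto
  qed
  then have umin: "J u \<le> J v" if "v \<in> V" for v using jle[OF that] by simp
  \<comment> \<open>Instead of differentiating \<open>J\<close> at \<open>u\<close>, the subgradient
    inequality at the perturbed point \<open>w n\<close> and the minimality of \<open>u\<close> give
    \<open>L v \<le> A (w n) v\<close> without remainder; then \<open>w n\<close> tends to
    \<open>u\<close>. Applied to \<open>- v\<close>, this also gives the reverse inequality.\<close>
  have ge: "L v \<le> A u v" if v: "v \<in> V" for v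
  proof -
    define t where "t n = 1 / real (Suc n)" for n
    have t: "t n > 0" for n by (simp add: t_def)
    define w where "w n = (\<lambda>x. u x + t n * v x)" for n
    have wV: "w n \<in> V" for n unfolding w_def by (intro V_lin u v)
    have "L v \<le> A (w n) v" for n
    proof -
      have e: "(\<lambda>x. u x - w n x) = (\<lambda>x. 0 + (- t n) * v x)" by (auto simp: w_def)
      have "A (w n) (\<lambda>x. u x - w n x) = - t n * A (w n) v"
        unfolding e A_lin[OF wV V_zero v] using A_lin[OF wV V_zero V_zero, of n 1] by simp
      then have "N (w n) - p * t n * A (w n) v \<le> N u" using A_sub[OF wV u, of n] by simp
      moreover have "N u / p \<le> N (w n) / p - t n * L v"
        using umin[OF wV, of n] Llin[OF u v, of "t n"] unfolding J_def w_def by simp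
      then have "N u \<le> N (w n) - p * t n * L v" using p2 by (simp add: field_simps)
      ultimately have "p * t n * L v \<le> p * t n * A (w n) v" by linarith
      then show ?thesis using t[of n] p2 by (simp add: mult_le_cancel_left)
    qed
    moreover have "(\<lambda>n. A (w n) v) \<longlonglongrightarrow> A u v"
    proof (rule A_cont[OF wV u v])
      have "(\<lambda>x. w n x - u x) = (\<lambda>x. t n * v x)" for n by (auto simp: w_def)
      then have Nw: "N (\<lambda>x. w n x - u x) = t n powr p * N v" for n
        using N_scale[OF v] t[of n] by simp
      have "(\<lambda>n. t n powr p * N v) \<longlonglongrightarrow> 0 powr p * N v"
        unfolding t_def using p2 by (intro tendsto_intros tendsto_powr' LIMSEQ_Suc[OF lim_1_over_n]) auto
      then show "(\<lambda>n. N (\<lambda>x. w n x - u x)) \<longlonglongrightarrow> 0" unfolding Nw by simp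
    qed
    ultimately show ?thesis by (intro LIMSEQ_le_const) auto
  qed
  have "A u v = L v" if v: "v \<in> V" for v
  proof -
    have e: "(\<lambda>x. - v x) = (\<lambda>x. 0 + (-1) * v x)" by auto
    have "A u (\<lambda>x. - v x) = - A u v"
      unfolding e A_lin[OF u V_zero v] using A_lin[OF u V_zero V_zero, of 1] by simp
    moreover have "L (\<lambda>x. - v x) = - L v" by (simp add: L_def)
    moreover have "(\<lambda>x. - v x) \<in> V" using V_scale[OF v, of "-1"] by simp
    ultimately show ?thesis using ge[OF v] ge[of "\<lambda>x. - v x"] by simp
  qed
  then show ?thesis using u unfolding L_def by blast
qed

end

subsection \<open>Translations in the mean\<close>

lemma lborel_integral_translate:
  fixes f :: "'a::euclidean_space \<Rightarrow> 'b::euclidean_space"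
  assumes [measurable]: "f \<in> borel_measurable borel"
  shows "(\<integral>x. f (x + c) \<partial>lborel) = (\<integral>x. f x \<partial>lborel)"
    and "integrable lborel (\<lambda>x. f (x + c)) \<longleftrightarrow> integrable lborel f"
proof -
  have "(\<integral>x. f x \<partial>lborel) = (\<integral>x. f x \<partial>distr lborel borel ((+) c))" by (simp add: lborel_distr_plus)
  also have "\<dots> = (\<integral>x. f (x + c) \<partial>lborel)" by (subst integral_distr) (auto simp: add.commute)
  finally show "(\<integral>x. f (x + c) \<partial>lborel) = (\<integral>x. f x \<partial>lborel)" by simp
  have "integrable lborel f \<longleftrightarrow> integrable (distr lborel borel ((+) c)) f" by (simp add: lborel_distr_plus)
  also have "\<dots> \<longleftrightarrow> integrable lborel (\<lambda>x. f (x + c))" by (subst integrable_distr_eq) (auto simp: add.commute)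
  finally show "integrable lborel (\<lambda>x. f (x + c)) \<longleftrightarrow> integrable lborel f" by simp
qed

lemma nn_integral_lborel_translate:
  fixes f :: "'a::euclidean_space \<Rightarrow> ennreal"
  assumes [measurable]: "f \<in> borel_measurable borel"
  shows "(\<integral>\<^sup>+x. f (x + c) \<partial>lborel) = (\<integral>\<^sup>+x. f x \<partial>lborel)"
proof -
  have "(\<integral>\<^sup>+x. f x \<partial>lborel) = (\<integral>\<^sup>+x. f x \<partial>distr lborel borel ((+) c))" by (simp add: lborel_distr_plus)
  also have "\<dots> = (\<integral>\<^sup>+x. f (x + c) \<partial>lborel)" by (subst nn_integral_distr) (auto simp: add.commute)
  finally show ?thesis by simp
qed

lemma integrable_translate_diff:
  fixes f :: "'a::euclidean_space \<Rightarrow> 'b::euclidean_space"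
  assumes "integrable lborel f"
  shows "integrable lborel (\<lambda>x. f (x + c) - f x)"
  using assms lborel_integral_translate(2)[of f c] borel_measurable_integrable[OF assms] by simp

definition L1_trans_cont :: "('a::euclidean_space \<Rightarrow> real) \<Rightarrow> bool" where
  "L1_trans_cont f \<longleftrightarrow> (\<forall>y. y \<longlonglongrightarrow> 0 \<longrightarrow> (\<lambda>n. \<integral>x. \<bar>f (x + y n) - f x\<bar> \<partial>lborel) \<longlonglongrightarrow> 0)"

text \<open>Translations preserve the integral, so the approximation error enters twice, once
  translated.\<close>

lemma L1_trans_cont_approx:
  fixes f :: "'a::euclidean_space \<Rightarrow> real"
  assumes f: "integrable lborel f"
    and approx: "\<And>e. e > 0 \<Longrightarrow> \<exists>g. integrable lborel g \<and> L1_trans_cont g \<and> (\<integral>x. \<bar>f x - g x\<bar> \<partial>lborel) < e"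
  shows "L1_trans_cont f"
  unfolding L1_trans_cont_def
proof (intro allI impI LIMSEQ_I)
  fix y :: "nat \<Rightarrow> 'a" and e :: real assume y: "y \<longlonglongrightarrow> 0" and e: "0 < e"
  obtain g where g: "integrable lborel g" "L1_trans_cont g" "(\<integral>x. \<bar>f x - g x\<bar> \<partial>lborel) < e / 3"
    using approx[of "e / 3"] e by auto
  note [measurable] = borel_measurable_integrable[OF f] borel_measurable_integrable[OF g(1)]
  have "(\<lambda>n. \<integral>x. \<bar>g (x + y n) - g x\<bar> \<partial>lborel) \<longlonglongrightarrow> 0" using g(2) y by (simp add: L1_trans_cont_def)
  then obtain no where no: "\<And>n. n \<ge> no \<Longrightarrow> (\<integral>x. \<bar>g (x + y n) - g x\<bar> \<partial>lborel) < e / 3"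
    using LIMSEQ_D[of _ 0 "e / 3"] e by fastforce
  show "\<exists>no. \<forall>n\<ge>no. norm ((\<integral>x. \<bar>f (x + y n) - f x\<bar> \<partial>lborel) - 0) < e"
  proof (intro exI allI impI)
    fix n assume n: "n \<ge> no"
    have i1: "integrable lborel (\<lambda>x. \<bar>f x - g x\<bar>)" using f g(1) by simp
    have i2: "integrable lborel (\<lambda>x. \<bar>f (x + y n) - g (x + y n)\<bar>)"
      using i1 lborel_integral_translate(2)[of "\<lambda>x. \<bar>f x - g x\<bar>" "y n"] by simp
    have i3: "integrable lborel (\<lambda>x. \<bar>g (x + y n) - g x\<bar>)"
      using integrable_translate_diff[OF g(1)] by simp
    have "(\<integral>x. \<bar>f (x + y n) - f x\<bar> \<partial>lborel)
       \<le> (\<integral>x. \<bar>f (x + y n) - g (x + y n)\<bar> + \<bar>g (x + y n) - g x\<bar> + \<bar>f x - g x\<bar> \<partial>lborel)"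
      using i1 i2 i3 integrable_translate_diff[OF f] by (intro integral_mono) auto
    also have "\<dots> = (\<integral>x. \<bar>f x - g x\<bar> \<partial>lborel) + (\<integral>x. \<bar>g (x + y n) - g x\<bar> \<partial>lborel) + (\<integral>x. \<bar>f x - g x\<bar> \<partial>lborel)"
      using i1 i2 i3 lborel_integral_translate(1)[of "\<lambda>x. \<bar>f x - g x\<bar>" "y n"] by simp
    also have "\<dots> < e" using g(3) no[OF n] by simp
    finally show "norm ((\<integral>x. \<bar>f (x + y n) - f x\<bar> \<partial>lborel) - 0) < e" by simp
  qed
qed

text \<open>The absolute difference of two indicators is their sum minus twice their product. The
  integral of the translate is constant, and the product converges pointwise because
  \<open>U\<close> is open, dominated by the indicator of \<open>U\<close>.\<close>

lemma L1_trans_cont_open: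
  fixes U :: "'a::euclidean_space set"
  assumes U: "open U" "emeasure lborel U < \<infinity>"
  shows "L1_trans_cont (indicator U :: 'a \<Rightarrow> real)"
  unfolding L1_trans_cont_def
proof (intro allI impI)
  fix y :: "nat \<Rightarrow> 'a" assume y: "y \<longlonglongrightarrow> 0"
  let ?I = "indicator U :: 'a \<Rightarrow> real"
  have Um [measurable]: "U \<in> sets borel" using U by simp
  have iU: "integrable lborel ?I" using U by (intro integrable_real_indicator) auto
  have iT: "integrable lborel (\<lambda>x. ?I (x + c))" for c
    using iU by (subst lborel_integral_translate(2)) auto
  have iM: "integrable lborel (\<lambda>x. ?I (x + c) * ?I x)" for c
    by (rule Bochner_Integration.integrable_bound[OF iU]) (auto split: split_indicator)
  have "(\<lambda>n. \<integral>x. ?I (x + y n) * ?I x \<partial>lborel) \<longlonglongrightarrow> (\<integral>x. ?I x \<partial>lborel)"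
  proof (rule integral_dominated_convergence[where w="?I"])
    show "AE x in lborel. (\<lambda>n. ?I (x + y n) * ?I x) \<longlonglongrightarrow> ?I x"
    proof (rule AE_I2)
      fix x
      show "(\<lambda>n. ?I (x + y n) * ?I x) \<longlonglongrightarrow> ?I x"
      proof (cases "x \<in> U")
        case True
        have "(\<lambda>n. x + y n) \<longlonglongrightarrow> x + 0" by (intro tendsto_intros y)
        then have "\<forall>\<^sub>F n in sequentially. x + y n \<in> U"
          using U(1) True by (simp add: topological_tendstoD)
        then have "\<forall>\<^sub>F n in sequentially. ?I (x + y n) * ?I x = ?I x" by eventually_elim (simp add: True)
        then show ?thesis by (rule tendsto_eventually)
      qed simp
    qed
  qed (use iU in \<open>auto split: split_indicator\<close>)
  then have "(\<lambda>n. 2 * (\<integral>x. ?I x \<partial>lborel) - 2 * (\<integral>x. ?I (x + y n) * ?I x \<partial>lborel))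
     \<longlonglongrightarrow> 2 * (\<integral>x. ?I x \<partial>lborel) - 2 * (\<integral>x. ?I x \<partial>lborel)" by (intro tendsto_intros)
  moreover have "2 * (\<integral>x. ?I x \<partial>lborel) - 2 * (\<integral>x. ?I (x + y n) * ?I x \<partial>lborel) = (\<integral>x. \<bar>?I (x + y n) - ?I x\<bar> \<partial>lborel)" for n
  proof -
    have "(\<integral>x. \<bar>?I (x + y n) - ?I x\<bar> \<partial>lborel) = (\<integral>x. ?I (x + y n) + ?I x - 2 * (?I (x + y n) * ?I x) \<partial>lborel)"
      by (intro Bochner_Integration.integral_cong) (auto split: split_indicator)
    also have "\<dots> = (\<integral>x. ?I (x + y n) \<partial>lborel) + (\<integral>x. ?I x \<partial>lborel) - 2 * (\<integral>x. ?I (x + y n) * ?I x \<partial>lborel)"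
      using iU iT iM by simp
    also have "(\<integral>x. ?I (x + y n) \<partial>lborel) = (\<integral>x. ?I x \<partial>lborel)" by (rule lborel_integral_translate) simp
    finally show ?thesis by simp
  qed
  ultimately show "(\<lambda>n. \<integral>x. \<bar>?I (x + y n) - ?I x\<bar> \<partial>lborel) \<longlonglongrightarrow> 0" by simp
qed

text \<open>Outer regularity approximates a set of finite measure by open sets, where openness gives
  pointwise convergence; sums and \<open>L1\<close> limits preserve the property.\<close>

lemma L1_translation_continuous:
  fixes f :: "'a::euclidean_space \<Rightarrow> real"
  assumes "integrable lborel f" shows "L1_trans_cont f"
  using assms
proof (induction rule: integrable_induct)
  case (base A c)
  have A [measurable]: "A \<in> sets borel" using base by simp
  have ind: "L1_trans_cont (indicator A :: 'a \<Rightarrow> real)"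
  proof (rule L1_trans_cont_approx)
    show iA: "integrable lborel (indicator A :: 'a \<Rightarrow> real)" using base by (intro integrable_real_indicator) auto
    fix e :: real assume e: "e > 0"
    obtain U where U: "open U" "A \<subseteq> U" "emeasure lebesgue (U - A) < ennreal e"
      using sets_lebesgue_outer_open[of A e] e A by (metis sets_completionI_sets sets_lborel)
    have m: "U - A \<in> sets lborel" using U A by auto
    have eUA: "emeasure lborel (U - A) < ennreal e" using U(3) m by simp
    have "emeasure lborel U \<le> emeasure lborel A + emeasure lborel (U - A)"
      using U(2) m A emeasure_subadditive[of A lborel "U - A"] by (simp add: Un_absorb1)
    also have "\<dots> < \<infinity>" using base(2) eUA by (simp add: less_top[symmetric] top_unique) (auto simp: top_unique)
    finally have fU: "emeasure lborel U < \<infinity>" .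
    have "(\<integral>x. \<bar>indicator A x - indicator U x\<bar> \<partial>lborel) = (\<integral>x. indicat_real (U - A) x \<partial>lborel)"
      using U(2) by (intro Bochner_Integration.integral_cong) (auto split: split_indicator)
    also have "\<dots> < e"
      using eUA e by (simp add: measure_def) (metis enn2real_ennreal enn2real_less_iff ennreal_less_top less_le less_trans)
    finally show "\<exists>g. integrable lborel g \<and> L1_trans_cont g \<and> (\<integral>x. \<bar>indicator A x - g x\<bar> \<partial>lborel) < e"
      using L1_trans_cont_open[OF U(1) fU] fU U(1)
      by (intro exI[of _ "indicator U"]) (auto intro!: integrable_real_indicator)
  qed
  show ?case unfolding L1_trans_cont_def
  proof (intro allI impI)
    fix y :: "nat \<Rightarrow> 'a" assume "y \<longlonglongrightarrow> 0"
    then have "(\<lambda>n. (\<integral>x. \<bar>indicator A (x + y n) - indicator A x\<bar> \<partial>lborel) * \<bar>c\<bar>) \<longlonglongrightarrow> 0"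
      using ind by (intro tendsto_mult_left_zero) (simp add: L1_trans_cont_def)
    then show "(\<lambda>n. \<integral>x. \<bar>indicator A (x + y n) *\<^sub>R c - indicator A x *\<^sub>R c\<bar> \<partial>lborel) \<longlonglongrightarrow> 0"
      by (simp add: abs_mult flip: left_diff_distrib)
  qed
next
  case (add f g)
  show ?case unfolding L1_trans_cont_def
  proof (intro allI impI)
    fix y :: "nat \<Rightarrow> 'a" assume y: "y \<longlonglongrightarrow> 0"
    have lim: "(\<lambda>n. (\<integral>x. \<bar>f (x + y n) - f x\<bar> \<partial>lborel) + (\<integral>x. \<bar>g (x + y n) - g x\<bar> \<partial>lborel)) \<longlonglongrightarrow> 0 + 0"
      using add y by (intro tendsto_add) (auto simp: L1_trans_cont_def)
    show "(\<lambda>n. \<integral>x. \<bar>f (x + y n) + g (x + y n) - (f x + g x)\<bar> \<partial>lborel) \<longlonglongrightarrow> 0"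
    proof (rule tendsto_sandwich[OF _ _ tendsto_const lim[simplified]])
      have "(\<integral>x. \<bar>f (x + y n) + g (x + y n) - (f x + g x)\<bar> \<partial>lborel)
        \<le> (\<integral>x. \<bar>f (x + y n) - f x\<bar> \<partial>lborel) + (\<integral>x. \<bar>g (x + y n) - g x\<bar> \<partial>lborel)" for n
      proof -
        note i = integrable_translate_diff[OF add.hyps(1), of "y n"] integrable_translate_diff[OF add.hyps(2), of "y n"]
        have "(\<integral>x. \<bar>f (x + y n) + g (x + y n) - (f x + g x)\<bar> \<partial>lborel)
           \<le> (\<integral>x. \<bar>f (x + y n) - f x\<bar> + \<bar>g (x + y n) - g x\<bar> \<partial>lborel)"
          using i integrable_translate_diff[OF Bochner_Integration.integrable_add[OF add.hyps(1,2)], of "y n"]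
          by (intro integral_mono) auto
        then show ?thesis using i by simp
      qed
      then show "\<forall>\<^sub>F n in sequentially. (\<integral>x. \<bar>f (x + y n) + g (x + y n) - (f x + g x)\<bar> \<partial>lborel)
        \<le> (\<integral>x. \<bar>f (x + y n) - f x\<bar> \<partial>lborel) + (\<integral>x. \<bar>g (x + y n) - g x\<bar> \<partial>lborel)" by simp
    qed simp
  qed
next
  case (lim f s)
  show ?case
  proof (rule L1_trans_cont_approx[OF lim.hyps(4)])
    fix e :: real assume e: "e > 0"
    note [measurable] = borel_measurable_integrable[OF lim.hyps(4)] borel_measurable_integrable[OF lim.hyps(1)]
    have "(\<lambda>i. \<integral>x. \<bar>f x - s i x\<bar> \<partial>lborel) \<longlonglongrightarrow> (\<integral>x. 0 \<partial>(lborel :: 'a measure))"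
    proof (rule integral_dominated_convergence[where w="\<lambda>x. 3 * \<bar>f x\<bar>"])
      show "AE x in lborel. (\<lambda>i. \<bar>f x - s i x\<bar>) \<longlonglongrightarrow> 0"
      proof (rule AE_I2)
        fix x
        have "(\<lambda>i. \<bar>f x - s i x\<bar>) \<longlonglongrightarrow> \<bar>f x - f x\<bar>" by (intro tendsto_intros lim.hyps(2)) simp
        then show "(\<lambda>i. \<bar>f x - s i x\<bar>) \<longlonglongrightarrow> 0" by simp
      qed
      show "AE x in lborel. norm \<bar>f x - s i x\<bar> \<le> 3 * \<bar>f x\<bar>" for i
        using lim.hyps(3)[of _ i] by (intro AE_I2) (smt (verit) real_norm_def space_lborel UNIV_I)
    qed (use lim.hyps(4) in auto)
    then obtain i where "(\<integral>x. \<bar>f x - s i x\<bar> \<partial>lborel) < e"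
      using LIMSEQ_D[of _ 0 e] e by fastforce
    then show "\<exists>g. integrable lborel g \<and> L1_trans_cont g \<and> (\<integral>x. \<bar>f x - g x\<bar> \<partial>lborel) < e"
      using lim.hyps(1) lim.IH by blast
  qed
qed

text \<open>The positive and negative parts of \<open>f\<close> are densities of finite measures
  that agree on all boxes, an intersection-stable generator, so the measures and then the densities
  coincide. Together with bumps that tend to indicators of boxes, this acts as the fundamental lemma
  of the calculus of variations.\<close>

lemma AE_zero_if_box_integrals_zero:
  fixes f :: "'a::euclidean_space \<Rightarrow> real"
  assumes f: "integrable lborel f"
    and zero: "\<And>l r. (\<integral>x. indicator (box l r) x * f x \<partial>lborel) = 0"
  shows "AE x in lborel. f x = 0"
proof -
  note [measurable] = borel_measurable_integrable[OF f]
  define m n where "m = density lborel (\<lambda>x. ennreal (f x))" and "n = density lborel (\<lambda>x. ennreal (- f x))"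
  have fin: "(\<integral>\<^sup>+x. ennreal (f x) \<partial>lborel) < \<infinity>" "(\<integral>\<^sup>+x. ennreal (- f x) \<partial>lborel) < \<infinity>"
    using f by (simp_all add: real_integrable_def less_top)
  have ball: "emeasure m (box l r) = emeasure n (box l r)" for l r
  proof -
    have ip: "integrable lborel (\<lambda>x. indicator (box l r) x * max 0 (f x))"
      "integrable lborel (\<lambda>x. indicator (box l r) x * max 0 (- f x))"
      by (rule Bochner_Integration.integrable_bound[OF f]; auto split: split_indicator)+
    have "(\<integral>x. indicator (box l r) x * max 0 (f x) \<partial>lborel) - (\<integral>x. indicator (box l r) x * max 0 (- f x) \<partial>lborel)
        = (\<integral>x. indicator (box l r) x * f x \<partial>lborel)"
      unfolding Bochner_Integration.integral_diff[OF ip, symmetric]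
      by (auto intro!: Bochner_Integration.integral_cong split: split_indicator)
    then have eq: "(\<integral>x. indicator (box l r) x * max 0 (f x) \<partial>lborel) = (\<integral>x. indicator (box l r) x * max 0 (- f x) \<partial>lborel)"
      using zero by simp
    have 1: "emeasure m (box l r) = (\<integral>\<^sup>+x. ennreal (indicator (box l r) x * max 0 (f x)) \<partial>lborel)"
      unfolding m_def by (subst emeasure_density) (auto intro!: nn_integral_cong split: split_indicator simp: max_def ennreal_neg)
    have 2: "emeasure n (box l r) = (\<integral>\<^sup>+x. ennreal (indicator (box l r) x * max 0 (- f x)) \<partial>lborel)"
      unfolding n_def by (subst emeasure_density) (auto intro!: nn_integral_cong split: split_indicator simp: max_def ennreal_neg)
    show ?thesis unfolding 1 2 using ip eq by (subst (1 2) nn_integral_eq_integral) auto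
  qed
  have "m = n"
  proof (rule measure_eqI_generator_eq)
    let ?E = "range (\<lambda>(a, b). box a b :: 'a set)"
    show "Int_stable ?E"
      by (auto simp: Int_stable_def box_Int_box)
    show "?E \<subseteq> Pow UNIV" "sets m = sigma_sets UNIV ?E" "sets n = sigma_sets UNIV ?E"
      by (simp_all add: m_def n_def borel_eq_box)
    let ?A = "\<lambda>k. box (- (real k *\<^sub>R One)) (real k *\<^sub>R One) :: 'a set"
    show "range ?A \<subseteq> ?E" "(\<Union>i. ?A i) = UNIV" by (auto simp: UN_box_eq_UNIV)
    have "emeasure m UNIV < \<infinity>" using fin by (simp add: m_def emeasure_density)
    then show "emeasure m (?A i) \<noteq> \<infinity>" for i
      using emeasure_mono[of "?A i" UNIV m] by (auto simp: m_def top_unique)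
    show "emeasure m X = emeasure n X" if "X \<in> ?E" for X using that ball by auto
  qed
  then have "AE x in lborel. ennreal (f x) = ennreal (- f x)"
    unfolding m_def n_def using fin by (subst (asm) finite_density_unique) auto
  then show ?thesis
    by eventually_elim (metis ennreal_eq_zero_iff ennreal_neg linorder_linear neg_le_0_iff_le order_antisym)
qed

subsection \<open>Smooth bump functions\<close>

text \<open>The standard flat function \<open>exp (- 1 / t)\<close>, divided by powers of
  \<open>t\<close> so that derivatives remain linear combinations of the same family.\<close>

definition exp_bump :: "nat \<Rightarrow> real \<Rightarrow> real" where
  "exp_bump k t = (if t \<le> 0 then 0 else exp (- 1 / t) / t ^ k)"

lemma exp_bump_tendsto_0: "(exp_bump k \<longlongrightarrow> 0) (at 0)"
proof (rule filterlim_split_at_real)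
  have "\<forall>\<^sub>F t in at_left 0. exp_bump k t = 0"
    by (auto simp: exp_bump_def eventually_at_filter)
  then show "(exp_bump k \<longlongrightarrow> 0) (at_left 0)" by (rule tendsto_eventually)
  have "((\<lambda>t::real. (inverse t) ^ k / exp (inverse t)) \<longlongrightarrow> 0) (at_right 0)"
    by (rule filterlim_compose[OF tendsto_power_div_exp_0 filterlim_inverse_at_top_right])
  moreover have "\<forall>\<^sub>F t in at_right 0. (inverse t) ^ k / exp (inverse t) = exp_bump k t"
    by (auto simp: exp_bump_def eventually_at_filter exp_minus field_simps intro!: always_eventually)
  ultimately show "(exp_bump k \<longlongrightarrow> 0) (at_right 0)" by (rule Lim_transform_eventually)
qed

lemma exp_bump_has_derivative:
  "(exp_bump k has_real_derivative exp_bump (k + 2) t - real k * exp_bump (k + 1) t) (at t)"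
proof -
  consider "t < 0" | "t = 0" | "t > 0" by linarith
  then show ?thesis
  proof cases
    case 1
    have "((\<lambda>_. 0::real) has_real_derivative 0) (at t)" by simp
    then have "(exp_bump k has_real_derivative 0) (at t)"
      by (rule has_field_derivative_transform_within_open[where S="{..<0}"]) (use 1 in \<open>auto simp: exp_bump_def\<close>)
    then show ?thesis using 1 by (simp add: exp_bump_def)
  next
    case 2
    have "exp_bump k h / h = exp_bump (k + 1) h" if "h \<noteq> 0" for h
      by (auto simp: exp_bump_def)
    then have "((\<lambda>h. exp_bump k h / h) \<longlongrightarrow> 0) (at 0)"
      using exp_bump_tendsto_0[of "k + 1"]
      by (subst tendsto_cong[of _ "exp_bump (k + 1)"]) (auto simp: eventually_at_filter)
    then show ?thesis using 2 by (simp add: has_field_derivative_iff exp_bump_def)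
  next
    case 3
    have "((\<lambda>t. exp (- 1 / t) / t ^ k) has_real_derivative
        exp (- 1 / t) / t ^ (k + 2) - real k * (exp (- 1 / t) / t ^ (k + 1))) (at t)"
      using 3
      apply (auto intro!: derivative_eq_intros)
      apply (cases k)
      apply (auto simp: field_simps power2_eq_square)
      done
    then have "(exp_bump k has_real_derivative
        exp (- 1 / t) / t ^ (k + 2) - real k * (exp (- 1 / t) / t ^ (k + 1))) (at t)"
      by (rule has_field_derivative_transform_within_open[where S="{0<..}"]) (use 3 in \<open>auto simp: exp_bump_def\<close>)
    then show ?thesis using 3 by (simp add: exp_bump_def)
  qed
qed

text \<open>The test functions are products of bumps in single coordinates; this class contains them and
  is closed under partial differentiation, which avoids a general theory of smooth functions.\<close>

inductive_set smooth_gen :: "('a::euclidean_space \<Rightarrow> real) set" where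
  base: "(\<lambda>x. exp_bump k (c + x \<bullet> v)) \<in> smooth_gen"
| const: "(\<lambda>x. c) \<in> smooth_gen"
| add: "f \<in> smooth_gen \<Longrightarrow> g \<in> smooth_gen \<Longrightarrow> (\<lambda>x. f x + g x) \<in> smooth_gen"
| mult: "f \<in> smooth_gen \<Longrightarrow> g \<in> smooth_gen \<Longrightarrow> (\<lambda>x. f x * g x) \<in> smooth_gen"

lemma smooth_gen_derivative:
  "f \<in> smooth_gen \<Longrightarrow> \<exists>D. (\<forall>x. (f has_derivative D x) (at x)) \<and> (\<forall>h. (\<lambda>x. D x h) \<in> smooth_gen)"
proof (induction rule: smooth_gen.induct)
  case (base k c v)
  define d where "d x = exp_bump (k + 2) (c + x \<bullet> v) + (- real k) * exp_bump (k + 1) (c + x \<bullet> v)" for x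
  have "((\<lambda>x. exp_bump k (c + x \<bullet> v)) has_derivative (\<lambda>h. d x * (h \<bullet> v))) (at x)" for x
  proof -
    have "((\<lambda>x. c + x \<bullet> v) has_derivative (\<lambda>h. h \<bullet> v)) (at x)"
      by (auto intro!: derivative_eq_intros)
    from DERIV_compose_FDERIV[OF exp_bump_has_derivative this, of k] show ?thesis
      by (simp add: d_def mult.commute)
  qed
  moreover have "(\<lambda>x. d x * (h \<bullet> v)) \<in> smooth_gen" for h
    unfolding d_def by (intro smooth_gen.intros)
  ultimately show ?case by (intro exI[of _ "\<lambda>x h. d x * (h \<bullet> v)"]) auto
next
  case (const c)
  show ?case by (intro exI[of _ "\<lambda>x h. 0"]) (auto intro: smooth_gen.intros)
next
  case (add f g)
  then obtain D E where "\<forall>x. (f has_derivative D x) (at x)" "\<forall>h. (\<lambda>x. D x h) \<in> smooth_gen"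
    "\<forall>x. (g has_derivative E x) (at x)" "\<forall>h. (\<lambda>x. E x h) \<in> smooth_gen" by blast
  then show ?case by (intro exI[of _ "\<lambda>x h. D x h + E x h"]) (auto intro!: smooth_gen.intros derivative_intros)
next
  case (mult f g)
  then obtain D E where "\<forall>x. (f has_derivative D x) (at x)" "\<forall>h. (\<lambda>x. D x h) \<in> smooth_gen"
    "\<forall>x. (g has_derivative E x) (at x)" "\<forall>h. (\<lambda>x. E x h) \<in> smooth_gen" by blast
  with mult show ?case
    by (intro exI[of _ "\<lambda>x h. f x * E x h + D x h * g x"]) (auto intro!: smooth_gen.intros derivative_intros)
qed

lemma smooth_gen_prod: "finite I \<Longrightarrow> (\<And>i. i \<in> I \<Longrightarrow> f i \<in> smooth_gen) \<Longrightarrow> (\<lambda>x. \<Prod>i\<in>I. f i x) \<in> smooth_gen"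
  by (induction I rule: finite_induct) (auto intro: smooth_gen.intros)

lemma iterated_partial_smooth_gen: "f \<in> smooth_gen \<Longrightarrow> iterated_partial bs f \<in> smooth_gen"
proof (induction bs)
  case (Cons b bs)
  then obtain D where D: "\<forall>x. (iterated_partial bs f has_derivative D x) (at x)" "\<forall>h. (\<lambda>x. D x h) \<in> smooth_gen"
    using smooth_gen_derivative by blast
  have "frechet_derivative (iterated_partial bs f) (at x) = D x" for x
    using D(1) frechet_derivative_at by metis
  then show ?case using D(2) by simp
qed simp

lemma test_function_smooth_gen:
  assumes "f \<in> smooth_gen" "\<And>x. f x \<noteq> 0 \<Longrightarrow> x \<in> K" "bounded K"
  shows "test_function f"
  unfolding test_function_def
proof (intro conjI allI impI)
  fix bs
  show "iterated_partial bs f differentiable_on UNIV"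
    using smooth_gen_derivative[OF iterated_partial_smooth_gen[OF assms(1), of bs]]
    unfolding differentiable_on_def differentiable_def by auto
  have "bounded {x. f x \<noteq> 0}" using assms(2,3) by (auto intro: bounded_subset)
  then show "compact (closure {x. f x \<noteq> 0})" by (simp add: compact_closure)
qed

text \<open>The parameter \<open>n\<close> steepens the profile: \<open>exp (- 1 / (n * t))\<close>
  tends to 1 for every \<open>t > 0\<close>, so these test functions approximate the indicator of
  the box.\<close>

definition box_bump :: "real \<Rightarrow> 'a::euclidean_space \<Rightarrow> 'a \<Rightarrow> 'a \<Rightarrow> real" where
  "box_bump n l r x = (\<Prod>b\<in>Basis. exp_bump 0 (n * ((x - l) \<bullet> b)) * exp_bump 0 (n * ((r - x) \<bullet> b)))"

lemma box_bump_smooth: "box_bump n l r \<in> smooth_gen"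
proof -
  have "(\<lambda>x. \<Prod>b\<in>Basis. exp_bump 0 (- n * (l \<bullet> b) + x \<bullet> (n *\<^sub>R b)) * exp_bump 0 (n * (r \<bullet> b) + x \<bullet> (- n *\<^sub>R b))) \<in> smooth_gen"
    by (intro smooth_gen_prod smooth_gen.intros) auto
  also have "(\<lambda>x. \<Prod>b\<in>Basis. exp_bump 0 (- n * (l \<bullet> b) + x \<bullet> (n *\<^sub>R b)) * exp_bump 0 (n * (r \<bullet> b) + x \<bullet> (- n *\<^sub>R b))) = box_bump n l r"
    by (auto simp: box_bump_def fun_eq_iff algebra_simps)
  finally show ?thesis .
qed

lemma box_bump_pos: assumes "n > 0" "x \<in> box l r" shows "box_bump n l r x > 0"
  using assms unfolding box_bump_def
  by (auto intro!: prod_pos mult_pos_pos simp: exp_bump_def mem_box inner_diff_left mult_le_0_iff)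

lemma box_bump_zero: assumes "n > 0" "x \<notin> box l r" shows "box_bump n l r x = 0"
proof -
  obtain b where "b \<in> Basis" "x \<bullet> b \<le> l \<bullet> b \<or> r \<bullet> b \<le> x \<bullet> b" using assms by (auto simp: mem_box not_less)
  then have "exp_bump 0 (n * ((x - l) \<bullet> b)) * exp_bump 0 (n * ((r - x) \<bullet> b)) = 0"
    using assms by (auto simp: exp_bump_def inner_diff_left mult_le_0_iff)
  with \<open>b \<in> Basis\<close> show ?thesis unfolding box_bump_def by (intro prod_zero) auto
qed

lemma box_bump_bounds: "0 \<le> box_bump n l r x" "box_bump n l r x \<le> 1"
  unfolding box_bump_def by (auto intro!: prod_nonneg prod_le_1 mult_le_one simp: exp_bump_def)

lemma box_bump_tendsto: "(\<lambda>n. box_bump (real (Suc n)) l r x) \<longlonglongrightarrow> indicator (box l r) x"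
proof (cases "x \<in> box l r")
  case True
  have *: "(\<lambda>n. exp_bump 0 (real (Suc n) * t)) \<longlonglongrightarrow> 1" if "t > 0" for t
  proof -
    have "(\<lambda>n. exp (- (1 / t) * (1 / real (Suc n)))) \<longlonglongrightarrow> exp (- (1 / t) * 0)"
      by (intro tendsto_intros LIMSEQ_Suc[OF lim_1_over_n])
    moreover have "exp (- (1 / t) * (1 / real (Suc n))) = exp_bump 0 (real (Suc n) * t)" for n
      using that by (simp add: exp_bump_def zero_less_mult_iff not_le mult.commute)
    ultimately show ?thesis by simp
  qed
  have "(\<lambda>n. box_bump (real (Suc n)) l r x) \<longlonglongrightarrow> (\<Prod>b\<in>(Basis::'a set). 1 * 1)"
    unfolding box_bump_def using True by (intro tendsto_prod tendsto_mult *) (auto simp: mem_box inner_diff_left)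
  then show ?thesis using True by simp
next
  case False
  then show ?thesis using box_bump_zero[of "real (Suc n)" x l r for n] by simp
qed

lemma test_function_box_bump: "n > 0 \<Longrightarrow> test_function (box_bump n l r)"
  by (rule test_function_smooth_gen[OF box_bump_smooth, of _ _ _ "box l r"]) (use box_bump_zero in auto)

lemma box_bump_translate: "box_bump n l r (x - c) = box_bump n (l + c) (r + c) x"
  by (simp add: box_bump_def algebra_simps)

lemma continuous_zero_off_compact_bounded:
  fixes f :: "'a::euclidean_space \<Rightarrow> real"
  assumes "continuous_on UNIV f" "compact K" "\<And>x. x \<notin> K \<Longrightarrow> f x = 0"
  obtains C where "C > 0" "\<And>x. \<bar>f x\<bar> \<le> C"
proof -
  have "compact (f ` K)" using assms by (intro compact_continuous_image) (auto intro: continuous_on_subset)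
  then obtain C where C: "C > 0" "\<And>x. x \<in> K \<Longrightarrow> \<bar>f x\<bar> \<le> C"
    using compact_imp_bounded bounded_pos by (metis imageI real_norm_def)
  then have "\<bar>f x\<bar> \<le> C" for x using assms(3)[of x] by (cases "x \<in> K") auto
  with C(1) that show thesis by blast
qed

lemma
  fixes f :: "'a::euclidean_space \<Rightarrow> real"
  assumes f: "test_function f"
  shows test_function_has_derivative: "(f has_derivative frechet_derivative f (at x)) (at x)"
    and test_function_continuous: "continuous_on UNIV f"
    and test_function_derivative_continuous: "continuous_on UNIV (\<lambda>x. frechet_derivative f (at x) e)"
    and test_function_bounded: "\<exists>C>0. \<forall>x. \<bar>f x\<bar> \<le> C"
    and test_function_derivative_bounded: "\<exists>C>0. \<forall>x. \<bar>frechet_derivative f (at x) e\<bar> \<le> C"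
proof -
  have "f differentiable_on UNIV" using f unfolding test_function_def by (metis empty_set empty_subsetI iterated_partial.simps(1))
  then have d: "f differentiable (at x)" for x by (simp add: differentiable_on_def)
  then show hd: "(f has_derivative frechet_derivative f (at x)) (at x)" for x by (simp add: frechet_derivative_works)
  show cf: "continuous_on UNIV f" using d by (simp add: continuous_at_imp_continuous_on differentiable_imp_continuous_within)
  have cb: "continuous_on UNIV (\<lambda>x. frechet_derivative f (at x) b)" if "b \<in> Basis" for b
  proof -
    have "iterated_partial [b] f differentiable_on UNIV" using f that unfolding test_function_def by (metis empty_set empty_subsetI insert_subset list.simps(15))
    then show ?thesis by (simp add: differentiable_imp_continuous_on)
  qed
  have lin: "frechet_derivative f (at x) e = (\<Sum>b\<in>Basis. (e \<bullet> b) * frechet_derivative f (at x) b)" for x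
  proof -
    have "linear (frechet_derivative f (at x))" using hd by (rule has_derivative_linear)
    then have "frechet_derivative f (at x) (\<Sum>b\<in>Basis. (e \<bullet> b) *\<^sub>R b) = (\<Sum>b\<in>Basis. (e \<bullet> b) *\<^sub>R frechet_derivative f (at x) b)"
      by (simp add: linear_sum linear_scale)
    then show ?thesis by (simp add: euclidean_representation)
  qed
  show ce: "continuous_on UNIV (\<lambda>x. frechet_derivative f (at x) e)"
    unfolding lin using cb by (intro continuous_intros) auto
  define K where "K = closure {x. f x \<noteq> 0}"
  have K: "compact K" using f by (simp add: test_function_def K_def)
  have fK: "f x = 0" if "x \<notin> K" for x using that closure_subset[of "{x. f x \<noteq> 0}"] by (auto simp: K_def)
  have dK: "frechet_derivative f (at x) e = 0" if "x \<notin> K" for x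
  proof -
    have "((\<lambda>_. 0) has_derivative (\<lambda>_. 0)) (at x)" by simp
    then have "(f has_derivative (\<lambda>_. 0)) (at x)"
      by (rule has_derivative_transform_within_open[of _ _ _ _ "- K"]) (use that K fK in \<open>auto simp: compact_imp_closed open_Compl\<close>)
    then show ?thesis by (metis frechet_derivative_at)
  qed
  show "\<exists>C>0. \<forall>x. \<bar>f x\<bar> \<le> C" by (rule continuous_zero_off_compact_bounded[OF cf K fK]) auto
  show "\<exists>C>0. \<forall>x. \<bar>frechet_derivative f (at x) e\<bar> \<le> C"
    by (rule continuous_zero_off_compact_bounded[OF ce K dK]) auto
qed

lemma test_function_derivative_lin:
  assumes "test_function f"
  shows "frechet_derivative f (at x) e = (\<Sum>b\<in>Basis. (e \<bullet> b) * frechet_derivative f (at x) b)"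
proof -
  have "linear (frechet_derivative f (at x))" using test_function_has_derivative[OF assms] by (rule has_derivative_linear)
  then have "frechet_derivative f (at x) (\<Sum>b\<in>Basis. (e \<bullet> b) *\<^sub>R b) = (\<Sum>b\<in>Basis. (e \<bullet> b) *\<^sub>R frechet_derivative f (at x) b)"
    by (simp add: linear_sum linear_scale)
  then show ?thesis by (simp add: euclidean_representation)
qed

lemma integrable_mult_bounded:
  fixes f :: "'m \<Rightarrow> real"
  assumes "integrable M f" and [measurable]: "g \<in> borel_measurable M" and "\<And>x. \<bar>g x\<bar> \<le> C"
  shows "integrable M (\<lambda>x. f x * g x)"
proof -
  have [measurable]: "f \<in> borel_measurable M" using assms(1) by auto
  have C: "C \<ge> 0" using assms(3)[of undefined] by simp
  have "norm (f x * g x) \<le> norm (C * f x)" for x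
    using mult_left_mono[OF assms(3)[of x], of "\<bar>f x\<bar>"] C by (simp add: abs_mult mult.commute)
  then show ?thesis
    by (intro Bochner_Integration.integrable_bound[OF integrable_mult_right[OF assms(1), of C]]) auto
qed

lemma weak_gradient_direction:
  fixes u :: "'a::euclidean_space \<Rightarrow> real"
  assumes w: "has_weak_gradient u G" and iu: "integrable lborel u" and iG: "integrable lborel G"
    and f: "test_function f"
  shows "(\<integral>x. u x * frechet_derivative f (at x) e \<partial>lborel) = - (\<integral>x. (G x \<bullet> e) * f x \<partial>lborel)"
proof -
  note [measurable] = borel_measurable_integrable[OF iu] borel_measurable_integrable[OF iG]
  have [measurable]: "f \<in> borel_measurable borel" "(\<lambda>x. frechet_derivative f (at x) e) \<in> borel_measurable borel" for e
    using test_function_continuous[OF f] test_function_derivative_continuous[OF f]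
    by (auto intro: borel_measurable_continuous_onI)
  have b: "(\<integral>x. u x * frechet_derivative f (at x) b \<partial>lborel) = - (\<integral>x. (G x \<bullet> b) * f x \<partial>lborel)" if "b \<in> Basis" for b
  proof -
    have "(\<integral>x. u x * frechet_derivative f (at x) b \<partial>lebesgue) = - (\<integral>x. (G x \<bullet> b) * f x \<partial>lebesgue)"
      using w f that unfolding has_weak_gradient_def by auto
    then show ?thesis by (simp add: integral_completion)
  qed
  have i1: "integrable lborel (\<lambda>x. u x * frechet_derivative f (at x) b)" for b
    using test_function_derivative_bounded[OF f, of b] by (auto intro: integrable_mult_bounded[OF iu])
  have i2: "integrable lborel (\<lambda>x. (G x \<bullet> b) * f x)" for b
    using test_function_bounded[OF f] iG by (auto intro!: integrable_mult_bounded)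
  have "(\<integral>x. u x * frechet_derivative f (at x) e \<partial>lborel)
      = (\<integral>x. (\<Sum>b\<in>Basis. (e \<bullet> b) * (u x * frechet_derivative f (at x) b)) \<partial>lborel)"
    by (subst test_function_derivative_lin[OF f]) (simp add: sum_distrib_left mult_ac)
  also have "\<dots> = (\<Sum>b\<in>Basis. (e \<bullet> b) * - (\<integral>x. (G x \<bullet> b) * f x \<partial>lborel))"
    using i1 b by (subst Bochner_Integration.integral_sum) auto
  also have "\<dots> = - (\<integral>x. (\<Sum>b\<in>Basis. (e \<bullet> b) * ((G x \<bullet> b) * f x)) \<partial>lborel)"
    using i2 by (subst Bochner_Integration.integral_sum) (auto simp: sum_negf)
  also have "\<dots> = - (\<integral>x. (G x \<bullet> e) * f x \<partial>lborel)"
    by (subst euclidean_inner[of "G _" e]) (simp add: sum_distrib_left sum_distrib_right mult_ac)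
  finally show ?thesis .
qed

subsection \<open>Weak gradients along lines\<close>

lemma integrable_line:
  fixes g :: "'a::euclidean_space \<Rightarrow> real"
  assumes g: "integrable lborel g"
  shows "integrable lborel (\<lambda>(t, x). indicator {0..1::real} t * g (x + t *\<^sub>R e))"
proof -
  have [measurable]: "g \<in> borel_measurable borel" using borel_measurable_integrable[OF g] by simp
  have "integrable (lborel \<Otimes>\<^sub>M lborel) (\<lambda>(t, x). indicator {0..1::real} t * g (x + t *\<^sub>R e))"
  proof (rule lborel_pair.Fubini_integrable)
    show "(\<lambda>(t, x). indicator {0..1::real} t * g (x + t *\<^sub>R e)) \<in> borel_measurable (lborel \<Otimes>\<^sub>M lborel)"
      by measurable
    have "(\<integral>x. norm (case (t, x) of (t, x) \<Rightarrow> indicator {0..1} t * g (x + t *\<^sub>R e)) \<partial>lborel)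
       = indicator {0..1} t * (\<integral>x. \<bar>g x\<bar> \<partial>lborel)" for t
      using lborel_integral_translate(1)[of "\<lambda>x. \<bar>g x\<bar>" "t *\<^sub>R e"] by (simp add: abs_mult)
    then show "integrable lborel (\<lambda>t. \<integral>x. norm (case (t, x) of (t, x) \<Rightarrow> indicator {0..1} t * g (x + t *\<^sub>R e)) \<partial>lborel)"
      by (simp add: integrable_real_indicator)
    show "AE t in lborel. integrable lborel (\<lambda>x. case (t, x) of (t, x) \<Rightarrow> indicator {0..1} t * g (x + t *\<^sub>R e))"
      using g lborel_integral_translate(2)[of g] by auto
  qed
  then show ?thesis by (simp add: lborel_prod)
qed

lemma line_Fubini:
  fixes g :: "'a::euclidean_space \<Rightarrow> real"
  assumes g: "integrable lborel g" and m: "m \<in> borel_measurable borel" "\<And>x. \<bar>m x\<bar> \<le> C"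
  shows "(\<integral>t. indicator {0..1::real} t * (\<integral>x. g (x + t *\<^sub>R e) * m x \<partial>lborel) \<partial>lborel)
       = (\<integral>x. (\<integral>t. indicator {0..1::real} t * g (x + t *\<^sub>R e) \<partial>lborel) * m x \<partial>lborel)"
    and "integrable lborel (\<lambda>x. \<integral>t. indicator {0..1::real} t * g (x + t *\<^sub>R e) \<partial>lborel)"
    and "AE x in lborel. integrable lborel (\<lambda>t. indicator {0..1::real} t * g (x + t *\<^sub>R e))"
proof -
  note [measurable] = m(1)
  note i = integrable_line[OF g, of e, folded lborel_prod]
  from lborel_pair.integrable_snd[OF i]
  show "integrable lborel (\<lambda>x. \<integral>t. indicator {0..1::real} t * g (x + t *\<^sub>R e) \<partial>lborel)" by simp
  from lborel_pair.AE_integrable_snd[OF i]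
  show "AE x in lborel. integrable lborel (\<lambda>t. indicator {0..1::real} t * g (x + t *\<^sub>R e))" by simp
  have "integrable (lborel \<Otimes>\<^sub>M lborel) (\<lambda>z. (case z of (t, x) \<Rightarrow> indicator {0..1::real} t * g (x + t *\<^sub>R e)) * m (snd z))"
    using i by (rule integrable_mult_bounded) (use m in auto)
  then have "integrable (lborel \<Otimes>\<^sub>M lborel) (\<lambda>(t, x). indicator {0..1::real} t * g (x + t *\<^sub>R e) * m x)"
    by (simp add: case_prod_beta')
  from lborel_pair.Fubini_integral[OF this]
  have "(\<integral>t. (\<integral>x. indicator {0..1::real} t * g (x + t *\<^sub>R e) * m x \<partial>lborel) \<partial>lborel)
      = (\<integral>x. (\<integral>t. indicator {0..1::real} t * g (x + t *\<^sub>R e) * m x \<partial>lborel) \<partial>lborel)" by simp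
  moreover have "(\<integral>x. indicator {0..1::real} t * g (x + t *\<^sub>R e) * m x \<partial>lborel)
      = indicator {0..1::real} t * (\<integral>x. g (x + t *\<^sub>R e) * m x \<partial>lborel)" for t
    by (simp add: mult.assoc)
  moreover have "(\<integral>t. indicator {0..1::real} t * g (x + t *\<^sub>R e) * m x \<partial>lborel)
      = (\<integral>t. indicator {0..1::real} t * g (x + t *\<^sub>R e) \<partial>lborel) * m x" for x
    by (rule integral_mult_left_zero)
  ultimately show "(\<integral>t. indicator {0..1::real} t * (\<integral>x. g (x + t *\<^sub>R e) * m x \<partial>lborel) \<partial>lborel)
       = (\<integral>x. (\<integral>t. indicator {0..1::real} t * g (x + t *\<^sub>R e) \<partial>lborel) * m x \<partial>lborel)"
    by simp
qed

text \<open>A bump is moved along the segment. Integrating its directional derivative over the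
  segment gives \<open>f x - f (x - e)\<close>; integrating by parts for each fixed \<open>t\<close>
  gives the averaged gradient. Comparing both evaluations of one double integral shows that the
  difference of the two sides is orthogonal to all box bumps, hence to all indicators of
  boxes.\<close>

lemma weak_gradient_line:
  fixes u :: "'a::euclidean_space \<Rightarrow> real"
  assumes w: "has_weak_gradient u G" and iu: "integrable lborel u" and iG: "integrable lborel G"
  shows "AE x in lborel. u (x + e) - u x = (\<integral>t. indicator {0..1::real} t * (G (x + t *\<^sub>R e) \<bullet> e) \<partial>lborel)"
proof -
  have [measurable]: "u \<in> borel_measurable borel" "G \<in> borel_measurable borel"
    using borel_measurable_integrable[OF iu] borel_measurable_integrable[OF iG] by auto
  define W where "W x = (\<integral>t. indicator {0..1::real} t * (G (x + t *\<^sub>R e) \<bullet> e) \<partial>lborel)" for x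
  have iGe: "integrable lborel (\<lambda>x. G x \<bullet> e)" using iG by simp
  have iW: "integrable lborel W"
    unfolding W_def by (rule line_Fubini(2)[OF iGe, of "\<lambda>_. 0" 0]) auto
  have idu: "integrable lborel (\<lambda>x. u (x + e) - u x)" by (rule integrable_translate_diff[OF iu])
  have iuT: "integrable lborel (\<lambda>x. u (x + c))" for c using iu by (subst lborel_integral_translate(2)) auto
  have bump: "(\<integral>x. (u (x + e) - u x - W x) * box_bump n l r x \<partial>lborel) = 0" if n: "n > 0" for n l r
  proof -
    define f where "f = box_bump n l r"
    have f: "test_function f" unfolding f_def by (rule test_function_box_bump[OF n])
    have ft: "test_function (\<lambda>x. f (x - c))" for c
      unfolding f_def box_bump_translate by (rule test_function_box_bump[OF n])
    have fm [measurable]: "f \<in> borel_measurable borel"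
      using test_function_continuous[OF f] by (rule borel_measurable_continuous_onI)
    define D where "D x = frechet_derivative f (at x) e" for x
    have D: "continuous_on UNIV D" unfolding D_def by (rule test_function_derivative_continuous[OF f])
    have Dm [measurable]: "D \<in> borel_measurable borel"
      using D by (rule borel_measurable_continuous_onI)
    have fb: "\<bar>f x\<bar> \<le> 1" for x using box_bump_bounds[of n l r x] by (simp add: f_def)
    obtain C where C: "\<And>x. \<bar>D x\<bar> \<le> C" using test_function_derivative_bounded[OF f] unfolding D_def by blast
    have Dt: "frechet_derivative (\<lambda>x. f (x - c)) (at x) e = D (x - c)" for c x
    proof -
      have "((\<lambda>x. x - c) has_derivative (\<lambda>h. h)) (at x)" by (auto intro!: derivative_eq_intros)
      from has_derivative_compose[OF this test_function_has_derivative[OF f]]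
      show ?thesis unfolding D_def by (metis frechet_derivative_at)
    qed
    \<comment> \<open>For fixed \<open>t\<close> the translation is moved onto the test function,
      where the weak gradient can be used, and is then moved back.\<close>
    have step: "(\<integral>x. u (x + t *\<^sub>R e) * D x \<partial>lborel) = - (\<integral>x. (G (x + t *\<^sub>R e) \<bullet> e) * f x \<partial>lborel)" for t
    proof -
      have "(\<integral>x. u (x + t *\<^sub>R e) * D (x + t *\<^sub>R e - t *\<^sub>R e) \<partial>lborel) = (\<integral>x. u x * D (x - t *\<^sub>R e) \<partial>lborel)"
        by (rule lborel_integral_translate(1)[of "\<lambda>x. u x * D (x - t *\<^sub>R e)"]) measurable
      also have "\<dots> = - (\<integral>x. (G x \<bullet> e) * f (x - t *\<^sub>R e) \<partial>lborel)"
        using weak_gradient_direction[OF w iu iG ft, of "t *\<^sub>R e" e] by (simp add: Dt)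
      also have "(\<integral>x. (G x \<bullet> e) * f (x - t *\<^sub>R e) \<partial>lborel) = (\<integral>x. (G (x + t *\<^sub>R e) \<bullet> e) * f (x + t *\<^sub>R e - t *\<^sub>R e) \<partial>lborel)"
        by (rule lborel_integral_translate(1)[of "\<lambda>x. (G x \<bullet> e) * f (x - t *\<^sub>R e)", symmetric]) measurable
      finally show ?thesis by simp
    qed
    have ftc: "(\<integral>t. indicator {0..1} t * D (x - t *\<^sub>R e) \<partial>lborel) = f x - f (x - e)" for x
    proof -
      have "(\<integral>t. indicator {0..1} t *\<^sub>R D (x - t *\<^sub>R e) \<partial>lborel) = (- f (x - 1 *\<^sub>R e)) - (- f (x - 0 *\<^sub>R e))"
      proof (rule integral_FTC_Icc)
        fix t :: real
        have d1: "((\<lambda>t. x - t *\<^sub>R e) has_derivative (\<lambda>h. - h *\<^sub>R e)) (at t within {0..1})"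
          by (auto intro!: derivative_eq_intros)
        have "((\<lambda>t. f (x - t *\<^sub>R e)) has_derivative (\<lambda>h. frechet_derivative f (at (x - t *\<^sub>R e)) (- h *\<^sub>R e))) (at t within {0..1})"
          using has_derivative_compose[OF d1 test_function_has_derivative[OF f]] .
        moreover have "frechet_derivative f (at (x - t *\<^sub>R e)) (- h *\<^sub>R e) = - (h * D (x - t *\<^sub>R e))" for h
          using has_derivative_linear[OF test_function_has_derivative[OF f, of "x - t *\<^sub>R e"]]
            linear_scale[of "frechet_derivative f (at (x - t *\<^sub>R e))" "- h" e] by (simp add: D_def)
        ultimately have "((\<lambda>t. f (x - t *\<^sub>R e)) has_derivative (\<lambda>h. - (h * D (x - t *\<^sub>R e)))) (at t within {0..1})"
          by simp
        from has_derivative_minus[OF this]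
        show "((\<lambda>t. - f (x - t *\<^sub>R e)) has_vector_derivative D (x - t *\<^sub>R e)) (at t within {0..1})"
          by (simp add: has_vector_derivative_def)
      qed (auto intro!: continuous_intros continuous_on_compose2[OF D])
      then show ?thesis by simp
    qed
    have iub: "integrable (lborel \<Otimes>\<^sub>M lborel) (\<lambda>(t, x). indicator {0..1::real} t * u x * D (x - t *\<^sub>R e))"
    proof -
      have "integrable (lborel \<Otimes>\<^sub>M lborel) (\<lambda>(t, x). indicator {0..1::real} t * u (x + t *\<^sub>R 0))"
        using integrable_line[OF iu, of 0] by (simp add: lborel_prod)
      then have "integrable (lborel \<Otimes>\<^sub>M lborel) (\<lambda>z. (case z of (t, x) \<Rightarrow> indicator {0..1::real} t * u (x + t *\<^sub>R 0)) * D (snd z - fst z *\<^sub>R e))"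
        by (rule integrable_mult_bounded) (use C in auto)
      then show ?thesis by (simp add: case_prod_beta')
    qed
    have "(\<integral>t. indicator {0..1::real} t * (\<integral>x. u (x + t *\<^sub>R e) * D x \<partial>lborel) \<partial>lborel)
        = (\<integral>t. (\<integral>x. indicator {0..1::real} t * u x * D (x - t *\<^sub>R e) \<partial>lborel) \<partial>lborel)"
    proof (rule Bochner_Integration.integral_cong[OF refl])
      fix t :: real
      have "(\<integral>x. u (x + t *\<^sub>R e) * D (x + t *\<^sub>R e - t *\<^sub>R e) \<partial>lborel) = (\<integral>x. u x * D (x - t *\<^sub>R e) \<partial>lborel)"
        by (rule lborel_integral_translate(1)[of "\<lambda>x. u x * D (x - t *\<^sub>R e)"]) measurable
      then show "indicator {0..1::real} t * (\<integral>x. u (x + t *\<^sub>R e) * D x \<partial>lborel)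
        = (\<integral>x. indicator {0..1::real} t * u x * D (x - t *\<^sub>R e) \<partial>lborel)" by (simp add: mult.assoc)
    qed
    also have "\<dots> = (\<integral>x. (\<integral>t. indicator {0..1::real} t * u x * D (x - t *\<^sub>R e) \<partial>lborel) \<partial>lborel)"
      using lborel_pair.Fubini_integral[OF iub] by simp
    also have "\<dots> = (\<integral>x. u x * (f x - f (x - e)) \<partial>lborel)"
      unfolding ftc[symmetric] by (simp add: mult_ac)
    also have "\<dots> = (\<integral>x. u x * f x \<partial>lborel) - (\<integral>x. u x * f (x - e) \<partial>lborel)"
      using fb by (subst Bochner_Integration.integral_diff [symmetric])
        (auto intro!: integrable_mult_bounded[OF iu] simp: right_diff_distrib)
    also have "(\<integral>x. u x * f (x - e) \<partial>lborel) = (\<integral>x. u (x + e) * f x \<partial>lborel)"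
      using lborel_integral_translate(1)[of "\<lambda>x. u x * f (x - e)" e] by simp
    finally have L: "(\<integral>t. indicator {0..1::real} t * (\<integral>x. u (x + t *\<^sub>R e) * D x \<partial>lborel) \<partial>lborel)
       = (\<integral>x. u x * f x \<partial>lborel) - (\<integral>x. u (x + e) * f x \<partial>lborel)" .
    \<comment> \<open>The same double integral as in \<open>L\<close>, now with integration by parts
      for each fixed \<open>t\<close> before the integrals are exchanged.\<close>
    have R: "(\<integral>t. indicator {0..1::real} t * (\<integral>x. u (x + t *\<^sub>R e) * D x \<partial>lborel) \<partial>lborel)
       = - (\<integral>x. W x * f x \<partial>lborel)"
      using line_Fubini(1)[OF iGe fm fb, of e] by (simp add: step W_def)
    have i: "integrable lborel (\<lambda>x. u x * f x)" "integrable lborel (\<lambda>x. u (x + e) * f x)" "integrable lborel (\<lambda>x. W x * f x)"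
      by (rule integrable_mult_bounded[OF iu _ fb] integrable_mult_bounded[OF iuT _ fb] integrable_mult_bounded[OF iW _ fb]; simp)+
    have "(\<integral>x. (u (x + e) - u x - W x) * f x \<partial>lborel)
       = (\<integral>x. u (x + e) * f x \<partial>lborel) - (\<integral>x. u x * f x \<partial>lborel) - (\<integral>x. W x * f x \<partial>lborel)"
      using i by (simp add: left_diff_distrib)
    then show ?thesis using L R unfolding f_def by simp
  qed
  define F where "F x = u (x + e) - u x - W x" for x
  have iF: "integrable lborel F" unfolding F_def using idu iW by simp
  have [measurable]: "F \<in> borel_measurable borel" using borel_measurable_integrable[OF iF] by simp
  have "AE x in lborel. F x = 0"
  proof (rule AE_zero_if_box_integrals_zero[OF iF])
    fix l r :: 'a
    have bm [measurable]: "box_bump n l r \<in> borel_measurable borel" if "n > 0" for n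
      using test_function_continuous[OF test_function_box_bump[OF that]] by (rule borel_measurable_continuous_onI)
    have "(\<lambda>n. \<integral>x. F x * box_bump (real (Suc n)) l r x \<partial>lborel) \<longlonglongrightarrow> (\<integral>x. indicator (box l r) x * F x \<partial>lborel)"
    proof (rule integral_dominated_convergence[where w="\<lambda>x. \<bar>F x\<bar>"])
      show "(\<lambda>x. F x * box_bump (real (Suc n)) l r x) \<in> borel_measurable lborel" for n
        using bm[of "real (Suc n)"] by simp
      show "AE x in lborel. (\<lambda>n. F x * box_bump (real (Suc n)) l r x) \<longlonglongrightarrow> indicator (box l r) x * F x"
      proof (rule AE_I2)
        fix x
        show "(\<lambda>n. F x * box_bump (real (Suc n)) l r x) \<longlonglongrightarrow> indicator (box l r) x * F x"
          using tendsto_mult_left[OF box_bump_tendsto[of l r x], of "F x"] by (simp only: mult.commute[of "indicat_real (box l r) x"])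
      qed
      show "AE x in lborel. norm (F x * box_bump (real (Suc n)) l r x) \<le> \<bar>F x\<bar>" for n
        using box_bump_bounds[of "real (Suc n)" l r] by (auto intro!: AE_I2 simp: abs_mult mult_left_le)
    qed (use iF in auto)
    moreover have "(\<integral>x. F x * box_bump (real (Suc n)) l r x \<partial>lborel) = 0" for n
      using bump[of "real (Suc n)"] by (simp add: F_def)
    ultimately have "(\<lambda>n::nat. 0::real) \<longlonglongrightarrow> (\<integral>x. indicator (box l r) x * F x \<partial>lborel)" by (simp only:)
    then show "(\<integral>x. indicator (box l r) x * F x \<partial>lborel) = 0"
      by (simp only: LIMSEQ_const_iff)
  qed
  then show ?thesis by eventually_elim (simp add: F_def W_def)
qed

text \<open>The subtracted \<open>H\<close> covers two uses: \<open>H = 0\<close> bounds the effect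
  of a translation by the gradient, and a step size times the directional derivative bounds the
  error of a difference quotient.\<close>

lemma weak_gradient_shift_error:
  fixes u :: "'a::euclidean_space \<Rightarrow> real"
  assumes w: "has_weak_gradient u G" and iu: "integrable lborel u" and iG: "integrable lborel G"
    and H: "integrable lborel H"
  shows "(\<integral>x. \<bar>u (x + e) - u x - H x\<bar> \<partial>lborel)
    \<le> (\<integral>t. indicator {0..1::real} t * (\<integral>x. \<bar>G (x + t *\<^sub>R e) \<bullet> e - H x\<bar> \<partial>lborel) \<partial>lborel)"
proof -
  have [measurable]: "u \<in> borel_measurable borel" "G \<in> borel_measurable borel" "H \<in> borel_measurable borel"
    using borel_measurable_integrable[OF iu] borel_measurable_integrable[OF iG] borel_measurable_integrable[OF H] by auto
  have iGe: "integrable lborel (\<lambda>x. G x \<bullet> e)" using iG by simp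
  have i: "integrable (lborel \<Otimes>\<^sub>M lborel) (\<lambda>(t, x). indicator {0..1::real} t * \<bar>G (x + t *\<^sub>R e) \<bullet> e - H x\<bar>)"
  proof -
    have "integrable (lborel \<Otimes>\<^sub>M lborel) (\<lambda>z. (case z of (t, x) \<Rightarrow> indicator {0..1::real} t * (G (x + t *\<^sub>R e) \<bullet> e))
      - (case z of (t, x) \<Rightarrow> indicator {0..1::real} t * H (x + t *\<^sub>R 0)))"
      using integrable_line[OF iGe, of e] integrable_line[OF H, of 0] by (intro Bochner_Integration.integrable_diff) (simp_all add: lborel_prod)
    from integrable_abs[OF this] show ?thesis
      by (simp add: case_prod_beta' abs_mult flip: right_diff_distrib)
  qed
  have "AE x in lborel. \<bar>u (x + e) - u x - H x\<bar> \<le> (\<integral>t. indicator {0..1::real} t * \<bar>G (x + t *\<^sub>R e) \<bullet> e - H x\<bar> \<partial>lborel)"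
    using weak_gradient_line[OF w iu iG, of e] line_Fubini(3)[OF iGe, of "\<lambda>_. 0" 0 e, simplified]
  proof eventually_elim
    case (elim x)
    have "u (x + e) - u x - H x = (\<integral>t. indicator {0..1::real} t * (G (x + t *\<^sub>R e) \<bullet> e) \<partial>lborel) - (\<integral>t. indicator {0..1::real} t * H x \<partial>lborel)"
      using elim(1) by simp
    also have "\<dots> = (\<integral>t. indicator {0..1::real} t * (G (x + t *\<^sub>R e) \<bullet> e - H x) \<partial>lborel)"
      using elim(2) by (subst Bochner_Integration.integral_diff [symmetric]) (auto simp: right_diff_distrib integrable_real_indicator)
    also have "\<bar>\<dots>\<bar> \<le> (\<integral>t. \<bar>indicator {0..1::real} t * (G (x + t *\<^sub>R e) \<bullet> e - H x)\<bar> \<partial>lborel)"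
      by (rule integral_abs_bound)
    finally show ?case by (simp add: abs_mult)
  qed
  then have "(\<integral>x. \<bar>u (x + e) - u x - H x\<bar> \<partial>lborel) \<le> (\<integral>x. (\<integral>t. indicator {0..1::real} t * \<bar>G (x + t *\<^sub>R e) \<bullet> e - H x\<bar> \<partial>lborel) \<partial>lborel)"
    using lborel_pair.integrable_snd[OF i] integrable_translate_diff[OF iu, of e] H
    by (intro integral_mono_AE) auto
  also have "\<dots> = (\<integral>t. indicator {0..1::real} t * (\<integral>x. \<bar>G (x + t *\<^sub>R e) \<bullet> e - H x\<bar> \<partial>lborel) \<partial>lborel)"
    using lborel_pair.Fubini_integral[OF i] by simp
  finally show ?thesis .
qed

lemma weak_gradient_shift:
  fixes u :: "'a::euclidean_space \<Rightarrow> real"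
  assumes w: "has_weak_gradient u G" and iu: "integrable lborel u" and iG: "integrable lborel G"
  shows "(\<integral>x. \<bar>u (x + e) - u x\<bar> \<partial>lborel) \<le> norm e * (\<integral>x. norm (G x) \<partial>lborel)"
proof -
  have [measurable]: "G \<in> borel_measurable borel" using borel_measurable_integrable[OF iG] by auto
  have "(\<integral>x. \<bar>u (x + e) - u x\<bar> \<partial>lborel) \<le> (\<integral>t. indicator {0..1::real} t * (\<integral>x. \<bar>G (x + t *\<^sub>R e) \<bullet> e\<bar> \<partial>lborel) \<partial>lborel)"
    using weak_gradient_shift_error[OF w iu iG, of "\<lambda>_. 0" e] by simp
  also have "\<dots> = (\<integral>x. \<bar>G x \<bullet> e\<bar> \<partial>lborel)"
    by (subst lborel_integral_translate(1)[of "\<lambda>x. \<bar>G x \<bullet> e\<bar>"]) auto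
  also have "\<dots> \<le> (\<integral>x. norm e * norm (G x) \<partial>lborel)"
    using iG Cauchy_Schwarz_ineq2[of "G _" e] by (intro integral_mono) (auto simp: mult.commute)
  finally show ?thesis by simp
qed

text \<open>The error is at most an average over \<open>t\<close> in \<open>[0, 1]\<close> of the
  \<open>L1\<close> distances between \<open>g\<close> and its translates by
  \<open>(t * h n) *\<^sub>R b\<close>. Each tends to 0 by continuity of translations, and all are
  bounded by twice the norm of \<open>g\<close>.\<close>

lemma weak_gradient_diff_quotient:
  fixes u :: "'a::euclidean_space \<Rightarrow> real"
  assumes w: "has_weak_gradient u G" and iu: "integrable lborel u" and iG: "integrable lborel G"
    and h: "\<And>n. h n \<noteq> 0" "h \<longlonglongrightarrow> 0"
  shows "(\<lambda>n. \<integral>x. \<bar>(u (x + h n *\<^sub>R b) - u x) / h n - G x \<bullet> b\<bar> \<partial>lborel) \<longlonglongrightarrow> 0"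
proof -
  have [measurable]: "G \<in> borel_measurable borel" using borel_measurable_integrable[OF iG] by auto
  define g where "g x = G x \<bullet> b" for x
  have ig: "integrable lborel g" unfolding g_def using iG by simp
  note [measurable] = borel_measurable_integrable[OF ig]
  define R where "R n t = (\<integral>x. \<bar>g (x + (t * h n) *\<^sub>R b) - g x\<bar> \<partial>lborel)" for n t
  have le: "(\<integral>x. \<bar>(u (x + h n *\<^sub>R b) - u x) / h n - G x \<bullet> b\<bar> \<partial>lborel) \<le> (\<integral>t. indicator {0..1::real} t * R n t \<partial>lborel)" for n
  proof -
    have "(\<integral>x. \<bar>(u (x + h n *\<^sub>R b) - u x) / h n - G x \<bullet> b\<bar> \<partial>lborel) = (\<integral>x. \<bar>u (x + h n *\<^sub>R b) - u x - h n * g x\<bar> / \<bar>h n\<bar> \<partial>lborel)"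
      using h(1)[of n] by (intro Bochner_Integration.integral_cong) (auto simp: g_def divide_simps mult.commute simp flip: abs_divide)
    also have "\<dots> \<le> (\<integral>t. indicator {0..1::real} t * (\<integral>x. \<bar>G (x + t *\<^sub>R (h n *\<^sub>R b)) \<bullet> (h n *\<^sub>R b) - h n * g x\<bar> \<partial>lborel) \<partial>lborel) / \<bar>h n\<bar>"
      using weak_gradient_shift_error[OF w iu iG, of "\<lambda>x. h n * g x" "h n *\<^sub>R b"] ig by (simp add: divide_right_mono)
    also have "\<dots> = (\<integral>t. indicator {0..1::real} t * R n t \<partial>lborel)"
    proof -
      have "(\<integral>x. \<bar>G (x + t *\<^sub>R (h n *\<^sub>R b)) \<bullet> (h n *\<^sub>R b) - h n * g x\<bar> \<partial>lborel) = \<bar>h n\<bar> * R n t" for t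
        unfolding R_def g_def by (simp add: abs_mult flip: right_diff_distrib)
      then show ?thesis using h(1)[of n] by (simp add: mult.left_commute)
    qed
    finally show ?thesis .
  qed
  have "(\<lambda>n. \<integral>t. indicator {0..1::real} t * R n t \<partial>lborel) \<longlonglongrightarrow> (\<integral>t. 0 \<partial>(lborel :: real measure))"
  proof (rule integral_dominated_convergence[where w="\<lambda>t. indicator {0..1::real} t * (2 * (\<integral>x. \<bar>g x\<bar> \<partial>lborel))"])
    show "(\<lambda>t. indicator {0..1::real} t * R n t) \<in> borel_measurable lborel" for n
      unfolding R_def by measurable
    show "AE t in lborel. (\<lambda>n. indicator {0..1::real} t * R n t) \<longlonglongrightarrow> 0"
    proof (rule AE_I2)
      fix t :: real
      have "(\<lambda>n. (t * h n) *\<^sub>R b) \<longlonglongrightarrow> (t * 0) *\<^sub>R b" by (intro tendsto_intros h(2))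
      then have "(\<lambda>n. R n t) \<longlonglongrightarrow> 0"
        using L1_translation_continuous[OF ig] unfolding L1_trans_cont_def R_def by simp
      then show "(\<lambda>n. indicator {0..1::real} t * R n t) \<longlonglongrightarrow> 0" by (rule tendsto_mult_right_zero)
    qed
    show "AE t in lborel. norm (indicator {0..1::real} t * R n t) \<le> indicator {0..1::real} t * (2 * (\<integral>x. \<bar>g x\<bar> \<partial>lborel))" for n
    proof (rule AE_I2)
      fix t :: real
      define c where "c = (t * h n) *\<^sub>R b"
      have ic: "integrable lborel (\<lambda>x. \<bar>g (x + c)\<bar>)"
        using ig lborel_integral_translate(2)[of "\<lambda>x. \<bar>g x\<bar>" c] by simp
      have "R n t \<le> (\<integral>x. \<bar>g (x + c)\<bar> + \<bar>g x\<bar> \<partial>lborel)"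
        unfolding R_def c_def[symmetric] using ic ig integrable_translate_diff[OF ig, of c] by (intro integral_mono) auto
      also have "\<dots> = 2 * (\<integral>x. \<bar>g x\<bar> \<partial>lborel)"
        using ic ig lborel_integral_translate(1)[of "\<lambda>x. \<bar>g x\<bar>" c] by simp
      finally have "R n t \<le> 2 * (\<integral>x. \<bar>g x\<bar> \<partial>lborel)" .
      moreover have "R n t \<ge> 0" by (simp add: R_def)
      ultimately show "norm (indicator {0..1::real} t * R n t) \<le> indicator {0..1::real} t * (2 * (\<integral>x. \<bar>g x\<bar> \<partial>lborel))"
        by (auto split: split_indicator)
    qed
  qed (auto simp: integrable_real_indicator)
  then have lim0: "(\<lambda>n. \<integral>t. indicator {0..1::real} t * R n t \<partial>lborel) \<longlonglongrightarrow> 0" by simp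
  show ?thesis
  proof (rule tendsto_sandwich[OF _ _ tendsto_const lim0])
    show "\<forall>\<^sub>F n in sequentially. 0 \<le> (\<integral>x. \<bar>(u (x + h n *\<^sub>R b) - u x) / h n - G x \<bullet> b\<bar> \<partial>lborel)"
      by (intro always_eventually allI integral_nonneg_AE AE_I2 abs_ge_zero)
    show "\<forall>\<^sub>F n in sequentially. (\<integral>x. \<bar>(u (x + h n *\<^sub>R b) - u x) / h n - G x \<bullet> b\<bar> \<partial>lborel)
        \<le> (\<integral>t. indicator {0..1::real} t * R n t \<partial>lborel)"
      by (intro always_eventually allI le)
  qed
qed

subsection \<open>Calculus of weak gradients\<close>

text \<open>Integrability over the whole space, instead of local integrability, makes the
  translation arguments available and rules out default values of the integrals. It fits functions
  that vanish off a bounded set.\<close>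

definition wgrad :: "('a::euclidean_space \<Rightarrow> real) \<Rightarrow> ('a \<Rightarrow> 'a) \<Rightarrow> bool" where
  "wgrad u G \<longleftrightarrow> integrable lborel u \<and> integrable lborel G \<and> has_weak_gradient u G"

lemma test_function_measurable:
  assumes "test_function f"
  shows "f \<in> borel_measurable borel" "(\<lambda>x. frechet_derivative f (at x) e) \<in> borel_measurable borel"
  using test_function_continuous[OF assms] test_function_derivative_continuous[OF assms]
  by (auto intro: borel_measurable_continuous_onI)

lemma integrable_imp_locally_integrable:
  fixes f :: "'a::euclidean_space \<Rightarrow> 'b::euclidean_space"
  assumes "integrable lborel f" shows "locally_integrable f"
  unfolding locally_integrable_def
proof (intro allI impI)
  fix K :: "'a set" assume "compact K"
  then have K: "K \<in> sets lebesgue" by (intro fmeasurableD lmeasurable_compact)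
  have "integrable lebesgue f" using assms borel_measurable_integrable[OF assms] by (simp add: integrable_completion)
  then show "set_integrable lebesgue K f" using K unfolding set_integrable_def by (rule integrable_mult_indicator[rotated])
qed

lemma wgradI:
  fixes u :: "'a::euclidean_space \<Rightarrow> real"
  assumes iu: "integrable lborel u" and iG: "integrable lborel G"
    and "\<And>f b. test_function f \<Longrightarrow> b \<in> Basis \<Longrightarrow>
      (\<integral>x. u x * frechet_derivative f (at x) b \<partial>lborel) = - (\<integral>x. (G x \<bullet> b) * f x \<partial>lborel)"
  shows "wgrad u G"
  unfolding wgrad_def has_weak_gradient_def
proof (intro conjI allI impI ballI iu iG integrable_imp_locally_integrable[OF iu] integrable_imp_locally_integrable[OF iG])
  fix f :: "'a \<Rightarrow> real" and b :: 'a assume f: "test_function f" and b: "b \<in> Basis"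
  note [measurable] = borel_measurable_integrable[OF iu] borel_measurable_integrable[OF iG] test_function_measurable[OF f]
  show "(LINT x|lebesgue. u x * frechet_derivative f (at x) b) = - (LINT x|lebesgue. (G x \<bullet> b) * f x)"
    using assms(3)[OF f b] by (simp add: integral_completion)
qed

lemma wgradD: "wgrad u G \<Longrightarrow> integrable lborel u" "wgrad u G \<Longrightarrow> integrable lborel G"
  "wgrad u G \<Longrightarrow> has_weak_gradient u G"
  by (auto simp: wgrad_def)

lemma wgrad_direction:
  assumes "wgrad u G" "test_function f"
  shows "(\<integral>x. u x * frechet_derivative f (at x) e \<partial>lborel) = - (\<integral>x. (G x \<bullet> e) * f x \<partial>lborel)"
  using weak_gradient_direction[of u G f e] assms by (auto simp: wgrad_def)

lemma test_function_integrable: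
  fixes u :: "'a::euclidean_space \<Rightarrow> real"
  assumes "test_function f" "integrable lborel u"
  shows "integrable lborel (\<lambda>x. u x * f x)" "integrable lborel (\<lambda>x. u x * frechet_derivative f (at x) e)"
proof -
  note [measurable] = test_function_measurable[OF assms(1)]
  obtain C where "\<And>x. \<bar>f x\<bar> \<le> C" using test_function_bounded[OF assms(1)] by blast
  then show "integrable lborel (\<lambda>x. u x * f x)" by (intro integrable_mult_bounded[OF assms(2)]) auto
  obtain C' where "\<And>x. \<bar>frechet_derivative f (at x) e\<bar> \<le> C'" using test_function_derivative_bounded[OF assms(1)] by blast
  then show "integrable lborel (\<lambda>x. u x * frechet_derivative f (at x) e)" by (intro integrable_mult_bounded[OF assms(2)]) auto
qed

lemma wgrad_lin:
  fixes u v :: "'a::euclidean_space \<Rightarrow> real"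
  assumes u: "wgrad u G" and v: "wgrad v H"
  shows "wgrad (\<lambda>x. u x + c * v x) (\<lambda>x. G x + c *\<^sub>R H x)"
proof (rule wgradI)
  show "integrable lborel (\<lambda>x. u x + c * v x)" "integrable lborel (\<lambda>x. G x + c *\<^sub>R H x)"
    using wgradD[OF u] wgradD[OF v] by auto
  fix f :: "'a \<Rightarrow> real" and b :: 'a assume f: "test_function f"
  note i = test_function_integrable[OF f wgradD(1)[OF u]] test_function_integrable[OF f wgradD(1)[OF v]]
  have g: "integrable lborel (\<lambda>x. (G x \<bullet> b) * f x)" "integrable lborel (\<lambda>x. (H x \<bullet> b) * f x)"
    using wgradD(2)[OF u] wgradD(2)[OF v] by (auto intro!: test_function_integrable[OF f])
  have "(\<integral>x. (u x + c * v x) * frechet_derivative f (at x) b \<partial>lborel)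
     = (\<integral>x. u x * frechet_derivative f (at x) b \<partial>lborel) + c * (\<integral>x. v x * frechet_derivative f (at x) b \<partial>lborel)"
    using i by (simp add: distrib_right mult.assoc)
  moreover have "(\<integral>x. ((G x + c *\<^sub>R H x) \<bullet> b) * f x \<partial>lborel) = (\<integral>x. (G x \<bullet> b) * f x \<partial>lborel) + c * (\<integral>x. (H x \<bullet> b) * f x \<partial>lborel)"
    using g by (simp add: inner_add_left distrib_right mult.assoc)
  ultimately show "(\<integral>x. (u x + c * v x) * frechet_derivative f (at x) b \<partial>lborel) = - (\<integral>x. ((G x + c *\<^sub>R H x) \<bullet> b) * f x \<partial>lborel)"
    using wgrad_direction[OF u f, of b] wgrad_direction[OF v f, of b] by simp
qed

lemma integrable_cong_AE_lborel:
  fixes f g :: "'a::euclidean_space \<Rightarrow> 'b::euclidean_space"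
  assumes "integrable lborel f" "g \<in> borel_measurable borel" "AE x in lborel. g x = f x"
  shows "integrable lborel g"
  using assms integrable_cong_AE[of g lborel f] borel_measurable_integrable[OF assms(1)] by simp

lemma wgrad_cong_AE:
  fixes u v :: "'a::euclidean_space \<Rightarrow> real"
  assumes u: "wgrad u G" and v: "v \<in> borel_measurable borel" "AE x in lborel. v x = u x"
    and H: "H \<in> borel_measurable borel" "AE x in lborel. H x = G x"
  shows "wgrad v H"
proof (rule wgradI)
  show iv: "integrable lborel v" and iH: "integrable lborel H"
    using integrable_cong_AE_lborel wgradD[OF u] v H by blast+
  fix f :: "'a \<Rightarrow> real" and b :: 'a assume f: "test_function f"
  note [measurable] = v(1) H(1) test_function_measurable[OF f] borel_measurable_integrable[OF wgradD(1)[OF u]] borel_measurable_integrable[OF wgradD(2)[OF u]]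
  have "(\<integral>x. v x * frechet_derivative f (at x) b \<partial>lborel) = (\<integral>x. u x * frechet_derivative f (at x) b \<partial>lborel)"
    using v(2) by (intro integral_cong_AE) auto
  moreover have "(\<integral>x. (H x \<bullet> b) * f x \<partial>lborel) = (\<integral>x. (G x \<bullet> b) * f x \<partial>lborel)"
    using H(2) by (intro integral_cong_AE) auto
  ultimately show "(\<integral>x. v x * frechet_derivative f (at x) b \<partial>lborel) = - (\<integral>x. (H x \<bullet> b) * f x \<partial>lborel)"
    using wgrad_direction[OF u f, of b] by simp
qed

lemma L1_tendsto_mult_bounded:
  fixes us :: "nat \<Rightarrow> 'a::euclidean_space \<Rightarrow> real"
  assumes us: "\<And>n. integrable lborel (us n)" and u: "integrable lborel u"
    and lim: "(\<lambda>n. \<integral>x. \<bar>us n x - u x\<bar> \<partial>lborel) \<longlonglongrightarrow> 0"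
    and g: "g \<in> borel_measurable borel" "\<And>x. \<bar>g x\<bar> \<le> C"
  shows "(\<lambda>n. \<integral>x. us n x * g x \<partial>lborel) \<longlonglongrightarrow> (\<integral>x. u x * g x \<partial>lborel)"
proof -
  note [measurable] = g(1)
  have i: "integrable lborel (\<lambda>x. us n x * g x)" "integrable lborel (\<lambda>x. u x * g x)" for n
    using g(2) by (auto intro!: integrable_mult_bounded[OF us] integrable_mult_bounded[OF u])
  have le: "norm ((\<integral>x. us n x * g x \<partial>lborel) - (\<integral>x. u x * g x \<partial>lborel)) \<le> (\<integral>x. \<bar>us n x - u x\<bar> \<partial>lborel) * C" for n
  proof -
    have "(\<integral>x. us n x * g x \<partial>lborel) - (\<integral>x. u x * g x \<partial>lborel) = (\<integral>x. (us n x - u x) * g x \<partial>lborel)"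
      using i by (simp add: left_diff_distrib)
    also have "norm \<dots> \<le> (\<integral>x. norm ((us n x - u x) * g x) \<partial>lborel)" by (rule integral_norm_bound)
    also have "\<dots> \<le> (\<integral>x. \<bar>us n x - u x\<bar> * C \<partial>lborel)"
      using us u g(2) integrable_norm[OF Bochner_Integration.integrable_diff[OF i(1)[of n] i(2)]]
      by (intro integral_mono) (auto simp: abs_mult left_diff_distrib[symmetric] intro!: mult_left_mono)
    finally show ?thesis by simp
  qed
  have "(\<lambda>n. (\<integral>x. us n x * g x \<partial>lborel) - (\<integral>x. u x * g x \<partial>lborel)) \<longlonglongrightarrow> 0"
    by (rule Lim_null_comparison[OF _ tendsto_mult_left_zero[OF lim, of C]]) (intro always_eventually allI le)
  then show ?thesis by (rule LIM_zero_cancel)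
qed

lemma wgrad_limit:
  fixes us :: "nat \<Rightarrow> 'a::euclidean_space \<Rightarrow> real"
  assumes us: "\<And>n. wgrad (us n) (Gs n)" and u: "integrable lborel u" and G: "integrable lborel G"
    and lim: "(\<lambda>n. \<integral>x. \<bar>us n x - u x\<bar> \<partial>lborel) \<longlonglongrightarrow> 0"
    and limG: "(\<lambda>n. \<integral>x. norm (Gs n x - G x) \<partial>lborel) \<longlonglongrightarrow> 0"
  shows "wgrad u G"
proof (rule wgradI[OF u G])
  fix f :: "'a \<Rightarrow> real" and b :: 'a assume f: "test_function f" and b: "b \<in> Basis"
  obtain C where C: "\<And>x. \<bar>f x\<bar> \<le> C" using test_function_bounded[OF f] by blast
  obtain C' where C': "\<And>x. \<bar>frechet_derivative f (at x) b\<bar> \<le> C'" using test_function_derivative_bounded[OF f] by blast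
  have 1: "(\<lambda>n. \<integral>x. us n x * frechet_derivative f (at x) b \<partial>lborel) \<longlonglongrightarrow> (\<integral>x. u x * frechet_derivative f (at x) b \<partial>lborel)"
    by (rule L1_tendsto_mult_bounded[OF wgradD(1)[OF us] u lim _ C']) (rule test_function_measurable[OF f])
  have lG: "(\<lambda>n. \<integral>x. \<bar>Gs n x \<bullet> b - G x \<bullet> b\<bar> \<partial>lborel) \<longlonglongrightarrow> 0"
  proof (rule tendsto_sandwich[OF _ _ tendsto_const limG])
    show "\<forall>\<^sub>F n in sequentially. (\<integral>x. \<bar>Gs n x \<bullet> b - G x \<bullet> b\<bar> \<partial>lborel) \<le> (\<integral>x. norm (Gs n x - G x) \<partial>lborel)"
      using wgradD(2)[OF us] G b
      by (intro always_eventually allI integral_mono) (auto simp: Basis_le_norm simp flip: inner_diff_left)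
  qed simp
  have 2: "(\<lambda>n. \<integral>x. (Gs n x \<bullet> b) * f x \<partial>lborel) \<longlonglongrightarrow> (\<integral>x. (G x \<bullet> b) * f x \<partial>lborel)"
    by (rule L1_tendsto_mult_bounded[OF _ _ lG _ C]) (use wgradD(2)[OF us] G test_function_measurable[OF f] in auto)
  show "(\<integral>x. u x * frechet_derivative f (at x) b \<partial>lborel) = - (\<integral>x. (G x \<bullet> b) * f x \<partial>lborel)"
    using LIMSEQ_unique[OF 1] tendsto_minus[OF 2] wgrad_direction[OF us f] by simp
qed

text \<open>Discrete integration by parts moves the quotient onto the test function, whose quotients
  converge pointwise and are bounded by its derivative. Being the converse of
  \<open>weak_gradient_diff_quotient\<close>, it allows chain rules to be verified on
  quotients.\<close>

lemma wgrad_from_diff_quotients: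
  fixes v :: "'a::euclidean_space \<Rightarrow> real"
  assumes v: "integrable lborel v" and H: "integrable lborel H"
    and dq: "\<And>b. b \<in> Basis \<Longrightarrow> \<exists>h. (\<forall>n. h n \<noteq> 0) \<and> h \<longlonglongrightarrow> 0 \<and>
      (\<lambda>n. \<integral>x. \<bar>(v (x + h n *\<^sub>R b) - v x) / h n - H x \<bullet> b\<bar> \<partial>lborel) \<longlonglongrightarrow> 0"
  shows "wgrad v H"
proof (rule wgradI[OF v H])
  fix f :: "'a \<Rightarrow> real" and b :: 'a assume f: "test_function f" and b: "b \<in> Basis"
  note [measurable] = test_function_measurable[OF f] borel_measurable_integrable[OF v] borel_measurable_integrable[OF H]
  obtain h :: "nat \<Rightarrow> real" where h: "\<And>n. h n \<noteq> 0" "h \<longlonglongrightarrow> 0"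
    and lim: "(\<lambda>n. \<integral>x. \<bar>(v (x + h n *\<^sub>R b) - v x) / h n - H x \<bullet> b\<bar> \<partial>lborel) \<longlonglongrightarrow> 0"
    using dq[OF b] by blast
  obtain C where C: "\<And>x. \<bar>f x\<bar> \<le> C" using test_function_bounded[OF f] by blast
  obtain C' where C': "\<And>x. \<bar>frechet_derivative f (at x) b\<bar> \<le> C'" using test_function_derivative_bounded[OF f] by blast
  have idq: "integrable lborel (\<lambda>x. (v (x + h n *\<^sub>R b) - v x) / h n)" for n
    using integrable_translate_diff[OF v] by simp
  have 1: "(\<lambda>n. \<integral>x. (v (x + h n *\<^sub>R b) - v x) / h n * f x \<partial>lborel) \<longlonglongrightarrow> (\<integral>x. (H x \<bullet> b) * f x \<partial>lborel)"
    by (rule L1_tendsto_mult_bounded[OF idq _ lim _ C]) (use H in auto)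
  have line: "((\<lambda>t. f (x - t *\<^sub>R b)) has_real_derivative - frechet_derivative f (at (x - t *\<^sub>R b)) b) (at t)" for x t
  proof -
    have d1: "((\<lambda>t. x - t *\<^sub>R b) has_derivative (\<lambda>h. - h *\<^sub>R b)) (at t)" by (auto intro!: derivative_eq_intros)
    have "((\<lambda>t. f (x - t *\<^sub>R b)) has_derivative (\<lambda>h. frechet_derivative f (at (x - t *\<^sub>R b)) (- h *\<^sub>R b))) (at t)"
      using has_derivative_compose[OF d1 test_function_has_derivative[OF f]] .
    moreover have "(\<lambda>h. frechet_derivative f (at (x - t *\<^sub>R b)) (- h *\<^sub>R b)) = (*) (- frechet_derivative f (at (x - t *\<^sub>R b)) b)"
    proof
      fix h
      show "frechet_derivative f (at (x - t *\<^sub>R b)) (- h *\<^sub>R b) = - frechet_derivative f (at (x - t *\<^sub>R b)) b * h"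
        using has_derivative_linear[OF test_function_has_derivative[OF f, of "x - t *\<^sub>R b"]]
          linear_scale[of "frechet_derivative f (at (x - t *\<^sub>R b))" "- h" b] by simp
    qed
    ultimately show ?thesis by (simp only: has_field_derivative_def)
  qed
  have eq: "(\<integral>x. (v (x + h n *\<^sub>R b) - v x) / h n * f x \<partial>lborel) = (\<integral>x. v x * ((f (x - h n *\<^sub>R b) - f x) / h n) \<partial>lborel)" for n
  proof -
    have i: "integrable lborel (\<lambda>x. v (x + h n *\<^sub>R b) * f x)" "integrable lborel (\<lambda>x. v x * f x)" "integrable lborel (\<lambda>x. v x * f (x - h n *\<^sub>R b))"
      using v lborel_integral_translate(2)[of v] C by (auto intro!: integrable_mult_bounded)
    have "(\<integral>x. v (x + h n *\<^sub>R b) * f x \<partial>lborel) = (\<integral>x. v x * f (x - h n *\<^sub>R b) \<partial>lborel)"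
      using lborel_integral_translate(1)[of "\<lambda>x. v x * f (x - h n *\<^sub>R b)" "h n *\<^sub>R b"] by simp
    then have "((\<integral>x. v (x + h n *\<^sub>R b) * f x \<partial>lborel) - (\<integral>x. v x * f x \<partial>lborel)) / h n
        = ((\<integral>x. v x * f (x - h n *\<^sub>R b) \<partial>lborel) - (\<integral>x. v x * f x \<partial>lborel)) / h n" by simp
    then have "(\<integral>x. (v (x + h n *\<^sub>R b) * f x - v x * f x) / h n \<partial>lborel) = (\<integral>x. (v x * f (x - h n *\<^sub>R b) - v x * f x) / h n \<partial>lborel)"
      using i by simp
    then show ?thesis by (simp add: left_diff_distrib right_diff_distrib)
  qed
  have 2: "(\<lambda>n. \<integral>x. v x * ((f (x - h n *\<^sub>R b) - f x) / h n) \<partial>lborel) \<longlonglongrightarrow> (\<integral>x. v x * (- frechet_derivative f (at x) b) \<partial>lborel)"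
  proof (rule integral_dominated_convergence[where w="\<lambda>x. \<bar>v x\<bar> * C'"])
    show "AE x in lborel. (\<lambda>n. v x * ((f (x - h n *\<^sub>R b) - f x) / h n)) \<longlonglongrightarrow> v x * (- frechet_derivative f (at x) b)"
    proof (rule AE_I2)
      fix x
      have "((\<lambda>t. (f (x - t *\<^sub>R b) - f x) / t) \<longlongrightarrow> - frechet_derivative f (at x) b) (at 0)"
        using line[of x 0] by (simp add: has_field_derivative_iff)
      moreover have "filterlim h (at 0) sequentially" using h by (simp add: filterlim_at)
      ultimately have "(\<lambda>n. (f (x - h n *\<^sub>R b) - f x) / h n) \<longlonglongrightarrow> - frechet_derivative f (at x) b"
        by (rule filterlim_compose)
      then show "(\<lambda>n. v x * ((f (x - h n *\<^sub>R b) - f x) / h n)) \<longlonglongrightarrow> v x * (- frechet_derivative f (at x) b)"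
        by (rule tendsto_mult_left)
    qed
    show "AE x in lborel. norm (v x * ((f (x - h n *\<^sub>R b) - f x) / h n)) \<le> \<bar>v x\<bar> * C'" for n
    proof (rule AE_I2)
      fix x
      have "norm (f (x - h n *\<^sub>R b) - f (x - 0 *\<^sub>R b)) \<le> C' * norm (h n - 0)"
        by (rule field_differentiable_bound[of UNIV "\<lambda>t. f (x - t *\<^sub>R b)" "\<lambda>t. - frechet_derivative f (at (x - t *\<^sub>R b)) b"])
          (use line C' in \<open>auto intro: has_field_derivative_at_within\<close>)
      then have "\<bar>(f (x - h n *\<^sub>R b) - f x) / h n\<bar> \<le> C'" using h(1)[of n] by (simp add: divide_simps)
      then show "norm (v x * ((f (x - h n *\<^sub>R b) - f x) / h n)) \<le> \<bar>v x\<bar> * C'"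
        unfolding real_norm_def abs_mult by (rule mult_left_mono) simp
    qed
  qed (use v in auto)
  have "(\<integral>x. v x * (- frechet_derivative f (at x) b) \<partial>lborel) = (\<integral>x. (H x \<bullet> b) * f x \<partial>lborel)"
    using LIMSEQ_unique[OF 2] 1 unfolding eq by blast
  then show "(\<integral>x. v x * frechet_derivative f (at x) b \<partial>lborel) = - (\<integral>x. (H x \<bullet> b) * f x \<partial>lborel)" by simp
qed

lemma wgrad_diff_quotient_subseq:
  fixes u :: "'a::euclidean_space \<Rightarrow> real"
  assumes u: "wgrad u G" and h: "\<And>n. h n \<noteq> 0" "h \<longlonglongrightarrow> 0"
  obtains r :: "nat \<Rightarrow> nat" where "strict_mono r"
    "AE x in lborel. (\<lambda>n. (u (x + h (r n) *\<^sub>R b) - u x) / h (r n)) \<longlonglongrightarrow> G x \<bullet> b"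
proof -
  have i: "integrable lborel (\<lambda>x. (u (x + h n *\<^sub>R b) - u x) / h n - G x \<bullet> b)" for n
    using integrable_translate_diff[OF wgradD(1)[OF u]] wgradD(2)[OF u] by simp
  obtain r :: "nat \<Rightarrow> nat" where r: "strict_mono r"
    "AE x in lborel. (\<lambda>n. (u (x + h (r n) *\<^sub>R b) - u x) / h (r n) - G x \<bullet> b) \<longlonglongrightarrow> 0"
    using tendsto_L1_AE_subseq[of lborel "\<lambda>n x. (u (x + h n *\<^sub>R b) - u x) / h n - G x \<bullet> b", OF i] weak_gradient_diff_quotient[OF wgradD(3)[OF u] wgradD(1)[OF u] wgradD(2)[OF u] h, of b] by auto
  from r(2) have "AE x in lborel. (\<lambda>n. (u (x + h (r n) *\<^sub>R b) - u x) / h (r n)) \<longlonglongrightarrow> G x \<bullet> b"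
    by eventually_elim (rule LIM_zero_cancel)
  with r(1) that show thesis by blast
qed

text \<open>The quotients of \<open>u\<close> converge in \<open>L1\<close>, so their distance
  \<open>q n\<close> from the limit is an error tending to 0 in mean, and dominated convergence with
  error applies to the quotients of \<open>v\<close>. The term with \<open>K\<close> lets
  \<open>v\<close> depend on the point also through a fixed smooth factor.\<close>

lemma wgrad_chain:
  fixes u v :: "'a::euclidean_space \<Rightarrow> real"
  assumes u: "wgrad u G" and v: "integrable lborel v" and H: "integrable lborel H"
    and K: "integrable lborel K"
    and lim: "\<And>b x h. b \<in> Basis \<Longrightarrow> (\<And>n. h n \<noteq> 0) \<Longrightarrow> h \<longlonglongrightarrow> 0 \<Longrightarrow>
        (\<lambda>n. (u (x + h n *\<^sub>R b) - u x) / h n) \<longlonglongrightarrow> G x \<bullet> b \<Longrightarrow>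
        (\<lambda>n. (v (x + h n *\<^sub>R b) - v x) / h n) \<longlonglongrightarrow> H x \<bullet> b"
    and bound: "\<And>b x h. b \<in> Basis \<Longrightarrow> \<bar>h\<bar> \<le> 1 \<Longrightarrow>
        \<bar>v (x + h *\<^sub>R b) - v x\<bar> \<le> c * \<bar>u (x + h *\<^sub>R b) - u x\<bar> + \<bar>h\<bar> * K x"
    and c: "c \<ge> 0"
  shows "wgrad v H"
proof (rule wgrad_from_diff_quotients[OF v H])
  fix b :: 'a assume b: "b \<in> Basis"
  note [measurable] = borel_measurable_integrable[OF v] borel_measurable_integrable[OF H]
    borel_measurable_integrable[OF wgradD(1)[OF u]] borel_measurable_integrable[OF wgradD(2)[OF u]]
  define h0 where "h0 n = 1 / real (Suc n)" for n
  have h0: "h0 n \<noteq> 0" "\<bar>h0 n\<bar> \<le> 1" for n by (auto simp: h0_def)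
  have h0l: "h0 \<longlonglongrightarrow> 0" unfolding h0_def by (rule LIMSEQ_Suc[OF lim_1_over_n])
  obtain r :: "nat \<Rightarrow> nat" where r: "strict_mono r"
    "AE x in lborel. (\<lambda>n. (u (x + h0 (r n) *\<^sub>R b) - u x) / h0 (r n)) \<longlonglongrightarrow> G x \<bullet> b"
    using wgrad_diff_quotient_subseq[OF u h0(1) h0l] by blast
  define h where "h n = h0 (r n)" for n
  have h: "h n \<noteq> 0" "\<bar>h n\<bar> \<le> 1" for n by (auto simp: h_def h0)
  have hl: "h \<longlonglongrightarrow> 0" using LIMSEQ_subseq_LIMSEQ[OF h0l r(1)] by (simp add: h_def[abs_def] o_def)
  define q where "q n x = (u (x + h n *\<^sub>R b) - u x) / h n - G x \<bullet> b" for n x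
  have iq: "integrable lborel (q n)" for n
    unfolding q_def using integrable_translate_diff[OF wgradD(1)[OF u]] wgradD(2)[OF u] by simp
  have ql: "(\<lambda>n. \<integral>x. \<bar>q n x\<bar> \<partial>lborel) \<longlonglongrightarrow> 0"
    unfolding q_def by (rule weak_gradient_diff_quotient[OF wgradD(3)[OF u] wgradD(1)[OF u] wgradD(2)[OF u] h(1) hl])
  have "(\<lambda>n. \<integral>x. norm ((v (x + h n *\<^sub>R b) - v x) / h n - H x \<bullet> b) \<partial>lborel) \<longlonglongrightarrow> 0"
  proof (rule tendsto_integral_dominated_error[where e="\<lambda>n x. c * \<bar>q n x\<bar>" and H="\<lambda>x. c * \<bar>G x \<bullet> b\<bar> + K x + \<bar>H x \<bullet> b\<bar>"])
    show "integrable lborel (\<lambda>x. c * \<bar>G x \<bullet> b\<bar> + K x + \<bar>H x \<bullet> b\<bar>)" using K H wgradD(2)[OF u] by auto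
    show "(\<lambda>n. \<integral>x. c * \<bar>q n x\<bar> \<partial>lborel) \<longlonglongrightarrow> 0" using tendsto_mult_right_zero[OF ql, of c] by simp
    show "AE x in lborel. norm ((v (x + h n *\<^sub>R b) - v x) / h n - H x \<bullet> b) \<le> c * \<bar>G x \<bullet> b\<bar> + K x + \<bar>H x \<bullet> b\<bar> + c * \<bar>q n x\<bar>" for n
    proof (rule AE_I2)
      fix x
      have "\<bar>(v (x + h n *\<^sub>R b) - v x) / h n\<bar> \<le> (c * \<bar>u (x + h n *\<^sub>R b) - u x\<bar> + \<bar>h n\<bar> * K x) / \<bar>h n\<bar>"
        using bound[OF b h(2)[of n], of x] by (simp add: divide_right_mono)
      also have "\<dots> = c * \<bar>q n x + G x \<bullet> b\<bar> + K x"
        using h(1)[of n] by (simp add: q_def add_divide_distrib)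
      also have "\<dots> \<le> c * (\<bar>q n x\<bar> + \<bar>G x \<bullet> b\<bar>) + K x" using c by (simp add: mult_left_mono)
      finally show "norm ((v (x + h n *\<^sub>R b) - v x) / h n - H x \<bullet> b) \<le> c * \<bar>G x \<bullet> b\<bar> + K x + \<bar>H x \<bullet> b\<bar> + c * \<bar>q n x\<bar>"
        using abs_triangle_ineq4[of "(v (x + h n *\<^sub>R b) - v x) / h n" "H x \<bullet> b"] by (simp add: distrib_left)
    qed
    show "AE x in lborel. (\<lambda>n. (v (x + h n *\<^sub>R b) - v x) / h n - H x \<bullet> b) \<longlonglongrightarrow> 0"
      using r(2)
    proof eventually_elim
      case (elim x)
      then have "(\<lambda>n. (u (x + h n *\<^sub>R b) - u x) / h n) \<longlonglongrightarrow> G x \<bullet> b" by (simp add: h_def)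
      from lim[OF b h(1) hl this] show ?case by (rule LIM_zero)
    qed
  qed (use iq c in auto)
  then show "\<exists>h. (\<forall>n. h n \<noteq> 0) \<and> h \<longlonglongrightarrow> 0 \<and>
      (\<lambda>n. \<integral>x. \<bar>(v (x + h n *\<^sub>R b) - v x) / h n - H x \<bullet> b\<bar> \<partial>lborel) \<longlonglongrightarrow> 0"
    using h(1) hl by (intro exI[of _ h]) simp
qed

text \<open>At a zero of a nonnegative function the quotients with positive steps are nonnegative
  and those with negative steps nonpositive. Along suitable subsequences both tend to the same
  component of \<open>G\<close> almost everywhere, which is therefore 0.\<close>

lemma wgrad_zero_set:
  fixes u :: "'a::euclidean_space \<Rightarrow> real"
  assumes u: "wgrad u G" and pos: "\<And>x. u x \<ge> 0"
  shows "AE x in lborel. u x = 0 \<longrightarrow> G x = 0"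
proof -
  have "AE x in lborel. u x = 0 \<longrightarrow> 0 \<le> G x \<bullet> (s *\<^sub>R b)" if s: "s = 1 \<or> s = -1" for s :: real and b
  proof -
    define h where "h n = s * (1 / real (Suc n))" for n
    have h: "h n \<noteq> 0" for n using s by (auto simp: h_def)
    have "h \<longlonglongrightarrow> s * 0" unfolding h_def by (intro tendsto_intros LIMSEQ_Suc[OF lim_1_over_n])
    then have hl: "h \<longlonglongrightarrow> 0" by simp
    obtain r :: "nat \<Rightarrow> nat" where
      "AE x in lborel. (\<lambda>n. (u (x + h (r n) *\<^sub>R b) - u x) / h (r n)) \<longlonglongrightarrow> G x \<bullet> b"
      using wgrad_diff_quotient_subseq[OF u h hl] by blast
    then show ?thesis
    proof eventually_elim
      case (elim x)
      show ?case
      proof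
        assume ux: "u x = 0"
        have "(\<lambda>n. s * ((u (x + h (r n) *\<^sub>R b) - u x) / h (r n))) \<longlonglongrightarrow> s * (G x \<bullet> b)"
          by (intro tendsto_intros elim)
        moreover have "0 \<le> s * ((u (x + h (r n) *\<^sub>R b) - u x) / h (r n))" for n
          using s pos ux by (auto simp: h_def divide_simps)
        ultimately show "0 \<le> G x \<bullet> (s *\<^sub>R b)" by (intro LIMSEQ_le_const) auto
      qed
    qed
  qed
  from this[of 1] this[of "-1"]
  have "AE x in lborel. u x = 0 \<longrightarrow> G x \<bullet> b = 0" for b
    by (smt (verit) eventually_elim2 inner_minus_right scaleR_minus1_left scaleR_one)
  then have "AE x in lborel. \<forall>b\<in>Basis. u x = 0 \<longrightarrow> G x \<bullet> b = 0"
    by (intro AE_finite_allI) auto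
  then show ?thesis by eventually_elim (auto intro: euclidean_eqI)
qed

text \<open>The zero function has \<open>G - H\<close> as a weak gradient, and this vanishes on the
  zero set, which is everything.\<close>

lemma wgrad_unique:
  fixes u v :: "'a::euclidean_space \<Rightarrow> real"
  assumes u: "wgrad u G" and v: "wgrad v H" and eq: "AE x in lborel. u x = v x"
  shows "AE x in lborel. G x = H x"
proof -
  have w: "wgrad (\<lambda>x. u x + (-1) * v x) (\<lambda>x. G x + (-1) *\<^sub>R H x)" by (rule wgrad_lin[OF u v])
  have "wgrad (\<lambda>x. 0) (\<lambda>x. G x + (-1) *\<^sub>R H x)"
    by (rule wgrad_cong_AE[OF w]) (use eq borel_measurable_integrable[OF wgradD(2)[OF w]] in auto)
  from wgrad_zero_set[OF this] show ?thesis by simp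
qed

text \<open>After a translation by \<open>2 * R\<close> the function and its translate are nowhere
  both nonzero. Their \<open>L1\<close> distance is then twice the norm of \<open>u\<close>, while
  it is at most \<open>2 * R\<close> times the norm of the gradient.\<close>

lemma wgrad_poincare:
  fixes u :: "'a::euclidean_space \<Rightarrow> real"
  assumes u: "wgrad u G" and R: "\<And>x. norm x \<ge> R \<Longrightarrow> u x = 0" "R > 0"
  shows "(\<integral>x. \<bar>u x\<bar> \<partial>lborel) \<le> R * (\<integral>x. norm (G x) \<partial>lborel)"
proof -
  note [measurable] = borel_measurable_integrable[OF wgradD(1)[OF u]]
  obtain b :: 'a where b: "b \<in> Basis" using nonempty_Basis by blast
  define e where "e = (2 * R) *\<^sub>R b"
  have e: "norm e = 2 * R" using b R by (simp add: e_def)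
  have iu: "integrable lborel (\<lambda>x. \<bar>u x\<bar>)" using wgradD(1)[OF u] by simp
  have iT: "integrable lborel (\<lambda>x. \<bar>u (x + e)\<bar>)" using iu lborel_integral_translate(2)[of "\<lambda>x. \<bar>u x\<bar>" e] by simp
  have "2 * (\<integral>x. \<bar>u x\<bar> \<partial>lborel) = (\<integral>x. \<bar>u (x + e)\<bar> + \<bar>u x\<bar> \<partial>lborel)"
    using iu iT lborel_integral_translate(1)[of "\<lambda>x. \<bar>u x\<bar>" e] by simp
  also have "\<dots> = (\<integral>x. \<bar>u (x + e) - u x\<bar> \<partial>lborel)"
  proof (rule Bochner_Integration.integral_cong[OF refl])
    fix x
    have "norm e \<le> norm (x + e) + norm x" using norm_triangle_ineq4[of "x + e" x] by simp
    then have "norm (x + e) \<ge> R \<or> norm x \<ge> R" using e by linarith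
    then show "\<bar>u (x + e)\<bar> + \<bar>u x\<bar> = \<bar>u (x + e) - u x\<bar>" using R(1) by auto
  qed
  also have "\<dots> \<le> norm e * (\<integral>x. norm (G x) \<partial>lborel)" by (rule weak_gradient_shift[OF wgradD(3)[OF u] wgradD(1)[OF u] wgradD(2)[OF u]])
  finally show ?thesis using e by simp
qed

text \<open>Poincare inequality with a constant that vanishes as the support of \<open>v\<close> shrinks:
  for every \<open>x\<close>, the translate \<open>v (x + y)\<close> vanishes for at least half of the \<open>y\<close> in a ball
  of twice the volume of that support.\<close>

lemma wgrad_gain:
  fixes v :: "'a::euclidean_space \<Rightarrow> real"
  assumes v: "wgrad v G" and pos: "\<And>x. v x \<ge> 0"
    and fin: "emeasure lborel {x. v x > 0} < \<infinity>" and m: "measure lborel {x. v x > 0} = m" "m > 0"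
    and r: "r > 0" "measure lborel (ball (0::'a) r) = 2 * m"
  shows "(\<integral>x. v x \<partial>lborel) \<le> 2 * r * (\<integral>x. norm (G x) \<partial>lborel)"
proof -
  have [measurable]: "v \<in> borel_measurable borel" using borel_measurable_integrable[OF wgradD(1)[OF v]] by simp
  let ?B = "ball (0::'a) r" and ?A = "{x. v x > 0}"
  have Bm [measurable]: "?B \<in> sets borel" by simp
  have Am [measurable]: "?A \<in> sets borel" by measurable
  have eB: "emeasure lborel ?B = ennreal (2 * m)"
    using r(2) emeasure_lborel_ball_finite by (metis emeasure_eq_ennreal_measure infinity_ennreal_def less_irrefl)
  have pt: "ennreal m * ennreal (v x) \<le> (\<integral>\<^sup>+z. indicator ?B z * ennreal \<bar>v (x + z) - v x\<bar> \<partial>lborel)" for x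
  proof -
    have S: "{z. x + z \<in> ?A} \<in> sets lborel" by measurable
    have "emeasure lborel {z. x + z \<in> ?A} = (\<integral>\<^sup>+z. indicator {z. x + z \<in> ?A} z \<partial>lborel)"
      by (rule nn_integral_indicator[OF S, symmetric])
    also have "\<dots> = (\<integral>\<^sup>+z. indicator ?A (z + x) \<partial>lborel)"
      by (intro nn_integral_cong) (auto simp: add.commute indicator_def)
    also have "\<dots> = (\<integral>\<^sup>+z. indicator ?A z \<partial>lborel)" by (rule nn_integral_lborel_translate) measurable
    also have "\<dots> = ennreal m" using fin m(1) by (simp add: emeasure_eq_ennreal_measure)
    finally have eS: "emeasure lborel {z. x + z \<in> ?A} = ennreal m" .
    have "emeasure lborel ?B \<le> emeasure lborel (?B - {z. x + z \<in> ?A}) + emeasure lborel {z. x + z \<in> ?A}"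
    proof -
      have "emeasure lborel ?B \<le> emeasure lborel ((?B - {z. x + z \<in> ?A}) \<union> {z. x + z \<in> ?A})"
        using S by (intro emeasure_mono) auto
      also have "\<dots> \<le> emeasure lborel (?B - {z. x + z \<in> ?A}) + emeasure lborel {z. x + z \<in> ?A}"
        using S by (intro emeasure_subadditive) auto
      finally show ?thesis .
    qed
    then have "ennreal m + ennreal m \<le> emeasure lborel (?B - {z. x + z \<in> ?A}) + ennreal m"
      unfolding eB eS using m(2) by (simp flip: ennreal_plus)
    then have low: "ennreal m \<le> emeasure lborel (?B - {z. x + z \<in> ?A})"
      by (simp add: ennreal_add_left_cancel_le add.commute)
    have D [measurable]: "?B - {z. x + z \<in> ?A} \<in> sets borel" using S by (intro sets.Diff) auto
    have "ennreal m * ennreal (v x) \<le> emeasure lborel (?B - {z. x + z \<in> ?A}) * ennreal (v x)"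
      using low by (rule mult_right_mono) simp
    also have "\<dots> = (\<integral>\<^sup>+z. indicator (?B - {z. x + z \<in> ?A}) z * ennreal (v x) \<partial>lborel)"
      by (subst nn_integral_multc) (use D in \<open>auto intro!: borel_measurable_indicator\<close>)
    also have "\<dots> \<le> (\<integral>\<^sup>+z. indicator ?B z * ennreal \<bar>v (x + z) - v x\<bar> \<partial>lborel)"
    proof (rule nn_integral_mono)
      fix z
      have "v (x + z) = 0" if "x + z \<notin> ?A" using pos[of "x + z"] that by auto
      then show "indicator (?B - {z. x + z \<in> ?A}) z * ennreal (v x) \<le> indicator ?B z * ennreal \<bar>v (x + z) - v x\<bar>"
        using pos[of x] by (auto split: split_indicator)
    qed
    finally show ?thesis .
  qed
  have "ennreal m * (\<integral>\<^sup>+x. ennreal (v x) \<partial>lborel) = (\<integral>\<^sup>+x. ennreal m * ennreal (v x) \<partial>lborel)"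
    by (rule nn_integral_cmult [symmetric]) measurable
  also have "\<dots> \<le> (\<integral>\<^sup>+x. (\<integral>\<^sup>+z. indicator ?B z * ennreal \<bar>v (x + z) - v x\<bar> \<partial>lborel) \<partial>lborel)"
    by (intro nn_integral_mono pt)
  also have "\<dots> = (\<integral>\<^sup>+z. (\<integral>\<^sup>+x. indicator ?B z * ennreal \<bar>v (x + z) - v x\<bar> \<partial>lborel) \<partial>lborel)"
    by (rule lborel_pair.Fubini') measurable
  also have "\<dots> \<le> (\<integral>\<^sup>+z. indicator ?B z * ennreal (r * (\<integral>x. norm (G x) \<partial>lborel)) \<partial>lborel)"
  proof (rule nn_integral_mono)
    fix z
    have "(\<integral>\<^sup>+x. ennreal \<bar>v (x + z) - v x\<bar> \<partial>lborel) = ennreal (\<integral>x. \<bar>v (x + z) - v x\<bar> \<partial>lborel)"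
      using integrable_translate_diff[OF wgradD(1)[OF v]] by (intro nn_integral_eq_integral) auto
    also have "\<dots> \<le> ennreal (norm z * (\<integral>x. norm (G x) \<partial>lborel))"
      by (intro ennreal_leI weak_gradient_shift[OF wgradD(3)[OF v] wgradD(1)[OF v] wgradD(2)[OF v]])
    finally have "(\<integral>\<^sup>+x. ennreal \<bar>v (x + z) - v x\<bar> \<partial>lborel) \<le> ennreal (norm z * (\<integral>x. norm (G x) \<partial>lborel))" .
    moreover have "z \<in> ?B \<Longrightarrow> norm z * (\<integral>x. norm (G x) \<partial>lborel) \<le> r * (\<integral>x. norm (G x) \<partial>lborel)"
      by (intro mult_right_mono) auto
    ultimately show "(\<integral>\<^sup>+x. indicator ?B z * ennreal \<bar>v (x + z) - v x\<bar> \<partial>lborel) \<le> indicator ?B z * ennreal (r * (\<integral>x. norm (G x) \<partial>lborel))"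
      by (auto split: split_indicator intro: order_trans ennreal_leI)
  qed
  also have "\<dots> = ennreal (2 * m) * ennreal (r * (\<integral>x. norm (G x) \<partial>lborel))"
    by (subst nn_integral_multc) (auto simp: eB)
  finally have "ennreal (m * (\<integral>x. v x \<partial>lborel)) \<le> ennreal (2 * m * (r * (\<integral>x. norm (G x) \<partial>lborel)))"
    using m(2) r(1) pos wgradD(1)[OF v] by (simp add: nn_integral_eq_integral ennreal_mult)
  then have "m * (\<integral>x. v x \<partial>lborel) \<le> m * (2 * r * (\<integral>x. norm (G x) \<partial>lborel))"
    using m(2) r(1) by (simp add: mult_ac)
  then show ?thesis using m(2) by simp
qed

text \<open>Jensen's inequality on \<open>S\<close>: the tangent of the \<open>p\<close>-th power at
  \<open>t\<close> is integrated over \<open>S\<close>. Replacing the measure of \<open>S\<close> by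
  the larger \<open>m\<close> is allowed because the constant term \<open>(1 - p) * t powr p\<close>
  of the tangent is nonpositive.\<close>

lemma L1_le_Lp:
  fixes G :: "'m \<Rightarrow> 'e::euclidean_space"
  assumes p: "p > 1" and G: "integrable M G" "integrable M (\<lambda>x. norm (G x) powr p)"
    and S: "S \<in> sets M" "emeasure M S < \<infinity>" "measure M S \<le> m" "m > 0"
    and off: "AE x in M. x \<notin> S \<longrightarrow> G x = 0"
  shows "(\<integral>x. norm (G x) \<partial>M) powr p \<le> m powr (p - 1) * (\<integral>x. norm (G x) powr p \<partial>M)"
proof -
  define t where "t = (\<integral>x. norm (G x) \<partial>M) / m"
  have t: "t \<ge> 0" using S by (simp add: t_def)
  have iS: "integrable M (indicator S :: 'm \<Rightarrow> real)" using S by (intro integrable_real_indicator) auto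
  have ptt: "pflux p t * t = t powr p" using pflux_inner_self[of p t] t by simp
  have "(\<integral>x. (1 - p) * t powr p * indicator S x + p * pflux p t * norm (G x) \<partial>M) \<le> (\<integral>x. norm (G x) powr p \<partial>M)"
  proof (rule integral_mono_AE)
    show "AE x in M. (1 - p) * t powr p * indicator S x + p * pflux p t * norm (G x) \<le> norm (G x) powr p"
      using off
    proof eventually_elim
      case (elim x)
      have "t powr p + p * (pflux p t * (norm (G x) - t)) \<le> norm (G x) powr p"
        using pflux_subgradient[OF p, of t "norm (G x)"] t by simp
      then have "(1 - p) * t powr p + p * pflux p t * norm (G x) \<le> norm (G x) powr p"
        using ptt by (simp add: algebra_simps)
      then show ?case using elim by (auto split: split_indicator)
    qed
  qed (use G iS in auto)
  moreover have "(\<integral>x. (1 - p) * t powr p * indicator S x + p * pflux p t * norm (G x) \<partial>M)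
     = (1 - p) * t powr p * measure M S + p * pflux p t * (m * t)"
    using G iS S by (simp add: t_def)
  moreover have "(1 - p) * t powr p * m \<le> (1 - p) * t powr p * measure M S"
    using p S(3) by (intro mult_left_mono_neg mult_nonpos_nonneg) auto
  moreover have "p * pflux p t * (m * t) = p * t powr p * m" using ptt by (simp add: mult_ac)
  moreover have "m * t powr p = (1 - p) * t powr p * m + p * t powr p * m" by (simp add: algebra_simps)
  ultimately have "m * t powr p \<le> (\<integral>x. norm (G x) powr p \<partial>M)" by linarith
  then have "m powr (p - 1) * (m * t powr p) \<le> m powr (p - 1) * (\<integral>x. norm (G x) powr p \<partial>M)"
    by (intro mult_left_mono) auto
  moreover have "m powr (p - 1) * (m * t powr p) = (\<integral>x. norm (G x) \<partial>M) powr p"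
  proof -
    have "m powr (p - 1) * m = m powr p" using powr_add[of m "p - 1" 1] S(4) by simp
    then have "m powr (p - 1) * (m * t powr p) = m powr p * t powr p" by simp
    also have "\<dots> = (m * t) powr p" using S(4) t by (simp add: powr_mult)
    finally show ?thesis using S(4) by (simp add: t_def)
  qed
  ultimately show ?thesis by simp
qed

subsection \<open>The mixed energy\<close>

definition du :: "('a \<Rightarrow> real) \<Rightarrow> 'a \<times> 'a \<Rightarrow> real" where
  "du u z = u (fst z) - u (snd z)"

lemma AE_lborel_pair:
  assumes "AE x in (lborel :: 'a::euclidean_space measure). P x"
  shows "AE z in (lborel :: ('a \<times> 'a) measure). P (fst z) \<and> P (snd z)"
proof -
  obtain N where N: "N \<in> null_sets lborel" "{x. \<not> P x} \<subseteq> N" using assms by (auto simp: eventually_ae_filter)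
  have e: "emeasure lborel N = 0" "N \<in> sets lborel" using N by auto
  have "N \<times> UNIV \<in> null_sets (lborel \<Otimes>\<^sub>M lborel)" "UNIV \<times> N \<in> null_sets (lborel \<Otimes>\<^sub>M lborel)"
    using e by (auto simp: null_sets_def lborel.emeasure_pair_measure_Times)
  then have "N \<times> UNIV \<union> UNIV \<times> N \<in> null_sets (lborel :: ('a \<times> 'a) measure)"
    by (metis lborel_prod null_sets.Un)
  then show ?thesis by (rule AE_I') (use N(2) in auto)
qed

lemma Lp_bounded_support_integrable:
  fixes G :: "'a::euclidean_space \<Rightarrow> 'b::euclidean_space"
  assumes p: "p \<ge> 1" and G: "Lp_fun p lborel G" and S: "bounded S" "\<And>x. x \<notin> S \<Longrightarrow> G x = 0"
  shows "integrable lborel G"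
proof -
  obtain R where "\<forall>x\<in>S. norm x \<le> R" using S(1) unfolding bounded_iff by blast
  then have R: "S \<subseteq> cball 0 R" by auto
  have i: "integrable lborel (indicator (cball (0::'a) R) :: 'a \<Rightarrow> real)"
    using emeasure_lborel_cball_finite[of 0 R] by (intro integrable_real_indicator) auto
  show ?thesis
  proof (rule Bochner_Integration.integrable_bound[OF Bochner_Integration.integrable_add[OF i Lp_fun_integrable[OF G]] Lp_fun_measurable[OF G]], rule AE_I2)
    fix x
    show "norm (G x) \<le> norm (indicator (cball 0 R) x + norm (G x) powr p)"
    proof (cases "x \<in> S")
      case True
      have "norm (G x) \<le> 1 + norm (G x) powr p"
      proof (cases "norm (G x) \<le> 1")
        case False
        then have "norm (G x) powr 1 \<le> norm (G x) powr p" using p by (intro powr_mono) auto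
        then show ?thesis using False by simp
      qed (smt (verit) powr_ge_zero)
      then show ?thesis using True R by auto
    qed (use S(2) in simp)
  qed
qed

text \<open>The nonlocal parts of all orders \<open>s\<^sub>k < 1\<close> are collected in one kernel \<open>K\<close>, and \<open>aL\<close> is the
  coefficient of the local \<open>p\<close>-Laplacian.  The last assumption says that one of the two parts
  controls the \<open>L\<^sup>1\<close> norm.\<close>

locale mixed_energy =
  fixes \<Omega> :: "'a::euclidean_space set" and p :: real and K :: "'a \<Rightarrow> real" and aL :: real
  assumes p2: "p \<ge> 2" and open_\<Omega>: "open \<Omega>" and bounded_\<Omega>: "bounded \<Omega>" and nonempty_\<Omega>: "\<Omega> \<noteq> {}"
    and K_meas [measurable]: "K \<in> borel_measurable borel" and K_nonneg: "\<And>z. 0 \<le> K z"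
    and K_int: "integrable lborel (\<lambda>z. min 1 (norm z powr p) * K z)"
    and aL_nonneg: "aL \<ge> 0"
    and coercive: "aL > 0 \<or> (\<forall>R. \<exists>k>0. \<forall>z. 0 < norm z \<and> norm z \<le> R \<longrightarrow> k \<le> K z)"
begin

lemma p1: "p \<ge> 1" "p > 1" "p > 0" using p2 by auto

lemma \<Omega>_meas [measurable]: "\<Omega> \<in> sets borel" using open_\<Omega> by simp

text \<open>With the kernel absorbed into the measure, the nonlocal energy is the integral of a
  \<open>p\<close>-th power of \<open>du u\<close>, and the lemmas on \<open>Lp_fun\<close> apply to
  it in the same way as to gradients.\<close>

definition MK :: "('a \<times> 'a) measure" where
  "MK = density lborel (\<lambda>z. ennreal (K (fst z - snd z)))"

lemma sets_MK [simp, measurable_cong]: "sets MK = sets borel" by (simp add: MK_def)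
lemma space_MK [simp]: "space MK = UNIV" by (simp add: MK_def)

lemma Kz_meas [measurable]: "(\<lambda>z :: 'a \<times> 'a. K (fst z - snd z)) \<in> borel_measurable borel"
proof -
  have "(\<lambda>z :: 'a \<times> 'a. fst z - snd z) \<in> borel_measurable borel"
    by (intro borel_measurable_continuous_onI continuous_intros)
  from measurable_compose[OF this K_meas] show ?thesis .
qed

lemma du_meas [measurable]: "u \<in> borel_measurable borel \<Longrightarrow> du (u :: 'a \<Rightarrow> real) \<in> borel_measurable borel"
proof -
  assume u: "u \<in> borel_measurable borel"
  have "fst \<in> (borel :: ('a \<times> 'a) measure) \<rightarrow>\<^sub>M borel" "snd \<in> (borel :: ('a \<times> 'a) measure) \<rightarrow>\<^sub>M borel"
    by (auto intro!: borel_measurable_continuous_onI continuous_intros)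
  from measurable_compose[OF this(1) u] measurable_compose[OF this(2) u] show ?thesis
    unfolding du_def[abs_def] by (rule borel_measurable_diff)
qed

lemma AE_MK:
  assumes "AE x in lborel. P x" shows "AE z in MK. P (fst z) \<and> P (snd z)"
  unfolding MK_def using AE_lborel_pair[OF assms] by (subst AE_density) auto

lemma MK_nn_integral:
  assumes [measurable]: "f \<in> borel_measurable borel"
  shows "(\<integral>\<^sup>+z. f z \<partial>MK) = (\<integral>\<^sup>+z. ennreal (K (fst z - snd z)) * f z \<partial>lborel)"
  unfolding MK_def by (subst nn_integral_density) auto

text \<open>A representative of the gradient with exact support. The closure appears because testing
  on the open complement of \<open>closure \<Omega>\<close> shows that the gradient vanishes there,
  while the boundary of \<Omega> may have positive measure.\<close>

definition good_grad :: "('a \<Rightarrow> real) \<Rightarrow> ('a \<Rightarrow> 'a) \<Rightarrow> bool" where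
  "good_grad u G \<longleftrightarrow> wgrad u G \<and> Lp_fun p lborel G \<and> (\<forall>x. x \<notin> closure \<Omega> \<longrightarrow> G x = 0)"

text \<open>Borel functions that vanish everywhere off \<Omega> are used instead of classes, so that
  pointwise arguments apply; \<open>V_cong_AE\<close> and \<open>X_rep\<close> change the
  representative.\<close>

definition V :: "('a \<Rightarrow> real) set" where
  "V = {u. u \<in> borel_measurable borel \<and> (\<forall>x. x \<notin> \<Omega> \<longrightarrow> u x = 0) \<and> integrable lborel u \<and>
     Lp_fun p MK (du u) \<and> (aL > 0 \<longrightarrow> (\<exists>G. good_grad u G))}"

text \<open>The value 0 without a local part makes \<open>N2\<close> and \<open>A2\<close> vanish,
  so that both cases share most proofs.\<close>

definition gr :: "('a \<Rightarrow> real) \<Rightarrow> 'a \<Rightarrow> 'a" where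
  "gr u = (if aL > 0 then SOME G. good_grad u G else (\<lambda>_. 0))"

definition N1 :: "('a \<Rightarrow> real) \<Rightarrow> real" where "N1 u = (\<integral>z. norm (du u z) powr p \<partial>MK)"
definition N2 :: "('a \<Rightarrow> real) \<Rightarrow> real" where "N2 u = (\<integral>x. norm (gr u x) powr p \<partial>lborel)"
definition A1 :: "('a \<Rightarrow> real) \<Rightarrow> ('a \<Rightarrow> real) \<Rightarrow> real" where
  "A1 u v = (\<integral>z. pflux p (du u z) \<bullet> du v z \<partial>MK)"
definition A2 :: "('a \<Rightarrow> real) \<Rightarrow> ('a \<Rightarrow> real) \<Rightarrow> real" where
  "A2 u v = (\<integral>x. pflux p (gr u x) \<bullet> gr v x \<partial>lborel)"
definition NN :: "('a \<Rightarrow> real) \<Rightarrow> real" where "NN u = N1 u + aL * N2 u"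
definition AA :: "('a \<Rightarrow> real) \<Rightarrow> ('a \<Rightarrow> real) \<Rightarrow> real" where "AA u v = A1 u v + aL * A2 u v"

lemma V_D:
  assumes "u \<in> V"
  shows V_meas: "u \<in> borel_measurable borel" and V_off: "\<And>x. x \<notin> \<Omega> \<Longrightarrow> u x = 0"
    and V_integrable: "integrable lborel u" and V_du: "Lp_fun p MK (du u)"
  using assms by (auto simp: V_def)

lemma gr_good: "u \<in> V \<Longrightarrow> aL > 0 \<Longrightarrow> good_grad u (gr u)"
  unfolding gr_def V_def by simp (metis someI_ex)

lemma gr_Lp: "u \<in> V \<Longrightarrow> Lp_fun p lborel (gr u)"
  using gr_good[of u] by (cases "aL > 0") (auto simp: good_grad_def gr_def)

lemma gr_wgrad: "u \<in> V \<Longrightarrow> aL > 0 \<Longrightarrow> wgrad u (gr u)"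
  using gr_good[of u] by (simp add: good_grad_def)

lemma gr_off: "u \<in> V \<Longrightarrow> x \<notin> closure \<Omega> \<Longrightarrow> gr u x = 0"
  using gr_good[of u] by (cases "aL > 0") (auto simp: good_grad_def gr_def)

lemma gr_meas: "u \<in> V \<Longrightarrow> gr u \<in> borel_measurable borel"
  using Lp_fun_measurable[OF gr_Lp] by simp

lemma gr_AE:
  assumes "u \<in> V" "aL > 0" "wgrad u G" shows "AE x in lborel. gr u x = G x"
  using wgrad_unique[OF gr_wgrad[OF assms(1,2)] assms(3)] by simp

lemma V_lin: assumes u: "u \<in> V" and v: "v \<in> V" shows "(\<lambda>x. u x + c * v x) \<in> V"
proof -
  note [measurable] = V_meas[OF u] V_meas[OF v]
  have du: "du (\<lambda>x. u x + c * v x) = (\<lambda>z. du u z + c *\<^sub>R du v z)" by (auto simp: du_def algebra_simps)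
  have "good_grad (\<lambda>x. u x + c * v x) (\<lambda>x. gr u x + c *\<^sub>R gr v x)" if aL: "aL > 0"
    unfolding good_grad_def
    using wgrad_lin[OF gr_wgrad[OF u aL] gr_wgrad[OF v aL]] Lp_fun_add[OF p1(1) gr_Lp[OF u] Lp_fun_scaleR[OF gr_Lp[OF v]]]
      gr_off[OF u] gr_off[OF v] by auto
  moreover have "Lp_fun p MK (du (\<lambda>x. u x + c * v x))"
    unfolding du by (intro Lp_fun_add[OF p1(1)] Lp_fun_scaleR V_du u v)
  ultimately show ?thesis
    unfolding V_def using V_D[OF u] V_D[OF v] by auto
qed

lemma gr_lin: assumes u: "u \<in> V" and v: "v \<in> V"
  shows "AE x in lborel. gr (\<lambda>x. u x + c * v x) x = gr u x + c *\<^sub>R gr v x"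
proof (cases "aL > 0")
  case True
  show ?thesis by (rule gr_AE[OF V_lin[OF u v] True wgrad_lin[OF gr_wgrad[OF u True] gr_wgrad[OF v True]]])
qed (simp add: gr_def)

lemma V_zero: "(\<lambda>_. 0) \<in> V"
proof -
  have "wgrad (\<lambda>x::'a. 0) (\<lambda>_. 0)" by (rule wgradI) auto
  then have "good_grad (\<lambda>_. 0) (\<lambda>_. 0)" by (simp add: good_grad_def)
  moreover have "du (\<lambda>_::'a. 0) = (\<lambda>_. 0)" by (auto simp: du_def)
  ultimately show ?thesis by (auto simp: V_def)
qed

lemma V_diff: "u \<in> V \<Longrightarrow> v \<in> V \<Longrightarrow> (\<lambda>x. u x - v x) \<in> V"
  using V_lin[of u v "-1"] by simp

lemma gr_diff: assumes u: "u \<in> V" and v: "v \<in> V"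
  shows "AE x in lborel. gr (\<lambda>x. u x - v x) x = gr u x - gr v x"
  using gr_lin[OF u v, of "-1"] by simp

lemma N2_diff: assumes u: "u \<in> V" and v: "v \<in> V"
  shows "N2 (\<lambda>x. u x - v x) = (\<integral>x. norm (gr u x - gr v x) powr p \<partial>lborel)"
proof -
  note [measurable] = gr_meas[OF u] gr_meas[OF v] gr_meas[OF V_diff[OF u v]]
  show ?thesis unfolding N2_def using gr_diff[OF u v] by (intro integral_cong_AE) auto
qed

lemma du_diff: "du (\<lambda>x. u x - v x) z = du u z - du v z" by (simp add: du_def)

lemma N1_diff: "N1 (\<lambda>x. u x - v x) = (\<integral>z. norm (du u z - du v z) powr p \<partial>MK)"
  unfolding N1_def du_diff ..

lemma integral_pflux_cong_AE:
  fixes f g f' g' :: "'m \<Rightarrow> 'b::euclidean_space"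
  assumes "f \<in> borel_measurable M" "g \<in> borel_measurable M" "f' \<in> borel_measurable M" "g' \<in> borel_measurable M"
    and "AE x in M. f x = f' x" "AE x in M. g x = g' x"
  shows "(\<integral>x. pflux p (f x) \<bullet> g x \<partial>M) = (\<integral>x. pflux p (f' x) \<bullet> g' x \<partial>M)"
proof -
  note [measurable] = assms(1-4) borel_measurable_pflux[OF p2]
  show ?thesis using assms(5,6) by (intro integral_cong_AE) auto
qed

lemma A2_lin: assumes u: "u \<in> V" and v: "v \<in> V" and w: "w \<in> V"
  shows "A2 u (\<lambda>x. v x + c * w x) = A2 u v + c * A2 u w"
proof -
  note m = gr_meas[OF u] gr_meas[OF v] gr_meas[OF w] gr_meas[OF V_lin[OF v w]]
  have "A2 u (\<lambda>x. v x + c * w x) = (\<integral>x. pflux p (gr u x) \<bullet> (gr v x + c *\<^sub>R gr w x) \<partial>lborel)"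
    unfolding A2_def using m gr_lin[OF v w, of c] by (intro integral_pflux_cong_AE) auto
  also have "\<dots> = A2 u v + c * A2 u w"
    unfolding A2_def inner_add_right inner_scaleR_right
    using integrable_pflux_inner[OF p2 gr_Lp[OF u] gr_Lp[OF v]] integrable_pflux_inner[OF p2 gr_Lp[OF u] gr_Lp[OF w]] by simp
  finally show ?thesis .
qed

lemma A1_lin: assumes u: "u \<in> V" and v: "v \<in> V" and w: "w \<in> V"
  shows "A1 u (\<lambda>x. v x + c * w x) = A1 u v + c * A1 u w"
proof -
  have "A1 u (\<lambda>x. v x + c * w x) = (\<integral>z. pflux p (du u z) \<bullet> du v z + c * (pflux p (du u z) \<bullet> du w z) \<partial>MK)"
    unfolding A1_def by (intro Bochner_Integration.integral_cong) (auto simp: du_def algebra_simps)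
  also have "\<dots> = A1 u v + c * A1 u w"
    unfolding A1_def
    using integrable_pflux_inner[OF p2 V_du[OF u] V_du[OF v]] integrable_pflux_inner[OF p2 V_du[OF u] V_du[OF w]] by simp
  finally show ?thesis .
qed

text \<open>Functions in \<open>V\<close> vanish on \<open>Q\<close>, so the interaction of a point
  of \<Omega> with \<open>Q\<close> sees only the value at that point. Points of \<open>Q\<close>
  have norm between \<open>R\<close> and \<open>R + 2\<close>, hence distance at most
  \<open>2 * R + 2\<close> from \<Omega>, where coercivity supplies \<open>k\<close>.\<close>

lemma V_bump_region:
  obtains k Q where "k > 0" "Q \<in> sets borel" "emeasure lborel Q < \<infinity>" "measure lborel Q > 0" "Q \<inter> \<Omega> = {}"
    "aL = 0 \<Longrightarrow> (\<And>x y. x \<in> \<Omega> \<Longrightarrow> y \<in> Q \<Longrightarrow> k \<le> K (x - y))"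
proof -
  obtain R where R: "R > 0" "\<Omega> \<subseteq> ball 0 R" using bounded_\<Omega> bounded_subset_ballD by blast
  obtain b :: 'a where b: "b \<in> Basis" using nonempty_Basis by blast
  define Q where "Q = ball ((R + 1) *\<^sub>R b) 1"
  have Qn: "norm y > R" "norm y < R + 2" if "y \<in> Q" for y
  proof -
    have d: "norm ((R + 1) *\<^sub>R b - y) < 1" using that by (simp add: Q_def dist_norm)
    have n: "norm ((R + 1) *\<^sub>R b) = R + 1" using b R by simp
    show "norm y > R" using norm_triangle_ineq2[of "(R + 1) *\<^sub>R b" y] d n by linarith
    show "norm y < R + 2" using norm_triangle_ineq2[of y "(R + 1) *\<^sub>R b"] d n by (simp add: norm_minus_commute)
  qed
  have disj: "Q \<inter> \<Omega> = {}" using R(2) Qn(1) by fastforce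
  have "\<exists>k>0. aL = 0 \<longrightarrow> (\<forall>z. 0 < norm z \<and> norm z \<le> 2 * R + 2 \<longrightarrow> k \<le> K z)"
    using coercive by (metis less_irrefl zero_less_one)
  then obtain k where k: "k > 0" "aL = 0 \<longrightarrow> (\<forall>z. 0 < norm z \<and> norm z \<le> 2 * R + 2 \<longrightarrow> k \<le> K z)"
    by blast
  show thesis
  proof (rule that[of k Q])
    show "k > 0" by fact
    show "Q \<in> sets borel" "emeasure lborel Q < \<infinity>" "Q \<inter> \<Omega> = {}"
      using disj emeasure_lborel_ball_finite by (auto simp: Q_def)
    show "measure lborel Q > 0" by (simp add: Q_def content_ball_pos)
    show "k \<le> K (x - y)" if "aL = 0" "x \<in> \<Omega>" "y \<in> Q" for x y
    proof (rule k(2)[rule_format, OF that(1)], rule conjI)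
      show "0 < norm (x - y)" using disj that by auto
      have "norm x < R" using R(2) that(2) by auto
      then show "norm (x - y) \<le> 2 * R + 2" using Qn(2)[OF that(3)] norm_triangle_ineq4[of x y] by linarith
    qed
  qed
qed

text \<open>The double integral is restricted to pairs from \<Omega> and \<open>Q\<close>, where the
  kernel is at least \<open>k\<close>. With the \<open>p\<close>-th power of \<open>du u\<close>
  this gives the Poincare inequality, with the flux paired with a truncation the upper bound for
  \<open>e\<close>. The alternative \<open>measure lborel Q = 0\<close> is the case in which the
  estimate says nothing about \<open>f\<close>.\<close>

lemma nonlocal_lower:
  assumes F: "integrable MK F" "\<And>z. 0 \<le> F z"
    and kQ: "k > 0" "Q \<in> sets borel" "emeasure lborel Q < \<infinity>" "\<And>x y. x \<in> \<Omega> \<Longrightarrow> y \<in> Q \<Longrightarrow> k \<le> K (x - y)"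
    and f [measurable]: "f \<in> borel_measurable borel" and "\<And>x. 0 \<le> f x" "\<And>x. x \<notin> \<Omega> \<Longrightarrow> f x = 0"
    and le: "\<And>x y. x \<in> \<Omega> \<Longrightarrow> y \<in> Q \<Longrightarrow> f x \<le> F (x, y)"
  shows "integrable lborel f \<or> measure lborel Q = 0" "k * measure lborel Q * (\<integral>x. f x \<partial>lborel) \<le> (\<integral>z. F z \<partial>MK)"
proof -
  have [measurable]: "F \<in> borel_measurable borel" using borel_measurable_integrable[OF F(1)] by (simp cong: measurable_cong_sets)
  note [measurable] = kQ(2)
  have eQ: "emeasure lborel Q = ennreal (measure lborel Q)" using kQ(3) by (simp add: emeasure_eq_ennreal_measure)
  have "(\<integral>\<^sup>+x. ennreal (k * measure lborel Q) * ennreal (f x) \<partial>lborel)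
      = (\<integral>\<^sup>+x. (\<integral>\<^sup>+y. ennreal (k * f x) * indicator Q y \<partial>lborel) \<partial>lborel)"
    using kQ assms(8) by (intro nn_integral_cong) (subst nn_integral_cmult_indicator, auto simp: eQ ennreal_mult mult_ac)
  also have "\<dots> \<le> (\<integral>\<^sup>+x. (\<integral>\<^sup>+y. ennreal (K (x - y)) * ennreal (F (x, y)) \<partial>lborel) \<partial>lborel)"
  proof (intro nn_integral_mono)
    fix x y
    show "ennreal (k * f x) * indicator Q y \<le> ennreal (K (x - y)) * ennreal (F (x, y))"
    proof (cases "x \<in> \<Omega> \<and> y \<in> Q")
      case True
      then have "k * f x \<le> K (x - y) * F (x, y)" using kQ(1) kQ(4)[of x y] le[of x y] assms(8)[of x] by (intro mult_mono) auto
      then show ?thesis using True K_nonneg[of "x - y"] F(2)[of "(x,y)"] by (simp add: ennreal_leI flip: ennreal_mult)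
    qed (use assms(9) in auto)
  qed
  also have "\<dots> = (\<integral>\<^sup>+z. ennreal (K (fst z - snd z)) * ennreal (F z) \<partial>(lborel \<Otimes>\<^sub>M lborel))"
  proof -
    have "(\<lambda>z. ennreal (K (fst z - snd z)) * ennreal (F z)) \<in> borel_measurable (lborel \<Otimes>\<^sub>M (lborel :: 'a measure))"
      unfolding lborel_prod by measurable
    from lborel.nn_integral_fst[OF this] show ?thesis by simp
  qed
  also have "\<dots> = (\<integral>\<^sup>+z. ennreal (F z) \<partial>MK)" unfolding lborel_prod by (rule MK_nn_integral [symmetric]) measurable
  also have "\<dots> = ennreal (\<integral>z. F z \<partial>MK)" using F by (intro nn_integral_eq_integral) auto
  finally have main: "ennreal (k * measure lborel Q) * (\<integral>\<^sup>+x. ennreal (f x) \<partial>lborel) \<le> ennreal (\<integral>z. F z \<partial>MK)"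
    by (subst (asm) nn_integral_cmult) auto
  show i: "integrable lborel f \<or> measure lborel Q = 0"
  proof (cases "measure lborel Q = 0")
    case False
    have "(\<integral>\<^sup>+x. ennreal (f x) \<partial>lborel) \<noteq> \<infinity>"
      using main kQ(1) False by (auto simp: ennreal_mult_top top_unique)
    then have "integrable lborel f" using assms(8) by (intro integrableI_nonneg) (auto simp: less_top)
    then show ?thesis by blast
  qed simp
  show "k * measure lborel Q * (\<integral>x. f x \<partial>lborel) \<le> (\<integral>z. F z \<partial>MK)"
  proof (cases "measure lborel Q = 0")
    case False
    then have "(\<integral>\<^sup>+x. ennreal (f x) \<partial>lborel) = ennreal (\<integral>x. f x \<partial>lborel)"
      using i assms(8) by (intro nn_integral_eq_integral) auto
    then have "ennreal (k * measure lborel Q * (\<integral>x. f x \<partial>lborel)) \<le> ennreal (\<integral>z. F z \<partial>MK)"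
      using main kQ(1) assms(8) by (simp add: ennreal_mult integral_nonneg_AE)
    then show ?thesis using F(2) by (subst (asm) ennreal_le_iff) (auto intro: integral_nonneg_AE)
  qed (use F(2) in \<open>simp add: integral_nonneg_AE\<close>)
qed

lemma finite_\<Omega>: "emeasure lborel \<Omega> < \<infinity>" "emeasure lborel (closure \<Omega>) < \<infinity>"
  by (rule emeasure_bounded_finite[OF bounded_\<Omega>] emeasure_bounded_finite[OF bounded_closure[OF bounded_\<Omega>]])+

text \<open>Between \<Omega> and \<open>Q\<close> the difference \<open>du u (x, y)\<close> is
  \<open>u x\<close>; this bounds the \<open>p\<close>-th power of \<open>u\<close>, and Jensen's
  inequality its \<open>L1\<close> norm. Integrability is part of the conclusion because it is not
  known beforehand for members of \<open>X_space\<close>.\<close>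

lemma poincare_nonlocal:
  assumes aL: "aL = 0"
  shows "\<exists>C>0. \<forall>u. u \<in> borel_measurable borel \<longrightarrow> (\<forall>x. x \<notin> \<Omega> \<longrightarrow> u x = 0) \<longrightarrow> Lp_fun p MK (du u) \<longrightarrow>
    integrable lborel u \<and> (\<integral>x. \<bar>u x\<bar> \<partial>lborel) powr p \<le> C * N1 u"
proof -
  obtain k Q where k: "k > 0" "Q \<in> sets borel" "emeasure lborel Q < \<infinity>" "measure lborel Q > 0" "Q \<inter> \<Omega> = {}"
    "\<And>x y. x \<in> \<Omega> \<Longrightarrow> y \<in> Q \<Longrightarrow> k \<le> K (x - y)" using V_bump_region aL by metis
  define m where "m = measure lborel \<Omega> + 1"
  have m: "m > 0" "measure lborel \<Omega> \<le> m" by (simp_all add: m_def add_nonneg_pos)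
  show ?thesis
  proof (intro exI[of _ "m powr (p - 1) / (k * measure lborel Q)"] conjI allI impI)
    show "m powr (p - 1) / (k * measure lborel Q) > 0" using m k by simp
    fix u :: "'a \<Rightarrow> real" assume u: "u \<in> borel_measurable borel" "\<forall>x. x \<notin> \<Omega> \<longrightarrow> u x = 0" and du: "Lp_fun p MK (du u)"
    have le: "\<bar>u x\<bar> powr p \<le> norm (du u (x, y)) powr p" if "x \<in> \<Omega>" "y \<in> Q" for x y
      using u(2) k(5) that by (auto simp: du_def)
    have F: "integrable lborel (\<lambda>x. \<bar>u x\<bar> powr p) \<or> measure lborel Q = 0"
      "k * measure lborel Q * (\<integral>x. \<bar>u x\<bar> powr p \<partial>lborel) \<le> N1 u"
      using nonlocal_lower[OF Lp_fun_integrable[OF du] _ k(1-3) k(6), of "\<lambda>x. \<bar>u x\<bar> powr p"] le u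
      unfolding N1_def by auto
    have Lp: "Lp_fun p lborel u" using F(1) k(4) u(1) by (auto simp: Lp_fun_def)
    show iu: "integrable lborel u"
      by (rule Lp_bounded_support_integrable[OF p1(1) Lp bounded_\<Omega>]) (use u(2) in auto)
    have "(\<integral>x. norm (u x) \<partial>lborel) powr p \<le> m powr (p - 1) * (\<integral>x. norm (u x) powr p \<partial>lborel)"
      using u(2) m finite_\<Omega> by (intro L1_le_Lp[where S=\<Omega>] p1 iu Lp_fun_integrable[OF Lp]) auto
    also have "\<dots> \<le> m powr (p - 1) * (N1 u / (k * measure lborel Q))"
      using F(2) k(1,4) by (intro mult_left_mono) (auto simp: field_simps)
    finally show "(\<integral>x. \<bar>u x\<bar> \<partial>lborel) powr p \<le> m powr (p - 1) / (k * measure lborel Q) * N1 u" by simp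
  qed
qed

lemma N1_nonneg: "N1 u \<ge> 0" and N2_nonneg: "N2 u \<ge> 0"
  by (simp_all add: N1_def N2_def)

lemma NN_nonneg: "NN u \<ge> 0"
  using N1_nonneg N2_nonneg aL_nonneg by (simp add: NN_def)

lemma gr_L1: assumes "aL > 0"
  shows "\<exists>m>0. \<forall>G :: 'a \<Rightarrow> 'a. Lp_fun p lborel G \<longrightarrow> (\<forall>x. x \<notin> closure \<Omega> \<longrightarrow> G x = 0) \<longrightarrow>
    integrable lborel G \<and> (\<integral>x. norm (G x) \<partial>lborel) powr p \<le> m * (\<integral>x. norm (G x) powr p \<partial>lborel)"
proof -
  define m where "m = measure lborel (closure \<Omega>) + 1"
  have m: "m > 0" "measure lborel (closure \<Omega>) \<le> m" by (simp_all add: m_def add_nonneg_pos)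
  show ?thesis
  proof (intro exI[of _ "m powr (p - 1)"] conjI allI impI)
    fix G :: "'a \<Rightarrow> 'a" assume G: "Lp_fun p lborel G" "\<forall>x. x \<notin> closure \<Omega> \<longrightarrow> G x = 0"
    show i: "integrable lborel G"
      by (rule Lp_bounded_support_integrable[OF p1(1) G(1) bounded_closure[OF bounded_\<Omega>]]) (use G in auto)
    show "(\<integral>x. norm (G x) \<partial>lborel) powr p \<le> m powr (p - 1) * (\<integral>x. norm (G x) powr p \<partial>lborel)"
      using G m finite_\<Omega> by (intro L1_le_Lp[where S="closure \<Omega>"] p1 i Lp_fun_integrable[OF G(1)]) auto
  qed (use m in simp)
qed

lemma poincare_ex: "\<exists>C>0. \<forall>u\<in>V. (\<integral>x. \<bar>u x\<bar> \<partial>lborel) powr p \<le> C * NN u"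
proof (cases "aL > 0")
  case False
  then have aL: "aL = 0" using aL_nonneg by simp
  then have "NN u = N1 u" for u unfolding NN_def by simp
  with poincare_nonlocal[OF aL] show ?thesis unfolding V_def by auto
next
  case True
  obtain m where m: "m > 0" "\<And>G :: 'a \<Rightarrow> 'a. Lp_fun p lborel G \<Longrightarrow> (\<forall>x. x \<notin> closure \<Omega> \<longrightarrow> G x = 0) \<Longrightarrow>
    (\<integral>x. norm (G x) \<partial>lborel) powr p \<le> m * (\<integral>x. norm (G x) powr p \<partial>lborel)" using gr_L1[OF True] by blast
  obtain R where R: "R > 0" "\<Omega> \<subseteq> ball 0 R" using bounded_\<Omega> bounded_subset_ballD by blast
  show ?thesis
  proof (intro exI[of _ "R powr p * m / aL"] conjI ballI)
    fix u assume u: "u \<in> V"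
    have "(\<integral>x. \<bar>u x\<bar> \<partial>lborel) \<le> R * (\<integral>x. norm (gr u x) \<partial>lborel)"
      by (rule wgrad_poincare[OF gr_wgrad[OF u True] _ R(1)]) (use V_off[OF u] R(2) in force)
    then have "(\<integral>x. \<bar>u x\<bar> \<partial>lborel) powr p \<le> (R * (\<integral>x. norm (gr u x) \<partial>lborel)) powr p"
      using p1 by (intro powr_mono2) auto
    also have "\<dots> = R powr p * (\<integral>x. norm (gr u x) \<partial>lborel) powr p" using R by (simp add: powr_mult)
    also have "\<dots> \<le> R powr p * (m * N2 u)"
      unfolding N2_def using gr_off[OF u] by (intro mult_left_mono m(2) gr_Lp u) auto
    also have "\<dots> \<le> R powr p * m / aL * NN u"
      using True m(1) N1_nonneg[of u] by (simp add: NN_def distrib_left)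
    finally show "(\<integral>x. \<bar>u x\<bar> \<partial>lborel) powr p \<le> R powr p * m / aL * NN u" .
  qed (use True m R in simp)
qed

section \<open>Completeness, uniform convexity and continuity of the mixed energy\<close>

definition CP :: real where
  "CP = (SOME C. C > 0 \<and> (\<forall>u\<in>V. (\<integral>x. \<bar>u x\<bar> \<partial>lborel) powr p \<le> C * NN u))"

lemma CP: "CP > 0" "u \<in> V \<Longrightarrow> (\<integral>x. \<bar>u x\<bar> \<partial>lborel) powr p \<le> CP * NN u"
  using someI_ex[OF poincare_ex] unfolding CP_def by auto

lemma NN_diff: assumes "u \<in> V" "v \<in> V"
  shows "NN (\<lambda>x. u x - v x) = (\<integral>z. norm (du u z - du v z) powr p \<partial>MK) + aL * (\<integral>x. norm (gr u x - gr v x) powr p \<partial>lborel)"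
  unfolding NN_def N1_diff N2_diff[OF assms] ..

text \<open>Poincare's inequality makes the sequence Cauchy in \<open>L1\<close>; functions,
  differences and gradients then converge separately. Almost everywhere convergent subsequences
  identify the limit of the differences with \<open>du u\<close>, and closedness of weak gradients
  under \<open>L1\<close> limits identifies the limit of the gradients.\<close>

lemma V_complete:
  assumes us: "\<And>n. us n \<in> V"
    and cau: "\<And>e. e > 0 \<Longrightarrow> \<exists>M. \<forall>m\<ge>M. \<forall>n\<ge>M. NN (\<lambda>x. us m x - us n x) \<le> e"
  shows "\<exists>u\<in>V. (\<lambda>n. NN (\<lambda>x. us n x - u x)) \<longlonglongrightarrow> 0"
proof -
  have L1: "Lp_fun 1 lborel (us n)" for n
    using V_integrable[OF us[of n]] borel_measurable_integrable[OF V_integrable[OF us[of n]]] by (simp add: Lp_fun_def)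
  have "\<exists>M. \<forall>m\<ge>M. \<forall>n\<ge>M. (\<integral>x. norm (us m x - us n x) powr 1 \<partial>lborel) \<le> e" if e: "e > 0" for e
  proof -
    have "e powr p / CP > 0" using e CP(1) by simp
    then obtain M where M: "\<And>m n. m \<ge> M \<Longrightarrow> n \<ge> M \<Longrightarrow> NN (\<lambda>x. us m x - us n x) \<le> e powr p / CP" using cau by meson
    have "(\<integral>x. norm (us m x - us n x) powr 1 \<partial>lborel) \<le> e" if "m \<ge> M" "n \<ge> M" for m n
    proof -
      have "(\<integral>x. \<bar>us m x - us n x\<bar> \<partial>lborel) powr p \<le> e powr p"
        using CP(2)[OF V_diff[OF us us], of m n] M[OF that] CP(1) by (simp add: field_simps)
      then show ?thesis
        using e p1(3) powr_less_mono2[of p e "\<integral>x. \<bar>us m x - us n x\<bar> \<partial>lborel"] by (simp add: not_less[symmetric]) blast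
    qed
    then show ?thesis by blast
  qed
  from Lp_complete[OF _ L1 this] obtain f where f: "Lp_fun 1 lborel f" "(\<lambda>n. \<integral>x. norm (us n x - f x) powr 1 \<partial>lborel) \<longlonglongrightarrow> 0"
    by auto
  \<comment> \<open>Cutting off outside \<Omega> does not increase the distance to
    \<open>us n\<close>, and it gives the exact support that \<open>V\<close> demands. The gradients
    are treated in the same way with \<open>closure \<Omega>\<close>.\<close>
  define u where "u x = indicator \<Omega> x * f x" for x
  have fm [measurable]: "f \<in> borel_measurable borel" using Lp_fun_measurable[OF f(1)] by simp
  note [measurable] = V_meas[OF us]
  have um [measurable]: "u \<in> borel_measurable borel" unfolding u_def by measurable
  have if': "integrable lborel f" using f(1) by (auto simp: Lp_fun_def intro: integrable_abs_cancel)
  have iu: "integrable lborel u"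
    by (rule Bochner_Integration.integrable_bound[OF if']) (auto simp: u_def split: split_indicator)
  have u1: "(\<lambda>n. \<integral>x. \<bar>us n x - u x\<bar> \<partial>lborel) \<longlonglongrightarrow> 0"
  proof (rule tendsto_sandwich[OF _ _ tendsto_const f(2)])
    show "\<forall>\<^sub>F n in sequentially. (\<integral>x. \<bar>us n x - u x\<bar> \<partial>lborel) \<le> (\<integral>x. norm (us n x - f x) powr 1 \<partial>lborel)"
    proof (intro always_eventually allI integral_mono)
      fix n x
      show "\<bar>us n x - u x\<bar> \<le> norm (us n x - f x) powr 1"
        using V_off[OF us, of x n] by (auto simp: u_def split: split_indicator)
    qed (use V_integrable[OF us] iu if' in auto)
  qed simp
  have Lu: "Lp_fun 1 lborel u" using iu by (simp add: Lp_fun_def)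
  have p1': "\<exists>M. \<forall>m\<ge>M. \<forall>n\<ge>M. (\<integral>z. norm (du (us m) z - du (us n) z) powr p \<partial>MK) \<le> e" if e: "e > 0" for e
  proof -
    obtain M where M: "\<And>m n. m \<ge> M \<Longrightarrow> n \<ge> M \<Longrightarrow> NN (\<lambda>x. us m x - us n x) \<le> e" using cau[OF e] by meson
    have "(\<integral>z. norm (du (us m) z - du (us n) z) powr p \<partial>MK) \<le> e" if "m \<ge> M" "n \<ge> M" for m n
    proof -
      have "0 \<le> aL * (\<integral>x. norm (gr (us m) x - gr (us n) x) powr p \<partial>lborel)" using aL_nonneg by simp
      then show ?thesis using M[OF that] unfolding NN_diff[OF us us] by linarith
    qed
    then show ?thesis by blast
  qed
  from Lp_complete[OF p1(1) V_du[OF us] this] obtain g where g: "Lp_fun p MK g"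
    "(\<lambda>n. \<integral>z. norm (du (us n) z - g z) powr p \<partial>MK) \<longlonglongrightarrow> 0" by auto
  obtain r :: "nat \<Rightarrow> nat" where r: "strict_mono r" "AE z in MK. (\<lambda>n. du (us (r n)) z) \<longlonglongrightarrow> g z"
    using Lp_AE_subseq[OF p1(1) V_du[OF us] g] by blast
  have u1r: "(\<lambda>n. \<integral>x. norm (us (r n) x - u x) powr 1 \<partial>lborel) \<longlonglongrightarrow> 0"
    using LIMSEQ_subseq_LIMSEQ[OF u1 r(1)] by (simp add: o_def)
  obtain r' :: "nat \<Rightarrow> nat" where r': "strict_mono r'" "AE x in lborel. (\<lambda>n. us (r (r' n)) x) \<longlonglongrightarrow> u x"
    using Lp_AE_subseq[OF _ L1 Lu u1r] by auto
  have gdu: "AE z in MK. g z = du u z"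
    using r(2) AE_MK[OF r'(2)]
  proof eventually_elim
    case (elim z)
    have "(\<lambda>n. du (us (r (r' n))) z) \<longlonglongrightarrow> du u z" unfolding du_def using elim(2) by (intro tendsto_diff) auto
    moreover have "(\<lambda>n. du (us (r (r' n))) z) \<longlonglongrightarrow> g z" using LIMSEQ_subseq_LIMSEQ[OF elim(1) r'(1)] by (simp add: o_def)
    ultimately show ?case by (rule LIMSEQ_unique[rotated])
  qed
  have dum: "du u \<in> borel_measurable MK" using du_meas[OF um] by (simp cong: measurable_cong_sets)
  have Ldu: "Lp_fun p MK (du u)"
    by (rule Lp_fun_cong_AE[OF g(1) dum]) (use gdu in auto)
  have lim1: "(\<lambda>n. \<integral>z. norm (du (us n) z - du u z) powr p \<partial>MK) \<longlonglongrightarrow> 0"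
  proof -
    have "(\<integral>z. norm (du (us n) z - du u z) powr p \<partial>MK) = (\<integral>z. norm (du (us n) z - g z) powr p \<partial>MK)" for n
    proof -
      note [measurable] = dum Lp_fun_measurable[OF g(1)] Lp_fun_measurable[OF V_du[OF us]]
      show ?thesis using gdu by (intro integral_cong_AE) auto
    qed
    then show ?thesis using g(2) by simp
  qed
  have uoff: "\<forall>x. x \<notin> \<Omega> \<longrightarrow> u x = 0" by (simp add: u_def)
  show ?thesis
  proof (cases "aL > 0")
    case False
    then have aL: "aL = 0" using aL_nonneg by simp
    have uV: "u \<in> V" unfolding V_def using um uoff iu Ldu aL by simp
    have "(\<lambda>n. NN (\<lambda>x. us n x - u x)) \<longlonglongrightarrow> 0" unfolding NN_diff[OF us uV] using lim1 aL by simp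
    then show ?thesis using uV by blast
  next
    case True
    have "\<exists>M. \<forall>m\<ge>M. \<forall>n\<ge>M. (\<integral>x. norm (gr (us m) x - gr (us n) x) powr p \<partial>lborel) \<le> e" if "e > 0" for e
    proof -
      have "aL * e > 0" using True that by simp
      then obtain M where M: "\<And>m n. m \<ge> M \<Longrightarrow> n \<ge> M \<Longrightarrow> NN (\<lambda>x. us m x - us n x) \<le> aL * e" using cau by meson
      have "(\<integral>x. norm (gr (us m) x - gr (us n) x) powr p \<partial>lborel) \<le> e" if "m \<ge> M" "n \<ge> M" for m n
      proof -
        have "0 \<le> (\<integral>z. norm (du (us m) z - du (us n) z) powr p \<partial>MK)" by simp
        then have "aL * (\<integral>x. norm (gr (us m) x - gr (us n) x) powr p \<partial>lborel) \<le> aL * e"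
          using M[OF that] unfolding NN_diff[OF us us] by linarith
        then show ?thesis using True by simp
      qed
      then show ?thesis by blast
    qed
    from Lp_complete[OF p1(1) gr_Lp[OF us] this] obtain G0 where G0: "Lp_fun p lborel G0"
      "(\<lambda>n. \<integral>x. norm (gr (us n) x - G0 x) powr p \<partial>lborel) \<longlonglongrightarrow> 0" by auto
    define G where "G x = indicator (closure \<Omega>) x *\<^sub>R G0 x" for x
    have [measurable]: "G0 \<in> borel_measurable borel" using Lp_fun_measurable[OF G0(1)] by simp
    have Gm [measurable]: "G \<in> borel_measurable borel" unfolding G_def by measurable
    have GL: "Lp_fun p lborel G"
      by (rule Lp_fun_bound[OF Lp_fun_integrable[OF G0(1)]]) (auto simp: G_def split: split_indicator)
    have Goff: "\<forall>x. x \<notin> closure \<Omega> \<longrightarrow> G x = 0" by (simp add: G_def)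
    note dL = Lp_fun_diff[OF p1(1) gr_Lp[OF us] GL]
    have limG: "(\<lambda>n. \<integral>x. norm (gr (us n) x - G x) powr p \<partial>lborel) \<longlonglongrightarrow> 0"
    proof (rule tendsto_sandwich[OF _ _ tendsto_const G0(2)])
      show "\<forall>\<^sub>F n in sequentially. (\<integral>x. norm (gr (us n) x - G x) powr p \<partial>lborel) \<le> (\<integral>x. norm (gr (us n) x - G0 x) powr p \<partial>lborel)"
      proof (intro always_eventually allI integral_mono)
        fix n x
        show "norm (gr (us n) x - G x) powr p \<le> norm (gr (us n) x - G0 x) powr p"
          using gr_off[OF us, of x n] by (auto simp: G_def split: split_indicator)
      qed (use Lp_fun_integrable[OF dL] Lp_fun_integrable[OF Lp_fun_diff[OF p1(1) gr_Lp[OF us] G0(1)]] in auto)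
    qed simp
    obtain m where m: "m > 0" "\<And>G :: 'a \<Rightarrow> 'a. Lp_fun p lborel G \<Longrightarrow> (\<forall>x. x \<notin> closure \<Omega> \<longrightarrow> G x = 0) \<Longrightarrow>
      integrable lborel G \<and> (\<integral>x. norm (G x) \<partial>lborel) powr p \<le> m * (\<integral>x. norm (G x) powr p \<partial>lborel)" using gr_L1[OF True] by blast
    have limG1: "(\<lambda>n. \<integral>x. norm (gr (us n) x - G x) \<partial>lborel) \<longlonglongrightarrow> 0"
    proof -
      have "(\<lambda>n. (m * (\<integral>x. norm (gr (us n) x - G x) powr p \<partial>lborel)) powr (1 / p)) \<longlonglongrightarrow> (m * 0) powr (1 / p)"
        using p1 m(1) by (intro tendsto_powr' tendsto_intros limG) auto
      then have lim0: "(\<lambda>n. (m * (\<integral>x. norm (gr (us n) x - G x) powr p \<partial>lborel)) powr (1 / p)) \<longlonglongrightarrow> 0" by simp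
      have le: "(\<integral>x. norm (gr (us n) x - G x) \<partial>lborel) \<le> (m * (\<integral>x. norm (gr (us n) x - G x) powr p \<partial>lborel)) powr (1 / p)" for n
      proof -
        have "((\<integral>x. norm (gr (us n) x - G x) \<partial>lborel) powr p) powr (1 / p) \<le> (m * (\<integral>x. norm (gr (us n) x - G x) powr p \<partial>lborel)) powr (1 / p)"
          using m(2)[OF dL[of n]] gr_off[OF us] Goff p1 by (intro powr_mono2) auto
        then show ?thesis using p1 by (simp add: powr_powr)
      qed
      show ?thesis
        by (rule tendsto_sandwich[OF _ _ tendsto_const lim0]) (simp_all add: le)
    qed
    have iG: "integrable lborel G" using m(2)[OF GL Goff] by simp
    have w: "wgrad u G" by (rule wgrad_limit[OF gr_wgrad[OF us True] iu iG u1 limG1])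
    have gg: "good_grad u G" using w GL Goff by (simp add: good_grad_def)
    have uV: "u \<in> V" unfolding V_def using um uoff iu Ldu gg by auto
    have "(\<integral>x. norm (gr (us n) x - gr u x) powr p \<partial>lborel) = (\<integral>x. norm (gr (us n) x - G x) powr p \<partial>lborel)" for n
    proof -
      note [measurable] = gr_meas[OF us] gr_meas[OF uV]
      show ?thesis using gr_AE[OF uV True w] by (intro integral_cong_AE) auto
    qed
    then have "(\<lambda>n. NN (\<lambda>x. us n x - u x)) \<longlonglongrightarrow> 0 + aL * 0"
      unfolding NN_diff[OF us uV] using lim1 limG by (intro tendsto_intros) auto
    then show ?thesis using uV by auto
  qed
qed

lemma gr_scale: assumes u: "u \<in> V" shows "AE x in lborel. gr (\<lambda>x. c * u x) x = c *\<^sub>R gr u x"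
proof -
  have "AE x in lborel. gr (\<lambda>_. 0) x = 0" using gr_diff[OF V_zero V_zero] by simp
  then show ?thesis using gr_lin[OF V_zero u, of c] by eventually_elim simp
qed

lemma V_scale: "u \<in> V \<Longrightarrow> (\<lambda>x. c * u x) \<in> V"
  using V_lin[OF V_zero, of u c] by simp

lemma gr_cong_integral:
  assumes "u \<in> V" "f \<in> borel_measurable borel" "AE x in lborel. gr u x = f x"
  shows "N2 u = (\<integral>x. norm (f x) powr p \<partial>lborel)"
proof -
  note [measurable] = gr_meas[OF assms(1)] assms(2)
  show ?thesis unfolding N2_def using assms(3) by (intro integral_cong_AE) auto
qed

lemma NN_scale: assumes u: "u \<in> V" shows "NN (\<lambda>x. c * u x) = \<bar>c\<bar> powr p * NN u"
proof -
  note [measurable] = gr_meas[OF u]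
  have "N2 (\<lambda>x. c * u x) = (\<integral>x. norm (c *\<^sub>R gr u x) powr p \<partial>lborel)"
    by (rule gr_cong_integral[OF V_scale[OF u] _ gr_scale[OF u]]) measurable
  then have 2: "N2 (\<lambda>x. c * u x) = \<bar>c\<bar> powr p * N2 u" by (simp add: N2_def powr_mult)
  have "du (\<lambda>x. c * u x) = (\<lambda>z. c * du u z)" by (auto simp: du_def right_diff_distrib)
  then have "N1 (\<lambda>x. c * u x) = \<bar>c\<bar> powr p * N1 u" by (simp add: N1_def abs_mult powr_mult)
  with 2 show ?thesis by (simp add: NN_def distrib_left)
qed

lemma NN_clarkson: assumes u: "u \<in> V" and v: "v \<in> V"
  shows "NN (\<lambda>x. (u x + v x) / 2) + NN (\<lambda>x. (u x - v x) / 2) \<le> (NN u + NN v) / 2"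
proof -
  note [measurable] = gr_meas[OF u] gr_meas[OF v]
  have half: "(\<lambda>x. (u x + v x) / 2) \<in> V" "(\<lambda>x. (u x - v x) / 2) \<in> V"
    using V_scale[OF V_lin[OF u v, of 1], of "1/2"] V_scale[OF V_diff[OF u v], of "1/2"] by simp_all
  have ae: "AE x in lborel. gr (\<lambda>x. (u x + v x) / 2) x = (gr u x + gr v x) /\<^sub>R 2"
    using gr_scale[OF V_lin[OF u v, of 1], of "1/2"] gr_lin[OF u v, of 1] by eventually_elim simp
  have ae': "AE x in lborel. gr (\<lambda>x. (u x - v x) / 2) x = (gr u x - gr v x) /\<^sub>R 2"
    using gr_scale[OF V_diff[OF u v], of "1/2"] gr_diff[OF u v] by eventually_elim simp
  have 2: "N2 (\<lambda>x. (u x + v x) / 2) + N2 (\<lambda>x. (u x - v x) / 2) \<le> (N2 u + N2 v) / 2"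
  proof -
    have "N2 (\<lambda>x. (u x + v x) / 2) = (\<integral>x. norm ((gr u x + gr v x) /\<^sub>R 2) powr p \<partial>lborel)"
      by (rule gr_cong_integral[OF half(1) _ ae]) measurable
    moreover have "N2 (\<lambda>x. (u x - v x) / 2) = (\<integral>x. norm ((gr u x - gr v x) /\<^sub>R 2) powr p \<partial>lborel)"
      by (rule gr_cong_integral[OF half(2) _ ae']) measurable
    ultimately show ?thesis using Lp_clarkson[OF p2 gr_Lp[OF u] gr_Lp[OF v]] unfolding N2_def by linarith
  qed
  have "du (\<lambda>x. (u x + v x) / 2) = (\<lambda>z. (du u z + du v z) /\<^sub>R 2)" "du (\<lambda>x. (u x - v x) / 2) = (\<lambda>z. (du u z - du v z) /\<^sub>R 2)"
    by (auto simp: du_def field_simps)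
  then have 1: "N1 (\<lambda>x. (u x + v x) / 2) + N1 (\<lambda>x. (u x - v x) / 2) \<le> (N1 u + N1 v) / 2"
    using Lp_clarkson[OF p2 V_du[OF u] V_du[OF v]] unfolding N1_def by simp
  have "aL * (N2 (\<lambda>x. (u x + v x) / 2) + N2 (\<lambda>x. (u x - v x) / 2)) \<le> aL * ((N2 u + N2 v) / 2)"
    using 2 aL_nonneg by (rule mult_left_mono)
  with 1 show ?thesis unfolding NN_def by (simp add: field_simps)
qed

lemma A2_diff: assumes u: "u \<in> V" and v: "v \<in> V" and w: "w \<in> V"
  shows "A2 w (\<lambda>x. v x - u x) = (\<integral>x. pflux p (gr w x) \<bullet> (gr v x - gr u x) \<partial>lborel)"
proof -
  note m [measurable] = gr_meas[OF u] gr_meas[OF v] gr_meas[OF w] gr_meas[OF V_diff[OF v u]]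
  show ?thesis unfolding A2_def using gr_diff[OF v u] by (intro integral_pflux_cong_AE) auto
qed

lemma AA_sub: assumes u: "u \<in> V" and v: "v \<in> V"
  shows "NN u + p * AA u (\<lambda>x. v x - u x) \<le> NN v"
proof -
  have 2: "N2 u + p * A2 u (\<lambda>x. v x - u x) \<le> N2 v"
    using Lp_subgradient[OF p2 gr_Lp[OF u] gr_Lp[OF v]] unfolding A2_diff[OF u v u] N2_def .
  have 1: "N1 u + p * A1 u (\<lambda>x. v x - u x) \<le> N1 v"
    using Lp_subgradient[OF p2 V_du[OF u] V_du[OF v]] unfolding N1_def A1_def du_diff .
  have "aL * (N2 u + p * A2 u (\<lambda>x. v x - u x)) \<le> aL * N2 v" using 2 aL_nonneg by (rule mult_left_mono)
  with 1 show ?thesis unfolding NN_def AA_def by (simp add: algebra_simps)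
qed

lemma AA_mono: assumes u: "u \<in> V" and v: "v \<in> V"
  shows "2 powr (1 - p) * NN (\<lambda>x. u x - v x) \<le> AA u (\<lambda>x. u x - v x) - AA v (\<lambda>x. u x - v x)"
proof -
  have 2: "2 powr (1 - p) * N2 (\<lambda>x. u x - v x) \<le> A2 u (\<lambda>x. u x - v x) - A2 v (\<lambda>x. u x - v x)"
    using Lp_strong_mono[OF p2 gr_Lp[OF u] gr_Lp[OF v]] unfolding A2_diff[OF v u u] A2_diff[OF v u v] N2_diff[OF u v] .
  have 1: "2 powr (1 - p) * N1 (\<lambda>x. u x - v x) \<le> A1 u (\<lambda>x. u x - v x) - A1 v (\<lambda>x. u x - v x)"
    using Lp_strong_mono[OF p2 V_du[OF u] V_du[OF v]] unfolding N1_def A1_def du_diff .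
  have "aL * (2 powr (1 - p) * N2 (\<lambda>x. u x - v x)) \<le> aL * (A2 u (\<lambda>x. u x - v x) - A2 v (\<lambda>x. u x - v x))"
    using 2 aL_nonneg by (rule mult_left_mono)
  with 1 show ?thesis unfolding NN_def AA_def by (simp add: algebra_simps)
qed

lemma Lp_pflux_bound:
  fixes f g :: "'m \<Rightarrow> 'b::euclidean_space"
  assumes f: "Lp_fun p M f" and g: "Lp_fun p M g"
  shows "\<bar>\<integral>x. pflux p (f x) \<bullet> g x \<partial>M\<bar> \<le> (\<integral>x. norm (f x) powr p \<partial>M) + (\<integral>x. norm (g x) powr p \<partial>M)"
proof -
  have "\<bar>\<integral>x. pflux p (f x) \<bullet> g x \<partial>M\<bar> \<le> (\<integral>x. \<bar>pflux p (f x) \<bullet> g x\<bar> \<partial>M)" by (rule integral_abs_bound)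
  also have "\<dots> \<le> (\<integral>x. norm (f x) powr p + norm (g x) powr p \<partial>M)"
  proof (rule integral_mono)
    fix x
    have "(p - 1) / p * norm (f x) powr p \<le> 1 * norm (f x) powr p" using p2 by (intro mult_right_mono) auto
    moreover have "norm (g x) powr p / p \<le> norm (g x) powr p" using p2 by (auto simp: divide_simps mult_le_cancel_left1)
    ultimately show "\<bar>pflux p (f x) \<bullet> g x\<bar> \<le> norm (f x) powr p + norm (g x) powr p"
      using pflux_young[OF p1(2), of "f x" "g x"] by linarith
  qed (use integrable_pflux_inner[OF p2 f g] f g in \<open>auto simp: Lp_fun_def\<close>)
  finally show ?thesis using f g by (simp add: Lp_fun_def)
qed

lemma AA_bound: assumes u: "u \<in> V" and v: "v \<in> V" shows "\<bar>AA u v\<bar> \<le> NN u + NN v"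
proof -
  have "\<bar>A1 u v\<bar> \<le> N1 u + N1 v" using Lp_pflux_bound[OF V_du[OF u] V_du[OF v]] by (simp add: A1_def N1_def)
  moreover have "\<bar>A2 u v\<bar> \<le> N2 u + N2 v" using Lp_pflux_bound[OF gr_Lp[OF u] gr_Lp[OF v]] by (simp add: A2_def N2_def)
  then have "aL * \<bar>A2 u v\<bar> \<le> aL * (N2 u + N2 v)" using aL_nonneg by (rule mult_left_mono)
  moreover have "\<bar>AA u v\<bar> \<le> \<bar>A1 u v\<bar> + aL * \<bar>A2 u v\<bar>"
    using aL_nonneg abs_triangle_ineq[of "A1 u v" "aL * A2 u v"] by (simp add: AA_def abs_mult)
  ultimately show ?thesis by (simp add: NN_def distrib_left)
qed

lemma AA_scale: assumes u: "u \<in> V" and v: "v \<in> V" and c: "c \<ge> 0"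
  shows "AA (\<lambda>x. c * u x) v = c powr (p - 1) * AA u v"
proof -
  have s: "pflux p (c * t) = c powr (p - 1) * pflux p t" for t :: real
    using pflux_scaleR[OF c, of p t] by simp
  have "A1 (\<lambda>x. c * u x) v = c powr (p - 1) * A1 u v"
    by (simp add: A1_def du_def s mult.assoc flip: right_diff_distrib)
  moreover have "A2 (\<lambda>x. c * u x) v = c powr (p - 1) * A2 u v"
  proof -
    note m [measurable] = gr_meas[OF u] gr_meas[OF v] gr_meas[OF V_scale[OF u]]
    have "A2 (\<lambda>x. c * u x) v = (\<integral>x. pflux p (c *\<^sub>R gr u x) \<bullet> gr v x \<partial>lborel)"
      unfolding A2_def using gr_scale[OF u, of c] by (intro integral_pflux_cong_AE) auto
    then show ?thesis unfolding pflux_scaleR[OF c] by (simp add: A2_def)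
  qed
  ultimately show ?thesis by (simp add: AA_def distrib_left)
qed

lemma AA_cont:
  assumes us: "\<And>n. us n \<in> V" and u: "u \<in> V" and v: "v \<in> V" and lim: "(\<lambda>n. NN (\<lambda>x. us n x - u x)) \<longlonglongrightarrow> 0"
  shows "(\<lambda>n. AA (us n) v) \<longlonglongrightarrow> AA u v"
proof -
  have l1: "(\<lambda>n. N1 (\<lambda>x. us n x - u x)) \<longlonglongrightarrow> 0"
  proof (rule tendsto_sandwich[OF _ _ tendsto_const lim])
    show "\<forall>\<^sub>F n in sequentially. N1 (\<lambda>x. us n x - u x) \<le> NN (\<lambda>x. us n x - u x)"
      using N2_nonneg aL_nonneg by (simp add: NN_def)
  qed (simp add: N1_nonneg)
  have c1: "(\<lambda>n. A1 (us n) v) \<longlonglongrightarrow> A1 u v"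
    unfolding A1_def by (rule tendsto_integral_pflux[OF p2 V_du[OF us] V_du[OF u] V_du[OF v] l1[unfolded N1_diff]])
  have c2: "(\<lambda>n. aL * A2 (us n) v) \<longlonglongrightarrow> aL * A2 u v"
  proof (cases "aL > 0")
    case True
    have "(\<lambda>n. N2 (\<lambda>x. us n x - u x)) \<longlonglongrightarrow> 0"
    proof (rule tendsto_sandwich[OF _ _ tendsto_const tendsto_mult_right_zero[OF lim, of "1 / aL"]])
      show "\<forall>\<^sub>F n in sequentially. N2 (\<lambda>x. us n x - u x) \<le> 1 / aL * NN (\<lambda>x. us n x - u x)"
        using N1_nonneg True by (simp add: NN_def field_simps)
    qed (simp add: N2_nonneg)
    then show ?thesis
      unfolding A2_def N2_diff[OF us u]
      by (intro tendsto_intros tendsto_integral_pflux[OF p2 gr_Lp[OF us] gr_Lp[OF u] gr_Lp[OF v]])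
  qed (use aL_nonneg in simp)
  show ?thesis unfolding AA_def by (rule tendsto_add[OF c1 c2])
qed

sublocale p_form V p CP NN AA
proof
  show "AA u (\<lambda>x. v x + c * w x) = AA u v + c * AA u w" if "u \<in> V" "v \<in> V" "w \<in> V" for u v w c
    using A1_lin[OF that] A2_lin[OF that] by (simp add: AA_def algebra_simps)
qed (fact p2 V_zero V_lin V_integrable NN_nonneg NN_scale NN_clarkson AA_sub AA_cont AA_bound CP V_complete)+

end

subsection \<open>Truncations and test functions in the energy space\<close>

text \<open>A continuously differentiable nondecreasing substitute for the positive part, so that the
  classical chain rule suffices in truncation arguments.\<close>

definition softpos :: "real \<Rightarrow> real" where
  "softpos t = (if t \<le> 0 then 0 else t\<^sup>2 / (1 + t))"

definition softpos' :: "real \<Rightarrow> real" where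
  "softpos' t = (if t \<le> 0 then 0 else (t\<^sup>2 + 2 * t) / (1 + t)\<^sup>2)"

lemma softpos_nonneg [simp]: "softpos t \<ge> 0" and softpos_eq_0_iff: "softpos t = 0 \<longleftrightarrow> t \<le> 0"
  by (auto simp: softpos_def)

lemma softpos'_bounds: "0 \<le> softpos' t" "softpos' t \<le> 1"
proof -
  show "0 \<le> softpos' t" by (simp add: softpos'_def)
  show "softpos' t \<le> 1"
  proof (cases "t \<le> 0")
    case False
    then have "0 < (1 + t)\<^sup>2" by simp
    then have "(t\<^sup>2 + 2 * t) / (1 + t)\<^sup>2 \<le> 1"
      by (subst pos_divide_le_eq) (simp_all add: power2_eq_square algebra_simps)
    then show ?thesis by (simp add: softpos'_def)
  qed (simp add: softpos'_def)
qed

lemma softpos_has_derivative: "(softpos has_real_derivative softpos' t) (at t)"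
proof -
  consider "t < 0" | "t = 0" | "t > 0" by linarith
  then show ?thesis
  proof cases
    case 1
    have "((\<lambda>_. 0::real) has_real_derivative 0) (at t)" by simp
    then have "(softpos has_real_derivative 0) (at t)"
      by (rule has_field_derivative_transform_within_open[where S="{..<0}"]) (use 1 in \<open>auto simp: softpos_def\<close>)
    then show ?thesis using 1 by (simp add: softpos'_def)
  next
    case 2
    have "((\<lambda>h. softpos h / h) \<longlongrightarrow> 0) (at 0)"
    proof (rule Lim_null_comparison)
      show "\<forall>\<^sub>F h in at 0. norm (softpos h / h) \<le> \<bar>h\<bar>"
        by (auto simp: softpos_def eventually_at_filter divide_simps power2_eq_square intro!: always_eventually)
      show "((\<lambda>h::real. \<bar>h\<bar>) \<longlongrightarrow> 0) (at 0)" by (rule tendsto_rabs_zero[OF tendsto_ident_at])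
    qed
    then show ?thesis using 2 by (simp add: has_field_derivative_iff softpos_def softpos'_def)
  next
    case 3
    have "((\<lambda>t. t\<^sup>2 / (1 + t)) has_real_derivative (t\<^sup>2 + 2 * t) / (1 + t)\<^sup>2) (at t)"
      using 3 by (auto intro!: derivative_eq_intros simp: divide_simps power2_eq_square algebra_simps)
    then have "(softpos has_real_derivative (t\<^sup>2 + 2 * t) / (1 + t)\<^sup>2) (at t)"
      by (rule has_field_derivative_transform_within_open[where S="{0<..}"]) (use 3 in \<open>auto simp: softpos_def\<close>)
    then show ?thesis using 3 by (simp add: softpos'_def)
  qed
qed

lemma softpos_lipschitz: "\<bar>softpos s - softpos t\<bar> \<le> \<bar>s - t\<bar>"
  using field_differentiable_bound[of UNIV softpos softpos' 1 s t] softpos_has_derivative softpos'_bounds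
  by (auto intro: has_field_derivative_at_within)

lemma softpos_mono: "s \<le> t \<Longrightarrow> softpos s \<le> softpos t"
  using DERIV_nonneg_imp_nondecreasing[of s t softpos] softpos_has_derivative softpos'_bounds by blast

lemma softpos_lower: "0 \<le> t \<Longrightarrow> t \<le> 1 \<Longrightarrow> t\<^sup>2 / 2 \<le> softpos t"
proof (cases "t = 0")
  case False
  assume t: "0 \<le> t" "t \<le> 1"
  have "t\<^sup>2 / 2 \<le> t\<^sup>2 / (1 + t)" using t False by (intro divide_left_mono) auto
  then show ?thesis using t False by (simp add: softpos_def)
qed (simp add: softpos_def)

lemma softpos_measurable [measurable]: "softpos \<in> borel_measurable borel" "softpos' \<in> borel_measurable borel"
  unfolding softpos_def[abs_def] softpos'_def[abs_def] by measurable

text \<open>Caratheodory's form of the derivative is used because \<open>y n - t\<close> may vanish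
  for some \<open>n\<close>, where the usual quotient would be a division by 0.\<close>

lemma seq_chain:
  fixes F :: "real \<Rightarrow> real"
  assumes F: "(F has_real_derivative D) (at t)" and h: "\<And>n. h n \<noteq> 0" "h \<longlonglongrightarrow> 0"
    and q: "(\<lambda>n. (y n - t) / h n) \<longlonglongrightarrow> g"
  shows "(\<lambda>n. (F (y n) - F t) / h n) \<longlonglongrightarrow> D * g" and "y \<longlonglongrightarrow> t"
proof -
  have "(\<lambda>n. (y n - t) / h n * h n) \<longlonglongrightarrow> g * 0" by (intro tendsto_intros q h)
  then have "(\<lambda>n. y n - t) \<longlonglongrightarrow> 0" using h(1) by simp
  then show y: "y \<longlonglongrightarrow> t" by (rule LIM_zero_cancel)
  obtain k where k: "\<And>z. F z - F t = k z * (z - t)" "isCont k t" "k t = D"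
    using F unfolding CARAT_DERIV by blast
  have "(\<lambda>n. k (y n) * ((y n - t) / h n)) \<longlonglongrightarrow> k t * g"
    by (intro tendsto_intros q isCont_tendsto_compose[OF k(2) y])
  then show "(\<lambda>n. (F (y n) - F t) / h n) \<longlonglongrightarrow> D * g" by (simp add: k(1,3))
qed

lemma Lp_fun_dom:
  assumes p: "p \<ge> 0" and h: "Lp_fun p M h" and f: "f \<in> borel_measurable M" and le: "\<And>x. norm (f x) \<le> norm (h x)"
  shows "Lp_fun p M f"
  by (rule Lp_fun_bound[OF Lp_fun_integrable[OF h] f]) (use p le in \<open>auto intro!: powr_mono2\<close>)

context mixed_energy
begin

text \<open>Bounds obtained by comparison hold almost everywhere; this permits passing to a clipped
  representative that satisfies them everywhere and has the same form.\<close>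

lemma V_cong_AE:
  assumes u: "u \<in> V" and v: "v \<in> borel_measurable borel" "\<And>x. x \<notin> \<Omega> \<Longrightarrow> v x = 0" and eq: "AE x in lborel. v x = u x"
  shows "v \<in> V" and "w \<in> V \<Longrightarrow> AA v w = AA u w"
proof -
  have dvm: "du v \<in> borel_measurable MK" "du u \<in> borel_measurable MK"
    using du_meas[OF v(1)] du_meas[OF V_meas[OF u]] by (simp_all cong: measurable_cong_sets)
  have dAE: "AE z in MK. du v z = du u z" using AE_MK[OF eq] by eventually_elim (simp add: du_def)
  have dv: "Lp_fun p MK (du v)" by (rule Lp_fun_cong_AE[OF V_du[OF u] dvm(1) dAE])
  have iv: "integrable lborel v" by (rule integrable_cong_AE_lborel[OF V_integrable[OF u] v(1) eq])
  have gg: "good_grad v (gr u)" if "aL > 0"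
    using wgrad_cong_AE[OF gr_wgrad[OF u that] v(1) eq gr_meas[OF u]] gr_good[OF u that] by (auto simp: good_grad_def)
  show vV: "v \<in> V" unfolding V_def using v iv dv gg by auto
  show "AA v w = AA u w" if w: "w \<in> V"
  proof -
    have "A1 v w = A1 u w" unfolding A1_def
      using dvm dAE du_meas[OF V_meas[OF w]] by (intro integral_pflux_cong_AE) (auto cong: measurable_cong_sets)
    moreover have "AE x in lborel. gr v x = gr u x"
    proof (cases "aL > 0")
      case True
      show ?thesis by (rule gr_AE[OF vV True]) (use gg[OF True] in \<open>simp add: good_grad_def\<close>)
    qed (simp add: gr_def)
    then have "A2 v w = A2 u w" unfolding A2_def
      using gr_meas[OF u] gr_meas[OF vV] gr_meas[OF w] by (intro integral_pflux_cong_AE) auto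
    ultimately show ?thesis by (simp add: AA_def)
  qed
qed

text \<open>Being 1-Lipschitz, \<open>softpos\<close> does not increase differences, which gives the
  nonlocal part; the quotients in \<open>wgrad_chain\<close> give the gradient.
  \<open>T \<ge> 0\<close> makes the truncation vanish off \<Omega>.\<close>

lemma V_softpos:
  assumes w: "w \<in> V" and T: "T \<ge> 0"
  shows "(\<lambda>x. softpos (w x - T)) \<in> V"
    and "AE x in lborel. gr (\<lambda>x. softpos (w x - T)) x = softpos' (w x - T) *\<^sub>R gr w x"
proof -
  note [measurable] = V_meas[OF w] gr_meas[OF w]
  define v where "v x = softpos (w x - T)" for x
  define H where "H x = softpos' (w x - T) *\<^sub>R gr w x" for x
  have vm [measurable]: "v \<in> borel_measurable borel" unfolding v_def by measurable
  have Hm [measurable]: "H \<in> borel_measurable borel" unfolding H_def by measurable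
  have off: "v x = 0" if "x \<notin> \<Omega>" for x using V_off[OF w that] T by (simp add: v_def softpos_eq_0_iff)
  have lip: "\<bar>v x - v y\<bar> \<le> \<bar>w x - w y\<bar>" for x y unfolding v_def using softpos_lipschitz[of "w x - T" "w y - T"] by simp
  have le: "\<bar>v x\<bar> \<le> \<bar>w x\<bar>" for x
    using softpos_lipschitz[of "w x - T" "- T"] T by (simp add: v_def softpos_eq_0_iff softpos_def)
  have iv: "integrable lborel v" by (rule Bochner_Integration.integrable_bound[OF V_integrable[OF w]]) (use le in auto)
  have dv: "Lp_fun p MK (du v)"
    by (rule Lp_fun_dom[OF _ V_du[OF w]]) (use p1 lip du_meas[OF vm] in \<open>auto simp: du_def cong: measurable_cong_sets\<close>)
  have gg: "good_grad v H" if aL: "aL > 0"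
  proof -
    have Hle: "norm (H x) \<le> norm (gr w x)" for x
      using softpos'_bounds[of "w x - T"] by (simp add: H_def mult_left_le_one_le)
    have "wgrad v H"
    proof (rule wgrad_chain[OF gr_wgrad[OF w aL] iv, where K="\<lambda>_. 0" and c=1])
      show "integrable lborel H"
        by (rule Bochner_Integration.integrable_bound[OF wgradD(2)[OF gr_wgrad[OF w aL]]]) (use Hle in auto)
      fix b x :: 'a and h :: "nat \<Rightarrow> real"
      assume h: "\<And>n. h n \<noteq> 0" "h \<longlonglongrightarrow> 0" and q: "(\<lambda>n. (w (x + h n *\<^sub>R b) - w x) / h n) \<longlonglongrightarrow> gr w x \<bullet> b"
      have "(\<lambda>n. ((w (x + h n *\<^sub>R b) - T) - (w x - T)) / h n) \<longlonglongrightarrow> gr w x \<bullet> b" using q by simp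
      from seq_chain(1)[OF softpos_has_derivative h this]
      show "(\<lambda>n. (v (x + h n *\<^sub>R b) - v x) / h n) \<longlonglongrightarrow> H x \<bullet> b" by (simp add: v_def H_def)
    qed (use lip in auto)
    moreover have "Lp_fun p lborel H" by (rule Lp_fun_dom[OF _ gr_Lp[OF w]]) (use p1 Hle in auto)
    ultimately show ?thesis using gr_off[OF w] by (simp add: good_grad_def H_def)
  qed
  show vV: "(\<lambda>x. softpos (w x - T)) \<in> V" unfolding V_def v_def[symmetric] using vm off iv dv gg by auto
  show "AE x in lborel. gr (\<lambda>x. softpos (w x - T)) x = softpos' (w x - T) *\<^sub>R gr w x"
  proof (cases "aL > 0")
    case True
    from gg[OF True] have "wgrad v H" by (simp add: good_grad_def)
    from gr_AE[OF vV True, of H] this show ?thesis unfolding v_def H_def by simp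
  qed (simp add: gr_def)
qed

section \<open>Finite nonlocal energy of bounded Lipschitz functions\<close>

lemma nn_integral_reflect:
  fixes f :: "'a \<Rightarrow> ennreal"
  assumes [measurable]: "f \<in> borel_measurable borel"
  shows "(\<integral>\<^sup>+y. f (x - y) \<partial>lborel) = (\<integral>\<^sup>+y. f y \<partial>lborel)"
proof -
  have "(\<integral>\<^sup>+y. f y \<partial>lborel) = (\<integral>\<^sup>+y. f (y + x) \<partial>lborel)" by (rule nn_integral_lborel_translate [symmetric]) measurable
  also have "\<dots> = (\<integral>\<^sup>+y. f (y + x) \<partial>distr lborel borel uminus)"
  proof -
    have "(lborel :: 'a measure) = distr lborel borel uminus"
      by (subst lborel_affine[of "-1" 0]) (auto simp: density_1)
    then show ?thesis by simp
  qed
  also have "\<dots> = (\<integral>\<^sup>+y. f (- y + x) \<partial>lborel)" by (subst nn_integral_distr) auto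
  finally show ?thesis by simp
qed

text \<open>Boundedness and the Lipschitz condition together bound differences by a multiple of
  \<open>min 1 (norm (x - y))\<close>, and differences vanish unless one of the points lies in
  \<Omega>. Integrating over the other point leaves the integral of
  \<open>min 1 (norm z powr p) * K z\<close>, finite by \<open>K_int\<close>.\<close>

lemma Lp_lipschitz:
  assumes m [measurable]: "f \<in> borel_measurable borel" and off: "\<And>x. x \<notin> \<Omega> \<Longrightarrow> f x = 0"
    and C: "\<And>x. \<bar>f x\<bar> \<le> C" and L: "\<And>x y. \<bar>f x - f y\<bar> \<le> L * norm (x - y)"
  shows "Lp_fun p MK (du f)"
proof -
  define c where "c = max (2 * C) L powr p"
  define k where "k z = min 1 (norm z powr p) * K z" for z
  have km [measurable]: "k \<in> borel_measurable borel" unfolding k_def by measurable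
  have k0: "k z \<ge> 0" for z using K_nonneg by (simp add: k_def)
  have kfin: "(\<integral>\<^sup>+z. ennreal (k z) \<partial>lborel) < \<infinity>"
    using K_int k0 unfolding k_def[abs_def, symmetric] by (subst nn_integral_eq_integral) auto
  have C0: "C \<ge> 0" using C[of undefined] by linarith
  have pt: "norm (du f (x, y)) powr p \<le> c * min 1 (norm (x - y) powr p) * (indicator \<Omega> x + indicator \<Omega> y)" for x y
  proof (cases "x \<in> \<Omega> \<or> y \<in> \<Omega>")
    case True
    have "\<bar>f x - f y\<bar> \<le> max (2 * C) L * min 1 (norm (x - y))"
    proof -
      have a: "\<bar>f x - f y\<bar> \<le> max (2 * C) L" using C[of x] C[of y] by linarith
      have b: "\<bar>f x - f y\<bar> \<le> max (2 * C) L * norm (x - y)"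
        using L[of x y] by (rule order_trans) (intro mult_right_mono, auto)
      show ?thesis using a b by (simp add: min_def)
    qed
    then have "\<bar>f x - f y\<bar> powr p \<le> (max (2 * C) L * min 1 (norm (x - y))) powr p"
      using p1 by (intro powr_mono2) auto
    also have "\<dots> = c * min 1 (norm (x - y)) powr p" using C0 by (simp add: c_def powr_mult)
    also have "min 1 (norm (x - y)) powr p = min 1 (norm (x - y) powr p)"
    proof (cases "norm (x - y) \<le> 1")
      case True
      then have "norm (x - y) powr p \<le> 1" using p1 by (intro powr_le1) auto
      then show ?thesis using True by (simp add: min_def)
    next
      case False
      then have "1 \<le> norm (x - y) powr p" using p1 by (intro ge_one_powr_ge_zero) auto
      then show ?thesis using False by (simp add: min_def)
    qed
    also have "c * min 1 (norm (x - y) powr p) * 1 \<le> c * min 1 (norm (x - y) powr p) * (indicator \<Omega> x + indicator \<Omega> y)"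
      using True by (intro mult_left_mono) (auto simp: c_def split: split_indicator)
    finally show ?thesis by (simp add: du_def)
  qed (use off in \<open>simp add: du_def\<close>)
  have dm: "du f \<in> borel_measurable MK" using du_meas[OF m] by (simp cong: measurable_cong_sets)
  have [measurable]: "du f \<in> borel_measurable borel" by (rule du_meas[OF m])
  have pm [measurable]: "(\<lambda>x. ennreal (k (fst x - snd x)) * indicator \<Omega> (fst x)) \<in> borel_measurable (lborel \<Otimes>\<^sub>M lborel)"
     "(\<lambda>x. ennreal (k (fst x - snd x)) * indicator \<Omega> (snd x)) \<in> borel_measurable (lborel \<Otimes>\<^sub>M lborel)"
    by measurable
  have "(\<integral>\<^sup>+z. ennreal (norm (du f z) powr p) \<partial>MK) = (\<integral>\<^sup>+z. ennreal (K (fst z - snd z)) * ennreal (norm (du f z) powr p) \<partial>lborel)"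
    by (rule MK_nn_integral) measurable
  also have "\<dots> \<le> (\<integral>\<^sup>+z. ennreal c * (ennreal (k (fst z - snd z)) * indicator \<Omega> (fst z) + ennreal (k (fst z - snd z)) * indicator \<Omega> (snd z)) \<partial>lborel)"
  proof (rule nn_integral_mono)
    fix z :: "'a \<times> 'a"
    have "K (fst z - snd z) * norm (du f z) powr p \<le> K (fst z - snd z) * (c * min 1 (norm (fst z - snd z) powr p) * (indicator \<Omega> (fst z) + indicator \<Omega> (snd z)))"
      using pt[of "fst z" "snd z"] K_nonneg by (intro mult_left_mono) auto
    also have "\<dots> = c * (k (fst z - snd z) * indicator \<Omega> (fst z) + k (fst z - snd z) * indicator \<Omega> (snd z))"
      by (simp add: k_def algebra_simps)
    finally have "ennreal (K (fst z - snd z) * norm (du f z) powr p) \<le> ennreal (c * (k (fst z - snd z) * indicator \<Omega> (fst z) + k (fst z - snd z) * indicator \<Omega> (snd z)))"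
      by (rule ennreal_leI)
    moreover have "c \<ge> 0" by (simp add: c_def)
    moreover have "ennreal (k y * indicator \<Omega> x) = ennreal (k y) * indicator \<Omega> x" for x y
      using k0 by (simp add: ennreal_mult ennreal_indicator[symmetric])
    ultimately show "ennreal (K (fst z - snd z)) * ennreal (norm (du f z) powr p)
      \<le> ennreal c * (ennreal (k (fst z - snd z)) * indicator \<Omega> (fst z) + ennreal (k (fst z - snd z)) * indicator \<Omega> (snd z))"
      using K_nonneg[of "fst z - snd z"] k0 by (simp add: ennreal_mult ennreal_plus)
  qed
  also have "\<dots> = ennreal c * ((\<integral>\<^sup>+z. ennreal (k (fst z - snd z)) * indicator \<Omega> (fst z) \<partial>lborel) + (\<integral>\<^sup>+z. ennreal (k (fst z - snd z)) * indicator \<Omega> (snd z) \<partial>lborel))"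
    using pm unfolding lborel_prod by (subst nn_integral_cmult, simp, subst nn_integral_add, auto)
  also have "(\<integral>\<^sup>+z. ennreal (k (fst z - snd z)) * indicator \<Omega> (fst z) \<partial>lborel) = (\<integral>\<^sup>+z. ennreal (k z) \<partial>lborel) * emeasure lborel \<Omega>"
  proof -
    have "(\<integral>\<^sup>+z. ennreal (k (fst z - snd z)) * indicator \<Omega> (fst z) \<partial>(lborel \<Otimes>\<^sub>M lborel))
        = (\<integral>\<^sup>+x. (\<integral>\<^sup>+y. ennreal (k (x - y)) * indicator \<Omega> x \<partial>lborel) \<partial>lborel)"
      using lborel.nn_integral_fst[OF pm(1)] by simp
    also have "\<dots> = (\<integral>\<^sup>+x. (\<integral>\<^sup>+z. ennreal (k z) \<partial>lborel) * indicator \<Omega> x \<partial>lborel)"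
      using nn_integral_reflect[of "\<lambda>z. ennreal (k z)"] by (intro nn_integral_cong) (subst nn_integral_multc, auto)
    also have "\<dots> = (\<integral>\<^sup>+z. ennreal (k z) \<partial>lborel) * emeasure lborel \<Omega>" by (subst nn_integral_cmult_indicator) auto
    finally show ?thesis by (simp add: lborel_prod)
  qed
  also have "(\<integral>\<^sup>+z. ennreal (k (fst z - snd z)) * indicator \<Omega> (snd z) \<partial>lborel) = (\<integral>\<^sup>+z. ennreal (k z) \<partial>lborel) * emeasure lborel \<Omega>"
  proof -
    have "(\<integral>\<^sup>+z. ennreal (k (fst z - snd z)) * indicator \<Omega> (snd z) \<partial>(lborel \<Otimes>\<^sub>M lborel))
        = (\<integral>\<^sup>+y. (\<integral>\<^sup>+x. ennreal (k (x - y)) * indicator \<Omega> y \<partial>lborel) \<partial>lborel)"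
      using lborel_pair.nn_integral_snd[OF pm(2)] by simp
    also have "\<dots> = (\<integral>\<^sup>+y. (\<integral>\<^sup>+z. ennreal (k z) \<partial>lborel) * indicator \<Omega> y \<partial>lborel)"
    proof (rule nn_integral_cong)
      fix y
      have "(\<integral>\<^sup>+x. ennreal (k (x - y)) \<partial>lborel) = (\<integral>\<^sup>+z. ennreal (k z) \<partial>lborel)"
        using nn_integral_lborel_translate[of "\<lambda>z. ennreal (k z)" "- y"] by simp
      then show "(\<integral>\<^sup>+x. ennreal (k (x - y)) * indicator \<Omega> y \<partial>lborel) = (\<integral>\<^sup>+z. ennreal (k z) \<partial>lborel) * indicator \<Omega> y"
        by (subst nn_integral_multc) auto
    qed
    also have "\<dots> = (\<integral>\<^sup>+z. ennreal (k z) \<partial>lborel) * emeasure lborel \<Omega>" by (subst nn_integral_cmult_indicator) auto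
    finally show ?thesis by (simp add: lborel_prod)
  qed
  also have "ennreal c * ((\<integral>\<^sup>+z. ennreal (k z) \<partial>lborel) * emeasure lborel \<Omega> + (\<integral>\<^sup>+z. ennreal (k z) \<partial>lborel) * emeasure lborel \<Omega>) < \<infinity>"
    using kfin finite_\<Omega> by (auto simp: ennreal_mult_less_top)
  finally show ?thesis unfolding Lp_fun_def using dm by (intro conjI integrableI_nonneg) auto
qed

end

section \<open>Classical gradients of test functions\<close>

definition grad_of :: "('a::euclidean_space \<Rightarrow> real) \<Rightarrow> 'a \<Rightarrow> 'a" where
  "grad_of f x = (\<Sum>b\<in>Basis. frechet_derivative f (at x) b *\<^sub>R b)"

lemma grad_of_inner:
  assumes "test_function f" shows "grad_of f x \<bullet> e = frechet_derivative f (at x) e"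
  unfolding grad_of_def inner_sum_left test_function_derivative_lin[OF assms, of x e]
  by (intro sum.cong) (auto simp: inner_commute)

lemma grad_of_continuous: "test_function f \<Longrightarrow> continuous_on UNIV (grad_of f)"
  unfolding grad_of_def[abs_def] by (intro continuous_intros test_function_derivative_continuous)

lemma grad_of_bounded:
  fixes f :: "'a::euclidean_space \<Rightarrow> real"
  assumes f: "test_function f" shows "\<exists>L>0. \<forall>x. norm (grad_of f x) \<le> L"
proof -
  have "\<exists>C>0. \<forall>x. \<bar>frechet_derivative f (at x) b\<bar> \<le> C" for b by (rule test_function_derivative_bounded[OF f])
  then obtain C where C: "\<And>b. C b > 0" "\<And>b x. \<bar>frechet_derivative f (at x) b\<bar> \<le> C b" by metis
  have "norm (grad_of f x) \<le> (\<Sum>b\<in>Basis. C b)" for x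
    unfolding grad_of_def by (rule order_trans[OF norm_sum]) (use C in \<open>auto intro!: sum_mono\<close>)
  moreover have "(\<Sum>b\<in>(Basis::'a set). C b) > 0" using C(1) by (intro sum_pos) auto
  ultimately show ?thesis by blast
qed

lemma test_function_lipschitz:
  fixes f :: "'a::euclidean_space \<Rightarrow> real"
  assumes f: "test_function f" and L: "\<And>x. norm (grad_of f x) \<le> L"
  shows "\<bar>f x - f y\<bar> \<le> L * norm (x - y)"
proof -
  have "norm (f x - f y) \<le> L * norm (x - y)"
  proof (rule differentiable_bound[of UNIV f "\<lambda>x. frechet_derivative f (at x)"])
    show "(f has_derivative frechet_derivative f (at z)) (at z within UNIV)" for z
      using test_function_has_derivative[OF f] by simp
    show "onorm (frechet_derivative f (at z)) \<le> L" for z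
    proof (rule onorm_le)
      fix h
      have "norm (frechet_derivative f (at z) h) \<le> norm (grad_of f z) * norm h"
        unfolding grad_of_inner[OF f, symmetric] real_norm_def by (rule Cauchy_Schwarz_ineq2)
      also have "\<dots> \<le> L * norm h" using L by (intro mult_right_mono) auto
      finally show "norm (frechet_derivative f (at z) h) \<le> L * norm h" .
    qed
  qed auto
  then show ?thesis by simp
qed

context mixed_energy
begin

section \<open>Bumps in the domain and Picone's test functions\<close>

definition bump_in :: "('a \<Rightarrow> real) \<Rightarrow> bool" where
  "bump_in f \<longleftrightarrow> test_function f \<and> (\<forall>x. 0 \<le> f x) \<and> (\<forall>x. f x \<le> 1) \<and> (\<forall>x. x \<notin> \<Omega> \<longrightarrow> f x = 0) \<and>
     (\<exists>x. f x \<noteq> 0)"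

lemma bump_in_exists: "\<exists>f. bump_in f"
proof -
  obtain x0 where "x0 \<in> \<Omega>" using nonempty_\<Omega> by blast
  then obtain l r where lr: "x0 \<in> box l r" "box l r \<subseteq> \<Omega>" using open_\<Omega> open_contains_box by (metis rational_boxes open_contains_ball order_trans)
  have "bump_in (box_bump 1 l r)"
    unfolding bump_in_def using test_function_box_bump[of 1 l r] box_bump_bounds[of 1 l r] box_bump_zero[of 1 _ l r] box_bump_pos[of 1 x0 l r] lr
    by (auto intro!: exI[of _ x0])
  then show ?thesis by blast
qed

lemma bump_facts:
  assumes "bump_in f"
  shows "test_function f" "0 \<le> f x" "f x \<le> 1" "x \<notin> \<Omega> \<Longrightarrow> f x = 0"
  using assms by (auto simp: bump_in_def)

lemma bump_grad_zero:
  assumes f: "bump_in f" and x: "x \<notin> closure \<Omega>" shows "grad_of f x = 0"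
proof -
  have "((\<lambda>_. 0::real) has_derivative (\<lambda>_. 0)) (at x)" by simp
  then have "(f has_derivative (\<lambda>_. 0)) (at x)"
    by (rule has_derivative_transform_within_open[of _ _ _ _ "- closure \<Omega>"])
      (use x bump_facts(4)[OF f] closure_subset[of \<Omega>] in auto)
  then have "frechet_derivative f (at x) = (\<lambda>_. 0)" by (metis frechet_derivative_at)
  then show ?thesis by (simp add: grad_of_def)
qed

lemma bump_meas:
  assumes f: "bump_in f" shows "f \<in> borel_measurable borel" "grad_of f \<in> borel_measurable borel"
  using test_function_measurable(1)[OF bump_facts(1)[OF f]] grad_of_continuous[OF bump_facts(1)[OF f]]
  by (auto intro: borel_measurable_continuous_onI)

lemma bounded_off_integrable:
  fixes g :: "'a \<Rightarrow> 'b::euclidean_space"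
  assumes m: "g \<in> borel_measurable borel" and C: "\<And>x. norm (g x) \<le> C" and off: "\<And>x. x \<notin> closure \<Omega> \<Longrightarrow> g x = 0"
  shows "integrable lborel g" and "Lp_fun p lborel g"
proof -
  have C0: "C \<ge> 0" using C[of undefined] norm_ge_zero[of "g undefined"] by linarith
  have i: "integrable lborel (\<lambda>x. C * indicat_real (closure \<Omega>) x)" for C :: real
    using finite_\<Omega>(2) by (auto intro!: integrable_real_indicator)
  show "integrable lborel g"
    by (rule Bochner_Integration.integrable_bound[OF i[of C]]) (use m C C0 off in \<open>auto split: split_indicator\<close>)
  show "Lp_fun p lborel g"
  proof (rule Lp_fun_bound[OF i[of "C powr p"]])
    show "AE x in lborel. norm (g x) powr p \<le> C powr p * indicat_real (closure \<Omega>) x"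
      using C off p1 by (auto intro!: AE_I2 powr_mono2 split: split_indicator)
  qed (use m in auto)
qed

lemma \<Omega>_closure: "x \<notin> closure \<Omega> \<Longrightarrow> x \<notin> \<Omega>" using closure_subset by blast

text \<open>\<open>wgrad_chain\<close> is applied to the zero function with \<open>c = 0\<close>:
  its hypotheses then reduce to classical differentiability and a Lipschitz bound with an integrable
  factor.\<close>

lemma bump_wgrad:
  assumes f: "bump_in f" shows "wgrad f (grad_of f)"
proof -
  note tf = bump_facts(1)[OF f]
  obtain L where L: "L > 0" "\<And>x. norm (grad_of f x) \<le> L" using grad_of_bounded[OF tf] by blast
  obtain R where R: "R > 0" "\<Omega> \<subseteq> ball 0 R" using bounded_\<Omega> bounded_subset_ballD by blast
  have if': "integrable lborel f"
    by (rule bounded_off_integrable(1)[where C=1]) (use bump_meas[OF f] bump_facts[OF f] \<Omega>_closure in auto)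
  have ig: "integrable lborel (grad_of f)"
    by (rule bounded_off_integrable(1)[OF bump_meas(2)[OF f] L(2)]) (use bump_grad_zero[OF f] in auto)
  have w0: "wgrad (\<lambda>_::'a. 0) (\<lambda>_. 0)" by (rule wgradI) auto
  show ?thesis
  \<comment> \<open>A step of length at most 1 from outside the ball of radius \<open>R + 1\<close>
    does not reach \<Omega>, so the factor may be cut off there.\<close>
  proof (rule wgrad_chain[OF w0 if' ig, where c=0 and K="\<lambda>x. L * indicat_real (ball 0 (R + 1)) x"])
    show "integrable lborel (\<lambda>x. L * indicat_real (ball 0 (R + 1)) (x::'a))"
      using emeasure_lborel_ball_finite[of "0::'a" "R + 1"] by (auto intro!: integrable_real_indicator)
    fix b x :: 'a
    assume b: "b \<in> Basis"
    show "(\<lambda>n. (f (x + h n *\<^sub>R b) - f x) / h n) \<longlonglongrightarrow> grad_of f x \<bullet> b"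
      if h: "\<And>n. h n \<noteq> 0" "h \<longlonglongrightarrow> 0" for h :: "nat \<Rightarrow> real"
    proof -
      have d1: "((\<lambda>t. x + t *\<^sub>R b) has_derivative (\<lambda>h. h *\<^sub>R b)) (at 0)" by (auto intro!: derivative_eq_intros)
      have "(f has_derivative frechet_derivative f (at (x + 0 *\<^sub>R b))) (at (x + 0 *\<^sub>R b))"
        by (rule test_function_has_derivative[OF tf])
      from has_derivative_compose[OF d1 this]
      have "((\<lambda>t. f (x + t *\<^sub>R b)) has_derivative (\<lambda>h. frechet_derivative f (at x) (h *\<^sub>R b))) (at 0)" by simp
      moreover have "(\<lambda>h. frechet_derivative f (at x) (h *\<^sub>R b)) = (*) (frechet_derivative f (at x) b)"
        using linear_scale[OF has_derivative_linear[OF test_function_has_derivative[OF tf, of x]]] by (auto simp: fun_eq_iff)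
      ultimately have "((\<lambda>t. f (x + t *\<^sub>R b)) has_real_derivative frechet_derivative f (at x) b) (at 0)"
        by (simp only: has_field_derivative_def)
      then have "((\<lambda>t. (f (x + t *\<^sub>R b) - f x) / t) \<longlongrightarrow> frechet_derivative f (at x) b) (at 0)"
        by (simp add: has_field_derivative_iff)
      moreover have "filterlim h (at 0) sequentially" using h by (simp add: filterlim_at)
      ultimately show ?thesis unfolding grad_of_inner[OF tf] by (rule filterlim_compose)
    qed
    show "\<bar>f (x + h *\<^sub>R b) - f x\<bar> \<le> 0 * \<bar>0 - 0\<bar> + \<bar>h\<bar> * (L * indicat_real (ball 0 (R + 1)) x)" if h: "\<bar>h\<bar> \<le> 1" for h
    proof (cases "x \<in> ball 0 (R + 1)")
      case True
      then show ?thesis using test_function_lipschitz[OF tf L(2), of "x + h *\<^sub>R b" x] b by (simp add: mult.commute)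
    next
      case False
      then have "norm x \<ge> R + 1" by simp
      moreover have "norm x \<le> norm (x + h *\<^sub>R b) + norm (h *\<^sub>R b)" using norm_triangle_ineq4[of "x + h *\<^sub>R b" "h *\<^sub>R b"] by simp
      moreover have "norm (h *\<^sub>R b) \<le> 1" using b h by simp
      ultimately have "x + h *\<^sub>R b \<notin> \<Omega>" "x \<notin> \<Omega>" using R by auto
      then show ?thesis using bump_facts(4)[OF f] False by simp
    qed
  qed simp
qed

lemma bump_V:
  assumes f: "bump_in f"
  shows "f \<in> V" and "AE x in lborel. aL > 0 \<longrightarrow> gr f x = grad_of f x"
proof -
  note tf = bump_facts(1)[OF f]
  obtain L where L: "L > 0" "\<And>x. norm (grad_of f x) \<le> L" using grad_of_bounded[OF tf] by blast
  have "Lp_fun p lborel (grad_of f)"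
    by (rule bounded_off_integrable(2)[OF bump_meas(2)[OF f] L(2)]) (use bump_grad_zero[OF f] in auto)
  then have gg: "good_grad f (grad_of f)" using bump_wgrad[OF f] bump_grad_zero[OF f] by (simp add: good_grad_def)
  have "Lp_fun p MK (du f)"
    by (rule Lp_lipschitz[of f 1 L]) (use bump_meas[OF f] bump_facts[OF f] test_function_lipschitz[OF tf L(2)] in auto)
  then show fV: "f \<in> V" unfolding V_def using bump_facts[OF f] bump_meas[OF f] wgradD(1)[OF bump_wgrad[OF f]] gg by auto
  show "AE x in lborel. aL > 0 \<longrightarrow> gr f x = grad_of f x"
    using gr_AE[OF fV _ bump_wgrad[OF f]] by (cases "aL > 0") auto
qed

text \<open>Picone's test function: \<open>f\<close> to the power \<open>p\<close> divided by
  \<open>u + d\<close> to the power \<open>p - 1\<close>. The shift \<open>d > 0\<close> bounds the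
  denominator away from 0.\<close>

definition ptest :: "('a \<Rightarrow> real) \<Rightarrow> ('a \<Rightarrow> real) \<Rightarrow> real \<Rightarrow> 'a \<Rightarrow> real" where
  "ptest f u d x = f x powr p * (u x + d) powr (1 - p)"

text \<open>On nonnegative arguments \<open>z\<close> is Lipschitz with constant \<open>M\<close>,
  and \<open>f powr p\<close> is Lipschitz and bounded. Increments of the product are thus
  controlled by those of \<open>u\<close> plus a multiple of the step length near \<Omega>, the form
  that \<open>wgrad_chain\<close> requires.\<close>

lemma ptest_V:
  assumes f: "bump_in f" and u: "u \<in> V" and upos: "\<And>x. 0 \<le> u x" and d: "d > 0"
  shows "ptest f u d \<in> V"
    and "AE x in lborel. aL > 0 \<longrightarrow> gr (ptest f u d) x = (p * f x powr (p - 1) * (u x + d) powr (1 - p)) *\<^sub>R grad_of f x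
       - ((p - 1) * f x powr p * (u x + d) powr (- p)) *\<^sub>R gr u x"
proof -
  note tf = bump_facts(1)[OF f] and fV = bump_V(1)[OF f]
  note [measurable] = V_meas[OF u] gr_meas[OF u] bump_meas[OF f]
  obtain L where L: "L > 0" "\<And>x. norm (grad_of f x) \<le> L" using grad_of_bounded[OF tf] by blast
  define z where "z t = (t + d) powr (1 - p)" for t
  define M where "M = (p - 1) * d powr (- p)"
  define v where "v x = f x powr p * z (u x)" for x
  have vp: "ptest f u d = v" by (auto simp: ptest_def v_def z_def)
  have [measurable]: "z \<in> borel_measurable borel" unfolding z_def[abs_def] by measurable
  have vm [measurable]: "v \<in> borel_measurable borel" unfolding v_def[abs_def] by measurable
  have M0: "M \<ge> 0" using p1 by (simp add: M_def)
  have z0: "0 \<le> z t" for t by (simp add: z_def)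
  have zb: "z t \<le> d powr (1 - p)" if "t \<ge> 0" for t
    unfolding z_def using that d p1 by (intro powr_mono2') auto
  have zd: "(z has_real_derivative (1 - p) * (t + d) powr (- p)) (at t)" if "t \<ge> 0" for t
  proof -
    have "((\<lambda>t. t powr (1 - p)) has_real_derivative (1 - p) * (t + d) powr (1 - p - 1)) (at (t + d))"
      using that d by (intro has_real_derivative_powr) auto
    then show ?thesis unfolding z_def[abs_def] by (simp add: DERIV_shift)
  qed
  have zl: "\<bar>z s - z t\<bar> \<le> M * \<bar>s - t\<bar>" if "s \<ge> 0" "t \<ge> 0" for s t
  proof -
    have "norm (z s - z t) \<le> M * norm (s - t)"
    proof (rule field_differentiable_bound[of "{0..}" z "\<lambda>t. (1 - p) * (t + d) powr (- p)"])
      show "norm ((1 - p) * (t + d) powr (- p)) \<le> M" if "t \<in> {0..}" for t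
      proof -
        have "(t + d) powr (- p) \<le> d powr (- p)" using that d p1 by (intro powr_mono2') auto
        then show ?thesis using p1 by (simp add: M_def abs_mult)
      qed
    qed (use zd that in \<open>auto intro: has_field_derivative_at_within\<close>)
    then show ?thesis by simp
  qed
  have fp: "0 \<le> f x powr p" "f x powr p \<le> 1" for x
    using bump_facts(2,3)[OF f, of x] p1 by (auto intro: powr_le1)
  have fl: "\<bar>f x powr p - f y powr p\<bar> \<le> p * \<bar>f x - f y\<bar>" for x y
    using powr_lipschitz[OF p1(2), of "f x" 1 "f y"] bump_facts(2,3)[OF f] by simp
  have lip: "\<bar>v x - v y\<bar> \<le> p * d powr (1 - p) * \<bar>f x - f y\<bar> + M * \<bar>u x - u y\<bar>" for x y
  proof -
    have "v x - v y = (f x powr p - f y powr p) * z (u x) + f y powr p * (z (u x) - z (u y))"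
      by (simp add: v_def algebra_simps)
    also have "\<bar>\<dots>\<bar> \<le> \<bar>f x powr p - f y powr p\<bar> * \<bar>z (u x)\<bar> + \<bar>f y powr p\<bar> * \<bar>z (u x) - z (u y)\<bar>"
      by (rule order_trans[OF abs_triangle_ineq]) (simp add: abs_mult)
    also have "\<dots> \<le> (p * \<bar>f x - f y\<bar>) * d powr (1 - p) + 1 * (M * \<bar>u x - u y\<bar>)"
      using fl zb zl fp z0 upos p1 by (intro add_mono mult_mono) auto
    finally show ?thesis by (simp add: mult_ac)
  qed
  have off: "v x = 0" if "x \<notin> \<Omega>" for x using bump_facts(4)[OF f that] by (simp add: v_def)
  have vb: "\<bar>v x\<bar> \<le> d powr (1 - p)" for x
    using mult_mono[OF fp(2)[of x] zb[OF upos[of x]]] fp(1)[of x] z0[of "u x"] by (simp add: v_def)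
  have iv: "integrable lborel v"
    by (rule bounded_off_integrable(1)[where C="d powr (1 - p)"]) (use vb off \<Omega>_closure in auto)
  have dv: "Lp_fun p MK (du v)"
  proof (rule Lp_fun_dom)
    have a: "Lp_fun p MK (\<lambda>w. \<bar>g w\<bar>)" if "Lp_fun p MK g" for g :: "'a \<times> 'a \<Rightarrow> real"
      by (rule Lp_fun_dom[OF _ that]) (use Lp_fun_measurable[OF that] p1 in auto)
    show "Lp_fun p MK (\<lambda>w. (p * d powr (1 - p)) *\<^sub>R \<bar>du f w\<bar> + M *\<^sub>R \<bar>du u w\<bar>)"
      by (intro Lp_fun_add p1 Lp_fun_scaleR a V_du fV u)
    show "du v \<in> borel_measurable MK" using du_meas[OF vm] by (simp cong: measurable_cong_sets)
    show "norm (du v w) \<le> norm ((p * d powr (1 - p)) *\<^sub>R \<bar>du f w\<bar> + M *\<^sub>R \<bar>du u w\<bar>)" for w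
      using lip[of "fst w" "snd w"] by (simp add: du_def)
  qed (use p1 in simp)
  define H1 where "H1 x = (p * f x powr (p - 1) * z (u x)) *\<^sub>R grad_of f x" for x
  define H2 where "H2 x = ((p - 1) * f x powr p * (u x + d) powr (- p)) *\<^sub>R gr u x" for x
  define H where "H x = H1 x - H2 x" for x
  have [measurable]: "H1 \<in> borel_measurable borel" "H2 \<in> borel_measurable borel"
    unfolding H1_def[abs_def] H2_def[abs_def] by measurable
  have H1b: "norm (H1 x) \<le> p * 1 * d powr (1 - p) * L" for x
  proof -
    have "f x powr (p - 1) \<le> 1" using bump_facts(2,3)[OF f, of x] p1 by (intro powr_le1) auto
    then have "p * f x powr (p - 1) * z (u x) * norm (grad_of f x) \<le> p * 1 * d powr (1 - p) * L"
      using L(2)[of x] zb[OF upos[of x]] z0[of "u x"] p1 by (intro mult_mono mult_left_mono) auto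
    then show ?thesis using z0[of "u x"] p1 unfolding H1_def norm_scaleR by (simp add: abs_mult)
  qed
  have H1off: "H1 x = 0" if "x \<notin> closure \<Omega>" for x using bump_grad_zero[OF f that] by (simp add: H1_def)
  have H2b: "norm (H2 x) \<le> norm (M *\<^sub>R gr u x)" for x
  proof -
    have "(u x + d) powr (- p) \<le> d powr (- p)" using upos[of x] d p1 by (intro powr_mono2') auto
    then have "f x powr p * (u x + d) powr (- p) \<le> 1 * d powr (- p)" using fp[of x] by (intro mult_mono) auto
    then have "(p - 1) * (f x powr p * (u x + d) powr (- p)) \<le> M" unfolding M_def using p1 by (intro mult_left_mono) auto
    then show ?thesis unfolding H2_def norm_scaleR using p1 fp(1)[of x] M0
      by (intro mult_right_mono) (auto simp: abs_mult mult.assoc)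
  qed
  have gg: "good_grad v H" if aL: "aL > 0"
  proof -
    note wg = gr_wgrad[OF u aL]
    have i2: "integrable lborel H2"
      by (rule Bochner_Integration.integrable_bound[of _ "\<lambda>x. M *\<^sub>R gr u x"]) (use wgradD(2)[OF wg] H2b in auto)
    have i1: "integrable lborel H1" by (rule bounded_off_integrable(1)[OF _ H1b H1off]) auto
    obtain R where R: "R > 0" "\<Omega> \<subseteq> ball 0 R" using bounded_\<Omega> bounded_subset_ballD by blast
    have "wgrad v H"
    proof (rule wgrad_chain[OF wg iv, where c=M and K="\<lambda>x. p * d powr (1 - p) * L * indicat_real (ball 0 (R + 1)) x"])
      show "integrable lborel H" unfolding H_def using i1 i2 by simp
      show "integrable lborel (\<lambda>x. p * d powr (1 - p) * L * indicat_real (ball 0 (R + 1)) (x::'a))"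
        using emeasure_lborel_ball_finite[of "0::'a" "R + 1"] by (auto intro!: integrable_real_indicator)
      fix b x :: 'a assume b: "b \<in> Basis"
      show "(\<lambda>n. (v (x + h n *\<^sub>R b) - v x) / h n) \<longlonglongrightarrow> H x \<bullet> b"
        if h: "\<And>n. h n \<noteq> 0" "h \<longlonglongrightarrow> 0" and q: "(\<lambda>n. (u (x + h n *\<^sub>R b) - u x) / h n) \<longlonglongrightarrow> gr u x \<bullet> b" for h :: "nat \<Rightarrow> real"
      proof -
        have d1: "((\<lambda>t. x + t *\<^sub>R b) has_derivative (\<lambda>h. h *\<^sub>R b)) (at 0)" by (auto intro!: derivative_eq_intros)
        have "(f has_derivative frechet_derivative f (at (x + 0 *\<^sub>R b))) (at (x + 0 *\<^sub>R b))"
          by (rule test_function_has_derivative[OF tf])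
        from has_derivative_compose[OF d1 this]
        have "((\<lambda>t. f (x + t *\<^sub>R b)) has_derivative (\<lambda>h. frechet_derivative f (at x) (h *\<^sub>R b))) (at 0)" by simp
        moreover have "(\<lambda>h. frechet_derivative f (at x) (h *\<^sub>R b)) = (*) (frechet_derivative f (at x) b)"
          using linear_scale[OF has_derivative_linear[OF test_function_has_derivative[OF tf, of x]]] by (auto simp: fun_eq_iff)
        ultimately have "((\<lambda>t. f (x + t *\<^sub>R b)) has_real_derivative frechet_derivative f (at x) b) (at 0)"
          by (simp only: has_field_derivative_def)
        then have "((\<lambda>t. (f (x + t *\<^sub>R b) - f x) / t) \<longlongrightarrow> frechet_derivative f (at x) b) (at 0)"
          by (simp add: has_field_derivative_iff)
        moreover have "filterlim h (at 0) sequentially" using h by (simp add: filterlim_at)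
        ultimately have fq: "(\<lambda>n. (f (x + h n *\<^sub>R b) - f x) / h n) \<longlonglongrightarrow> grad_of f x \<bullet> b"
          unfolding grad_of_inner[OF tf] by (rule filterlim_compose)
        have fabs: "\<bar>f y\<bar> = f y" for y using bump_facts(2)[OF f, of y] by simp
        have e1: "(\<lambda>n. (f (x + h n *\<^sub>R b) powr p - f x powr p) / h n) \<longlonglongrightarrow> p * pflux p (f x) * (grad_of f x \<bullet> b)"
          using seq_chain(1)[OF has_real_derivative_abs_powr[OF p1(2)] h fq] by (simp add: fabs)
        have e2: "(\<lambda>n. (z (u (x + h n *\<^sub>R b)) - z (u x)) / h n) \<longlonglongrightarrow> (1 - p) * (u x + d) powr (- p) * (gr u x \<bullet> b)"
          by (rule seq_chain(1)[OF zd[OF upos] h q])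
        have e3: "(\<lambda>n. z (u (x + h n *\<^sub>R b))) \<longlonglongrightarrow> z (u x)"
          using seq_chain(2)[OF zd[OF upos] h q] DERIV_isCont[OF zd[OF upos]] isCont_tendsto_compose by blast
        have "(\<lambda>n. (f (x + h n *\<^sub>R b) powr p - f x powr p) / h n * z (u (x + h n *\<^sub>R b))
            + f x powr p * ((z (u (x + h n *\<^sub>R b)) - z (u x)) / h n))
          \<longlonglongrightarrow> p * pflux p (f x) * (grad_of f x \<bullet> b) * z (u x) + f x powr p * ((1 - p) * (u x + d) powr (- p) * (gr u x \<bullet> b))"
          by (intro tendsto_intros e1 e2 e3)
        moreover have "(f (x + h n *\<^sub>R b) powr p - f x powr p) / h n * z (u (x + h n *\<^sub>R b))
            + f x powr p * ((z (u (x + h n *\<^sub>R b)) - z (u x)) / h n) = (v (x + h n *\<^sub>R b) - v x) / h n" for n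
          using h(1)[of n] by (simp add: v_def field_simps)
        moreover have "pflux p (f x) = f x powr (p - 1)"
          using norm_pflux[of p "f x"] bump_facts(2)[OF f, of x] by (simp add: pflux_def abs_mult)
        then have "p * pflux p (f x) * (grad_of f x \<bullet> b) * z (u x) + f x powr p * ((1 - p) * (u x + d) powr (- p) * (gr u x \<bullet> b)) = H x \<bullet> b"
          by (simp add: H_def H1_def H2_def inner_diff_left algebra_simps)
        ultimately show ?thesis by simp
      qed
      show "\<bar>v (x + h *\<^sub>R b) - v x\<bar> \<le> M * \<bar>u (x + h *\<^sub>R b) - u x\<bar> + \<bar>h\<bar> * (p * d powr (1 - p) * L * indicat_real (ball 0 (R + 1)) x)"
        if h: "\<bar>h\<bar> \<le> 1" for h
      proof (cases "x \<in> ball 0 (R + 1)")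
        case True
        have "\<bar>f (x + h *\<^sub>R b) - f x\<bar> \<le> L * \<bar>h\<bar>" using test_function_lipschitz[OF tf L(2), of "x + h *\<^sub>R b" x] b by simp
        then have "p * d powr (1 - p) * \<bar>f (x + h *\<^sub>R b) - f x\<bar> \<le> p * d powr (1 - p) * (L * \<bar>h\<bar>)"
          using p1 by (intro mult_left_mono) auto
        then show ?thesis using True lip[of "x + h *\<^sub>R b" x] by (simp add: mult_ac)
      next
        case False
        then have "norm x \<ge> R + 1" by simp
        moreover have "norm x \<le> norm (x + h *\<^sub>R b) + norm (h *\<^sub>R b)" using norm_triangle_ineq4[of "x + h *\<^sub>R b" "h *\<^sub>R b"] by simp
        moreover have "norm (h *\<^sub>R b) \<le> 1" using b h by simp
        ultimately have "x + h *\<^sub>R b \<notin> \<Omega>" "x \<notin> \<Omega>" using R by auto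
        then show ?thesis using off M0 False by simp
      qed
    qed (rule M0)
    moreover have "Lp_fun p lborel H" unfolding H_def
    proof (rule Lp_fun_diff[OF p1(1)])
      show "Lp_fun p lborel H1" by (rule bounded_off_integrable(2)[OF _ H1b H1off]) auto
      show "Lp_fun p lborel H2" by (rule Lp_fun_dom[OF _ Lp_fun_scaleR[OF gr_Lp[OF u], of M] _ H2b]) (use p1 in auto)
    qed
    moreover have "\<forall>x. x \<notin> closure \<Omega> \<longrightarrow> H x = 0" using H1off gr_off[OF u] by (simp add: H_def H2_def)
    ultimately show ?thesis by (simp add: good_grad_def)
  qed
  show vV: "ptest f u d \<in> V" unfolding vp V_def using vm off iv dv gg by auto
  show "AE x in lborel. aL > 0 \<longrightarrow> gr (ptest f u d) x = (p * f x powr (p - 1) * (u x + d) powr (1 - p)) *\<^sub>R grad_of f x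
       - ((p - 1) * f x powr p * (u x + d) powr (- p)) *\<^sub>R gr u x"
  proof (cases "aL > 0")
    case True
    from gg[OF True] have "wgrad v H" by (simp add: good_grad_def)
    from gr_AE[OF vV True, unfolded vp, OF this] show ?thesis
      unfolding vp by eventually_elim (simp add: H_def H1_def H2_def z_def)
  qed simp
qed

end

subsection \<open>Comparison, Picone and boundedness\<close>

text \<open>The left side scales with \<open>t powr p\<close> and the right side with
  \<open>t\<close>, and \<open>t powr p \<le> t\<close> on \<open>[0, 1]\<close>. This transfers
  strong monotonicity to test functions that are contractions of the difference.\<close>

lemma pflux_mono_scaled:
  fixes x y :: "'e::real_inner"
  assumes p: "p \<ge> 2" and t: "0 \<le> t" "t \<le> 1"
  shows "2 powr (1 - p) * norm (t *\<^sub>R (x - y)) powr p \<le> (pflux p x - pflux p y) \<bullet> (t *\<^sub>R (x - y))"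
proof -
  have tp: "t powr p \<le> t"
  proof (cases "t = 0")
    case False
    then have "t powr p \<le> t powr 1" using t p by (intro powr_mono') auto
    then show ?thesis using t False by simp
  qed simp
  have "2 powr (1 - p) * norm (t *\<^sub>R (x - y)) powr p \<le> t * (2 powr (1 - p) * norm (x - y) powr p)"
  proof -
    have "2 powr (1 - p) * norm (t *\<^sub>R (x - y)) powr p = t powr p * (2 powr (1 - p) * norm (x - y) powr p)"
      using t by (simp add: powr_mult)
    also have "\<dots> \<le> t * (2 powr (1 - p) * norm (x - y) powr p)"
      using tp by (intro mult_right_mono) auto
    finally show ?thesis .
  qed
  also have "\<dots> \<le> t * ((pflux p x - pflux p y) \<bullet> (x - y))"
    using t pflux_strong_mono[OF p] by (intro mult_left_mono) auto
  finally show ?thesis by simp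
qed

text \<open>The factor is the secant slope, which lies in \<open>[0, 1]\<close> by monotonicity and
  the Lipschitz bound; it is the nonlocal counterpart of \<open>softpos'\<close> in the chain
  rule.\<close>

lemma softpos_quotient:
  "\<exists>r. 0 \<le> r \<and> r \<le> 1 \<and> softpos s - softpos t = r * (s - t)"
proof (cases "s = t")
  case False
  define r where "r = (softpos s - softpos t) / (s - t)"
  have "0 \<le> r" using softpos_mono[of s t] softpos_mono[of t s] False
    unfolding r_def zero_le_divide_iff by linarith
  moreover have "\<bar>r\<bar> \<le> 1" using softpos_lipschitz[of s t] False unfolding r_def abs_divide by (simp add: divide_le_eq)
  moreover have "softpos s - softpos t = r * (s - t)" using False by (simp add: r_def)
  ultimately show ?thesis by (intro exI[of _ r]) auto
qed (auto intro: exI[of _ 0])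

text \<open>De Giorgi's iteration lemma. The ansatz \<open>a n \<le> \<epsilon> * \<mu> ^ n\<close>
  reproduces itself if \<open>4 * \<mu> powr g = 1\<close>, which cancels the growing factor, and
  \<open>C * \<epsilon> powr g = \<mu>\<close>, which yields one more power of \<mu>. Solving for
  \<epsilon> gives the smallness condition.\<close>

lemma geometric_superlinear_decay:
  fixes a :: "nat \<Rightarrow> real"
  assumes C: "C > 0" and g: "g > 0" and a0: "\<And>n. 0 \<le> a n"
    and rec: "\<And>n. a (Suc n) \<le> C * 4 ^ n * a n powr (1 + g)"
    and small: "a 0 \<le> (4 powr (- 1 / g) / C) powr (1 / g)"
  shows "a \<longlonglongrightarrow> 0"
proof -
  define \<mu> :: real where "\<mu> = 4 powr (- 1 / g)"
  define \<epsilon> where "\<epsilon> = (\<mu> / C) powr (1 / g)"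
  have "(4::real) powr (- 1 / g) < 4 powr 0" using g by (intro powr_less_mono) auto
  then have mu: "0 < \<mu>" "\<mu> < 1" by (auto simp: \<mu>_def)
  have e: "\<epsilon> > 0" using mu C by (simp add: \<epsilon>_def)
  have eg: "C * \<epsilon> powr g = \<mu>" using C mu g by (simp add: \<epsilon>_def powr_powr)
  have mg: "4 * \<mu> powr g = 1" 
  proof -
    have "\<mu> powr g = 4 powr (- 1)" unfolding \<mu>_def powr_powr using g by simp
    then show ?thesis by (simp add: powr_minus)
  qed
  have le: "a n \<le> \<epsilon> * \<mu> ^ n" for n
  proof (induction n)
    case 0
    show ?case using small by (simp add: \<epsilon>_def \<mu>_def)
  next
    case (Suc n)
    have "a n powr (1 + g) \<le> (\<epsilon> * \<mu> ^ n) powr (1 + g)" using Suc a0[of n] g by (intro powr_mono2) auto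
    then have "C * 4 ^ n * a n powr (1 + g) \<le> C * 4 ^ n * (\<epsilon> * \<mu> ^ n) powr (1 + g)"
      using C by (intro mult_left_mono) auto
    with rec[of n] have "a (Suc n) \<le> C * 4 ^ n * (\<epsilon> * \<mu> ^ n) powr (1 + g)" by (rule order_trans)
    also have "(\<epsilon> * \<mu> ^ n) powr (1 + g) = (\<epsilon> * \<mu> ^ n) * (\<epsilon> powr g * (\<mu> powr g) ^ n)"
    proof -
      have "(\<epsilon> * \<mu> ^ n) powr g = \<epsilon> powr g * (\<mu> powr g) ^ n"
        using e mu by (simp add: powr_mult powr_powr mult.commute flip: powr_realpow)
      then show ?thesis using e mu by (simp add: powr_add)
    qed
    also have "C * 4 ^ n * ((\<epsilon> * \<mu> ^ n) * (\<epsilon> powr g * (\<mu> powr g) ^ n)) = (C * \<epsilon> powr g) * (\<epsilon> * \<mu> ^ n) * (4 * \<mu> powr g) ^ n"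
      by (simp add: power_mult_distrib)
    finally show ?case unfolding eg mg by (simp add: mult_ac)
  qed
  have lim: "(\<lambda>n. \<epsilon> * \<mu> ^ n) \<longlonglongrightarrow> 0" using mu by (intro tendsto_mult_right_zero LIMSEQ_realpow_zero) auto
  show ?thesis by (rule tendsto_sandwich[OF _ _ tendsto_const lim]) (use a0 le in auto)
qed

context mixed_energy
begin

section \<open>Comparison principle and Picone's inequality for the mixed form\<close>

lemma V_zero_if_L1_le:
  assumes "v \<in> V" "(\<integral>x. \<bar>v x\<bar> \<partial>lborel) \<le> 0" shows "AE x in lborel. v x = 0"
proof -
  have "(\<integral>x. \<bar>v x\<bar> \<partial>lborel) = 0" using assms(2) by (intro antisym) auto
  then show ?thesis
    using integral_nonneg_eq_0_iff_AE[of lborel "\<lambda>x. \<bar>v x\<bar>"] V_integrable[OF assms(1)] by simp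
qed

lemma AA_softpos_mono:
  assumes u: "u \<in> V" and w: "w \<in> V"
  shows "2 powr (1 - p) * NN (\<lambda>x. softpos (u x - w x)) \<le> AA u (\<lambda>x. softpos (u x - w x)) - AA w (\<lambda>x. softpos (u x - w x))"
proof -
  note d = V_diff[OF u w]
  define v where "v = (\<lambda>x. softpos (u x - w x))"
  have vV: "v \<in> V" unfolding v_def using V_softpos(1)[OF d, of 0] by simp
  have gv: "AE x in lborel. gr v x = softpos' (u x - w x) *\<^sub>R (gr u x - gr w x)"
  proof -
    have "AE x in lborel. gr v x = softpos' (u x - w x) *\<^sub>R gr (\<lambda>x. u x - w x) x"
      using V_softpos(2)[OF d, of 0] by (simp add: v_def)
    then show ?thesis using gr_diff[OF u w] by eventually_elim simp
  qed
  note i1 = integrable_pflux_inner[OF p2 V_du[OF u] V_du[OF vV]] integrable_pflux_inner[OF p2 V_du[OF w] V_du[OF vV]]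
  note i2 = integrable_pflux_inner[OF p2 gr_Lp[OF u] gr_Lp[OF vV]] integrable_pflux_inner[OF p2 gr_Lp[OF w] gr_Lp[OF vV]]
  have "2 powr (1 - p) * N1 v = (\<integral>z. 2 powr (1 - p) * norm (du v z) powr p \<partial>MK)" by (simp add: N1_def)
  also have "\<dots> \<le> (\<integral>z. pflux p (du u z) \<bullet> du v z - pflux p (du w z) \<bullet> du v z \<partial>MK)"
  proof (rule integral_mono)
    show "integrable MK (\<lambda>z. 2 powr (1 - p) * norm (du v z) powr p)" using Lp_fun_integrable[OF V_du[OF vV]] by simp
    show "integrable MK (\<lambda>z. pflux p (du u z) \<bullet> du v z - pflux p (du w z) \<bullet> du v z)" using i1 by (rule Bochner_Integration.integrable_diff)
    fix z
    obtain r where r: "0 \<le> r" "r \<le> 1" "softpos (u (fst z) - w (fst z)) - softpos (u (snd z) - w (snd z)) = r * ((u (fst z) - w (fst z)) - (u (snd z) - w (snd z)))"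
      using softpos_quotient by blast
    then have "du v z = r *\<^sub>R (du u z - du w z)" by (simp add: v_def du_def algebra_simps)
    then show "2 powr (1 - p) * norm (du v z) powr p \<le> pflux p (du u z) \<bullet> du v z - pflux p (du w z) \<bullet> du v z"
      using pflux_mono_scaled[OF p2 r(1,2), of "du u z" "du w z"] by (simp only: inner_diff_left)
  qed
  also have "\<dots> = A1 u v - A1 w v" unfolding A1_def by (rule Bochner_Integration.integral_diff[OF i1])
  finally have 1: "2 powr (1 - p) * N1 v \<le> A1 u v - A1 w v" .
  have "2 powr (1 - p) * N2 v = (\<integral>x. 2 powr (1 - p) * norm (gr v x) powr p \<partial>lborel)" by (simp add: N2_def)
  also have "\<dots> \<le> (\<integral>x. pflux p (gr u x) \<bullet> gr v x - pflux p (gr w x) \<bullet> gr v x \<partial>lborel)"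
  proof (rule integral_mono_AE)
    show "integrable lborel (\<lambda>z. 2 powr (1 - p) * norm (gr v z) powr p)" using Lp_fun_integrable[OF gr_Lp[OF vV]] by simp
    show "integrable lborel (\<lambda>z. pflux p (gr u z) \<bullet> gr v z - pflux p (gr w z) \<bullet> gr v z)" using i2 by (rule Bochner_Integration.integrable_diff)
    show "AE x in lborel. 2 powr (1 - p) * norm (gr v x) powr p \<le> pflux p (gr u x) \<bullet> gr v x - pflux p (gr w x) \<bullet> gr v x"
      using gv
    proof eventually_elim
      case (elim x)
      show ?case unfolding elim
        using pflux_mono_scaled[OF p2 softpos'_bounds, of _ "gr u x" "gr w x"] by (simp only: inner_diff_left)
    qed
  qed
  also have "\<dots> = A2 u v - A2 w v" unfolding A2_def by (rule Bochner_Integration.integral_diff[OF i2])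
  finally have 2: "2 powr (1 - p) * N2 v \<le> A2 u v - A2 w v" .
  have "aL * (2 powr (1 - p) * N2 v) \<le> aL * (A2 u v - A2 w v)" using 2 aL_nonneg by (rule mult_left_mono)
  with 1 show ?thesis unfolding NN_def AA_def v_def[symmetric] by (simp add: algebra_simps)
qed

text \<open>Testing with \<open>softpos (u x - w x)\<close> makes the energy of this function
  nonpositive; Poincare's inequality then makes it vanish almost everywhere.\<close>

lemma comparison:
  assumes u: "u \<in> V" and w: "w \<in> V"
    and le: "\<And>v. v \<in> V \<Longrightarrow> (\<And>x. 0 \<le> v x) \<Longrightarrow> AA u v \<le> AA w v"
  shows "AE x in lborel. u x \<le> w x"
proof -
  define v where "v = (\<lambda>x. softpos (u x - w x))"
  have vV: "v \<in> V" unfolding v_def using V_softpos(1)[OF V_diff[OF u w], of 0] by simp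
  have "2 powr (1 - p) * NN v \<le> 0"
    using AA_softpos_mono[OF u w] le[OF vV] unfolding v_def[symmetric] by (simp add: v_def)
  then have "NN v \<le> 0" by (simp add: mult_le_0_iff)
  then have "(\<integral>x. \<bar>v x\<bar> \<partial>lborel) powr p \<le> 0"
    using CP(2)[OF vV] CP(1) NN_nonneg[of v] by simp
  then have "(\<integral>x. \<bar>v x\<bar> \<partial>lborel) \<le> 0" by (simp add: powr_nonneg_iff)
  from V_zero_if_L1_le[OF vV this] show ?thesis
    by eventually_elim (simp add: v_def softpos_eq_0_iff)
qed

text \<open>The pointwise inequalities are integrated with \<open>u + d\<close> as the positive
  function; adding \<open>d\<close> changes neither the differences nor the gradient of
  \<open>u\<close>.\<close>

lemma picone:
  assumes f: "bump_in f" and u: "u \<in> V" and upos: "\<And>x. 0 \<le> u x" and d: "d > 0"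
  shows "AA u (ptest f u d) \<le> NN f"
proof -
  define v where "v = ptest f u d"
  have vV: "v \<in> V" unfolding v_def by (rule ptest_V(1)[OF f u upos d])
  note fV = bump_V(1)[OF f]
  have 1: "A1 u v \<le> N1 f" unfolding A1_def N1_def
  proof (rule integral_mono[OF integrable_pflux_inner[OF p2 V_du[OF u] V_du[OF vV]] Lp_fun_integrable[OF V_du[OF fV]]])
    fix z
    show "pflux p (du u z) \<bullet> du v z \<le> norm (du f z) powr p"
      using picone_discrete[OF p2, of "u (fst z) + d" "u (snd z) + d" "f (fst z)" "f (snd z)"] upos[of "fst z"] upos[of "snd z"] d
        bump_facts(2)[OF f, of "fst z"] bump_facts(2)[OF f, of "snd z"]
      by (simp add: du_def v_def ptest_def add_nonneg_pos)
  qed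
  have 2: "aL * A2 u v \<le> aL * N2 f"
  proof (cases "aL > 0")
    case True
    have "A2 u v \<le> N2 f" unfolding A2_def N2_def
    proof (rule integral_mono_AE[OF integrable_pflux_inner[OF p2 gr_Lp[OF u] gr_Lp[OF vV]] Lp_fun_integrable[OF gr_Lp[OF fV]]])
      show "AE x in lborel. pflux p (gr u x) \<bullet> gr v x \<le> norm (gr f x) powr p"
        using ptest_V(2)[OF f u upos d] bump_V(2)[OF f]
      proof eventually_elim
        case (elim x)
        have a: "gr v x = (p * f x powr (p - 1) * (u x + d) powr (1 - p)) *\<^sub>R gr f x - ((p - 1) * f x powr p * (u x + d) powr (- p)) *\<^sub>R gr u x"
          using elim True unfolding v_def by simp
        show ?case unfolding a
          by (rule picone_local[OF p2]) (use upos[of x] d bump_facts(2)[OF f, of x] in auto)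
      qed
    qed
    then show ?thesis using True by simp
  qed (use aL_nonneg in simp)
  from 1 2 show ?thesis unfolding AA_def NN_def v_def by linarith
qed

lemma A1_softpos_integrand:
  "0 \<le> pflux p (du u z) \<bullet> du (\<lambda>x. softpos (u x - T)) z"
proof -
  obtain r where r: "0 \<le> r" "r \<le> 1" "softpos (u (fst z) - T) - softpos (u (snd z) - T) = r * ((u (fst z) - T) - (u (snd z) - T))"
    using softpos_quotient by blast
  then have "du (\<lambda>x. softpos (u x - T)) z = r *\<^sub>R du u z" by (simp add: du_def)
  then have "pflux p (du u z) \<bullet> du (\<lambda>x. softpos (u x - T)) z = r * (pflux p (du u z) \<bullet> du u z)"
    by (simp add: mult.left_commute)
  then show ?thesis using r(1) by (simp only: pflux_inner_self) simp
qed

text \<open>The truncation of \<open>e\<close> at a level \<open>T\<close> is tested. Without a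
  local part, its interaction with \<open>Q\<close> exceeds the right-hand side once
  \<open>T\<close> is large. With a local part, the nonnegative nonlocal contribution is dropped and
  De Giorgi's iteration makes the measure of a superlevel set vanish; the gain in the exponent comes
  from the shrinking constant in \<open>wgrad_gain\<close>.\<close>

lemma linfty_bound:
  assumes e: "e \<in> V" and eq: "\<And>v. v \<in> V \<Longrightarrow> AA e v = (\<integral>x. v x \<partial>lborel)"
    and epos: "\<And>x. 0 \<le> e x"
  shows "\<exists>T>0. AE x in lborel. e x \<le> T"
proof (cases "aL > 0")
  case False
  then have aL: "aL = 0" using aL_nonneg by simp
  obtain k Q where k: "k > 0" "Q \<in> sets borel" "emeasure lborel Q < \<infinity>" "measure lborel Q > 0" "Q \<inter> \<Omega> = {}"
    "\<And>x y. x \<in> \<Omega> \<Longrightarrow> y \<in> Q \<Longrightarrow> k \<le> K (x - y)" using V_bump_region aL by metis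
  define c where "c = k * measure lborel Q"
  have c: "c > 0" using k by (simp add: c_def)
  \<comment> \<open>With \<open>c * T powr (p - 1) = 2\<close> the tested equation says that twice
    the integral of \<open>v\<close> is at most the integral of \<open>v\<close>.\<close>
  define T where "T = (2 / c) powr (1 / (p - 1))"
  have T: "T > 0" "T powr (p - 1) = 2 / c" using c p1 by (auto simp: T_def powr_powr)
  define v where "v x = softpos (e x - T)" for x
  have vV: "v \<in> V" unfolding v_def using V_softpos(1)[OF e, of T] T by simp
  have [measurable]: "v \<in> borel_measurable borel" by (rule V_meas[OF vV])
  have "k * measure lborel Q * (\<integral>x. T powr (p - 1) * v x \<partial>lborel) \<le> (\<integral>z. pflux p (du e z) \<bullet> du v z \<partial>MK)"
  proof (rule nonlocal_lower(2)[OF _ _ k(1-3) k(6)])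
    show "integrable MK (\<lambda>z. pflux p (du e z) \<bullet> du v z)" by (rule integrable_pflux_inner[OF p2 V_du[OF e] V_du[OF vV]])
    show "0 \<le> pflux p (du e z) \<bullet> du v z" for z unfolding v_def by (rule A1_softpos_integrand)
    show "0 \<le> T powr (p - 1) * v x" for x by (simp add: v_def)
    show "T powr (p - 1) * v x = 0" if "x \<notin> \<Omega>" for x using V_off[OF vV that] by simp
    show "T powr (p - 1) * v x \<le> pflux p (du e (x, y)) \<bullet> du v (x, y)" if "x \<in> \<Omega>" "y \<in> Q" for x y
    proof -
      have y: "y \<notin> \<Omega>" using that(2) k(5) by auto
      have "pflux p (e x) = e x powr (p - 1)" using norm_pflux[of p "e x"] epos[of x] by (simp add: pflux_def abs_mult)
      moreover have "T powr (p - 1) * v x \<le> e x powr (p - 1) * v x"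
      proof (cases "e x \<le> T")
        case False
        then show ?thesis using T p1 by (intro mult_right_mono powr_mono2) (auto simp: v_def)
      qed (auto simp: v_def softpos_eq_0_iff[THEN iffD2])
      ultimately show ?thesis using V_off[OF e y] V_off[OF vV y] by (simp add: du_def)
    qed
  qed auto
  also have "\<dots> = (\<integral>x. v x \<partial>lborel)" using eq[OF vV] unfolding AA_def A1_def by (simp add: aL)
  finally have "(\<integral>x. v x \<partial>lborel) \<le> 0" using T c k(1,4) by (simp add: c_def split: if_splits)
  then have "(\<integral>x. \<bar>v x\<bar> \<partial>lborel) \<le> 0" by (simp add: v_def)
  from V_zero_if_L1_le[OF vV this] have "AE x in lborel. e x \<le> T"
    by eventually_elim (simp add: v_def softpos_eq_0_iff)
  then show ?thesis using T(1) by blast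
next
  case aL: True
  note [measurable] = V_meas[OF e]
  define \<omega> where "\<omega> = measure lborel (ball (0::'a) 1)"
  have om: "\<omega> > 0" by (simp add: \<omega>_def content_ball_pos)
  define N where "N = real DIM('a)"
  have N: "N > 0" by (simp add: N_def)
  define al where "al T = measure lborel {x. e x > T}" for T
  have fin: "emeasure lborel {x. e x > T} < \<infinity>" if "T \<ge> 0" for T
  proof -
    have "emeasure lborel {x. e x > T} \<le> emeasure lborel \<Omega>"
      using V_off[OF e] that by (intro emeasure_mono) force+
    then show ?thesis using finite_\<Omega>(1) by (rule le_less_trans)
  qed
  \<comment> \<open>With \<open>X\<close> the integral of the truncation at \<open>T\<close>, the
    estimates below give \<open>X powr (p - 1) \<le> C * al T powr (p / N + (p - 1))\<close>: the
    radius in \<open>wgrad_gain\<close> contributes \<open>p / N\<close>, Jensen's inequality on the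
    superlevel set \<open>p - 1\<close>. Taking the root yields the exponent
    \<open>1 + g\<close>.\<close>
  define g where "g = p / (N * (p - 1))"
  have g: "g > 0" using p1 N by (simp add: g_def)
  define c where "c = ((2 * (2 / \<omega>) powr (1 / N)) powr p / aL) powr (1 / (p - 1))"
  have c: "c > 0" using om aL by (simp add: c_def)
  have main: "(\<integral>x. softpos (e x - T) \<partial>lborel) \<le> c * al T powr (1 + g)" if T: "T \<ge> 0" and pos: "al T > 0" for T
  proof -
    define v where "v x = softpos (e x - T)" for x
    have vV: "v \<in> V" and gv: "AE x in lborel. gr v x = softpos' (e x - T) *\<^sub>R gr e x"
      unfolding v_def using V_softpos[OF e T] by auto
    define X where "X = (\<integral>x. v x \<partial>lborel)"
    have X0: "X \<ge> 0" by (simp add: X_def v_def)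
    have vset: "{x. v x > 0} = {x. e x > T}" by (auto simp: v_def softpos_def)
    define r where "r = (2 * al T / \<omega>) powr (1 / N)"
    have r: "r > 0" using pos om by (simp add: r_def)
    have "measure lborel (ball (0::'a) r) = \<omega> * r powr N"
      using content_ball_conv_unit_ball[of r "0::'a"] r by (simp add: \<omega>_def N_def powr_realpow mult.commute)
    also have "r powr N = 2 * al T / \<omega>" using N pos om by (simp add: r_def powr_powr)
    finally have rb: "measure lborel (ball (0::'a) r) = 2 * al T" using om by simp
    have wv: "wgrad v (gr v)" by (rule gr_wgrad[OF vV aL])
    have gain: "X \<le> 2 * r * (\<integral>x. norm (gr v x) \<partial>lborel)"
      unfolding X_def
    proof (rule wgrad_gain[OF wv _ _ _ pos r rb])
      show "emeasure lborel {x. 0 < v x} < \<infinity>" "measure lborel {x. 0 < v x} = al T"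
        unfolding vset al_def by (rule fin[OF T] refl)+
    qed (simp add: v_def)
    have L1p: "(\<integral>x. norm (gr v x) \<partial>lborel) powr p \<le> al T powr (p - 1) * N2 v"
      unfolding N2_def
    proof (rule L1_le_Lp[OF p1(2) wgradD(2)[OF wv] Lp_fun_integrable[OF gr_Lp[OF vV]], where S="{x. e x > T}"])
      show "AE x in lborel. x \<notin> {x. e x > T} \<longrightarrow> gr v x = 0"
      proof -
        have "AE x in lborel. v x = 0 \<longrightarrow> gr v x = 0" by (rule wgrad_zero_set[OF wv]) (simp add: v_def)
        then show ?thesis by eventually_elim (auto simp: v_def softpos_eq_0_iff)
      qed
    qed (use fin[OF T] pos in \<open>auto simp: al_def\<close>)
    \<comment> \<open>The gradient of the truncation carries a factor \<open>t\<close> in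
      \<open>[0, 1]\<close>, and \<open>t powr p \<le> t\<close> bounds its energy by the flux of
      \<open>e\<close> paired with it; the nonlocal part of the form only helps.\<close>
    have N2X: "aL * N2 v \<le> X"
    proof -
      have "N2 v \<le> A2 e v" unfolding N2_def A2_def
      proof (rule integral_mono_AE[OF Lp_fun_integrable[OF gr_Lp[OF vV]] integrable_pflux_inner[OF p2 gr_Lp[OF e] gr_Lp[OF vV]]])
        show "AE x in lborel. norm (gr v x) powr p \<le> pflux p (gr e x) \<bullet> gr v x"
          using gv
        proof eventually_elim
          case (elim x)
          define t where "t = softpos' (e x - T)"
          have t: "0 \<le> t" "t \<le> 1" by (simp_all add: t_def softpos'_bounds)
          have "t powr p \<le> t"
          proof (cases "t = 0")
            case False
            then have "t powr p \<le> t powr 1" using t p1 by (intro powr_mono') auto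
            then show ?thesis using t False by simp
          qed simp
          then have "t powr p * norm (gr e x) powr p \<le> t * norm (gr e x) powr p" by (intro mult_right_mono) auto
          then show ?case unfolding elim t_def[symmetric] using t by (simp add: powr_mult pflux_inner_self)
        qed
      qed
      then have "aL * N2 v \<le> aL * A2 e v" using aL by simp
      moreover have "0 \<le> A1 e v" unfolding A1_def v_def by (intro integral_nonneg_AE AE_I2 A1_softpos_integrand)
      ultimately show ?thesis using eq[OF vV] by (simp add: AA_def X_def)
    qed
    have "X powr p \<le> (2 * r * (\<integral>x. norm (gr v x) \<partial>lborel)) powr p" using gain X0 p1 by (intro powr_mono2) auto
    also have "\<dots> = (2 * r) powr p * (\<integral>x. norm (gr v x) \<partial>lborel) powr p" using r by (simp add: powr_mult)
    also have "\<dots> \<le> (2 * r) powr p * (al T powr (p - 1) * (X / aL))"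
    proof (intro mult_left_mono order_trans[OF L1p])
      show "N2 v \<le> X / aL" using N2X aL by (simp add: field_simps)
    qed auto
    finally have Xp: "X powr p \<le> (2 * r) powr p * al T powr (p - 1) / aL * X" by simp
    have "X \<le> ((2 * r) powr p * al T powr (p - 1) / aL) powr (1 / (p - 1))"
    proof (cases "X = 0")
      case False
      then have Xpos: "X > 0" using X0 by simp
      have "X powr (p - 1) * X = X powr p" using powr_add[of X "p - 1" 1] Xpos by simp
      then have "X powr (p - 1) * X \<le> (2 * r) powr p * al T powr (p - 1) / aL * X" using Xp by (simp only:)
      then have "X powr (p - 1) \<le> (2 * r) powr p * al T powr (p - 1) / aL" using Xpos by (rule mult_right_le_imp_le)
      then have "(X powr (p - 1)) powr (1 / (p - 1)) \<le> ((2 * r) powr p * al T powr (p - 1) / aL) powr (1 / (p - 1))"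
        using p1 by (intro powr_mono2) auto
      then show ?thesis using p1 Xpos by (simp add: powr_powr)
    qed simp
    also have "(2 * r) powr p * al T powr (p - 1) / aL = (2 * (2 / \<omega>) powr (1 / N)) powr p / aL * (al T powr (p / N) * al T powr (p - 1))"
    proof -
      have "2 * r = (2 * (2 / \<omega>) powr (1 / N)) * al T powr (1 / N)"
        using pos om unfolding r_def by (simp add: powr_mult powr_divide)
      then have "(2 * r) powr p = (2 * (2 / \<omega>) powr (1 / N)) powr p * (al T powr (1 / N)) powr p"
        using pos om by (simp add: powr_mult)
      then show ?thesis by (simp add: powr_powr)
    qed
    also have "\<dots> powr (1 / (p - 1)) = c * (al T powr (p / N) * al T powr (p - 1)) powr (1 / (p - 1))"
      unfolding c_def using aL by (subst powr_mult) auto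
    also have "(al T powr (p / N) * al T powr (p - 1)) powr (1 / (p - 1)) = al T powr (1 + g)"
    proof -
      have "(p / N + (p - 1)) * (1 / (p - 1)) = 1 + g" using p1 N by (simp add: g_def field_simps)
      then show ?thesis unfolding powr_add[symmetric] powr_powr by (simp only:)
    qed
    finally show ?thesis by (simp add: X_def v_def)
  qed
  \<comment> \<open>Chebyshev's inequality: above the level \<open>T + d\<close> the truncation at
    \<open>T\<close> is at least \<open>d\<^sup>2 / 2\<close>. A superlevel set of measure 0 is
    treated apart because \<open>main\<close> requires positive measure.\<close>
  have step: "al (T + d) \<le> 2 * c / d\<^sup>2 * al T powr (1 + g)" if T: "T \<ge> 0" and d: "0 < d" "d \<le> 1" for T d
  proof (cases "al T > 0")
    case True
    have iv: "integrable lborel (\<lambda>x. softpos (e x - T))" using V_integrable[OF V_softpos(1)[OF e T]] .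
    have s: "{x. e x > T + d} \<in> sets lborel" by measurable
    have "(d\<^sup>2 / 2) * al (T + d) = (\<integral>x. (d\<^sup>2 / 2) * indicat_real {x. e x > T + d} x \<partial>lborel)"
      by (simp add: al_def)
    also have "\<dots> \<le> (\<integral>x. softpos (e x - T) \<partial>lborel)"
    proof (rule integral_mono[OF _ iv])
      show "integrable lborel (\<lambda>x. (d\<^sup>2 / 2) * indicat_real {x. e x > T + d} x)"
        using fin[of "T + d"] T d s by (auto intro!: integrable_real_indicator)
      fix x
      have "e x > T + d \<Longrightarrow> d\<^sup>2 / 2 \<le> softpos (e x - T)" using softpos_lower[of d] softpos_mono[of d "e x - T"] d by linarith
      then show "(d\<^sup>2 / 2) * indicat_real {x. e x > T + d} x \<le> softpos (e x - T)" by (auto split: split_indicator)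
    qed
    also have "\<dots> \<le> c * al T powr (1 + g)" by (rule main[OF T True])
    finally show ?thesis using d by (simp add: field_simps)
  next
    case False
    then have z: "al T = 0" using measure_nonneg[of lborel "{x. e x > T}"] unfolding al_def by linarith
    have "al (T + d) \<le> al T" unfolding al_def
      using fin[OF T] d by (intro measure_mono_fmeasurable) (auto simp: fmeasurable_def)
    then show ?thesis using z by simp
  qed
  \<comment> \<open>This is the smallness threshold of \<open>geometric_superlinear_decay\<close>
    for the constant \<open>8 * c\<close>; \<open>T0\<close> is chosen so large that Chebyshev's
    inequality brings \<open>al T0\<close> below it.\<close>
  define \<epsilon> where "\<epsilon> = (4 powr (- 1 / g) / (8 * c)) powr (1 / g)"
  have eps: "\<epsilon> > 0" using c by (simp add: \<epsilon>_def)
  define T0 where "T0 = (\<integral>x. e x \<partial>lborel) / \<epsilon> + 1"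
  have ie: "(\<integral>x. e x \<partial>lborel) \<ge> 0" using epos by simp
  have T0: "T0 > 0" using ie eps by (simp add: T0_def add_nonneg_pos)
  have a0: "al T0 \<le> \<epsilon>"
  proof -
    have "T0 * al T0 = (\<integral>x. T0 * indicat_real {x. e x > T0} x \<partial>lborel)" by (simp add: al_def)
    also have "\<dots> \<le> (\<integral>x. e x \<partial>lborel)"
    proof (rule integral_mono[OF _ V_integrable[OF e]])
      show "integrable lborel (\<lambda>x. T0 * indicat_real {x. e x > T0} x)"
        using fin[of T0] T0 by (auto intro!: integrable_real_indicator)
    qed (use epos in \<open>auto split: split_indicator\<close>)
    also have "\<dots> \<le> T0 * \<epsilon>" using eps ie by (simp add: T0_def field_simps)
    finally show ?thesis using T0 by simp
  qed
  \<comment> \<open>The levels rise from \<open>T0\<close> towards \<open>T0 + 1\<close> with gaps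
    \<open>(1/2) ^ Suc n\<close>. The square in \<open>step\<close> turns the gap into
    \<open>4 ^ Suc n\<close>, hence the constant \<open>8 * c\<close> in front of
    \<open>4 ^ n\<close>.\<close>
  define t where "t n = T0 + 1 - (1/2) ^ n" for n :: nat
  have t: "t n \<ge> 0" for n using T0 power_le_one[of "1/2::real" n] by (simp add: t_def)
  have "(\<lambda>n. al (t n)) \<longlonglongrightarrow> 0"
  proof (rule geometric_superlinear_decay[of "8 * c" g])
    show "al (t (Suc n)) \<le> 8 * c * 4 ^ n * al (t n) powr (1 + g)" for n
    proof -
      have "al (t n + (1/2) ^ Suc n) \<le> 2 * c / ((1/2) ^ Suc n)\<^sup>2 * al (t n) powr (1 + g)"
        by (rule step[OF t]) (use power_le_one[of "1/2::real" "Suc n"] in simp_all)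
      also have "t n + (1/2) ^ Suc n = t (Suc n)" by (simp add: t_def)
      also have "2 * c / ((1/2) ^ Suc n)\<^sup>2 = 8 * c * 4 ^ n"
      proof -
        have "((1/2::real) ^ Suc n)\<^sup>2 = (1/4) * (1 / 4) ^ n"
          by (simp add: power2_eq_square power_mult_distrib[symmetric] power_divide)
        then show ?thesis by (simp add: power_divide)
      qed
      finally show ?thesis .
    qed
    show "al (t 0) \<le> (4 powr (- 1 / g) / (8 * c)) powr (1 / g)" using a0 by (simp add: t_def \<epsilon>_def)
  qed (use c g in \<open>auto simp: al_def\<close>)
  moreover have "al (T0 + 1) \<le> al (t n)" for n
  proof -
    have "t n \<le> T0 + 1" by (simp add: t_def)
    then have "{x. e x > T0 + 1} \<subseteq> {x. e x > t n}" by auto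
    then show ?thesis unfolding al_def using fin[OF t] by (intro measure_mono_fmeasurable) (auto simp: fmeasurable_def)
  qed
  ultimately have "al (T0 + 1) \<le> 0" by (intro LIMSEQ_le_const) auto
  then have "measure lborel {x. e x > T0 + 1} = 0" using measure_nonneg[of lborel "{x. e x > T0 + 1}"] unfolding al_def by linarith
  then have "{x. e x > T0 + 1} \<in> null_sets lborel"
    using fin[of "T0 + 1"] T0 by (auto simp: null_sets_def measure_def enn2real_eq_0_iff)
  then have "AE x in lborel. e x \<le> T0 + 1" by (rule AE_I') auto
  then show ?thesis using T0 by (intro exI[of _ "T0 + 1"]) auto
qed

end

subsection \<open>Monotone iteration\<close>

context mixed_energy
begin

lemma AA_zero: "v \<in> V \<Longrightarrow> AA (\<lambda>_. 0) v = 0"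
  using AA_scale[OF V_zero, of v 0] p1 by simp

text \<open>By continuity the set where \<open>f\<close> is nonzero is open; a vanishing integral
  would make this nonempty set negligible.\<close>

lemma bump_integral_pos:
  assumes f: "bump_in f" shows "integrable lborel (\<lambda>x. f x powr p)" and "(\<integral>x. f x powr p \<partial>lborel) > 0"
proof -
  have [measurable]: "f \<in> borel_measurable borel" by (rule bump_meas[OF f])
  show i: "integrable lborel (\<lambda>x. f x powr p)"
    by (rule bounded_off_integrable(1)[where C=1])
      (use bump_facts[OF f] \<Omega>_closure p1 in \<open>auto intro!: powr_le1\<close>)
  have "(\<integral>x. f x powr p \<partial>lborel) \<noteq> 0"
  proof
    assume "(\<integral>x. f x powr p \<partial>lborel) = 0"
    then have "AE x in lborel. f x powr p = 0" using integral_nonneg_eq_0_iff_AE[OF i] by simp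
    then have "AE x in lborel. x \<notin> {x. f x \<noteq> 0}" by eventually_elim simp
    then have "{x. f x \<noteq> 0} \<in> null_sets lborel" by (subst AE_iff_null_sets) auto
    then have "negligible {x. f x \<noteq> 0}" by (metis negligible_iff_null_sets null_sets_completionI)
    moreover have "open {x. f x \<noteq> 0}"
      by (rule open_Collect_neq) (use test_function_continuous[OF bump_facts(1)[OF f]] in \<open>auto intro: continuous_intros\<close>)
    ultimately show False using f open_not_negligible[of "{x. f x \<noteq> 0}"] by (auto simp: bump_in_def)
  qed
  moreover have "(\<integral>x. f x powr p \<partial>lborel) \<ge> 0" by simp
  ultimately show "(\<integral>x. f x powr p \<partial>lborel) > 0" by linarith
qed

text \<open>The signs and bounds hold almost everywhere at first. The solution is clipped twice
  because \<open>linfty_bound\<close> expects a function that is already nonnegative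
  everywhere.\<close>

lemma torsion:
  obtains e T where "e \<in> V" "T > 0" "\<And>x. 0 \<le> e x" "\<And>x. e x \<le> T" "\<And>v. v \<in> V \<Longrightarrow> AA e v = (\<integral>x. v x \<partial>lborel)"
proof -
  obtain e0 where e0: "e0 \<in> V" "\<And>v. v \<in> V \<Longrightarrow> AA e0 v = (\<integral>x. v x \<partial>lborel)"
    using solve[of "\<lambda>_. 1" 1] by auto
  have pos: "AE x in lborel. 0 \<le> e0 x"
    by (rule comparison[OF V_zero e0(1)]) (use e0(2) AA_zero in auto)
  define e1 where "e1 x = max 0 (e0 x)" for x
  have e1m: "e1 \<in> borel_measurable borel" unfolding e1_def[abs_def] using V_meas[OF e0(1)] by measurable
  have e1off: "e1 x = 0" if "x \<notin> \<Omega>" for x using V_off[OF e0(1) that] by (simp add: e1_def)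
  have e1ae: "AE x in lborel. e1 x = e0 x" using pos by eventually_elim (simp add: e1_def)
  note e1 = V_cong_AE[OF e0(1) e1m e1off e1ae]
  have "\<exists>T>0. AE x in lborel. e1 x \<le> T"
    by (rule linfty_bound[OF e1(1)]) (use e1(2) e0(2) in \<open>auto simp: e1_def\<close>)
  then obtain T where T: "T > 0" "AE x in lborel. e1 x \<le> T" by blast
  define e where "e x = min T (e1 x)" for x
  have em: "e \<in> borel_measurable borel" unfolding e_def[abs_def] using e1m by measurable
  have eoff: "e x = 0" if "x \<notin> \<Omega>" for x using e1off[OF that] T by (simp add: e_def)
  have eae: "AE x in lborel. e x = e1 x" using T(2) by eventually_elim (simp add: e_def)
  note e = V_cong_AE[OF e1(1) em eoff eae]
  show thesis
  proof (rule that[of e T])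
    show "AA e v = (\<integral>x. v x \<partial>lborel)" if "v \<in> V" for v
      using that by (simp add: e(2) e1(2) e0(2))
    show "e \<in> V" by (rule e(1))
  qed (use T in \<open>auto simp: e_def e1_def\<close>)
qed

text \<open>The comparison principle gives \<open>0 \<le> w \<le> u\<close> only almost everywhere; the representative
  of the solution is changed on a null set.\<close>

lemma solve_clipped:
  assumes u: "u \<in> V" and ub: "\<And>x. 0 \<le> u x" "\<And>x. u x \<le> T"
    and G: "G \<in> borel_measurable borel" "\<And>v. v \<in> V \<Longrightarrow> AA u v = (\<integral>x. G x * v x \<partial>lborel)" "\<And>x. \<bar>G x\<bar> \<le> B"
    and g: "g \<in> borel_measurable borel" "\<And>x. 0 \<le> g x" "\<And>x. g x \<le> B" and le: "AE x in lborel. g x \<le> G x"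
  obtains w where "w \<in> V" "\<And>x. 0 \<le> w x" "\<And>x. w x \<le> T" "AE x in lborel. w x \<le> u x"
    "\<And>v. v \<in> V \<Longrightarrow> AA w v = (\<integral>x. g x * v x \<partial>lborel)"
proof -
  have gb: "\<bar>g x\<bar> \<le> B" for x using g(2,3)[of x] by simp
  obtain w0 where w0: "w0 \<in> V" "\<And>v. v \<in> V \<Longrightarrow> AA w0 v = (\<integral>x. g x * v x \<partial>lborel)"
    using solve[of g B] g(1) gb by auto
  have pos: "AE x in lborel. 0 \<le> w0 x"
  proof (rule comparison[OF V_zero w0(1)])
    fix v assume v: "v \<in> V" "\<And>x. 0 \<le> v x"
    have "0 \<le> (\<integral>x. g x * v x \<partial>lborel)" using v(2) g(2) by simp
    then show "AA (\<lambda>_. 0) v \<le> AA w0 v" using w0(2)[OF v(1)] AA_zero[OF v(1)] by simp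
  qed
  have wu: "AE x in lborel. w0 x \<le> u x"
  proof (rule comparison[OF w0(1) u])
    fix v assume v: "v \<in> V" "\<And>x. 0 \<le> v x"
    show "AA w0 v \<le> AA u v" unfolding w0(2)[OF v(1)] G(2)[OF v(1)]
    proof (rule integral_mono_AE)
      show "integrable lborel (\<lambda>x. g x * v x)" "integrable lborel (\<lambda>x. G x * v x)"
        using integrable_bounded_mult[OF v(1) _ gb] integrable_bounded_mult[OF v(1) _ G(3)] g(1) G(1) by auto
      show "AE x in lborel. g x * v x \<le> G x * v x"
        using le by eventually_elim (use v(2) in \<open>auto intro: mult_right_mono\<close>)
    qed
  qed
  define w where "w x = min T (max 0 (w0 x))" for x
  have T0: "T \<ge> 0" using ub[of undefined] by linarith
  have wm: "w \<in> borel_measurable borel" unfolding w_def[abs_def] using V_meas[OF w0(1)] by measurable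
  have woff: "w x = 0" if "x \<notin> \<Omega>" for x using V_off[OF w0(1) that] T0 by (simp add: w_def)
  have wae: "AE x in lborel. w x = w0 x"
    using pos wu
  proof eventually_elim
    case (elim x)
    then show ?case using ub(2)[of x] by (simp add: w_def)
  qed
  note w = V_cong_AE[OF w0(1) wm woff wae]
  show thesis
  proof (rule that[of w])
    show "AE x in lborel. w x \<le> u x" using wae wu by eventually_elim simp
    show "AA w v = (\<integral>x. g x * v x \<partial>lborel)" if "v \<in> V" for v
      using that by (simp add: w(2) w0(2))
    show "w \<in> V" by (rule w(1))
  qed (use T0 in \<open>auto simp: w_def\<close>)
qed

text \<open>The iteration starts at the supersolution \<open>c e\<close> and solves for
  \<open>h (u\<^sub>n + T / (n + 1))\<close>.  The shift decreases to \<open>0\<close>, so the iterates decrease;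
  it keeps every \<open>u\<^sub>n + T / (n + 1)\<close> away from \<open>0\<close>, so that Picone's inequality applies and excludes
  the limit \<open>0\<close> through the term \<open>l t\<^sup>m\<^sup>-\<^sup>1\<close> with \<open>m < p\<close>.\<close>

theorem monotone_iteration:
  obtains T1 where "T1 > 0"
    "\<And>h T c l m. \<lbrakk>T > 0; c > 0; c * T1 \<le> T; h (2 * T) \<le> c powr (p - 1);
       h \<in> borel_measurable borel; continuous_on {0..} h; mono_on {0..} h; l > 0; m < p;
       \<And>t. t > 0 \<Longrightarrow> l * t powr (m - 1) \<le> h t; 0 \<le> h 0\<rbrakk> \<Longrightarrow>
     \<exists>u\<in>V. (\<forall>x. 0 \<le> u x \<and> u x \<le> T) \<and> (\<forall>v\<in>V. AA u v = (\<integral>x. h (u x) * v x \<partial>lborel)) \<and> \<not> (AE x in lborel. u x = 0)"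
proof -
  obtain e T1 where e: "e \<in> V" "T1 > 0" "\<And>x. 0 \<le> e x" "\<And>x. e x \<le> T1" "\<And>v. v \<in> V \<Longrightarrow> AA e v = (\<integral>x. v x \<partial>lborel)"
    using torsion by blast
  show thesis
  proof (rule that[OF e(2)])
    fix h :: "real \<Rightarrow> real" and T c l m :: real
    assume T: "T > 0" and c: "c > 0" "c * T1 \<le> T" and hT: "h (2 * T) \<le> c powr (p - 1)"
      and hm [measurable]: "h \<in> borel_measurable borel" and hc: "continuous_on {0..} h" and hmono: "mono_on {0..} h"
      and l: "l > 0" and m: "m < p" and hl: "\<And>t. t > 0 \<Longrightarrow> l * t powr (m - 1) \<le> h t" and h0: "0 \<le> h 0"
    define B where "B = c powr (p - 1)"
    \<comment> \<open>Since \<open>d 0 = T\<close> and the iterates stay below \<open>T\<close>, the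
      arguments of \<open>h\<close> stay in \<open>[0, 2 * T]\<close>; this is the origin of the
      hypothesis on \<open>h (2 * T)\<close>.\<close>
    define d where "d n = T / real (Suc n)" for n
    have d: "d n > 0" "d n \<le> T" "d (Suc n) \<le> d n" for n using T by (auto simp: d_def divide_simps)
    have dlim: "d \<longlonglongrightarrow> 0"
      unfolding d_def using tendsto_mult_right_zero[OF LIMSEQ_Suc[OF lim_1_over_n], of T] by simp
    have hpos: "0 \<le> h t" if "t \<ge> 0" for t using mono_onD[OF hmono, of 0 t] that h0 by simp
    have hle: "h s \<le> h t" if "0 \<le> s" "s \<le> t" for s t using mono_onD[OF hmono, of s t] that by simp
    have hB: "h t \<le> B" if "0 \<le> t" "t \<le> 2 * T" for t using hle[OF that] hT by (simp add: B_def)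
    \<comment> \<open>The invariant keeps a density \<open>G\<close> of the right-hand side of the
      current iterate together with \<open>h (u x + d n) \<le> G x\<close>. This supersolution
      property is what the next comparison uses, and monotonicity of \<open>h\<close> and of
      \<open>d\<close> reproduces it.\<close>
    define P where "P n u \<longleftrightarrow> u \<in> V \<and> (\<forall>x. 0 \<le> u x \<and> u x \<le> T) \<and>
      (\<exists>G. G \<in> borel_measurable borel \<and> (\<forall>v\<in>V. AA u v = (\<integral>x. G x * v x \<partial>lborel)) \<and> (\<forall>x. \<bar>G x\<bar> \<le> B) \<and>
        (AE x in lborel. h (u x + d n) \<le> G x))" for n u
    define Q where "Q n u w \<longleftrightarrow> (AE x in lborel. w x \<le> u x) \<and>
      (\<forall>v\<in>V. AA w v = (\<integral>x. h (u x + d n) * v x \<partial>lborel))" for n and u w :: "'a \<Rightarrow> real"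
    have "\<exists>u. \<forall>n. P n (u n) \<and> Q n (u n) (u (Suc n))"
    proof (rule dependent_nat_choice)
      have b: "0 \<le> c * e x" "c * e x \<le> T" for x
      proof -
        have "c * e x \<le> c * T1" using c by (intro mult_left_mono e(4)) simp
        then show "c * e x \<le> T" using c(2) by linarith
      qed (use c e(3)[of x] in simp)
      \<comment> \<open>The form is homogeneous of degree \<open>p - 1\<close> in its first
        argument, so \<open>c * e\<close> has the constant right-hand side
        \<open>B = c powr (p - 1)\<close>, which bounds \<open>h\<close> on
        \<open>[0, 2 * T]\<close>.\<close>
      have "P 0 (\<lambda>x. c * e x)"
        unfolding P_def
      proof (intro conjI allI exI[of _ "\<lambda>_. B"] ballI AE_I2)
        show "h (c * e x + d 0) \<le> B" for x using b[of x] d(1,2)[of 0] by (intro hB) auto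
        show "AA (\<lambda>x. c * e x) v = (\<integral>x. B * v x \<partial>lborel)" if "v \<in> V" for v
          using AA_scale[OF e(1) that, of c] e(5)[OF that] c by (simp add: B_def)
      qed (use b V_scale[OF e(1)] in \<open>auto simp: B_def\<close>)
      then show "\<exists>u. P 0 u" by blast
      fix u n assume Pn: "P n u"
      then obtain G where G: "G \<in> borel_measurable borel" "\<And>v. v \<in> V \<Longrightarrow> AA u v = (\<integral>x. G x * v x \<partial>lborel)" "\<And>x. \<bar>G x\<bar> \<le> B"
        "AE x in lborel. h (u x + d n) \<le> G x" and u: "u \<in> V" "\<And>x. 0 \<le> u x" "\<And>x. u x \<le> T" unfolding P_def by blast
      have [measurable]: "u \<in> borel_measurable borel" by (rule V_meas[OF u(1)])
      have ud: "0 \<le> u x + d n" "u x + d n \<le> 2 * T" for x using u(2,3)[of x] d(1,2)[of n] by auto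
      have gm: "(\<lambda>x. h (u x + d n)) \<in> borel_measurable borel" by measurable
      obtain w where w: "w \<in> V" "\<And>x. 0 \<le> w x" "\<And>x. w x \<le> T" "AE x in lborel. w x \<le> u x"
        "\<And>v. v \<in> V \<Longrightarrow> AA w v = (\<integral>x. h (u x + d n) * v x \<partial>lborel)"
        using solve_clipped[OF u G(1-3) gm hpos[OF ud(1)] hB[OF ud] G(4)] by blast
      have "P (Suc n) w"
        unfolding P_def
      proof (intro conjI exI[of _ "\<lambda>x. h (u x + d n)"] allI ballI)
        show "AE x in lborel. h (w x + d (Suc n)) \<le> h (u x + d n)"
          using w(4)
        proof eventually_elim
          case (elim x)
          show ?case using w(2)[of x] d[of n] d(1)[of "Suc n"] elim by (intro hle) auto
        qed
        show "\<bar>h (u x + d n)\<bar> \<le> B" for x using hpos[OF ud(1)[of x]] hB[OF ud[of x]] by simp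
      qed (use w gm in auto)
      moreover have "Q n u w" using w by (auto simp: Q_def)
      ultimately show "\<exists>w. P (Suc n) w \<and> Q n u w" by blast
    qed
    then obtain us where us: "\<And>n. P n (us n)" "\<And>n. Q n (us n) (us (Suc n))" by blast
    have uV: "us n \<in> V" and ub: "0 \<le> us n x" "us n x \<le> T" for n x using us(1)[of n] by (auto simp: P_def)
    have dec: "AE x in lborel. us (Suc n) x \<le> us n x" for n using us(2)[of n] by (simp add: Q_def)
    have eqn: "AA (us (Suc n)) v = (\<integral>x. h (us n x + d n) * v x \<partial>lborel)" if "v \<in> V" for n v
      using us(2)[of n] that by (simp add: Q_def)
    note [measurable] = V_meas[OF uV]
    have decm: "AE x in lborel. us n x \<le> us k x" if "k \<le> n" for n k
      using that
    proof (induction n rule: dec_induct)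
      case (step n)
      from step.IH dec[of n] show ?case by eventually_elim simp
    qed simp
    \<comment> \<open>For an ordered sequence the \<open>L1\<close> distance is the difference of
      the integrals, so convergence of the decreasing numbers \<open>I n\<close> makes the iterates
      Cauchy in \<open>L1\<close>.\<close>
    define I where "I n = (\<integral>x. us n x \<partial>lborel)" for n
    have Idec: "decseq I" unfolding I_def decseq_def
      using decm V_integrable[OF uV] by (intro allI impI integral_mono_AE) auto
    have I0: "0 \<le> I n" for n unfolding I_def using ub by simp
    have "\<forall>n. 0 \<le> I n" using I0 by blast
    then have "convergent I" using decseq_convergent[OF Idec, of 0] unfolding convergent_def by metis
    then have Icau: "Cauchy I" by (simp add: Cauchy_convergent_iff)
    have IL: "(\<integral>x. \<bar>us n x - us k x\<bar> \<partial>lborel) = \<bar>I n - I k\<bar>" for n k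
    proof -
      have *: "(\<integral>x. \<bar>us n x - us k x\<bar> \<partial>lborel) = \<bar>I n - I k\<bar>" if "k \<le> n" for n k
      proof -
        have "(\<integral>x. \<bar>us n x - us k x\<bar> \<partial>lborel) = (\<integral>x. us k x - us n x \<partial>lborel)"
          using decm[OF that] by (intro integral_cong_AE) auto
        also have "\<dots> = I k - I n" using V_integrable[OF uV] by (simp add: I_def)
        finally show ?thesis using decseqD[OF Idec that] by simp
      qed
      show ?thesis using *[of k n] *[of n k] by (cases "k \<le> n") (auto simp: abs_minus_commute)
    qed
    have hb: "\<bar>h (us n x + d n)\<bar> \<le> B" for n x
      using hpos[of "us n x + d n"] hB[of "us n x + d n"] ub[of n x] d(1,2)[of n] by simp
    have Bpos: "B > 0" using c by (simp add: B_def)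
    \<comment> \<open>Strong monotonicity upgrades this to a Cauchy sequence in energy, because all
      right-hand sides are bounded by \<open>B\<close>. The index shift is due to
      \<open>eqn\<close>, which describes successors only.\<close>
    have Ncau: "\<exists>M. \<forall>j\<ge>M. \<forall>k\<ge>M. NN (\<lambda>x. us (Suc j) x - us (Suc k) x) \<le> \<epsilon>" if eps: "\<epsilon> > 0" for \<epsilon>
    proof -
      define r where "r = 2 powr (1 - p) * \<epsilon> / (2 * B)"
      have "r > 0" using eps Bpos by (simp add: r_def)
      then obtain M where M: "\<And>j k. j \<ge> M \<Longrightarrow> k \<ge> M \<Longrightarrow> \<bar>I j - I k\<bar> < r"
        using Icau unfolding Cauchy_def dist_real_def by blast
      have "NN (\<lambda>x. us (Suc j) x - us (Suc k) x) \<le> \<epsilon>" if jk: "j \<ge> M" "k \<ge> M" for j k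
      proof -
        define D where "D x = us (Suc j) x - us (Suc k) x" for x
        have DV: "D \<in> V" unfolding D_def by (rule V_diff[OF uV uV])
        have "2 powr (1 - p) * NN D \<le> AA (us (Suc j)) D - AA (us (Suc k)) D"
          unfolding D_def by (rule AA_mono[OF uV uV])
        also have "\<dots> \<le> B * (\<integral>x. \<bar>D x\<bar> \<partial>lborel) + B * (\<integral>x. \<bar>D x\<bar> \<partial>lborel)"
        proof -
          have "\<bar>\<integral>x. h (us n x + d n) * D x \<partial>lborel\<bar> \<le> B * (\<integral>x. \<bar>D x\<bar> \<partial>lborel)" for n
            by (rule bounded_mult_le[OF DV _ hb]) measurable
          from this[of j] this[of k] show ?thesis unfolding eqn[OF DV] by linarith
        qed
        also have "(\<integral>x. \<bar>D x\<bar> \<partial>lborel) \<le> r"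
          unfolding D_def IL using M[of "Suc j" "Suc k"] jk by simp
        then have "B * (\<integral>x. \<bar>D x\<bar> \<partial>lborel) + B * (\<integral>x. \<bar>D x\<bar> \<partial>lborel) \<le> 2 powr (1 - p) * \<epsilon>"
          using Bpos by (simp add: r_def field_simps)
        finally have "2 powr (1 - p) * NN D \<le> 2 powr (1 - p) * \<epsilon>" .
        then show ?thesis unfolding D_def by (simp add: mult_le_cancel_left)
      qed
      then show ?thesis by blast
    qed
    obtain u0 where u0: "u0 \<in> V" and Nlim: "(\<lambda>n. NN (\<lambda>x. us (Suc n) x - u0 x)) \<longlonglongrightarrow> 0"
      using V_complete[OF uV Ncau] by blast
    have L1S: "(\<lambda>n. \<integral>x. \<bar>us (Suc n) x - u0 x\<bar> \<partial>lborel) \<longlonglongrightarrow> 0"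
      by (rule L1_tendsto[OF V_diff[OF uV u0] Nlim])
    then have L1: "(\<lambda>n. \<integral>x. norm (us n x - u0 x) \<partial>lborel) \<longlonglongrightarrow> 0"
      using LIMSEQ_imp_Suc[of "\<lambda>n. \<integral>x. \<bar>us n x - u0 x\<bar> \<partial>lborel"] by simp
    obtain r :: "nat \<Rightarrow> nat" where r: "strict_mono r" "AE x in lborel. (\<lambda>n. us (r n) x - u0 x) \<longlonglongrightarrow> 0"
      using tendsto_L1_AE_subseq[of lborel "\<lambda>n x. us n x - u0 x", OF V_integrable[OF V_diff[OF uV u0]] L1] by blast
    have rl: "AE x in lborel. (\<lambda>n. us (r n) x) \<longlonglongrightarrow> u0 x" using r(2) by eventually_elim (rule LIM_zero_cancel)
    have ub0: "AE x in lborel. 0 \<le> u0 x \<and> u0 x \<le> T"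
      using rl by eventually_elim (use ub in \<open>auto intro: LIMSEQ_le_const LIMSEQ_le_const2\<close>)
    define u where "u x = min T (max 0 (u0 x))" for x
    have um [measurable]: "u \<in> borel_measurable borel" unfolding u_def[abs_def] using V_meas[OF u0] by measurable
    have uoff: "u x = 0" if "x \<notin> \<Omega>" for x using V_off[OF u0 that] T by (simp add: u_def)
    have uae: "AE x in lborel. u x = u0 x" using ub0 by eventually_elim (simp add: u_def)
    note u = V_cong_AE[OF u0 um uoff uae]
    have ubd: "0 \<le> u x" "u x \<le> T" for x using T by (auto simp: u_def)
    have rlu: "AE x in lborel. (\<lambda>n. us (r n) x) \<longlonglongrightarrow> u x" using rl uae by eventually_elim simp
    have drl: "(\<lambda>n. d (r n)) \<longlonglongrightarrow> 0" using LIMSEQ_subseq_LIMSEQ[OF dlim r(1)] by (simp add: o_def)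
    have weak: "AA u v = (\<integral>x. h (u x) * v x \<partial>lborel)" if v: "v \<in> V" for v
    proof -
      have [measurable]: "v \<in> borel_measurable borel" by (rule V_meas[OF v])
      have "(\<lambda>n. AA (us (Suc (r n))) v) \<longlonglongrightarrow> AA u0 v"
        using LIMSEQ_subseq_LIMSEQ[OF Nlim r(1)] by (intro AA_cont[OF uV u0 v]) (simp add: o_def)
      then have l1: "(\<lambda>n. \<integral>x. h (us (r n) x + d (r n)) * v x \<partial>lborel) \<longlonglongrightarrow> AA u v"
        unfolding eqn[OF v] u(2)[OF _ v, simplified] .
      have l2: "(\<lambda>n. \<integral>x. h (us (r n) x + d (r n)) * v x \<partial>lborel) \<longlonglongrightarrow> (\<integral>x. h (u x) * v x \<partial>lborel)"
      proof (rule integral_dominated_convergence[where w="\<lambda>x. B * \<bar>v x\<bar>"])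
        show "AE x in lborel. (\<lambda>n. h (us (r n) x + d (r n)) * v x) \<longlonglongrightarrow> h (u x) * v x"
          using rlu
        proof eventually_elim
          case (elim x)
          have "(\<lambda>n. us (r n) x + d (r n)) \<longlonglongrightarrow> u x + 0" by (intro tendsto_intros elim drl)
          then have "(\<lambda>n. us (r n) x + d (r n)) \<longlonglongrightarrow> u x" by simp
          moreover have "us (r n) x + d (r n) \<in> {0..}" for n using ub[of "r n" x] d(1)[of "r n"] by simp
          ultimately have "(\<lambda>n. h (us (r n) x + d (r n))) \<longlonglongrightarrow> h (u x)"
            using hc ubd(1)[of x] by (intro continuous_on_tendsto_compose[OF hc]) auto
          then show ?case by (intro tendsto_intros)
        qed
        show "AE x in lborel. norm (h (us (r n) x + d (r n)) * v x) \<le> B * \<bar>v x\<bar>" for n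
          using hb by (auto simp: abs_mult intro!: AE_I2 mult_right_mono)
      qed (use V_integrable[OF v] in auto)
      show ?thesis by (rule LIMSEQ_unique[OF l1 l2])
    qed
    have nontriv: "\<not> (AE x in lborel. u x = 0)"
    proof
      assume z: "AE x in lborel. u x = 0"
      obtain f where f: "bump_in f" using bump_in_exists by blast
      have [measurable]: "f \<in> borel_measurable borel" by (rule bump_meas[OF f])
      define F where "F = (\<integral>x. f x powr p \<partial>lborel)"
      have iF: "integrable lborel (\<lambda>x. f x powr p)" and F: "F > 0" using bump_integral_pos[OF f] by (auto simp: F_def)
      define k where "k = p - m"
      have k: "k > 0" using m by (simp add: k_def)
      have fp: "0 \<le> f x powr p" "f x powr p \<le> 1" for x
        using bump_facts(2,3)[OF f, of x] p1 by (auto intro: powr_le1)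
      have ifu: "integrable lborel (\<lambda>x. us n x * f x powr p)" for n
        by (rule integrable_mult_bounded[OF V_integrable[OF uV], of _ 1]) (use fp in auto)
      \<comment> \<open>The equation of the successor is tested with Picone's function. With
        \<open>y = us (Suc n) x + d n\<close>, monotonicity gives a density of at least
        \<open>l * y powr (- k)\<close>, and \<open>t powr (- k) * (1 - y / t)\<close> is a lower
        bound for \<open>y powr (- k)\<close>: for \<open>y \<le> t\<close> because the negative
        power decreases, for \<open>y > t\<close> because it is negative. This bound is affine in
        \<open>y\<close>, so convergence in \<open>L1\<close> suffices to pass to the limit.\<close>
      have key: "l * t powr (- k) * (F - (1 / t) * ((\<integral>x. us (Suc n) x * f x powr p \<partial>lborel) + d n * F)) \<le> NN f" if t: "t > 0" for t n
      proof -
        define w where "w = us (Suc n)"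
        have wpos: "0 \<le> w x" for x using ub by (simp add: w_def)
        have wV: "w \<in> V" using uV by (simp add: w_def)
        note pV = ptest_V(1)[OF f wV wpos d(1)[of n]]
        have "l * t powr (- k) * (F - (1 / t) * ((\<integral>x. w x * f x powr p \<partial>lborel) + d n * F))
           = (\<integral>x. l * t powr (- k) * (f x powr p - (1 / t) * (w x * f x powr p + d n * f x powr p)) \<partial>lborel)"
          using iF ifu[of "Suc n"] by (simp add: F_def w_def)
        also have "\<dots> \<le> (\<integral>x. h (us n x + d n) * ptest f w (d n) x \<partial>lborel)"
        proof (rule integral_mono_AE)
          show "integrable lborel (\<lambda>x. l * t powr (- k) * (f x powr p - (1 / t) * (w x * f x powr p + d n * f x powr p)))"
            using iF ifu[of "Suc n"] by (simp add: w_def)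
          show "integrable lborel (\<lambda>x. h (us n x + d n) * ptest f w (d n) x)"
            by (rule integrable_bounded_mult[OF pV _ hb]) measurable
          show "AE x in lborel. l * t powr (- k) * (f x powr p - (1 / t) * (w x * f x powr p + d n * f x powr p)) \<le> h (us n x + d n) * ptest f w (d n) x"
            using dec[of n]
          proof eventually_elim
            case (elim x)
            define y where "y = w x + d n"
            have y: "y > 0" using wpos[of x] d(1)[of n] by (simp add: y_def)
            have "l * y powr (m - 1) \<le> h y" using hl y by simp
            also have "\<dots> \<le> h (us n x + d n)" using elim wpos[of x] d(1)[of n] unfolding y_def w_def by (intro hle) auto
            finally have h1: "l * y powr (m - 1) \<le> h (us n x + d n)" .
            have h2: "t powr (- k) * (1 - y / t) \<le> y powr (- k)"
            proof (cases "y \<le> t")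
              case True
              have "t powr (- k) * (1 - y / t) \<le> t powr (- k) * 1" using y t by (intro mult_left_mono) auto
              also have "\<dots> \<le> y powr (- k)" using True y k by (simp add: powr_mono2')
              finally show ?thesis .
            next
              case False
              then have "t powr (- k) * (1 - y / t) \<le> 0" using t by (intro mult_nonneg_nonpos) (auto simp: field_simps)
              then show ?thesis by (rule order_trans) simp
            qed
            have "l * t powr (- k) * (f x powr p - (1 / t) * (w x * f x powr p + d n * f x powr p))
              = l * f x powr p * (t powr (- k) * (1 - y / t))" by (simp add: y_def algebra_simps add_divide_distrib)
            also have "\<dots> \<le> l * f x powr p * y powr (- k)" using h2 l fp by (intro mult_left_mono) auto
            also have "y powr (- k) = y powr (m - 1) * y powr (1 - p)" by (simp add: k_def flip: powr_add)
            also have "l * f x powr p * (y powr (m - 1) * y powr (1 - p)) = (l * y powr (m - 1)) * (f x powr p * y powr (1 - p))"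
              by simp
            also have "\<dots> \<le> h (us n x + d n) * (f x powr p * y powr (1 - p))" using h1 by (intro mult_right_mono) auto
            finally show ?case by (simp add: ptest_def y_def)
          qed
        qed
        also have "\<dots> = AA w (ptest f w (d n))" unfolding w_def using eqn[OF pV] by (simp add: w_def)
        also have "\<dots> \<le> NN f" by (rule picone[OF f wV wpos d(1)])
        finally show ?thesis by (simp add: w_def)
      qed
      have lim0: "(\<lambda>n. \<integral>x. us (Suc n) x * f x powr p \<partial>lborel) \<longlonglongrightarrow> 0"
      proof -
        have "(\<lambda>n. \<integral>x. us (Suc n) x * f x powr p \<partial>lborel) \<longlonglongrightarrow> (\<integral>x. u0 x * f x powr p \<partial>lborel)"
          by (rule L1_tendsto_mult_bounded[OF V_integrable[OF uV] V_integrable[OF u0] L1S, of _ 1]) (use fp in auto)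
        moreover have "(\<integral>x. u0 x * f x powr p \<partial>lborel) = (\<integral>x. 0 \<partial>(lborel :: 'a measure))"
          using z uae V_meas[OF u0] by (intro integral_cong_AE) auto
        ultimately show ?thesis by simp
      qed
      have fin: "l * t powr (- k) * F \<le> NN f" if t: "t > 0" for t
      proof -
        have "(\<lambda>n. l * t powr (- k) * (F - (1 / t) * ((\<integral>x. us (Suc n) x * f x powr p \<partial>lborel) + d n * F)))
          \<longlonglongrightarrow> l * t powr (- k) * (F - (1 / t) * (0 + 0 * F))"
          by (intro tendsto_intros lim0 dlim)
        then show ?thesis using key[OF t] by (intro LIMSEQ_le_const2[of _ "l * t powr (- k) * F"]) auto
      qed
      \<comment> \<open>The choice gives \<open>l * t powr (- k) * F = NN f + 1\<close>, while
        \<open>fin\<close> bounds this quantity by \<open>NN f\<close>.\<close>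
      define y where "y = (NN f + 1) / (l * F)"
      define t where "t = y powr (- 1 / k)"
      have q: "y > 0" unfolding y_def using NN_nonneg[of f] l F by (simp add: add_nonneg_pos)
      then have "t > 0" unfolding t_def powr_gt_zero by linarith
      moreover have "t powr (- k) = y" using q k by (simp add: t_def powr_powr)
      ultimately have "l * y * F \<le> NN f" using fin[of t] by simp
      then show False using l F by (simp add: y_def)
    qed
    show "\<exists>u\<in>V. (\<forall>x. 0 \<le> u x \<and> u x \<le> T) \<and> (\<forall>v\<in>V. AA u v = (\<integral>x. h (u x) * v x \<partial>lborel)) \<and> \<not> (AE x in lborel. u x = 0)"
      using u(1) ubd weak nontriv by blast
  qed
qed

end

subsection \<open>The mixed kernel\<close>

lemma frac_const_pos:
  assumes "N > 0" "p > 0" "0 < s" "s < 1" shows "frac_const N p s > 0"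
  unfolding frac_const_def using assms
  by (intro mult_pos_pos divide_pos_pos Gamma_real_pos powr_gt_zero[THEN iffD2]) (auto intro!: add_pos_nonneg)

lemma frac_const_1 [simp]: "frac_const N p 1 = 0"
  by (simp add: frac_const_def)

text \<open>The constant is \<open>s\<close> times a function that is continuous on the closed
  interval \<open>[0, 1]\<close>, as the arguments of \<open>Gamma\<close> stay positive there. The
  explicit factor \<open>s\<close> later cancels the growth of the tail integral for small
  orders.\<close>

lemma frac_const_bound:
  assumes "N > 0" "p > 0"
  shows "\<exists>c>0. \<forall>s. 0 < s \<longrightarrow> s \<le> 1 \<longrightarrow> 0 \<le> frac_const N p s \<and> frac_const N p s \<le> c * s"
proof -
  define F where "F s = (p / 2 * (1 - s) * 2 powr (2 * s - 1)) / pi powr ((N - 1) / 2) *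
     (Gamma ((N + p * s) / 2) / (Gamma ((p + 1) / 2) * Gamma (2 - s)))" for s
  have G: "0 < (N + p * s) / 2" "0 < 2 - s" if "s \<in> {0..1}" for s
    using that assms by (auto intro!: add_pos_nonneg)
  have cG: "continuous_on {0<..} (Gamma :: real \<Rightarrow> real)"
    by (rule continuous_on_Gamma) (auto elim!: nonpos_Ints_cases)
  have c1: "continuous_on {0..1} (\<lambda>s. Gamma ((N + p * s) / 2))"
    by (rule continuous_on_compose2[OF cG]) (use G in \<open>auto intro!: continuous_intros\<close>)
  have c2: "continuous_on {0..1} (\<lambda>s::real. Gamma (2 - s))"
    by (rule continuous_on_compose2[OF cG]) (use G in \<open>auto intro!: continuous_intros\<close>)
  have p1: "Gamma ((p + 1) / 2) > 0" by (intro Gamma_real_pos) (use assms in simp)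
  have p2: "Gamma (2 - s) > 0" if "s \<in> {0..1}" for s :: real by (intro Gamma_real_pos G that)
  have ne: "Gamma ((p + 1) / 2) * Gamma (2 - s) \<noteq> 0" if "s \<in> {0..1}" for s
    using p1 p2[OF that] by (simp add: less_imp_neq[symmetric])
  have "continuous_on {0..1} F"
    unfolding F_def using ne by (intro continuous_intros c1 c2) auto
  then have "bounded (F ` {0..1})" by (intro compact_imp_bounded compact_continuous_image) auto
  then obtain c where c: "c > 0" "\<And>s. s \<in> {0..1} \<Longrightarrow> \<bar>F s\<bar> \<le> c" unfolding bounded_pos by force
  have eq: "frac_const N p s = s * F s" for s by (simp add: frac_const_def F_def)
  have "0 \<le> frac_const N p s \<and> frac_const N p s \<le> c * s" if "0 < s" "s \<le> 1" for s
  proof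
    show "0 \<le> frac_const N p s" using frac_const_pos[OF assms, of s] that by (cases "s = 1") auto
    have "s * F s \<le> s * c" using c(2)[of s] that by (intro mult_left_mono) auto
    then show "frac_const N p s \<le> c * s" by (simp add: eq mult.commute)
  qed
  then show ?thesis using c(1) by blast
qed

lemma emeasure_ball_powr:
  assumes "r \<ge> 0"
  shows "emeasure lborel (ball (0::'a::euclidean_space) r) = ennreal (measure lborel (ball (0::'a) 1) * r ^ DIM('a))"
proof -
  have "emeasure lborel (ball (0::'a) r) = ennreal (measure lborel (ball (0::'a) r))"
    using emeasure_lborel_ball_finite[of "0::'a" r] by (simp add: emeasure_eq_ennreal_measure)
  then show ?thesis using content_ball_conv_unit_ball[OF assms, of "0::'a"] by (simp add: mult.commute)
qed

text \<open>The bound, from dyadic shells, stays bounded after multiplication by \<open>frac_const\<close>, whose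
  factor \<open>s (1 - s)\<close> compensates both poles; this makes the sum over the orders \<open>s\<^sub>k\<close> converge.\<close>

lemma riesz_kernel_integral:
  fixes p s :: real
  assumes p: "p > 0" and s: "0 < s" "s < 1"
  defines "\<omega> \<equiv> measure lborel (ball (0::'a::euclidean_space) 1)"
  shows "(\<integral>\<^sup>+z. ennreal (min 1 (norm (z::'a) powr p) / norm z powr (real DIM('a) + s * p)) \<partial>lborel)
    \<le> ennreal (\<omega> * 2 ^ DIM('a) * (1 / (1 - 2 powr (- (s * p))) + 1 / (1 - 2 powr (- (p * (1 - s))))))"
proof -
  define D where "D = DIM('a)"
  define a where "a = (2::real) powr (- (s * p))"
  define b where "b = (2::real) powr (- (p * (1 - s)))"
  have a: "0 < a" "a < 1"
  proof -
    have "(2::real) powr (- (s * p)) < 2 powr 0" using p s by (intro powr_less_mono) auto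
    then show "0 < a" "a < 1" by (auto simp: a_def)
  qed
  have b: "0 < b" "b < 1"
  proof -
    have "(2::real) powr (- (p * (1 - s))) < 2 powr 0" using p s by (intro powr_less_mono) auto
    then show "0 < b" "b < 1" by (auto simp: b_def)
  qed
  \<comment> \<open>\<open>f j\<close> majorises the integrand on the shell
    \<open>2 ^ j \<le> norm z < 2 ^ Suc j\<close>, and \<open>g j\<close> on
    \<open>(1/2) ^ Suc j \<le> norm z < (1/2) ^ j\<close>. Both are constant on balls, and their
    integrals form geometric series with ratios \<open>a\<close> and \<open>b\<close>.\<close>
  define f where "f j z = a ^ j * (1/2) ^ (j * D) * indicat_real (ball 0 (2 ^ Suc j)) z" for j and z :: 'a
  define g where "g j z = b ^ j * 2 ^ (Suc j * D) * indicat_real (ball 0 ((1/2) ^ j)) z" for j and z :: 'a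
  have pt: "ennreal (min 1 (norm z powr p) / norm z powr (real D + s * p)) \<le> (\<Sum>j. ennreal (f j z)) + (\<Sum>j. ennreal (g j z))" for z :: 'a
  proof -
    have le_suminf: "F j \<le> (\<Sum>j. F j)" for F :: "nat \<Rightarrow> ennreal" and j
      using sum_le_suminf[of F "{j}"] by simp
    consider "z = 0" | "norm z \<ge> 1" | "0 < norm z" "norm z < 1" by force
    then show ?thesis
    proof cases
      case 1
      then show ?thesis by simp
    next
      case 2
      define P where "P j \<longleftrightarrow> norm z < 2 ^ Suc j" for j
      have ex: "\<exists>j. P j"
        using real_arch_pow[of 2 "norm z"] unfolding P_def by (meson less_trans one_less_numeral_iff power_strict_increasing_iff lessI semiring_norm(76))
      define j where "j = (LEAST j. P j)"
      have j: "norm z < 2 ^ Suc j" using LeastI_ex[OF ex] unfolding j_def P_def .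
      have jl: "2 ^ j \<le> norm z"
      proof (cases j)
        case 0
        then show ?thesis using 2 by simp
      next
        case (Suc i)
        then have "\<not> P i" using not_less_Least[of i P] by (simp add: j_def)
        then show ?thesis using Suc by (simp add: P_def)
      qed
      have "min 1 (norm z powr p) / norm z powr (real D + s * p) \<le> 1 / (2 ^ j) powr (real D + s * p)"
        using jl 2 p s by (intro frac_le powr_mono2) auto
      also have "\<dots> = a ^ j * (1/2) ^ (j * D)"
      proof -
        have "((2::real) ^ j) powr (real D + s * p) = (2 ^ j) powr real D * (2 ^ j) powr (s * p)" by (simp add: powr_add)
        also have "((2::real) ^ j) powr real D = 2 ^ (j * D)" by (simp add: powr_realpow power_mult)
        also have "((2::real) ^ j) powr (s * p) = 1 / a ^ j"
          by (simp add: a_def powr_minus powr_powr mult.commute power_divide inverse_eq_divide flip: powr_realpow)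
        finally show ?thesis by (simp add: power_divide)
      qed
      also have "\<dots> = f j z" using j by (simp add: f_def)
      finally have "ennreal (min 1 (norm z powr p) / norm z powr (real D + s * p)) \<le> ennreal (f j z)" by (rule ennreal_leI)
      also have "\<dots> \<le> (\<Sum>j. ennreal (f j z))" by (rule le_suminf)
      also have "\<dots> \<le> (\<Sum>j. ennreal (f j z)) + (\<Sum>j. ennreal (g j z))" by simp
      finally show ?thesis .
    next
      case 3
      define P where "P j \<longleftrightarrow> (1/2) ^ Suc j \<le> norm z" for j
      have ex: "\<exists>j. P j"
      proof -
        obtain n where "(1/2::real) ^ n < norm z" using real_arch_pow_inv[of "norm z" "1/2"] 3 by auto
        moreover have "(1/2::real) ^ Suc n \<le> (1/2) ^ n" by simp
        ultimately show ?thesis unfolding P_def by (intro exI[of _ n]) linarith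
      qed
      define j where "j = (LEAST j. P j)"
      have j: "(1/2) ^ Suc j \<le> norm z" using LeastI_ex[OF ex] unfolding j_def P_def .
      have jl: "norm z < (1/2) ^ j"
      proof (cases j)
        case 0
        then show ?thesis using 3 by simp
      next
        case (Suc i)
        then have "\<not> P i" using not_less_Least[of i P] by (simp add: j_def)
        then show ?thesis using Suc by (simp add: P_def)
      qed
      have "norm z powr p \<le> 1" using 3 p by (intro powr_le1) auto
      then have "min 1 (norm z powr p) / norm z powr (real D + s * p) = norm z powr p / norm z powr (real D + s * p)" by simp
      also have "\<dots> = norm z powr (p * (1 - s)) / norm z powr real D"
        using 3 by (simp add: algebra_simps flip: powr_diff)
      also have "\<dots> \<le> ((1/2) ^ j) powr (p * (1 - s)) / ((1/2) ^ Suc j) powr real D"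
        using j jl 3 p s by (intro frac_le powr_mono2) auto
      also have "\<dots> = b ^ j * 2 ^ (Suc j * D)"
      proof -
        have "((1/2::real) ^ j) powr (p * (1 - s)) = b ^ j"
        proof -
          have "((1/2::real) ^ j) powr (p * (1 - s)) = ((1/2) powr (p * (1 - s))) ^ j"
            by (simp add: powr_powr mult.commute flip: powr_realpow)
          then show ?thesis by (simp add: b_def powr_minus powr_divide inverse_eq_divide)
        qed
        moreover have "((1/2::real) ^ Suc j) powr real D = 1 / 2 ^ (Suc j * D)"
        proof -
          have "((1/2::real) ^ Suc j) powr real D = ((1/2) ^ Suc j) ^ D" by (rule powr_realpow) simp
          then show ?thesis by (simp only: power_mult[symmetric] power_one_over)
        qed
        ultimately show ?thesis by (simp only: divide_divide_eq_right div_by_1 mult.right_neutral)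
      qed
      also have "\<dots> = g j z" using jl by (simp add: g_def)
      finally have "ennreal (min 1 (norm z powr p) / norm z powr (real D + s * p)) \<le> ennreal (g j z)" by (rule ennreal_leI)
      also have "\<dots> \<le> (\<Sum>j. ennreal (g j z))" by (rule le_suminf)
      also have "\<dots> \<le> (\<Sum>j. ennreal (f j z)) + (\<Sum>j. ennreal (g j z))" by simp
      finally show ?thesis .
    qed
  qed
  have [measurable]: "f j \<in> borel_measurable borel" "g j \<in> borel_measurable borel" for j
    unfolding f_def[abs_def] g_def[abs_def]
    by (intro borel_measurable_times borel_measurable_const borel_measurable_indicator; simp)+
  have ind: "(\<integral>\<^sup>+z. ennreal (c * indicat_real (ball (0::'a) r) z) \<partial>lborel) = ennreal (c * (\<omega> * r ^ D))" if "c \<ge> 0" "r \<ge> 0" for c r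
  proof -
    have "(\<integral>\<^sup>+z. ennreal (c * indicat_real (ball (0::'a) r) z) \<partial>lborel) = (\<integral>\<^sup>+z. ennreal c * indicator (ball (0::'a) r) z \<partial>lborel)"
      by (intro nn_integral_cong) (auto split: split_indicator)
    also have "\<dots> = ennreal c * ennreal (\<omega> * r ^ D)"
      using emeasure_ball_powr[OF that(2), where 'a='a] by (subst nn_integral_cmult_indicator) (auto simp: \<omega>_def D_def)
    also have "\<dots> = ennreal (c * (\<omega> * r ^ D))" using that by (simp add: ennreal_mult \<omega>_def)
    finally show ?thesis .
  qed
  have If: "(\<integral>\<^sup>+z. ennreal (f j z) \<partial>lborel) = ennreal (\<omega> * 2 ^ D * a ^ j)" for j
  proof -
    have "(\<integral>\<^sup>+z. ennreal (f j z) \<partial>lborel) = ennreal (a ^ j * (1/2) ^ (j * D) * (\<omega> * (2 ^ Suc j) ^ D))"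
      unfolding f_def by (rule ind) (use a in auto)
    also have "a ^ j * (1/2) ^ (j * D) * (\<omega> * (2 ^ Suc j) ^ D) = \<omega> * 2 ^ D * a ^ j"
      by (simp add: power_mult_distrib power_divide power_mult)
    finally show ?thesis .
  qed
  have Ig: "(\<integral>\<^sup>+z. ennreal (g j z) \<partial>lborel) = ennreal (\<omega> * 2 ^ D * b ^ j)" for j
  proof -
    have "(\<integral>\<^sup>+z. ennreal (g j z) \<partial>lborel) = ennreal (b ^ j * 2 ^ (Suc j * D) * (\<omega> * ((1/2) ^ j) ^ D))"
      unfolding g_def by (rule ind) (use b in auto)
    also have "b ^ j * 2 ^ (Suc j * D) * (\<omega> * ((1/2) ^ j) ^ D) = \<omega> * 2 ^ D * b ^ j"
      by (simp add: power_add power_divide power_mult)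
    finally show ?thesis .
  qed
  have om: "\<omega> \<ge> 0" by (simp add: \<omega>_def)
  have geo: "(\<Sum>j. ennreal (\<omega> * 2 ^ D * x ^ j)) = ennreal (\<omega> * 2 ^ D * (1 / (1 - x)))" if "0 < x" "x < 1" for x
  proof -
    have "(\<lambda>j. \<omega> * 2 ^ D * x ^ j) sums (\<omega> * 2 ^ D * (1 / (1 - x)))"
      using that by (intro sums_mult geometric_sums) auto
    then show ?thesis using om that by (intro suminf_ennreal_eq) auto
  qed
  have "(\<integral>\<^sup>+z. ennreal (min 1 (norm (z::'a) powr p) / norm z powr (real D + s * p)) \<partial>lborel)
      \<le> (\<integral>\<^sup>+z. (\<Sum>j. ennreal (f j z)) + (\<Sum>j. ennreal (g j z)) \<partial>lborel)"
    by (intro nn_integral_mono pt)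
  also have "\<dots> = (\<Sum>j. \<integral>\<^sup>+z. ennreal (f j z) \<partial>lborel) + (\<Sum>j. \<integral>\<^sup>+z. ennreal (g j z) \<partial>lborel)"
    by (subst nn_integral_add) (auto simp: nn_integral_suminf)
  also have "\<dots> = ennreal (\<omega> * 2 ^ D * (1 / (1 - a)) + \<omega> * 2 ^ D * (1 / (1 - b)))"
    unfolding If Ig geo[OF a] geo[OF b] using om a b by (intro ennreal_plus [symmetric]) auto
  finally show ?thesis by (simp add: D_def a_def b_def distrib_left)
qed

text \<open>A term with \<open>s k = 1\<close> vanishes, because \<open>frac_const\<close> has the factor \<open>1 - s\<close>.\<close>

definition mixed_kernel :: "real \<Rightarrow> (nat \<Rightarrow> real) \<Rightarrow> (nat \<Rightarrow> real) \<Rightarrow> 'a::euclidean_space \<Rightarrow> real" where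
  "mixed_kernel p s a z = (\<Sum>k. a k * frac_const (real DIM('a)) p (s k) / norm z powr (real DIM('a) + s k * p))"

section \<open>Summation over the orders\<close>

locale mixed_exponents =
  fixes p :: real and s a :: "nat \<Rightarrow> real"
  assumes p2: "p \<ge> 2" and s0: "s 0 \<le> 1" and s_dec: "\<And>k. s (Suc k) < s k" and s_nonneg: "\<And>k. 0 \<le> s k"
    and a_sum: "summable a" and a_nonneg: "\<And>k. 0 \<le> a k" and a0: "0 < a 0"
begin

lemma s_pos: "0 < s k" using s_dec[of k] s_nonneg[of "Suc k"] by linarith

lemma s_le: "s k \<le> 1"
  by (induction k) (use s0 s_dec in \<open>auto intro: less_imp_le order.strict_trans2\<close>)

lemma s_Suc_le: "s (Suc k) \<le> s 1"
  by (induction k) (use s_dec in \<open>auto intro: less_imp_le order.strict_trans2\<close>)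

lemma s_Suc_less: "s (Suc k) < 1"
  using s_Suc_le[of k] s_dec[of 0] s0 by simp

lemma C_nonneg: "0 \<le> frac_const (real DIM('a::euclidean_space)) p (s k)"
  using frac_const_bound[of "real DIM('a)" p] p2 s_pos s_le by auto

lemma kernel_term_nonneg:
  "0 \<le> a k * frac_const (real DIM('a::euclidean_space)) p (s k) / norm (z::'a) powr (real DIM('a) + s k * p)"
  using a_nonneg C_nonneg[of k, where 'a='a] by simp

text \<open>For fixed \<open>z\<close> the powers of \<open>norm z\<close> are bounded uniformly in
  the order; at \<open>z = 0\<close> every term is 0, because division by 0 gives 0.\<close>

lemma kernel_summable:
  "summable (\<lambda>k. a k * frac_const (real DIM('a::euclidean_space)) p (s k) / norm (z::'a) powr (real DIM('a) + s k * p))"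
proof -
  obtain c where c: "c > 0" "\<And>t. 0 < t \<Longrightarrow> t \<le> 1 \<Longrightarrow> frac_const (real DIM('a)) p t \<le> c * t"
    using frac_const_bound[of "real DIM('a)" p] p2 by auto
  define M where "M = max 1 (1 / norm z powr (real DIM('a) + p))"
  have b: "1 / norm z powr (real DIM('a) + s k * p) \<le> M" for k
  proof -
    consider "z = 0" | "norm z \<ge> 1" | "0 < norm z" "norm z < 1" by force
    then show ?thesis
    proof cases
      case 2
      then have "1 \<le> norm z powr (real DIM('a) + s k * p)" using s_pos[of k] p2 by (intro ge_one_powr_ge_zero) auto
      then show ?thesis by (simp add: M_def divide_le_eq le_max_iff_disj)
    next
      case 3
      have "norm z powr (real DIM('a) + p) \<le> norm z powr (real DIM('a) + s k * p)"
        using 3 s_le[of k] p2 mult_right_mono[of "s k" 1 p] by (intro powr_mono') auto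
      then have "1 / norm z powr (real DIM('a) + s k * p) \<le> 1 / norm z powr (real DIM('a) + p)"
        using 3 by (intro divide_left_mono) auto
      then show ?thesis by (simp add: M_def le_max_iff_disj)
    qed (simp add: M_def)
  qed
  show ?thesis
  proof (rule summable_comparison_test')
    show "summable (\<lambda>k. a k * (c * M))" using a_sum by (rule summable_mult2)
    fix k
    have "frac_const (real DIM('a)) p (s k) \<le> c" using c(2)[OF s_pos s_le, of k] c(1) mult_left_mono[OF s_le[of k], of c] by linarith
    then have "a k * frac_const (real DIM('a)) p (s k) * (1 / norm z powr (real DIM('a) + s k * p)) \<le> a k * c * M"
      using b[of k] a_nonneg C_nonneg[of k, where 'a='a] c(1) by (intro mult_mono mult_nonneg_nonneg) auto
    then show "norm (a k * frac_const (real DIM('a)) p (s k) / norm z powr (real DIM('a) + s k * p)) \<le> a k * (c * M)"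
      using kernel_term_nonneg[of k z] by (simp add: mult_ac)
  qed
qed

lemma mixed_kernel_nonneg: "0 \<le> mixed_kernel p s a z"
  unfolding mixed_kernel_def by (intro suminf_nonneg kernel_summable kernel_term_nonneg)

lemma mixed_kernel_measurable [measurable]: "mixed_kernel p s a \<in> borel_measurable borel"
  unfolding mixed_kernel_def[abs_def] by measurable

lemma ennreal_mixed_kernel:
  "ennreal (mixed_kernel p s a (z::'a::euclidean_space)) = (\<Sum>k. ennreal (a k * frac_const (real DIM('a)) p (s k) / norm z powr (real DIM('a) + s k * p)))"
  unfolding mixed_kernel_def by (intro suminf_ennreal2[symmetric] kernel_term_nonneg kernel_summable)

text \<open>Each order contributes at most \<open>a k * M\<close> with one constant
  \<open>M\<close>. For small orders the factor \<open>s\<close> in the bound on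
  \<open>frac_const\<close> compensates the tail of the kernel; near the origin the kernels are
  uniformly harmless because all orders other than 1 stay below one \<sigma> < 1.\<close>

lemma mixed_kernel_integrable:
  "integrable lborel (\<lambda>z::'a::euclidean_space. min 1 (norm z powr p) * mixed_kernel p s a z)"
proof -
  obtain c where c: "c > 0" "\<And>t. 0 < t \<Longrightarrow> t \<le> 1 \<Longrightarrow> frac_const (real DIM('a)) p t \<le> c * t"
    using frac_const_bound[of "real DIM('a)" p] p2 by auto
  define \<omega> where "\<omega> = measure lborel (ball (0::'a) 1) * 2 ^ DIM('a)"
  have om: "\<omega> \<ge> 0" by (simp add: \<omega>_def)
  \<comment> \<open>The largest order below 1: strict decrease allows the value 1 at index 0
    only.\<close>
  define \<sigma> where "\<sigma> = (if s 0 < 1 then s 0 else s 1)"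
  have \<sigma>: "0 < \<sigma>" "\<sigma> < 1" using s_pos s_Suc_less[of 0] by (auto simp: \<sigma>_def)
  have s\<sigma>: "s k \<le> \<sigma>" if "s k \<noteq> 1" for k
  proof (cases k)
    case 0
    then show ?thesis using that s0 by (simp add: \<sigma>_def)
  next
    case (Suc i)
    then show ?thesis using s_Suc_le[of i] s_dec[of 0] by (auto simp: \<sigma>_def)
  qed
  define M where "M = c * \<omega> * ((1 + p * ln 2) / (p * ln 2) + 1 / (1 - 2 powr (- (p * (1 - \<sigma>)))))"
  have b1: "(2::real) powr (- (p * (1 - \<sigma>))) < 1"
  proof -
    have "(2::real) powr (- (p * (1 - \<sigma>))) < 2 powr 0" using p2 \<sigma> by (intro powr_less_mono) auto
    then show ?thesis by simp
  qed
  have each: "(\<integral>\<^sup>+z. ennreal (min 1 (norm z powr p) * (a k * frac_const (real DIM('a)) p (s k) / norm (z::'a) powr (real DIM('a) + s k * p))) \<partial>lborel)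
      \<le> ennreal (a k * M)" for k
  proof (cases "s k = 1")
    case False
    define t where "t = s k"
    have t: "0 < t" "t < 1" "t \<le> \<sigma>" using False s_pos[of k] s_le[of k] s\<sigma>[of k] by (auto simp: t_def)
    define J where "J = \<omega> * (1 / (1 - 2 powr (- (t * p))) + 1 / (1 - 2 powr (- (p * (1 - t)))))"
    have J: "(\<integral>\<^sup>+z. ennreal (min 1 (norm (z::'a) powr p) / norm z powr (real DIM('a) + t * p)) \<partial>lborel) \<le> ennreal J"
      using riesz_kernel_integral[where 'a='a, of p t] t p2 by (simp add: J_def \<omega>_def)
    define q where "q = a k * frac_const (real DIM('a)) p t"
    have q: "0 \<le> q" using a_nonneg[of k] C_nonneg[of k, where 'a='a] by (simp add: q_def t_def)
    have "(\<integral>\<^sup>+z. ennreal (min 1 (norm z powr p) * (q / norm (z::'a) powr (real DIM('a) + t * p))) \<partial>lborel)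
      = (\<integral>\<^sup>+z. ennreal q * ennreal (min 1 (norm z powr p) / norm (z::'a) powr (real DIM('a) + t * p)) \<partial>lborel)"
      using q by (intro nn_integral_cong) (simp add: mult.commute flip: ennreal_mult)
    also have "\<dots> = ennreal q * (\<integral>\<^sup>+z. ennreal (min 1 (norm (z::'a) powr p) / norm z powr (real DIM('a) + t * p)) \<partial>lborel)"
      by (rule nn_integral_cmult) measurable
    also have "\<dots> \<le> ennreal q * ennreal J" by (intro mult_left_mono J) simp
    also have "\<dots> = ennreal (q * J)" by (rule ennreal_mult'[OF q, symmetric])
    also have "q * J \<le> a k * M"
    proof -
      \<comment> \<open>This is \<open>exp x \<ge> 1 + x\<close>; it bounds
        \<open>t / (1 - 2 powr (- (t * p)))\<close> uniformly as \<open>t\<close> tends to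
        0.\<close>
      have tp: "(2::real) powr (- (t * p)) \<le> 1 / (1 + t * p * ln 2)"
      proof -
        have "1 + t * p * ln 2 \<le> exp (t * p * ln 2)" by (rule exp_ge_add_one_self)
        then have "1 / exp (t * p * ln 2) \<le> 1 / (1 + t * p * ln 2)"
          using t p2 by (intro divide_left_mono) (auto intro!: mult_pos_pos add_pos_nonneg)
        then show ?thesis by (simp add: powr_def exp_minus inverse_eq_divide)
      qed
      have tpos: "0 < t * p * ln 2" using t p2 by simp
      have "1 - 2 powr (- (t * p)) \<ge> t * p * ln 2 / (1 + t * p * ln 2)"
        using tp tpos by (simp add: field_simps)
      then have "1 / (1 - 2 powr (- (t * p))) \<le> 1 / (t * p * ln 2 / (1 + t * p * ln 2))"
        using tpos by (intro divide_left_mono) (auto intro!: mult_pos_pos divide_pos_pos add_pos_pos intro: less_le_trans[rotated])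
      then have "t * (1 / (1 - 2 powr (- (t * p)))) \<le> t * (1 / (t * p * ln 2 / (1 + t * p * ln 2)))"
        using t by (intro mult_left_mono) auto
      also have "\<dots> = (1 + t * p * ln 2) / (p * ln 2)" using t by simp
      also have "\<dots> \<le> (1 + p * ln 2) / (p * ln 2)"
        using t p2 mult_right_mono[of t 1 "p * ln 2"] by (intro divide_right_mono) (auto simp: mult.assoc)
      finally have e1: "t * (1 / (1 - 2 powr (- (t * p)))) \<le> (1 + p * ln 2) / (p * ln 2)" .
      have le\<sigma>: "(2::real) powr (- (p * (1 - t))) \<le> 2 powr (- (p * (1 - \<sigma>)))"
        using t p2 by (intro powr_mono) (auto intro!: mult_left_mono)
      then have lt1: "(2::real) powr (- (p * (1 - t))) < 1" using b1 by (rule le_less_trans)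
      have "1 / (1 - 2 powr (- (p * (1 - t)))) \<le> 1 / (1 - 2 powr (- (p * (1 - \<sigma>))))"
      proof (rule divide_left_mono)
        show "0 < (1 - (2::real) powr (- (p * (1 - t)))) * (1 - 2 powr (- (p * (1 - \<sigma>))))"
          using lt1 b1 by (intro mult_pos_pos) linarith+
      qed (use le\<sigma> in linarith, simp)
      then have "t * (1 / (1 - 2 powr (- (p * (1 - t))))) \<le> 1 * (1 / (1 - 2 powr (- (p * (1 - \<sigma>)))))"
      proof (rule mult_mono[rotated])
        show "0 \<le> 1 / (1 - (2::real) powr (- (p * (1 - t))))"
          using lt1 by (intro divide_nonneg_nonneg) linarith+
      qed (use t in linarith)+
      with e1 have "t * (1 / (1 - 2 powr (- (t * p))) + 1 / (1 - 2 powr (- (p * (1 - t)))))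
         \<le> (1 + p * ln 2) / (p * ln 2) + 1 / (1 - 2 powr (- (p * (1 - \<sigma>))))" by (simp only: distrib_left mult_1_left)
      then have "c * \<omega> * (t * (1 / (1 - 2 powr (- (t * p))) + 1 / (1 - 2 powr (- (p * (1 - t)))))) \<le> M"
        unfolding M_def using c(1) om by (intro mult_left_mono) auto
      then have tJ: "c * t * J \<le> M" by (simp add: J_def mult_ac)
      have "J \<ge> 0"
      proof -
        have l1: "(2::real) powr (- (t * p)) < 2 powr 0" using t p2 by (intro powr_less_mono) auto
        have l2: "(2::real) powr (- (p * (1 - t))) < 2 powr 0" using t p2 by (intro powr_less_mono) auto
        have z: "(2::real) powr 0 = 1" by simp
        have "0 \<le> 1 / (1 - (2::real) powr (- (t * p)))" "0 \<le> 1 / (1 - (2::real) powr (- (p * (1 - t))))"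
          using l1 l2 unfolding z by (intro divide_nonneg_nonneg; linarith)+
        then show ?thesis unfolding J_def using om by (intro mult_nonneg_nonneg add_nonneg_nonneg)
      qed
      then have "frac_const (real DIM('a)) p t * J \<le> c * t * J" using c(2)[OF t(1)] t by (intro mult_right_mono) auto
      then have "frac_const (real DIM('a)) p t * J \<le> M" using tJ by simp
      then have "a k * (frac_const (real DIM('a)) p t * J) \<le> a k * M" using a_nonneg by (intro mult_left_mono) auto
      then show ?thesis by (simp add: q_def mult.assoc)
    qed
    finally show ?thesis by (simp add: q_def t_def ennreal_leI)
  qed simp
  have M0: "M \<ge> 0" unfolding M_def using c(1) om b1 p2
    by (intro mult_nonneg_nonneg add_nonneg_nonneg divide_nonneg_nonneg) auto
  have "(\<integral>\<^sup>+z. ennreal (min 1 (norm z powr p) * mixed_kernel p s a z) \<partial>(lborel :: 'a measure))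
     = (\<integral>\<^sup>+z. (\<Sum>k. ennreal (min 1 (norm z powr p) * (a k * frac_const (real DIM('a)) p (s k) / norm z powr (real DIM('a) + s k * p)))) \<partial>(lborel :: 'a measure))"
  proof (rule nn_integral_cong)
    fix z :: 'a
    show "ennreal (min 1 (norm z powr p) * mixed_kernel p s a z)
      = (\<Sum>k. ennreal (min 1 (norm z powr p) * (a k * frac_const (real DIM('a)) p (s k) / norm z powr (real DIM('a) + s k * p))))"
      using mixed_kernel_nonneg[of z] kernel_term_nonneg[of _ z]
      by (simp add: ennreal_mult ennreal_mixed_kernel del: times_divide_eq_right)
  qed
  also have "\<dots> = (\<Sum>k. \<integral>\<^sup>+z. ennreal (min 1 (norm z powr p) * (a k * frac_const (real DIM('a)) p (s k) / norm z powr (real DIM('a) + s k * p))) \<partial>(lborel :: 'a measure))"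
    by (rule nn_integral_suminf) measurable
  also have "\<dots> \<le> (\<Sum>k. ennreal (a k * M))" by (intro suminf_le each) auto
  also have "\<dots> < \<infinity>"
    using a_sum a_nonneg M0 by (subst suminf_ennreal2) (auto intro: summable_mult2)
  finally show ?thesis
    using mixed_kernel_nonneg by (intro integrableI_nonneg) (auto intro!: AE_I2 mult_nonneg_nonneg)
qed

text \<open>The term of index 0 already suffices: its coefficient is positive since the order lies
  strictly between 0 and 1, and it decreases with the norm. This is the coercivity of the purely
  nonlocal case.\<close>

lemma mixed_kernel_lower:
  assumes "s 0 < 1"
  shows "\<exists>k>0. \<forall>z::'a::euclidean_space. 0 < norm z \<and> norm z \<le> R \<longrightarrow> k \<le> mixed_kernel p s a z"
proof -
  define q where "q = a 0 * frac_const (real DIM('a)) p (s 0)"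
  have q: "q > 0" using a0 frac_const_pos[of "real DIM('a)" p "s 0"] s_pos[of 0] assms p2 by (simp add: q_def)
  define R' where "R' = max R 1"
  have R': "R' > 0" by (simp add: R'_def)
  have "q / R' powr (real DIM('a) + s 0 * p) \<le> mixed_kernel p s a z" if z: "0 < norm z" "norm z \<le> R" for z :: 'a
  proof -
    have "q / R' powr (real DIM('a) + s 0 * p) \<le> q / norm z powr (real DIM('a) + s 0 * p)"
      using z q R' s_pos[of 0] p2 by (intro divide_left_mono powr_mono2) (auto simp: R'_def)
    also have "\<dots> = (\<Sum>k\<in>{0}. a k * frac_const (real DIM('a)) p (s k) / norm z powr (real DIM('a) + s k * p))"
      by (simp add: q_def)
    also have "\<dots> \<le> mixed_kernel p s a z"
      unfolding mixed_kernel_def by (rule sum_le_suminf[OF kernel_summable]) (use kernel_term_nonneg in auto)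
    finally show ?thesis .
  qed
  then show ?thesis using q R' by (intro exI[of _ "q / R' powr (real DIM('a) + s 0 * p)"]) auto
qed

end

subsection \<open>Weak solutions from the energy space\<close>

lemma lebesgue_measurable_cong_AE:
  fixes f g :: "'a::euclidean_space \<Rightarrow> 'b::euclidean_space"
  assumes f: "f \<in> borel_measurable lebesgue" and eq: "AE x in lebesgue. f x = g x"
  shows "g \<in> borel_measurable lebesgue"
proof (rule measurableI)
  obtain N where N: "N \<in> null_sets lebesgue" "{x. f x \<noteq> g x} \<subseteq> N" using eq by (auto simp: eventually_ae_filter)
  fix A :: "'b set" assume A: "A \<in> sets borel"
  have "f x = g x" if "x \<notin> N" for x using N(2) that by auto
  then have e: "g -` A = (f -` A - N) \<union> (g -` A \<inter> N)" by auto
  have "f -` A \<in> sets lebesgue" using measurable_sets[OF f A] by simp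
  moreover have "g -` A \<inter> N \<in> sets lebesgue"
    using N(1) by (metis inf_le2 negligible_iff_null_sets negligible_imp_sets negligible_subset)
  ultimately have "(f -` A - N) \<union> (g -` A \<inter> N) \<in> sets lebesgue" using N(1) by (intro sets.Un sets.Diff) auto
  then show "g -` A \<inter> space lebesgue \<in> sets lebesgue" using e by simp
qed simp

lemma lebesgue_borel_rep:
  fixes f g :: "'a::euclidean_space \<Rightarrow> 'b::euclidean_space"
  assumes g: "g \<in> borel_measurable borel" and eq: "AE x in lborel. f x = g x"
  shows "integral\<^sup>L lebesgue f = integral\<^sup>L lborel g" and "integrable lebesgue f \<longleftrightarrow> integrable lborel g"
proof -
  have gl: "g \<in> borel_measurable lebesgue" using g by (intro measurable_completion) simp
  have eq': "AE x in lebesgue. g x = f x" using eq by (auto simp: AE_completion_iff)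
  have fl: "f \<in> borel_measurable lebesgue" by (rule lebesgue_measurable_cong_AE[OF gl eq'])
  have "integral\<^sup>L lebesgue f = integral\<^sup>L lebesgue g" using eq' by (intro integral_cong_AE fl gl) auto
  then show "integral\<^sup>L lebesgue f = integral\<^sup>L lborel g" using g by (simp add: integral_completion)
  have "integrable lebesgue f \<longleftrightarrow> integrable lebesgue g" using eq' by (intro integrable_cong_AE fl gl) auto
  then show "integrable lebesgue f \<longleftrightarrow> integrable lborel g" using g by (simp add: integrable_completion)
qed

lemma borel_rep_vector:
  fixes G :: "'a::euclidean_space \<Rightarrow> 'b::euclidean_space"
  assumes G: "G \<in> borel_measurable lebesgue"
  obtains G' where "G' \<in> borel_measurable borel" "AE x in lborel. G x = G' x"
proof -
  have "\<exists>g\<in>borel_measurable lborel. AE x in lborel. G x \<bullet> b = g x" for b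
    using G by (intro completion_ex_borel_measurable_real) simp
  then obtain g where g: "\<And>b. g b \<in> borel_measurable lborel" "\<And>b. AE x in lborel. G x \<bullet> b = g b x" by metis
  have "AE x in lborel. \<forall>b\<in>Basis. G x \<bullet> b = g b x" using g(2) by (intro AE_finite_allI) auto
  then have "AE x in lborel. G x = (\<Sum>b\<in>Basis. g b x *\<^sub>R b)"
    by eventually_elim (metis (no_types, lifting) euclidean_representation sum.cong)
  moreover have "(\<lambda>x. \<Sum>b\<in>Basis. g b x *\<^sub>R b) \<in> borel_measurable borel" using g(1) by simp
  ultimately show thesis using that by blast
qed

lemma locally_integrable_measurable:
  fixes G :: "'a::euclidean_space \<Rightarrow> 'b::euclidean_space"
  assumes "locally_integrable G" shows "G \<in> borel_measurable lebesgue"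
proof (rule borel_measurable_LIMSEQ_metric)
  show "(\<lambda>x. indicat_real (cball 0 (real n)) x *\<^sub>R G x) \<in> borel_measurable lebesgue" for n
    using assms unfolding locally_integrable_def set_integrable_def by (intro borel_measurable_integrable) auto
  show "(\<lambda>n. indicat_real (cball 0 (real n)) x *\<^sub>R G x) \<longlonglongrightarrow> G x" for x
  proof (rule tendsto_eventually)
    obtain m where "norm x \<le> real m" using real_arch_simple by blast
    then have "\<forall>n\<ge>m. indicat_real (cball 0 (real n)) x *\<^sub>R G x = G x" by auto
    then show "\<forall>\<^sub>F n in sequentially. indicat_real (cball 0 (real n)) x *\<^sub>R G x = G x"
      unfolding eventually_sequentially by blast
  qed
qed

lemma locally_integrable_rep:
  fixes G :: "'a::euclidean_space \<Rightarrow> 'b::euclidean_space"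
  assumes l: "locally_integrable G" and G': "G' \<in> borel_measurable borel" "AE x in lborel. G x = G' x" and K: "compact K"
  shows "integrable lborel (\<lambda>x. indicat_real K x *\<^sub>R G' x)"
proof -
  have [measurable]: "K \<in> sets borel" using K by (simp add: borel_compact)
  have "integrable lebesgue (\<lambda>x. indicat_real K x *\<^sub>R G x)" using l K by (simp add: locally_integrable_def set_integrable_def)
  moreover have "AE x in lborel. indicat_real K x *\<^sub>R G x = indicat_real K x *\<^sub>R G' x" using G'(2) by eventually_elim simp
  moreover have "(\<lambda>x. indicat_real K x *\<^sub>R G' x) \<in> borel_measurable borel" using G'(1) by measurable
  ultimately show ?thesis by (subst lebesgue_borel_rep(2)[symmetric])
qed

text \<open>The given gradient is only locally integrable. Test functions supported in a box off
  \<open>closure \<Omega>\<close> meet only zeros of \<open>u'\<close>, so the gradient vanishes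
  almost everywhere in that box; countably many such boxes fill the complement. Cutting off to the
  compact closure then makes it integrable.\<close>

lemma wgrad_of_has_weak_gradient:
  fixes u u' :: "'a::euclidean_space \<Rightarrow> real"
  assumes O: "open \<Omega>" "bounded \<Omega>" and u': "u' \<in> borel_measurable borel" "AE x in lborel. u x = u' x" "\<And>x. x \<notin> \<Omega> \<Longrightarrow> u' x = 0"
    and w: "has_weak_gradient u G"
  obtains G' where "wgrad u' G'" "AE x in lborel. G x = G' x" "\<And>x. x \<notin> closure \<Omega> \<Longrightarrow> G' x = 0"
proof -
  have cl: "compact (closure \<Omega>)" using O(2) by (simp add: compact_closure)
  have lu: "locally_integrable u" and lG: "locally_integrable G" using w by (auto simp: has_weak_gradient_def)
  obtain H where H: "H \<in> borel_measurable borel" "AE x in lborel. G x = H x"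
    using borel_rep_vector[OF locally_integrable_measurable[OF lG]] by blast
  note [measurable] = u'(1) H(1)
  have iu: "integrable lborel u'"
  proof -
    have "indicat_real (closure \<Omega>) x *\<^sub>R u' x = u' x" for x
      using u'(3)[of x] closure_subset[of \<Omega>] by (cases "x \<in> \<Omega>") auto
    then show ?thesis using locally_integrable_rep[OF lu u'(1,2) cl] by (simp only:)
  qed
  have ident: "(\<integral>x. u' x * frechet_derivative f (at x) b \<partial>lborel) = - (\<integral>x. (H x \<bullet> b) * f x \<partial>lborel)"
    if f: "test_function f" and b: "b \<in> Basis" for f b
  proof -
    note [measurable] = test_function_measurable[OF f]
    have "integral\<^sup>L lebesgue (\<lambda>x. u x * frechet_derivative f (at x) b) = (\<integral>x. u' x * frechet_derivative f (at x) b \<partial>lborel)"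
      by (rule lebesgue_borel_rep(1)) (use u'(2) in auto)
    moreover have "integral\<^sup>L lebesgue (\<lambda>x. (G x \<bullet> b) * f x) = (\<integral>x. (H x \<bullet> b) * f x \<partial>lborel)"
      by (rule lebesgue_borel_rep(1)) (use H(2) in auto)
    ultimately show ?thesis using w f b by (simp add: has_weak_gradient_def)
  qed
  have box0: "AE x in lborel. x \<in> box l0 r0 \<longrightarrow> H x = 0" if B: "box l0 r0 \<subseteq> - closure \<Omega>" for l0 r0
  proof -
    have "AE x in lborel. x \<in> box l0 r0 \<longrightarrow> H x \<bullet> b = 0" if b: "b \<in> Basis" for b
    proof -
      define F where "F x = indicat_real (box l0 r0) x * (H x \<bullet> b)" for x
      have [measurable]: "F \<in> borel_measurable borel" unfolding F_def[abs_def] by measurable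
      have iF: "integrable lborel F"
      proof -
        have "integrable lborel (\<lambda>x. (indicat_real (cbox l0 r0) x *\<^sub>R H x) \<bullet> b)"
          by (intro integrable_inner_left) (use locally_integrable_rep[OF lG H compact_cbox] in auto)
        then show ?thesis
          by (rule Bochner_Integration.integrable_bound) (use box_subset_cbox[of l0 r0] in \<open>auto simp: F_def split: split_indicator\<close>)
      qed
      have "AE x in lborel. F x = 0"
      proof (rule AE_zero_if_box_integrals_zero[OF iF])
        fix l r :: 'a
        \<comment> \<open>The intersection of the two boxes is again a box, so its bumps are test
          functions supported in \<open>box l0 r0\<close>.\<close>
        obtain l1 r1 where lr: "box l r \<inter> box l0 r0 = box l1 r1" using box_Int_box by blast
        define \<phi> where "\<phi> n = box_bump (real (Suc n)) l1 r1" for n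
        have t: "test_function (\<phi> n)" for n unfolding \<phi>_def by (rule test_function_box_bump) simp
        note [measurable] = test_function_measurable[OF t]
        have z: "\<phi> n x = 0" if "x \<notin> box l0 r0" for n x
          unfolding \<phi>_def using that lr by (intro box_bump_zero) auto
        have "(\<integral>x. F x * \<phi> n x \<partial>lborel) = 0" for n
        proof -
          have "u' x * frechet_derivative (\<phi> n) (at x) b = 0" for x
          proof (cases "x \<in> \<Omega>")
            case True
            have "((\<lambda>_. 0::real) has_derivative (\<lambda>_. 0)) (at x)" by simp
            moreover have "0 = \<phi> n y" if "y \<in> \<Omega>" for y
            proof -
              have "y \<notin> box l0 r0" using B that closure_subset[of \<Omega>] by blast
              then show ?thesis using z[of y n] by simp
            qed
            ultimately have "(\<phi> n has_derivative (\<lambda>_. 0)) (at x)"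
              by (rule has_derivative_transform_within_open[OF _ O(1) True])
            then have "frechet_derivative (\<phi> n) (at x) = (\<lambda>_. 0)" by (metis frechet_derivative_at)
            then show ?thesis by simp
          qed (use u'(3) in simp)
          note z0 = this
          have "(\<integral>x. u' x * frechet_derivative (\<phi> n) (at x) b \<partial>lborel) = 0"
            unfolding z0 by simp
          then have "(\<integral>x. (H x \<bullet> b) * \<phi> n x \<partial>lborel) = 0" unfolding ident[OF t b] by simp
          moreover have "F x * \<phi> n x = (H x \<bullet> b) * \<phi> n x" for x
            by (cases "x \<in> box l0 r0") (simp_all add: F_def z)
          ultimately show ?thesis by (simp only:)
        qed
        moreover have "(\<lambda>n. \<integral>x. F x * \<phi> n x \<partial>lborel) \<longlonglongrightarrow> (\<integral>x. indicator (box l r) x * F x \<partial>lborel)"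
        proof (rule integral_dominated_convergence[where w="\<lambda>x. \<bar>F x\<bar>"])
          show "AE x in lborel. (\<lambda>n. F x * \<phi> n x) \<longlonglongrightarrow> indicator (box l r) x * F x"
          proof (rule AE_I2)
            fix x
            have "(\<lambda>n. F x * \<phi> n x) \<longlonglongrightarrow> F x * indicator (box l1 r1) x"
              unfolding \<phi>_def by (rule tendsto_mult_left[OF box_bump_tendsto])
            moreover have "F x * indicator (box l1 r1) x = indicator (box l r) x * F x"
              using lr by (auto simp: F_def split: split_indicator)
            ultimately show "(\<lambda>n. F x * \<phi> n x) \<longlonglongrightarrow> indicator (box l r) x * F x" by simp
          qed
          show "AE x in lborel. norm (F x * \<phi> n x) \<le> \<bar>F x\<bar>" for n
            unfolding \<phi>_def using box_bump_bounds[of "real (Suc n)" l1 r1] by (auto intro!: AE_I2 simp: abs_mult mult_left_le)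
        qed (use iF in auto)
        ultimately have "(\<lambda>n::nat. 0::real) \<longlonglongrightarrow> (\<integral>x. indicator (box l r) x * F x \<partial>lborel)" by (simp only:)
        then show "(\<integral>x. indicator (box l r) x * F x \<partial>lborel) = 0" by (simp only: LIMSEQ_const_iff)
      qed
      then show ?thesis by eventually_elim (auto simp: F_def)
    qed
    then have "AE x in lborel. \<forall>b\<in>Basis. x \<in> box l0 r0 \<longrightarrow> H x \<bullet> b = 0" by (intro AE_finite_allI) auto
    then show ?thesis
    proof eventually_elim
      case (elim x)
      then show ?case by (metis euclidean_eq_iff inner_zero_left)
    qed
  qed
  obtain D where D: "countable D" "D \<subseteq> Pow (- closure \<Omega>)" "\<And>X. X \<in> D \<Longrightarrow> \<exists>a b. X = box a b" "\<Union>D = - closure \<Omega>"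
    using open_countable_Union_open_box[OF open_Compl[OF closed_closure[of \<Omega>]]] by blast
  have "AE x in lborel. \<forall>X\<in>D. x \<in> X \<longrightarrow> H x = 0"
  proof (subst AE_ball_countable[OF D(1)], intro ballI)
    fix X assume X: "X \<in> D"
    then obtain l0 r0 where "X = box l0 r0" using D(3) by blast
    then show "AE x in lborel. x \<in> X \<longrightarrow> H x = 0" using box0[of l0 r0] X D(2) by blast
  qed
  then have off: "AE x in lborel. x \<notin> closure \<Omega> \<longrightarrow> H x = 0" 
  proof eventually_elim
    case (elim x)
    show ?case
    proof
      assume "x \<notin> closure \<Omega>"
      then have "x \<in> \<Union>D" unfolding D(4) by simp
      then show "H x = 0" using elim by blast
    qed
  qed
  define G' where "G' x = indicat_real (closure \<Omega>) x *\<^sub>R H x" for x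
  have iG': "integrable lborel G'" unfolding G'_def by (rule locally_integrable_rep[OF lG H cl])
  have G'H: "AE x in lborel. G' x = H x" using off by eventually_elim (auto simp: G'_def split: split_indicator)
  have "wgrad u' G'"
  proof (rule wgradI[OF iu iG'])
    fix f :: "'a \<Rightarrow> real" and b :: 'a assume f: "test_function f" and b: "b \<in> Basis"
    note [measurable] = test_function_measurable[OF f] borel_measurable_integrable[OF iG']
    have "(\<integral>x. (G' x \<bullet> b) * f x \<partial>lborel) = (\<integral>x. (H x \<bullet> b) * f x \<partial>lborel)"
      using G'H by (intro integral_cong_AE) auto
    then show "(\<integral>x. u' x * frechet_derivative f (at x) b \<partial>lborel) = - (\<integral>x. (G' x \<bullet> b) * f x \<partial>lborel)"
      using ident[OF f b] by (simp only:)
  qed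
  moreover have "AE x in lborel. G x = G' x" using H(2) G'H by eventually_elim simp
  moreover have "G' x = 0" if "x \<notin> closure \<Omega>" for x using that by (simp add: G'_def)
  ultimately show thesis by (rule that)
qed

section \<open>Identification of \<open>X_space\<close> and \<open>energy_form\<close> with
  \<open>V\<close> and \<open>AA\<close>\<close>

lemma ennreal_powr_inverse:
  assumes "p > 0" shows "ennreal_powr (ennreal_powr x (1 / p)) p = x"
  using assms by (cases x) (auto simp: ennreal_powr_def powr_powr)

lemma ennreal_powr_less_top: "ennreal_powr x r < top \<longleftrightarrow> x < top"
  by (auto simp: ennreal_powr_def less_top)

locale mixed_problem = mixed_exponents p s a for p s a +
  fixes \<Omega> :: "'a::euclidean_space set"
  assumes O: "open \<Omega>" "bounded \<Omega>" "\<Omega> \<noteq> {}"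
begin

text \<open>Only index 0 can carry the order 1. If it does, the local coefficient is
  \<open>a 0 > 0\<close>; otherwise the kernel of index 0 provides the coercivity.\<close>

sublocale E: mixed_energy \<Omega> p "mixed_kernel p s a" "if s 0 = 1 then a 0 else 0"
proof
  show "integrable lborel (\<lambda>z::'a. min 1 (norm z powr p) * mixed_kernel p s a z)" by (rule mixed_kernel_integrable)
  show "(if s 0 = 1 then a 0 else 0) > 0 \<or> (\<forall>R. \<exists>k>0. \<forall>z::'a. 0 < norm z \<and> norm z \<le> R \<longrightarrow> k \<le> mixed_kernel p s a z)"
    using mixed_kernel_lower[where 'a='a] s0 a0 by (cases "s 0 = 1") auto
qed (use p2 O a0 mixed_kernel_nonneg in auto)

lemma s_eq_1: "s k = 1 \<Longrightarrow> k = 0"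
  using s_Suc_less by (cases k) (auto simp: less_le)

lemma fst_snd_measurable [measurable]:
  "(\<lambda>z::'a \<times> 'a. norm (fst z - snd z)) \<in> borel_measurable borel"
  by (intro borel_measurable_continuous_onI continuous_intros)

lemma nonlocal_terms:
  assumes u': "u' \<in> borel_measurable borel" "AE x in lborel. u x = u' x" and sk: "s k < 1"
  shows "ennreal (a k) * ennreal_powr (seminorm_sp (s k) p u) p
     = (\<integral>\<^sup>+z. ennreal (a k * frac_const (real DIM('a)) p (s k) / norm (fst z - snd z) powr (real DIM('a) + s k * p)) * ennreal (norm (du u' z) powr p) \<partial>(lborel :: ('a \<times> 'a) measure))"
proof -
  let ?C = "frac_const (real DIM('a)) p (s k)"
  have [measurable]: "du u' \<in> borel_measurable borel" by (rule E.du_meas[OF u'(1)])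
  have sk0: "s k \<noteq> 0" "s k \<noteq> 1" using s_pos[of k] sk by auto
  have "ennreal_powr (seminorm_sp (s k) p u) p = ennreal ?C * (\<integral>\<^sup>+(x, y). ennreal (\<bar>u x - u y\<bar> powr p / norm (x - y) powr (real DIM('a) + s k * p)) \<partial>lebesgue)"
    using sk0 p2 by (simp add: seminorm_sp_def ennreal_powr_inverse)
  also have "(\<integral>\<^sup>+(x, y). ennreal (\<bar>u x - u y\<bar> powr p / norm (x - y) powr (real DIM('a) + s k * p)) \<partial>lebesgue)
     = (\<integral>\<^sup>+(x, y). ennreal (\<bar>u x - u y\<bar> powr p / norm (x - y) powr (real DIM('a) + s k * p)) \<partial>lborel)"
    by (rule nn_integral_completion)
  also have "\<dots> = (\<integral>\<^sup>+z. ennreal (norm (du u' z) powr p / norm (fst z - snd z) powr (real DIM('a) + s k * p)) \<partial>lborel)"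
  proof (rule nn_integral_cong_AE)
    show "AE z in lborel. (case z of (x, y) \<Rightarrow> ennreal (\<bar>u x - u y\<bar> powr p / norm (x - y) powr (real DIM('a) + s k * p)))
        = ennreal (norm (du u' z) powr p / norm (fst z - snd z) powr (real DIM('a) + s k * p))"
      using AE_lborel_pair[OF u'(2)] by eventually_elim (simp add: du_def case_prod_beta)
  qed
  finally have "ennreal (a k) * ennreal_powr (seminorm_sp (s k) p u) p
      = ennreal (a k) * ennreal ?C * (\<integral>\<^sup>+z. ennreal (norm (du u' z) powr p / norm (fst z - snd z) powr (real DIM('a) + s k * p)) \<partial>lborel)"
    by (simp add: mult.assoc)
  also have "\<dots> = (\<integral>\<^sup>+z. ennreal (a k) * ennreal ?C * ennreal (norm (du u' z) powr p / norm (fst z - snd z) powr (real DIM('a) + s k * p)) \<partial>lborel)"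
    by (rule nn_integral_cmult [symmetric]) measurable
  also have "\<dots> = (\<integral>\<^sup>+z. ennreal (a k * ?C / norm (fst z - snd z) powr (real DIM('a) + s k * p)) * ennreal (norm (du u' z) powr p) \<partial>lborel)"
    using a_nonneg[of k] C_nonneg[of k, where 'a='a] by (intro nn_integral_cong) (simp add: mult_ac flip: ennreal_mult)
  finally show ?thesis .
qed

text \<open>The orders below 1 are summed under the integral into the mixed kernel. An order equal
  to 1 contributes to the local term alone, since its \<open>frac_const\<close> is 0.\<close>

lemma X_series:
  assumes u': "u' \<in> borel_measurable borel" "AE x in lborel. u x = u' x"
  shows "(\<Sum>k. ennreal (a k) * ennreal_powr (seminorm_sp (s k) p u) p)
    = (if s 0 = 1 then ennreal (a 0) * ennreal_powr (seminorm_sp 1 p u) p else 0) + (\<integral>\<^sup>+z. ennreal (norm (du u' z) powr p) \<partial>E.MK)"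
proof -
  have [measurable]: "du u' \<in> borel_measurable borel" by (rule E.du_meas[OF u'(1)])
  define t where "t k = (\<integral>\<^sup>+z. ennreal (a k * frac_const (real DIM('a)) p (s k) / norm (fst z - snd z) powr (real DIM('a) + s k * p)) * ennreal (norm (du u' z) powr p) \<partial>(lborel :: ('a \<times> 'a) measure))" for k
  define e where "e k = (if k = 0 then (if s 0 = 1 then ennreal (a 0) * ennreal_powr (seminorm_sp 1 p u) p else 0) else 0)" for k :: nat
  have "ennreal (a k) * ennreal_powr (seminorm_sp (s k) p u) p = e k + t k" for k
  proof (cases "s k = 1")
    case True
    then have "k = 0" by (rule s_eq_1)
    then show ?thesis using True by (simp add: e_def t_def)
  next
    case False
    then have "s k < 1" using s_le[of k] by simp
    from nonlocal_terms[OF u' this] False show ?thesis by (auto simp: e_def t_def)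
  qed
  then have "(\<Sum>k. ennreal (a k) * ennreal_powr (seminorm_sp (s k) p u) p) = (\<Sum>k. e k) + (\<Sum>k. t k)"
    by (simp add: suminf_add[OF summableI summableI])
  also have "(\<Sum>k. e k) = e 0" by (subst suminf_finite[of "{0}"]) (auto simp: e_def)
  also have "(\<Sum>k. t k) = (\<integral>\<^sup>+z. ennreal (mixed_kernel p s a (fst z - snd z)) * ennreal (norm (du u' z) powr p) \<partial>lborel)"
    unfolding t_def ennreal_mixed_kernel by (subst nn_integral_suminf [symmetric]) auto
  also have "\<dots> = (\<integral>\<^sup>+z. ennreal (norm (du u' z) powr p) \<partial>E.MK)" by (rule E.MK_nn_integral [symmetric]) measurable
  finally show ?thesis by (simp add: e_def)
qed

lemma X_norm_finite_iff:
  assumes u': "u' \<in> borel_measurable borel" "AE x in lborel. u x = u' x"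
  shows "X_norm p s a u < top \<longleftrightarrow> Lp_fun p E.MK (du u') \<and>
    (s 0 = 1 \<longrightarrow> (\<exists>G. has_weak_gradient u G) \<and> (\<integral>\<^sup>+x. ennreal (norm (weak_gradient u x) powr p) \<partial>lborel) < top)"
proof -
  have m: "du u' \<in> borel_measurable E.MK" using E.du_meas[OF u'(1)] by (simp cong: measurable_cong_sets)
  have "Lp_fun p E.MK (du u') \<longleftrightarrow> (\<integral>\<^sup>+z. ennreal (norm (du u' z) powr p) \<partial>E.MK) < top"
    unfolding Lp_fun_def using m by (auto simp: integrable_iff_bounded)
  moreover have "ennreal_powr (seminorm_sp 1 p u) p
      = (if \<exists>G. has_weak_gradient u G then (\<integral>\<^sup>+x. ennreal (norm (weak_gradient u x) powr p) \<partial>lborel) else top)"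
  proof (cases "\<exists>G. has_weak_gradient u G")
    case True
    then have "seminorm_sp 1 p u = Lp_norm p (weak_gradient u)" by (simp add: seminorm_sp_def)
    then show ?thesis using p2 True by (simp add: Lp_norm_def ennreal_powr_inverse nn_integral_completion)
  next
    case False
    have "seminorm_sp 1 p u = top" unfolding seminorm_sp_def if_not_P[OF False] by simp
    then show ?thesis unfolding if_not_P[OF False] by (simp add: ennreal_powr_def)
  qed
  ultimately show ?thesis
    unfolding X_norm_def ennreal_powr_less_top X_series[OF u'] using a0
    by (auto simp: ennreal_mult_less_top less_top[symmetric] ennreal_mult_eq_top_iff)
qed

text \<open>A Borel representative is cut off outside \<Omega>. Its integrability is not part of
  \<open>X_space\<close>: with a local part it follows from the local integrability in
  \<open>has_weak_gradient\<close>, otherwise from \<open>poincare_nonlocal\<close>.\<close>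

lemma X_rep:
  assumes v: "v \<in> X_space \<Omega> p s a"
  obtains v' where "v' \<in> E.V" "AE x in lborel. v x = v' x"
    "s 0 = 1 \<Longrightarrow> AE x in lborel. weak_gradient v x = E.gr v' x"
proof -
  have vm: "v \<in> borel_measurable lebesgue" and off: "AE x in lborel. x \<notin> \<Omega> \<longrightarrow> v x = 0" and fin: "X_norm p s a v < top"
    using v by (auto simp: X_space_def AE_completion_iff)
  obtain v0 where v0: "v0 \<in> borel_measurable borel" "AE x in lborel. v x = v0 x" using borel_rep_vector[OF vm] by blast
  define v' where "v' x = indicat_real \<Omega> x * v0 x" for x
  have v'm [measurable]: "v' \<in> borel_measurable borel" unfolding v'_def[abs_def] using v0(1) O(1) by measurable
  have v'ae: "AE x in lborel. v x = v' x" using v0(2) off by eventually_elim (auto simp: v'_def split: split_indicator)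
  have v'off: "v' x = 0" if "x \<notin> \<Omega>" for x using that by (simp add: v'_def)
  have L: "Lp_fun p E.MK (du v')" and g1: "s 0 = 1 \<Longrightarrow> \<exists>G. has_weak_gradient v G"
    and g2: "s 0 = 1 \<Longrightarrow> (\<integral>\<^sup>+x. ennreal (norm (weak_gradient v x) powr p) \<partial>lborel) < top"
    using fin unfolding X_norm_finite_iff[OF v'm v'ae] by auto
  show thesis
  proof (cases "s 0 = 1")
    case True
    have hw: "has_weak_gradient v (weak_gradient v)" unfolding weak_gradient_def by (rule someI_ex[OF g1[OF True]])
    obtain G' where G': "wgrad v' G'" "AE x in lborel. weak_gradient v x = G' x" "\<And>x. x \<notin> closure \<Omega> \<Longrightarrow> G' x = 0"
      using wgrad_of_has_weak_gradient[OF O(1,2) v'm v'ae v'off hw] by blast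
    note [measurable] = borel_measurable_integrable[OF wgradD(2)[OF G'(1)]]
    have "(\<integral>\<^sup>+x. ennreal (norm (G' x) powr p) \<partial>lborel) = (\<integral>\<^sup>+x. ennreal (norm (weak_gradient v x) powr p) \<partial>lborel)"
      using G'(2) by (intro nn_integral_cong_AE) auto
    then have "Lp_fun p lborel G'" using g2[OF True] by (auto simp: Lp_fun_def integrable_iff_bounded)
    then have gg: "E.good_grad v' G'" using G' by (simp add: E.good_grad_def)
    have vV: "v' \<in> E.V" unfolding E.V_def using v'm v'off wgradD(1)[OF G'(1)] L gg by auto
    have "AE x in lborel. E.gr v' x = G' x" by (rule E.gr_AE[OF vV _ G'(1)]) (use True a0 in simp)
    then have "AE x in lborel. weak_gradient v x = E.gr v' x" using G'(2) by eventually_elim simp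
    then show thesis using that vV v'ae by blast
  next
    case False
    then have aL: "(if s 0 = 1 then a 0 else 0) = 0" by simp
    have "integrable lborel v'" using E.poincare_nonlocal[OF aL] v'm v'off L by blast
    then have "v' \<in> E.V" unfolding E.V_def using v'm v'off L False by auto
    then show thesis using that v'ae False by blast
  qed
qed

text \<open>\<open>weak_gradient\<close> is an arbitrary choice among the weak gradients of
  \<open>u\<close>; uniqueness up to null sets identifies it with \<open>gr\<close>.\<close>

lemma V_in_X:
  assumes u: "u \<in> E.V"
  shows "u \<in> X_space \<Omega> p s a" and "s 0 = 1 \<Longrightarrow> AE x in lborel. weak_gradient u x = E.gr u x"
proof -
  have um: "u \<in> borel_measurable borel" by (rule E.V_meas[OF u])
  have g: "(\<exists>G. has_weak_gradient u G) \<and> (AE x in lborel. weak_gradient u x = E.gr u x)" if s1: "s 0 = 1"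
  proof -
    have wg: "wgrad u (E.gr u)" by (rule E.gr_wgrad[OF u]) (use s1 a0 in simp)
    then have ex: "\<exists>G. has_weak_gradient u G" by (auto simp: wgrad_def)
    have hw: "has_weak_gradient u (weak_gradient u)" unfolding weak_gradient_def by (rule someI_ex[OF ex])
    obtain G' where G': "wgrad u G'" "AE x in lborel. weak_gradient u x = G' x"
      using wgrad_of_has_weak_gradient[OF O(1,2) um _ E.V_off[OF u] hw] by auto
    have "AE x in lborel. E.gr u x = G' x" by (rule wgrad_unique[OF wg G'(1)]) simp
    then have "AE x in lborel. weak_gradient u x = E.gr u x" using G'(2) by eventually_elim simp
    with ex show ?thesis by blast
  qed
  then show "s 0 = 1 \<Longrightarrow> AE x in lborel. weak_gradient u x = E.gr u x" by blast
  have "(\<integral>\<^sup>+x. ennreal (norm (weak_gradient u x) powr p) \<partial>lborel) < top" if s1: "s 0 = 1"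
  proof -
    have "(\<integral>\<^sup>+x. ennreal (norm (weak_gradient u x) powr p) \<partial>lborel) = (\<integral>\<^sup>+x. ennreal (norm (E.gr u x) powr p) \<partial>lborel)"
      using g[OF s1] by (intro nn_integral_cong_AE) auto
    also have "\<dots> < top" using Lp_fun_integrable[OF E.gr_Lp[OF u]] by (simp add: integrable_iff_bounded)
    finally show ?thesis .
  qed
  then have "X_norm p s a u < top"
    using X_norm_finite_iff[OF um, of u] E.V_du[OF u] g by simp
  then show "u \<in> X_space \<Omega> p s a"
    unfolding X_space_def using um E.V_off[OF u] by (auto intro: measurable_completion)
qed

text \<open>The integrals of the absolute values over all orders add up to the integral of
  \<open>\<bar>F z\<bar>\<close> under \<open>MK\<close>, which is finite, so sum and integral may
  be exchanged.\<close>

lemma energy_series: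
  assumes u: "u \<in> E.V" and upos: "\<And>x. 0 \<le> u x" and v': "v' \<in> E.V" and eq: "AE x in lborel. v x = v' x"
    and wg: "s 0 = 1 \<Longrightarrow> AE x in lborel. weak_gradient v x = E.gr v' x"
  shows "(\<lambda>k. a k * energy_form \<Omega> p (s k) u v) sums E.AA u v'"
proof -
  let ?w = "\<lambda>k z. a k * frac_const (real DIM('a)) p (s k) / norm (fst z - snd z :: 'a) powr (real DIM('a) + s k * p)"
  define F where "F z = pflux p (du u z) \<bullet> du v' z" for z
  have um: "u \<in> borel_measurable borel" and vm: "v' \<in> borel_measurable borel" by (rule E.V_meas[OF u] E.V_meas[OF v'])+
  note [measurable] = E.du_meas[OF um] E.du_meas[OF vm] borel_measurable_pflux[OF p2]
  have Fm [measurable]: "F \<in> borel_measurable borel" unfolding F_def[abs_def] by measurable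
  have iF: "integrable E.MK F" unfolding F_def by (rule integrable_pflux_inner[OF p2 E.V_du[OF u] E.V_du[OF v']])
  have w0: "0 \<le> ?w k z" for k z by (rule kernel_term_nonneg)
  have fin: "(\<Sum>k. \<integral>\<^sup>+z. ennreal (norm (?w k z * F z)) \<partial>lborel) < top"
  proof -
    have "(\<Sum>k. \<integral>\<^sup>+z. ennreal (norm (?w k z * F z)) \<partial>lborel) = (\<integral>\<^sup>+z. (\<Sum>k. ennreal (norm (?w k z * F z))) \<partial>lborel)"
      by (rule nn_integral_suminf [symmetric]) measurable
    also have "\<dots> = (\<integral>\<^sup>+z. ennreal (mixed_kernel p s a (fst z - snd z)) * ennreal (norm (F z)) \<partial>lborel)"
    proof (rule nn_integral_cong)
      fix z :: "'a \<times> 'a"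
      have "ennreal \<bar>?w k z * F z\<bar> = ennreal (?w k z) * ennreal \<bar>F z\<bar>" for k
        by (subst abs_mult, subst abs_of_nonneg[OF w0]) (rule ennreal_mult[OF w0 abs_ge_zero])
      then show "(\<Sum>k. ennreal (norm (?w k z * F z))) = ennreal (mixed_kernel p s a (fst z - snd z)) * ennreal (norm (F z))"
        by (simp only: real_norm_def ennreal_mixed_kernel) (rule ennreal_suminf_multc)
    qed
    also have "\<dots> = (\<integral>\<^sup>+z. ennreal (norm (F z)) \<partial>E.MK)" by (rule E.MK_nn_integral [symmetric]) measurable
    also have "\<dots> < top" using iF by (simp add: integrable_iff_bounded)
    finally show ?thesis .
  qed
  have ik: "integrable lborel (\<lambda>z. ?w k z * F z)" for k
  proof -
    have "(\<integral>\<^sup>+z. ennreal (norm (?w k z * F z)) \<partial>lborel) \<le> (\<Sum>k. \<integral>\<^sup>+z. ennreal (norm (?w k z * F z)) \<partial>lborel)"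
      using sum_le_suminf[of "\<lambda>k. \<integral>\<^sup>+z. ennreal (norm (?w k z * F z)) \<partial>lborel" "{k}"] by simp
    also note fin
    finally show ?thesis unfolding integrable_iff_bounded by simp
  qed
  have "(\<lambda>k. \<integral>z. ?w k z * F z \<partial>lborel) sums (\<integral>z. (\<Sum>k. ?w k z * F z) \<partial>lborel)"
  proof (rule sums_integral[OF ik])
    show "AE z in lborel. summable (\<lambda>k. norm (?w k z * F z))"
    proof (rule AE_I2)
      fix z :: "'a \<times> 'a"
      have "summable (\<lambda>k. ?w k z * norm (F z))" by (rule summable_mult2[OF kernel_summable])
      moreover have "norm (?w k z * F z) = ?w k z * norm (F z)" for k
        unfolding real_norm_def abs_mult abs_of_nonneg[OF w0] ..
      ultimately show "summable (\<lambda>k. norm (?w k z * F z))" by (simp only:)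
    qed
    have "(\<Sum>k. ennreal (\<integral>z. norm (?w k z * F z) \<partial>lborel)) = (\<Sum>k. \<integral>\<^sup>+z. ennreal (norm (?w k z * F z)) \<partial>lborel)"
      by (intro suminf_cong nn_integral_eq_integral[symmetric] integrable_norm ik AE_I2 norm_ge_zero)
    with fin have "(\<Sum>k. ennreal (\<integral>z. norm (?w k z * F z) \<partial>lborel)) < top" by (simp only:)
    then show "summable (\<lambda>k. \<integral>z. norm (?w k z * F z) \<partial>lborel)"
      by (intro summable_suminf_not_top) auto
  qed
  moreover have "(\<integral>z. (\<Sum>k. ?w k z * F z) \<partial>lborel) = E.A1 u v'"
  proof -
    have "(\<Sum>k. ?w k z * F z) = mixed_kernel p s a (fst z - snd z) * F z" for z
      unfolding mixed_kernel_def by (rule suminf_mult2[OF kernel_summable, symmetric])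
    then have "(\<integral>z. (\<Sum>k. ?w k z * F z) \<partial>lborel) = (\<integral>z. mixed_kernel p s a (fst z - snd z) * F z \<partial>lborel)" by simp
    also have "\<dots> = (\<integral>z. F z \<partial>E.MK)"
      unfolding E.MK_def by (subst integral_real_density) (auto simp: mixed_kernel_nonneg E.Kz_meas)
    finally show ?thesis by (simp add: E.A1_def F_def)
  qed
  ultimately have s1: "(\<lambda>k. \<integral>z. ?w k z * F z \<partial>lborel) sums E.A1 u v'" by simp
  define e where "e k = (if k = 0 then (if s 0 = 1 then a 0 else 0) * E.A2 u v' else 0)" for k :: nat
  have s2: "e sums ((if s 0 = 1 then a 0 else 0) * E.A2 u v')"
    using sums_single[of 0 "\<lambda>_. (if s 0 = 1 then a 0 else 0) * E.A2 u v'"] unfolding e_def by simp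
  have "a k * energy_form \<Omega> p (s k) u v = (\<integral>z. ?w k z * F z \<partial>lborel) + e k" for k
  proof (cases "s k = 1")
    case True
    then have k: "k = 0" "s 0 = 1" using s_eq_1 by auto
    have aL: "(if s 0 = 1 then a 0 else 0) > 0" using k a0 by simp
    \<comment> \<open>\<open>energy_form\<close> integrates over \<Omega> and \<open>A2\<close> over
      the whole space, and the boundary of \<Omega> may have positive measure. Nonnegativity of
      \<open>u\<close> closes the gap: its gradient vanishes almost everywhere on its zero
      set.\<close>
    have z: "AE x in lborel. u x = 0 \<longrightarrow> E.gr u x = 0" by (rule wgrad_zero_set[OF E.gr_wgrad[OF u aL] upos])
    note [measurable] = E.gr_meas[OF u] E.gr_meas[OF v']
    have "(LINT x:\<Omega>|lebesgue. norm (weak_gradient u x) powr (p - 2) * (weak_gradient u x \<bullet> weak_gradient v x))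
      = E.A2 u v'"
      unfolding E.A2_def set_lebesgue_integral_def
    proof (rule lebesgue_borel_rep(1))
      show "(\<lambda>x. pflux p (E.gr u x) \<bullet> E.gr v' x) \<in> borel_measurable borel" by measurable
      show "AE x in lborel. indicat_real \<Omega> x *\<^sub>R (norm (weak_gradient u x) powr (p - 2) * (weak_gradient u x \<bullet> weak_gradient v x))
        = pflux p (E.gr u x) \<bullet> E.gr v' x"
        using V_in_X(2)[OF u k(2)] wg[OF k(2)] z
      proof eventually_elim
        case (elim x)
        have "x \<notin> \<Omega> \<Longrightarrow> E.gr u x = 0" using elim(3) E.V_off[OF u] by blast
        then show ?case using elim(1,2) by (auto simp: pflux_def split: split_indicator)
      qed
    qed
    then show ?thesis using True k by (simp add: energy_form_def e_def)
  next
    case False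
    then have sk: "s k \<noteq> 0" "s k \<noteq> 1" using s_pos[of k] by auto
    have e0: "e k = 0" using False by (auto simp: e_def)
    have "(LINT (x, y)|lebesgue. \<bar>u x - u y\<bar> powr (p - 2) * (u x - u y) * (v x - v y) / norm (x - y) powr (real DIM('a) + s k * p))
      = (\<integral>z. F z / norm (fst z - snd z) powr (real DIM('a) + s k * p) \<partial>lborel)"
    proof (rule lebesgue_borel_rep(1))
      show "(\<lambda>z. F z / norm (fst z - snd z) powr (real DIM('a) + s k * p)) \<in> borel_measurable borel" by measurable
      show "AE z in lborel. (case z of (x, y) \<Rightarrow> \<bar>u x - u y\<bar> powr (p - 2) * (u x - u y) * (v x - v y) / norm (x - y) powr (real DIM('a) + s k * p))
         = F z / norm (fst z - snd z) powr (real DIM('a) + s k * p)"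
        using AE_lborel_pair[OF eq] by eventually_elim (auto simp: F_def du_def pflux_def split: prod.splits)
    qed
    then have "a k * energy_form \<Omega> p (s k) u v = a k * frac_const (real DIM('a)) p (s k) * (\<integral>z. F z / norm (fst z - snd z) powr (real DIM('a) + s k * p) \<partial>lborel)"
      using sk by (simp add: energy_form_def)
    also have "\<dots> = (\<integral>z. ?w k z * F z \<partial>lborel)"
      by (subst integral_mult_right_zero [symmetric]) (auto intro!: Bochner_Integration.integral_cong)
    finally show ?thesis using e0 by simp
  qed
  then show ?thesis using sums_add[OF s1 s2] by (simp add: E.AA_def)
qed

end

subsection \<open>The nonlinearity\<close>

lemma borel_measurable_pow0 [measurable]:
  "(\<lambda>t. pow0 t e) \<in> borel_measurable borel"
  by (cases "e = 0") (auto simp: pow0_def)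

lemma borel_measurable_nonlinearity [measurable]:
  "nonlinearity r m q l \<in> borel_measurable borel"
proof -
  have [measurable]: "(\<lambda>t. pow0 \<bar>t\<bar> e) \<in> borel_measurable borel" for e
    by (rule measurable_compose[OF _ borel_measurable_pow0]) simp
  show ?thesis unfolding nonlinearity_def[abs_def] by measurable
qed

lemma continuous_on_pow0:
  assumes "0 \<le> e" shows "continuous_on {0..} (\<lambda>t. pow0 t e)"
proof (cases "e = 0")
  case False
  then have "continuous_on {0..} (\<lambda>t. t powr e)" using assms by (intro continuous_on_powr' continuous_intros) auto
  then show ?thesis using False by (simp add: pow0_def)
qed (simp add: pow0_def)

lemma pow0_mono: "0 \<le> e \<Longrightarrow> 0 \<le> x \<Longrightarrow> x \<le> y \<Longrightarrow> pow0 x e \<le> pow0 y e"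
  by (auto simp: pow0_def intro: powr_mono2)

lemma pow0_nonneg: "0 \<le> pow0 t e"
  by (simp add: pow0_def)

lemma pow0_powr: "0 < t \<Longrightarrow> pow0 t e = t powr e"
  by (simp add: pow0_def)

lemma nonlinearity_nonneg_arg:
  assumes "r > 2" "0 \<le> t"
  shows "nonlinearity r m q l t = t powr (r - 1) + l * (pow0 t (m - 1) + pow0 t (q - 1))"
proof -
  have "pow0 \<bar>t\<bar> (r - 2) * t = t powr (r - 1)"
  proof (cases "t = 0")
    case False
    then have "t powr (r - 2) * t = t powr (r - 2 + 1)" using assms by (simp only: powr_add) simp
    then show ?thesis using assms by (simp add: pow0_def)
  qed simp
  then show ?thesis using assms by (simp add: nonlinearity_def)
qed

lemma critical_exponent_gt:
  assumes "0 < p" "0 < s" "p * s < N"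
  shows "p < critical_exponent N p s"
  using assms by (simp add: critical_exponent_def field_simps)

text \<open>As \<open>r > p\<close>, the equation amounts to \<open>T powr (r - p) = B\<close> with
  a positive constant \<open>B\<close>. The factor 1/2 reserves the other half of
  \<open>(T / T1) powr (p - 1)\<close> for the terms with the parameter.\<close>

lemma scale_balance:
  fixes T1 p r :: real
  assumes "0 < T1" "p < r"
  obtains T where "0 < T" "(2 * T) powr (r - 1) = (T / T1) powr (p - 1) / 2"
proof -
  define B where "B = T1 powr (1 - p) / (2 * 2 powr (r - 1))"
  define T where "T = B powr (1 / (r - p))"
  have B: "B > 0" using assms by (simp add: B_def)
  then have T: "T > 0" by (simp add: T_def)
  have "T powr (r - p) = B" using B assms by (simp add: T_def powr_powr)
  then have "T powr (r - 1) = B * T powr (p - 1)" using powr_add[of T "r - p" "p - 1"] by simp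
  then have "(2 * T) powr (r - 1) = 2 powr (r - 1) * B * T powr (p - 1)" using T by (simp add: powr_mult)
  also have "\<dots> = T1 powr (1 - p) * T powr (p - 1) / 2" by (simp add: B_def)
  also have "T1 powr (1 - p) = inverse (T1 powr (p - 1))" by (simp flip: powr_minus)
  finally have "(2 * T) powr (r - 1) = (T / T1) powr (p - 1) / 2"
    using T assms by (simp add: powr_divide field_simps)
  with T show thesis by (rule that)
qed

context mixed_problem
begin

text \<open>A test function is replaced by its representative in \<open>V\<close>, which changes all
  integrands on null sets only; boundedness of \<open>h\<close> on \<open>[0, T]\<close> gives the
  required integrability.\<close>

lemma weak_solution_of_V:
  assumes u: "u \<in> E.V" and ub: "\<And>x. 0 \<le> u x \<and> u x \<le> T"
    and h: "h = nonlinearity (critical_exponent (real DIM('a)) p (s 0)) m q l"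
    and hb: "\<And>t. 0 \<le> t \<Longrightarrow> t \<le> T \<Longrightarrow> \<bar>h t\<bar> \<le> B"
    and eq: "\<And>v. v \<in> E.V \<Longrightarrow> E.AA u v = (\<integral>x. h (u x) * v x \<partial>lborel)"
  shows "weak_solution \<Omega> p s a m q l u"
  unfolding weak_solution_def Let_def h[symmetric]
proof (intro conjI ballI)
  show "u \<in> X_space \<Omega> p s a" by (rule V_in_X[OF u])
  fix v assume "v \<in> X_space \<Omega> p s a"
  then obtain v' where v': "v' \<in> E.V" "AE x in lborel. v x = v' x"
    "s 0 = 1 \<Longrightarrow> AE x in lborel. weak_gradient v x = E.gr v' x" using X_rep by blast
  have [measurable]: "h \<in> borel_measurable borel" unfolding h by measurable
  note [measurable] = E.V_meas[OF u] E.V_meas[OF v'(1)]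
  have i: "integrable lborel (\<lambda>x. h (u x) * v' x)"
    by (rule E.integrable_bounded_mult[OF v'(1)]) (use ub hb in auto)
  have ae: "AE x in lborel. indicat_real \<Omega> x *\<^sub>R (h (u x) * v x) = h (u x) * v' x"
    using v'(2) by eventually_elim (use E.V_off[OF v'(1)] in \<open>auto split: split_indicator\<close>)
  have m: "(\<lambda>x. h (u x) * v' x) \<in> borel_measurable borel" by measurable
  show "set_integrable lebesgue \<Omega> (\<lambda>x. h (u x) * v x)"
    unfolding set_integrable_def by (rule iffD2[OF lebesgue_borel_rep(2)[OF m ae] i])
  have "(LINT x:\<Omega>|lebesgue. h (u x) * v x) = E.AA u v'"
    unfolding set_lebesgue_integral_def eq[OF v'(1)] by (rule lebesgue_borel_rep(1)[OF m ae])
  moreover have "(\<lambda>k. a k * energy_form \<Omega> p (s k) u v) sums E.AA u v'"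
    by (rule energy_series[OF u _ v']) (use ub in auto)
  ultimately show "(\<lambda>k. a k * energy_form \<Omega> p (s k) u v) sums (LINT x:\<Omega>|lebesgue. h (u x) * v x)"
    by simp
qed

theorem small_parameter_solutions:
  assumes pN: "p < real DIM('a)" and m: "1 \<le> m" "m < p" and q: "p \<le> q"
  shows "\<exists>l0>0. \<forall>l\<in>{0<..<l0}. \<exists>u. weak_solution \<Omega> p s a m q l u \<and>
       (AE x in lebesgue. 0 \<le> u x) \<and> \<not> (AE x in lebesgue. u x = 0)"
proof -
  define r where "r = critical_exponent (real DIM('a)) p (s 0)"
  \<comment> \<open>Together with \<open>p < N\<close> this keeps the denominator of the critical
    exponent positive.\<close>
  have ps: "p * s 0 \<le> p" using s0 p2 by (simp add: mult_left_le)
  have r: "p < r" unfolding r_def by (rule critical_exponent_gt) (use ps p2 s_pos[of 0] pN in linarith)+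
  then have r2: "r > 2" using p2 by simp
  show ?thesis
  proof (rule E.monotone_iteration, goal_cases)
    case (1 T1)
    note T1 = 1(1) and iter = 1(2)
  obtain T where T: "0 < T" "(2 * T) powr (r - 1) = (T / T1) powr (p - 1) / 2" using scale_balance[OF T1 r] .
  define c where "c = T / T1"
  have c: "c > 0" "c * T1 \<le> T" using T(1) T1 by (auto simp: c_def)
  define D where "D = (2 * T) powr (m - 1) + (2 * T) powr (q - 1)"
  have D: "D > 0" using T(1) by (auto simp: D_def intro: add_pos_pos)
  \<comment> \<open>The choice of \<open>T\<close> lets the critical power at \<open>2 * T\<close>
    use exactly half of \<open>c powr (p - 1)\<close>. \<open>D\<close> is the value of the lower
    order powers at \<open>2 * T\<close>, so below \<open>l0\<close> they use at most the other
    half.\<close>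
  define l0 where "l0 = c powr (p - 1) / (2 * D)"
  have "\<exists>u. weak_solution \<Omega> p s a m q l u \<and> (AE x in lebesgue. 0 \<le> u x) \<and> \<not> (AE x in lebesgue. u x = 0)"
    if l: "l \<in> {0<..<l0}" for l
  proof -
    have l': "l > 0" using l by simp
    define h where "h = nonlinearity r m q l"
    have ht: "h t = t powr (r - 1) + l * (pow0 t (m - 1) + pow0 t (q - 1))" if "0 \<le> t" for t
      unfolding h_def using nonlinearity_nonneg_arg[OF r2 that] .
    have hm: "h \<in> borel_measurable borel" unfolding h_def by measurable
    have hc: "continuous_on {0..} h"
    proof -
      have "continuous_on {0..} (\<lambda>t. t powr (r - 1) + l * (pow0 t (m - 1) + pow0 t (q - 1)))"
        using m q r2 p2 by (intro continuous_intros continuous_on_powr' continuous_on_pow0) auto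
      then show ?thesis by (rule continuous_on_eq) (simp add: ht)
    qed
    have hmono: "mono_on {0..} h"
    proof (rule mono_onI)
      fix x y :: real assume "x \<in> {0..}" "y \<in> {0..}" "x \<le> y"
      then show "h x \<le> h y" using m q r2 p2 l
        by (auto simp: ht intro!: add_mono mult_left_mono pow0_mono powr_mono2)
    qed
    have h0: "0 \<le> h t" if "0 \<le> t" for t using l that by (auto simp: ht intro!: add_nonneg_nonneg mult_nonneg_nonneg pow0_nonneg)
    have hl: "l * t powr (m - 1) \<le> h t" if "t > 0" for t
      using l that by (simp add: ht pow0_powr distrib_left)
    have h2: "h (2 * T) \<le> c powr (p - 1)"
    proof -
      have "h (2 * T) = c powr (p - 1) / 2 + l * D" using T by (simp add: ht pow0_powr D_def c_def)
      moreover have "l * D \<le> l0 * D" using l D by (intro mult_right_mono) auto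
      moreover have "l0 * D = c powr (p - 1) / 2" using D by (simp add: l0_def)
      ultimately show ?thesis by linarith
    qed
    obtain u where u: "u \<in> E.V" "\<And>x. 0 \<le> u x \<and> u x \<le> T" "\<And>v. v \<in> E.V \<Longrightarrow> E.AA u v = (\<integral>x. h (u x) * v x \<partial>lborel)"
      "\<not> (AE x in lborel. u x = 0)"
      using iter[OF T(1) c h2 hm hc hmono l' m(2) hl h0[OF order_refl]] by blast
    have "weak_solution \<Omega> p s a m q l u"
    proof (rule weak_solution_of_V[OF u(1,2) _ _ u(3)])
      show "h = nonlinearity (critical_exponent (real DIM('a)) p (s 0)) m q l" by (simp add: h_def r_def)
      show "\<bar>h t\<bar> \<le> h T" if "0 \<le> t" "t \<le> T" for t using that h0[of t] mono_onD[OF hmono, of t T] by simp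
    qed
    moreover have "AE x in lebesgue. 0 \<le> u x" using u(2) by simp
    moreover have "\<not> (AE x in lebesgue. u x = 0)" using u(4) E.V_meas[OF u(1)] by (simp add: AE_completion_iff)
    ultimately show ?thesis by blast
  qed
  moreover have "l0 > 0" using c D by (simp add: l0_def)
  ultimately show ?case by blast
  qed
qed

end

theorem corollary8p9:
  fixes \<Omega> :: "'a::euclidean_space set"
    and p m q :: real
    and s a :: "nat \<Rightarrow> real"
  assumes "open \<Omega>" and "bounded \<Omega>" and "\<Omega> \<noteq> {}"
    and "2 \<le> p" and "p < real DIM('a)"
    and "s 0 \<le> 1" and "\<And>k. s (Suc k) < s k" and "\<And>k. 0 \<le> s k"
    and "summable a" and "0 < (\<Sum>k. a k)"
    and "0 < a 0" and "\<And>k. 1 \<le> k \<Longrightarrow> 0 \<le> a k"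
    and "1 \<le> m" and "m < p" and "p \<le> q"
    and "q < critical_exponent (real DIM('a)) p (s 0)"
  shows "\<exists>\<Lambda> :: real set. open \<Lambda> \<and> is_interval \<Lambda> \<and> \<Lambda> \<noteq> {} \<and> \<Lambda> \<subseteq> {0<..} \<and>
    (\<forall>l\<in>\<Lambda>. \<exists>u. weak_solution \<Omega> p s a m q l u \<and>
       (AE x in lebesgue. 0 \<le> u x) \<and> \<not> (AE x in lebesgue. u x = 0))"
proof -
  have "0 \<le> a k" for k using assms(11,12) by (cases "k = 0") (auto simp: Suc_le_eq)
  then interpret mixed_problem p s a \<Omega> by unfold_locales (use assms in auto)
  obtain l0 where l0: "l0 > 0" "\<forall>l\<in>{0<..<l0}. \<exists>u. weak_solution \<Omega> p s a m q l u \<and>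
       (AE x in lebesgue. 0 \<le> u x) \<and> \<not> (AE x in lebesgue. u x = 0)"
    using small_parameter_solutions[OF assms(5,13,14,15)] by blast
  show ?thesis
    by (intro exI[of _ "{0<..<l0}"] conjI l0(2)) (use l0(1) in \<open>auto simp: is_interval_oo\<close>)
qed

end
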